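(* Let $u_\lambda$ be the Ginzburg–Landau heat flow with parameter $\lambda$ and data $u_0$, and for $z_0=(t_0,x_0)\in Q(T)$ and $R>0$ with $t_0-(2R)^2>0$ put $$E_\lambda(R;z_0)=\frac1{R^d}\int_{t_0-(2R)^2}^{t_0-R^2}dt\int_{\mathbb{B}^d}\mathbf{e}_\lambda\exp\Bigl(\frac{|x-x_0|^2}{4(t-t_0)}\Bigr)dx.$$ Then for all $0<R_1<R_2$ with $t_0-(2R_2)^2>0$, $$E_\lambda(R_2;z_0)\ge E_\lambda(R_1;z_0)+\int_{R_1}^{R_2}\frac{dR}{R^{d-1}}\int_{t_0-(2R)^2}^{t_0-R^2}dt\int_{\mathbb{B}^d}\left|\frac{\partial u_\lambda}{\partial t}+\frac{x-x_0}{2(t-t_0)}\cdot\nabla u_\lambda\right|^2\exp\Bigl(\frac{|x-x_0|^2}{4(t-t_0)}\Bigr)dx-\frac{C_{\mathsf M}}2(R_2^2-R_1^2),$$ where, with $d_0$ the distance from $x_0$ to $\partial\mathbb{B}^d$, $$C_{\mathsf M}=\frac{C}{d_0^{d+2}}\left(\int_{\partial\mathbb{B}^d}|\nabla_\tau u_0|^2\,d\mathcal{H}^{d-1}_x+\int_{\mathbb{B}^d}|\nabla u_0|^2\,dx\right).$$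
   Context: $d,D\ge2$ are integers, $T>0$, $\mathbb{B}^d$ is the open unit ball of $\mathbb{R}^d$ centred at $0$, $\mathbb{S}^D\subset\mathbb{R}^{D+1}$ the unit sphere, $Q(T)=(0,T)\times\mathbb{B}^d$. The data satisfy $u_0\in H^{1,2}(\mathbb{B}^d;\mathbb{S}^D)\cap H^{2,2}(\mathbb{B}^d\setminus B_{1-\delta_0}(0);\mathbb{S}^D)$ with a sufficiently small $\delta_0>0$ (sphere-valued Sobolev maps are $\mathbb{R}^{D+1}$-valued ones with $|u_0|=1$ a.e.). $\kappa=\kappa(t)=\arctan(t)/\pi$; $\chi$ is a smooth function with $\chi(t)=t$ for $t<2$, $\chi(t)=3$ for $t\ge4$, $\chi\le3$, and $\dot\chi$ is its derivative. For $\lambda>0$ the Ginzburg–Landau heat flow (GLHF) $u_\lambda\in C^\infty(Q(T);\mathbb{R}^{D+1})$ is the solution of $$\frac{\partial u_\lambda}{\partial t}-\triangle u_\lambda+\lambda^{1-\kappa}\dot\chi\bigl((|u_\lambda|^2-1)^2\bigr)(|u_\lambda|^2-1)u_\lambda=0\quad\text{in }Q(T)$$ with $u_\lambda(t,\cdot)-u_0\in\mathring{H}^{1,2}(\mathbb{B}^d;\mathbb{R}^{D+1})$ for a.e. $t\in(0,T)$ and $\lim_{t\searrow0}\|u_\lambda(t,\cdot)-u_0\|_{L^2(\mathbb{B}^d)}=0$. The energy density is $\mathbf{e}_\lambda=\tfrac12|\nabla u_\lambda|^2+\tfrac{\lambda^{1-\kappa}}4\chi\bigl((|u_\lambda|^2-1)^2\bigr)$.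 $\nabla_\tau=\nabla-\nu(\nu\cdot\nabla)$ is the tangential gradient on $\partial\mathbb{B}^d$ ($\nu$ outward unit normal). $C$ denotes a generic positive constant, not depending on $\lambda$, $R_1$, $R_2$, $z_0$.
   Formalization: The flow is additionally required to have its gradient square-integrable over Q(T), the class where the solution is unique; with the boundary condition for a.e. t alone, constant data admit spurious solutions, singular at the boundary at one interior time, that violate the inequality. *)

theory Defs
  imports "HOL-Analysis.Analysis"
begin

section \<open>Smooth functions and square-integrable functions\<close>

(* Meant for open S, where the derivative within S is the full derivative. *)
primrec Ck_on :: "nat \<Rightarrow> ('a::euclidean_space \<Rightarrow> 'b::euclidean_space) \<Rightarrow> 'a set \<Rightarrow> bool" where
  "Ck_on 0 f S \<longleftrightarrow> continuous_on S f"
| "Ck_on (Suc k) f S \<longleftrightarrow>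
     f differentiable_on S \<and> (\<forall>v. Ck_on k (\<lambda>x. frechet_derivative f (at x) v) S)"

definition smooth_on :: "'a::euclidean_space set \<Rightarrow> ('a \<Rightarrow> 'b::euclidean_space) \<Rightarrow> bool" where
  "smooth_on S f \<longleftrightarrow> (\<forall>k. Ck_on k f S)"

definition partial_deriv :: "'a::euclidean_space \<Rightarrow> ('a \<Rightarrow> 'b::euclidean_space) \<Rightarrow> 'a \<Rightarrow> 'b" where
  "partial_deriv b f x = frechet_derivative f (at x) b"

definition grad_sq :: "('a::euclidean_space \<Rightarrow> 'b::euclidean_space) \<Rightarrow> 'a \<Rightarrow> real" where
  "grad_sq f x = (\<Sum>b\<in>Basis. (norm (partial_deriv b f x))\<^sup>2)"

definition laplacian :: "('a::euclidean_space \<Rightarrow> 'b::euclidean_space) \<Rightarrow> 'a \<Rightarrow> 'b" where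
  "laplacian f x = (\<Sum>b\<in>Basis. partial_deriv b (partial_deriv b f) x)"

definition L2_fun :: "'a measure \<Rightarrow> ('a \<Rightarrow> 'b::euclidean_space) \<Rightarrow> bool" where
  "L2_fun M f \<longleftrightarrow> f \<in> borel_measurable M \<and> integrable M (\<lambda>x. (norm (f x))\<^sup>2)"

section \<open>Sobolev spaces\<close>

definition test_function :: "'a::euclidean_space set \<Rightarrow> ('a \<Rightarrow> 'b::euclidean_space) \<Rightarrow> bool" where
  "test_function \<Omega> \<phi> \<longleftrightarrow>
     smooth_on UNIV \<phi> \<and> (\<exists>K. compact K \<and> K \<subseteq> \<Omega> \<and> (\<forall>x. x \<notin> K \<longrightarrow> \<phi> x = 0))"

definition locally_integrable_on :: "'a::euclidean_space set \<Rightarrow> ('a \<Rightarrow> 'b::euclidean_space) \<Rightarrow> bool" where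
  "locally_integrable_on \<Omega> f \<longleftrightarrow> (\<forall>K. compact K \<and> K \<subseteq> \<Omega> \<longrightarrow> integrable (lebesgue_on K) f)"

definition has_weak_partial ::
  "'a::euclidean_space set \<Rightarrow> 'a \<Rightarrow> ('a \<Rightarrow> 'b::euclidean_space) \<Rightarrow> ('a \<Rightarrow> 'b) \<Rightarrow> bool" where
  "has_weak_partial \<Omega> b f g \<longleftrightarrow>
     locally_integrable_on \<Omega> f \<and> locally_integrable_on \<Omega> g \<and>
     (\<forall>\<phi> :: 'a \<Rightarrow> real. test_function \<Omega> \<phi> \<longrightarrow>
        (\<integral>x. partial_deriv b \<phi> x *\<^sub>R f x \<partial>lebesgue_on \<Omega>) = - (\<integral>x. \<phi> x *\<^sub>R g x \<partial>lebesgue_on \<Omega>))"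

(* Weak derivatives, and the traces below, are unique almost everywhere; the choice of a
   representative is irrelevant because they only occur under integrals. *)
definition weak_partial ::
  "'a::euclidean_space set \<Rightarrow> 'a \<Rightarrow> ('a \<Rightarrow> 'b::euclidean_space) \<Rightarrow> 'a \<Rightarrow> 'b" where
  "weak_partial \<Omega> b f = (SOME g. has_weak_partial \<Omega> b f g)"

definition weak_grad_sq :: "'a::euclidean_space set \<Rightarrow> ('a \<Rightarrow> 'b::euclidean_space) \<Rightarrow> 'a \<Rightarrow> real" where
  "weak_grad_sq \<Omega> f x = (\<Sum>b\<in>Basis. (norm (weak_partial \<Omega> b f x))\<^sup>2)"

(* H^{k,2}: k is the number of derivatives, 2 the integrability exponent. *)
primrec sobolev_H :: "nat \<Rightarrow> 'a::euclidean_space set \<Rightarrow> ('a \<Rightarrow> 'b::euclidean_space) \<Rightarrow> bool" where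
  "sobolev_H 0 \<Omega> f \<longleftrightarrow> L2_fun (lebesgue_on \<Omega>) f"
| "sobolev_H (Suc k) \<Omega> f \<longleftrightarrow> L2_fun (lebesgue_on \<Omega>) f \<and>
     (\<forall>b\<in>Basis. \<exists>g. has_weak_partial \<Omega> b f g \<and> sobolev_H k \<Omega> g)"

definition sobolev_H_sphere :: "nat \<Rightarrow> 'a::euclidean_space set \<Rightarrow> ('a \<Rightarrow> 'b::euclidean_space) \<Rightarrow> bool" where
  "sobolev_H_sphere k \<Omega> f \<longleftrightarrow> sobolev_H k \<Omega> f \<and> (AE x in lebesgue_on \<Omega>. norm (f x) = 1)"

definition H1_norm :: "'a::euclidean_space set \<Rightarrow> ('a \<Rightarrow> 'b::euclidean_space) \<Rightarrow> real" where
  "H1_norm \<Omega> f = sqrt ((\<integral>x. (norm (f x))\<^sup>2 \<partial>lebesgue_on \<Omega>) + (\<integral>x. weak_grad_sq \<Omega> f x \<partial>lebesgue_on \<Omega>))"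

definition H1_zero :: "'a::euclidean_space set \<Rightarrow> ('a \<Rightarrow> 'b::euclidean_space) \<Rightarrow> bool" where
  "H1_zero \<Omega> f \<longleftrightarrow> sobolev_H 1 \<Omega> f \<and>
     (\<exists>\<phi> :: nat \<Rightarrow> 'a \<Rightarrow> 'b. (\<forall>n. test_function \<Omega> (\<phi> n)) \<and>
        (\<lambda>n. H1_norm \<Omega> (\<lambda>x. \<phi> n x - f x)) \<longlonglongrightarrow> 0)"

section \<open>Hausdorff measure and traces on the unit sphere\<close>

(* Normalised so that the n-dimensional measure on n-space is Lebesgue measure. *)
definition hausdorff_pre :: "nat \<Rightarrow> real \<Rightarrow> 'a::metric_space set \<Rightarrow> ennreal" where
  "hausdorff_pre k \<delta> A =
     (INF F \<in> {F :: nat \<Rightarrow> 'a set. A \<subseteq> (\<Union>i. F i) \<and> (\<forall>i. bounded (F i) \<and> diameter (F i) \<le> \<delta>)}.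
        \<Sum>i. if F i = {} then 0 else ennreal (unit_ball_vol (real k) * (diameter (F i) / 2) ^ k))"

definition hausdorff_outer :: "nat \<Rightarrow> 'a::metric_space set \<Rightarrow> ennreal" where
  "hausdorff_outer k A = (SUP \<delta>\<in>{0<..}. hausdorff_pre k \<delta> A)"

(* The outer measure above is a metric outer measure, hence countably additive on Borel sets. *)
definition hausdorff_measure :: "nat \<Rightarrow> 'a::metric_space measure" where
  "hausdorff_measure k = measure_of UNIV (sets borel) (hausdorff_outer k)"

definition surface_measure :: "'a::euclidean_space measure" where
  "surface_measure = restrict_space (hausdorff_measure (DIM('a) - 1)) (sphere 0 1)"

(* Trace on the unit sphere of an H^{1,2}-function on a Lipschitz domain having the sphere as
   part of its boundary: the L^2-continuous extension of restriction of smooth functions. *)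
definition has_sphere_trace ::
  "'a::euclidean_space set \<Rightarrow> ('a \<Rightarrow> 'b::euclidean_space) \<Rightarrow> ('a \<Rightarrow> 'b) \<Rightarrow> bool" where
  "has_sphere_trace \<Omega> f g \<longleftrightarrow> L2_fun surface_measure g \<and>
     (\<exists>\<phi> :: nat \<Rightarrow> 'a \<Rightarrow> 'b. (\<forall>n. smooth_on UNIV (\<phi> n)) \<and>
        (\<lambda>n. H1_norm \<Omega> (\<lambda>x. \<phi> n x - f x)) \<longlonglongrightarrow> 0 \<and>
        (\<lambda>n. \<integral>x. (norm (\<phi> n x - g x))\<^sup>2 \<partial>surface_measure) \<longlonglongrightarrow> 0)"

definition sphere_trace ::
  "'a::euclidean_space set \<Rightarrow> ('a \<Rightarrow> 'b::euclidean_space) \<Rightarrow> 'a \<Rightarrow> 'b" where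
  "sphere_trace \<Omega> f = (SOME g. has_sphere_trace \<Omega> f g)"

definition boundary_layer :: "real \<Rightarrow> 'a::euclidean_space set" where
  "boundary_layer \<delta> = ball 0 1 - cball 0 (1 - \<delta>)"

definition boundary_partial ::
  "real \<Rightarrow> 'a::euclidean_space \<Rightarrow> ('a \<Rightarrow> 'b::euclidean_space) \<Rightarrow> 'a \<Rightarrow> 'b" where
  "boundary_partial \<delta> b f =
     sphere_trace (boundary_layer \<delta>) (weak_partial (boundary_layer \<delta>) b f)"

(* |grad f - nu (nu . grad f)|^2; the outward unit normal nu at x in the unit sphere is x. *)
definition tangential_grad_sq ::
  "real \<Rightarrow> ('a::euclidean_space \<Rightarrow> 'b::euclidean_space) \<Rightarrow> 'a \<Rightarrow> real" where
  "tangential_grad_sq \<delta> f x =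
     (\<Sum>b\<in>Basis. (norm (boundary_partial \<delta> b f x -
        (x \<bullet> b) *\<^sub>R (\<Sum>c\<in>Basis. (x \<bullet> c) *\<^sub>R boundary_partial \<delta> c f x)))\<^sup>2)"

section \<open>The Ginzburg--Landau heat flow\<close>

definition kappa :: "real \<Rightarrow> real" where
  "kappa t = arctan t / pi"

definition cutoff :: "(real \<Rightarrow> real) \<Rightarrow> bool" where
  "cutoff chi \<longleftrightarrow> smooth_on UNIV chi \<and> (\<forall>t<2. chi t = t) \<and> (\<forall>t\<ge>4. chi t = 3) \<and> (\<forall>t. chi t \<le> 3)"

definition initial_data :: "real \<Rightarrow> ('a::euclidean_space \<Rightarrow> 'b::euclidean_space) \<Rightarrow> bool" where
  "initial_data \<delta> u0 \<longleftrightarrow>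
     sobolev_H_sphere 1 (ball 0 1) u0 \<and> sobolev_H_sphere 2 (boundary_layer \<delta>) u0"

(* The condition that the gradient is square-integrable on Q(T) makes the lateral boundary
   condition say that u - u0 lies in L^2(0,T; H^1_0), the class in which the solution is unique.
   With the condition for a.e. t alone there would be spurious solutions: already for the heat
   equation on the half line, x (t - s)^(-3/2) exp (- x^2 / (4 (t - s))) for t > s, continued
   by 0 for t \<le> s, is smooth in the interior, lies in H^1_0 for every t and has initial value 0. *)
definition GLHF ::
  "(real \<Rightarrow> real) \<Rightarrow> real \<Rightarrow> real \<Rightarrow> ('a::euclidean_space \<Rightarrow> 'b::euclidean_space) \<Rightarrow> (real \<Rightarrow> 'a \<Rightarrow> 'b) \<Rightarrow> bool"
where
  "GLHF chi T lam u0 u \<longleftrightarrow>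
     smooth_on ({0<..<T} \<times> ball 0 1) (\<lambda>(t, x). u t x) \<and>
     (\<integral>\<^sup>+t\<in>{0<..<T}. (\<integral>\<^sup>+x\<in>ball 0 1. ennreal (grad_sq (u t) x) \<partial>lborel) \<partial>lborel) < \<infinity> \<and>
     (\<forall>t\<in>{0<..<T}. \<forall>x\<in>ball 0 1.
        vector_derivative (\<lambda>s. u s x) (at t) - laplacian (u t) x
        + (lam powr (1 - kappa t) * deriv chi (((norm (u t x))\<^sup>2 - 1)\<^sup>2) * ((norm (u t x))\<^sup>2 - 1)) *\<^sub>R u t x
        = 0) \<and>
     (AE t in lebesgue_on {0<..<T}. H1_zero (ball 0 1) (\<lambda>x. u t x - u0 x)) \<and>
     ((\<lambda>t. \<integral>\<^sup>+x. ennreal ((norm (u t x - u0 x))\<^sup>2) \<partial>lebesgue_on (ball 0 1)) \<longlongrightarrow> 0) (at_right 0)"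

definition energy_density ::
  "(real \<Rightarrow> real) \<Rightarrow> real \<Rightarrow> (real \<Rightarrow> 'a::euclidean_space \<Rightarrow> 'b::euclidean_space) \<Rightarrow> real \<Rightarrow> 'a \<Rightarrow> real" where
  "energy_density chi lam u t x =
     grad_sq (u t) x / 2 + lam powr (1 - kappa t) / 4 * chi (((norm (u t x))\<^sup>2 - 1)\<^sup>2)"

definition scaled_energy ::
  "(real \<Rightarrow> real) \<Rightarrow> real \<Rightarrow> (real \<Rightarrow> 'a::euclidean_space \<Rightarrow> 'b::euclidean_space) \<Rightarrow> real \<Rightarrow> real \<Rightarrow> 'a \<Rightarrow> real" where
  "scaled_energy chi lam u R t0 x0 =
     1 / R ^ DIM('a) * (LBINT t:{t0 - (2*R)\<^sup>2..t0 - R\<^sup>2}. LBINT x:ball 0 1.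
        energy_density chi lam u t x * exp ((norm (x - x0))\<^sup>2 / (4 * (t - t0))))"

(* A nonnegative integral, so that finiteness is not presupposed. *)
definition dissipation ::
  "(real \<Rightarrow> 'a::euclidean_space \<Rightarrow> 'b::euclidean_space) \<Rightarrow> real \<Rightarrow> real \<Rightarrow> real \<Rightarrow> 'a \<Rightarrow> ennreal" where
  "dissipation u R1 R2 t0 x0 =
     (\<integral>\<^sup>+R\<in>{R1..R2}. ennreal (1 / R ^ (DIM('a) - 1)) *
       (\<integral>\<^sup>+t\<in>{t0 - (2*R)\<^sup>2..t0 - R\<^sup>2}. (\<integral>\<^sup>+x\<in>ball 0 1.
          ennreal ((norm (vector_derivative (\<lambda>s. u s x) (at t)
                     + frechet_derivative (u t) (at x) ((x - x0) /\<^sub>R (2 * (t - t0)))))\<^sup>2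
                   * exp ((norm (x - x0))\<^sup>2 / (4 * (t - t0)))) \<partial>lborel) \<partial>lborel) \<partial>lborel)"

definition monotonicity_const ::
  "real \<Rightarrow> real \<Rightarrow> ('a::euclidean_space \<Rightarrow> 'b::euclidean_space) \<Rightarrow> 'a \<Rightarrow> real" where
  "monotonicity_const C \<delta> u0 x0 =
     C / infdist x0 (frontier (ball 0 1)) ^ (DIM('a) + 2) *
       ((\<integral>x. tangential_grad_sq \<delta> u0 x \<partial>surface_measure)
        + (\<integral>x. weak_grad_sq (ball 0 1) u0 x \<partial>lebesgue_on (ball 0 1)))"

end

theory Submission
 imports Defs "HOL-Analysis.Analysis" "HOL-Real_Asymp.Real_Asymp"
begin

text \<open>Testing the equation with \<open>u F'(|u|^2 - 1)\<close>, where \<open>F r = r exp (- 1/r)\<close> is flat at 0, gives \<open>|u| \<le> 1\<close>; the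
boundary terms vanish because Hardy's inequality puts \<open>(u - u0)/(1 - |x|^2)\<close> in \<open>L^2\<close>. Testing with \<open>u - u0\<close> and with
difference quotients in time bounds the energy at every time, and \<open>\<integral>\<integral> |u_t|^2\<close>, by \<open>C \<integral> |grad u0|^2\<close>.

With \<open>y = x - x0\<close>, \<open>\<tau> = t0 - t\<close> and \<open>G = exp (- |y|^2/(4 \<tau>))\<close>, the derivative of \<open>R^(-d) \<integral>\<integral> \<phi> e G\<close> in \<open>R\<close> dominates the
dissipation, up to a divergence and terms that contain \<open>grad \<phi>\<close>. The cutoff \<open>\<phi>\<close> is 1 for \<open>|y|^2 \<le> d0^2/2\<close> and vanishes
near the sphere, so the divergence integrates to 0. Whatever carries \<open>grad \<phi>\<close> or \<open>1 - \<phi>\<close> lives where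
\<open>G \<le> exp (- d0^2/(32 R^2))\<close>; this factor beats every power of \<open>d0/R\<close>, and the energy bound applies. The time dependence of the
coupling contributes a term with \<open>(2 + 2 \<tau> \<kappa>' ln \<lambda>) V\<close>. It is negative only if \<open>\<tau> |ln \<lambda>|\<close> is bounded below, and then
\<open>V \<le> \<lambda>^(1/2) |u - u0|^2\<close> is small enough.\<close>

text \<open>Two regularity gaps shape the proof. At the sphere: u is smooth only in the open
  cylinder, so every integration by parts carries cutoffs whose gradient is at most
  \<open>L/(1 - |x|^2)\<close>, exactly the weight of Hardy's inequality, and their errors vanish by
  dominated convergence. At time 0: the gradient of u is not known to converge, so the energy cannot
  simply be followed down to t = 0. Testing with u - u0 bounds the integral of |grad u|^2 over (0,
  b) by \<open>b exp (c b)\<close> times the Dirichlet integral of u0. The resulting mean over a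
  short interval is at most the Dirichlet integral in the limit, whatever \<lambda> is in c, and
  Steklov averages carry this to later times. The maximum principle comes first because chi is not
  assumed monotone; once |u| \<le> 1, chi acts as the identity. Since \<open>kappa < 1/2\<close>,
  the coupling is at most \<open>\<lambda>^(1/2)\<close> for \<lambda> \<le> 1, and
  \<open>\<lambda>^(1/2) |ln \<lambda>|\<close> is bounded, which keeps all constants free of
  \<lambda>. The part of the energy under \<open>1 - \<phi>\<close> reaches the sphere, so it is not
  differentiated in R but compared directly between two radii.\<close>

lemmas L1_bound = Bochner_Integration.integrable_bound
 and L1_cong = Bochner_Integration.integral_cong
 and L1_sum = Bochner_Integration.integral_sum
 and L1_nonneg = Bochner_Integration.integral_nonneg
 and L1_diff = Bochner_Integration.integrable_diff

lemmas spaces = space_pair_measure space_restrict_space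

notation scaleR (infixr ".*" 75)

abbreviation LI :: "'a measure => ('a => 'b) => 'b::{banach, second_countable_topology}" where
 "LI \<equiv> integral\<^sup>L"

abbreviation (input) tends_to :: "(nat => 'a::topological_space) => 'a => bool" (infix "---->" 60) where
 "X ----> l \<equiv> X \<longlonglongrightarrow> l"

abbreviation nsq :: "'a::real_normed_vector => real" where "nsq x \<equiv> (norm x)^2"

section \<open>Smooth functions\<close>

text \<open>\<open>frechet_derivative\<close> is a Hilbert choice, so it is enough that
  \<open>f\<close> and \<open>g\<close> have the same set of derivatives at
  \<open>x\<close>.\<close>

lemma frechet_derivative_cong_open:
 assumes "open S" "x \<in> S" "\<And>y. y \<in> S ==> f y = g y"
 shows "frechet_derivative f (at x) = frechet_derivative g (at x)"
proof -
 have "(f has_derivative f') (at x) \<longleftrightarrow> (g has_derivative f') (at x)" for f'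
  using assms by (metis has_derivative_transform_within_open)
 then show ?thesis
  unfolding frechet_derivative_def by simp
qed

lemma differentiable_on_cong_open:
 assumes "open S" "\<And>y. y \<in> S ==> f y = g y" "f differentiable_on S"
 shows "g differentiable_on S"
 using assms(2,3) by (auto simp: differentiable_on_def intro: differentiable_transform_within[where d=1])

lemma Ck_on_cong:
 assumes "open S" "\<And>y. y \<in> S ==> f y = g y" "Ck_on k f S"
 shows "Ck_on k g S"
 using assms(2,3)
proof (induction k arbitrary: f g)
 case 0
 then show ?case by (simp cong: continuous_on_cong)
next
 case (Suc k)
 have "Ck_on k (\<lambda>x. frechet_derivative g (at x) v) S" for v
 proof (rule Suc.IH)
  show "Ck_on k (\<lambda>x. frechet_derivative f (at x) v) S" using Suc.prems by simp
  show "\<And>y. y \<in> S ==> frechet_derivative f (at y) v = frechet_derivative g (at y) v"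
   using frechet_derivative_cong_open[OF assms(1)] Suc.prems(1) by metis
 qed
 then show ?case
  using differentiable_on_cong_open[OF assms(1) Suc.prems(1)] Suc.prems(2) by auto
qed

lemma Ck_on_SucD: "Ck_on (Suc k) f S ==> Ck_on k f S"
proof (induction k arbitrary: f)
 case 0
 then show ?case by (simp add: differentiable_imp_continuous_on)
next
 case (Suc k)
 then have "Ck_on k (\<lambda>x. frechet_derivative f (at x) v) S" for v
  using Suc.prems Suc.IH Ck_on.simps(2) by blast
 with Suc.prems show ?case by simp
qed

text \<open>\<open>Ck_on\<close> speaks of the chosen \<open>frechet_derivative\<close>; this rule
  lets the derivative be computed by the usual rules as an explicit \<open>f'\<close>. All closure
  properties below rest on it.\<close>

lemma Ck_on_SucI:
 assumes "open S" "\<And>x. x \<in> S ==> (f has_derivative f' x) (at x)" "\<And>v. Ck_on k (\<lambda>x. f' x v) S"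
 shows "Ck_on (Suc k) f S"
proof -
 have "f' x = frechet_derivative f (at x)" if "x \<in> S" for x
  using assms(2) frechet_derivative_at that by blast
 then have "Ck_on k (\<lambda>x. frechet_derivative f (at x) v) S" for v
  by (intro Ck_on_cong[OF assms(1) _ assms(3)[of v]]) auto
 moreover have "f differentiable_on S"
  using assms(2) by (meson differentiable_at_withinI differentiable_def differentiable_on_def)
 ultimately show ?thesis by simp
qed

lemma Ck_on_Suc_has_derivative:
 assumes "open S" "Ck_on (Suc k) f S" "x \<in> S"
 shows "(f has_derivative frechet_derivative f (at x)) (at x)"
proof -
 have "f differentiable_on S" using assms(2) unfolding Ck_on.simps by blast
 then have "f differentiable (at x)"
  using assms(1,3) by (metis differentiable_on_def at_within_open)
 then show ?thesis using frechet_derivative_works by blast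
qed

lemma Ck_on_subset:
 assumes "Ck_on k f S" "open S" "open S'" "S' \<subseteq> S"
 shows "Ck_on k f S'"
 using assms(1)
proof (induction k arbitrary: f)
 case 0
 then show ?case using assms continuous_on_subset by auto
next
 case (Suc k)
 then show ?case using assms differentiable_on_subset by auto
qed

lemma Ck_on_const: "open S ==> Ck_on k (\<lambda>x. c) S"
 by (induction k arbitrary: c) (auto simp del: Ck_on.simps(2) intro!: Ck_on_SucI derivative_eq_intros)

lemma Ck_on_linear:
 assumes "open S" "bounded_linear f"
 shows "Ck_on k f S"
proof (cases k)
 case 0
 then show ?thesis using assms by (auto intro: linear_continuous_on)
next
 case (Suc j)
 show ?thesis unfolding Suc
  by (rule Ck_on_SucI[where f' = "\<lambda>x. f"])
   (use assms in \<open>auto intro: bounded_linear_imp_has_derivative Ck_on_const\<close>)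
qed

lemma Ck_on_bounded_linear_compose:
 assumes S: "open S" and h: "bounded_linear h" and f: "Ck_on k f S"
 shows "Ck_on k (\<lambda>x. h (f x)) S"
 using f
proof (induction k arbitrary: f)
 case 0
 then show ?case using h by (auto intro: bounded_linear.continuous_on)
next
 case (Suc k)
 note d = Ck_on_Suc_has_derivative[OF S Suc.prems]
 show ?case
  by (rule Ck_on_SucI[OF S, where f' = "\<lambda>x v. h (frechet_derivative f (at x) v)"])
   (use d Suc in \<open>auto intro: bounded_linear.has_derivative[OF h]\<close>)
qed

lemma Ck_on_add:
 assumes S: "open S" and "Ck_on k f S" "Ck_on k g S"
 shows "Ck_on k (\<lambda>x. f x + g x) S"
 using assms(2,3)
proof (induction k arbitrary: f g)
 case 0
 then show ?case by (auto intro: continuous_on_add)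
next
 case (Suc k)
 note d = Ck_on_Suc_has_derivative[OF S Suc.prems(1)] Ck_on_Suc_has_derivative[OF S Suc.prems(2)]
 show ?case
  by (rule Ck_on_SucI[OF S, where f' = "\<lambda>x v. frechet_derivative f (at x) v + frechet_derivative g (at x) v"])
   (use d Suc in \<open>auto intro!: has_derivative_add\<close>)
qed

lemma Ck_on_bilinear:
 assumes S: "open S" and h: "bounded_bilinear h" and "Ck_on k f S" "Ck_on k g S"
 shows "Ck_on k (\<lambda>x. h (f x) (g x)) S"
 using assms(3,4)
proof (induction k arbitrary: f g)
 case 0
 then show ?case using h by (auto intro: bounded_bilinear.continuous_on)
next
 case (Suc k)
 note d = Ck_on_Suc_has_derivative[OF S Suc.prems(1)] Ck_on_Suc_has_derivative[OF S Suc.prems(2)]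
 show ?case
 proof (rule Ck_on_SucI[OF S, where f' = "\<lambda>x v. h (f x) (frechet_derivative g (at x) v) + h (frechet_derivative f (at x) v) (g x)"])
  show "((\<lambda>x. h (f x) (g x)) has_derivative (\<lambda>v. h (f x) (frechet_derivative g (at x) v) + h (frechet_derivative f (at x) v) (g x))) (at x)"
   if "x \<in> S" for x
   using bounded_bilinear.FDERIV[OF h d(1)[OF that] d(2)[OF that]] .
  show "Ck_on k (\<lambda>x. h (f x) (frechet_derivative g (at x) v) + h (frechet_derivative f (at x) v) (g x)) S" for v
   by (intro Ck_on_add[OF S] Suc.IH) (use Suc.prems Ck_on_SucD in auto)
 qed
qed

text \<open>A real inner function makes the chain rule a product of a scalar derivative and
  \<open>\<beta>' (q x)\<close>. Hence the induction varies only \<open>\<beta>\<close> and closes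
  with the product rule.\<close>

lemma Ck_on_compose_real:
 fixes q :: "'a::euclidean_space => real" and \<beta> :: "real => 'b::euclidean_space"
 assumes S: "open S" and q: "Ck_on k q S" and \<beta>: "Ck_on k \<beta> T" "open T" "q ` S \<subseteq> T"
 shows "Ck_on k (\<lambda>x. \<beta> (q x)) S"
 using q \<beta>(1)
proof (induction k arbitrary: \<beta>)
 case 0
 then show ?case using \<beta>(3) by (auto intro: continuous_on_compose2)
next
 case (Suc k)
 note dq = Ck_on_Suc_has_derivative[OF S Suc.prems(1)]
 note db = Ck_on_Suc_has_derivative[OF \<open>open T\<close> Suc.prems(2)]
 define \<beta>' where "\<beta>' = (\<lambda>s. frechet_derivative \<beta> (at s) 1)"
 have db': "(\<beta> has_derivative (\<lambda>v. v .* \<beta>' s)) (at s)" if "s \<in> T" for s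
 proof -
  have "frechet_derivative \<beta> (at s) v = v .* \<beta>' s" for v
   using linear_scale[OF linear_frechet_derivative, of \<beta> "at s" v 1] db[OF that]
   by (auto simp: \<beta>'_def differentiable_def)
  then have "frechet_derivative \<beta> (at s) = (\<lambda>v. v .* \<beta>' s)" by blast
  then show ?thesis using db[OF that] by simp
 qed
 show ?case
 proof (rule Ck_on_SucI[OF S, where f' = "\<lambda>x v. frechet_derivative q (at x) v .* \<beta>' (q x)"])
  show "((\<lambda>x. \<beta> (q x)) has_derivative (\<lambda>v. frechet_derivative q (at x) v .* \<beta>' (q x))) (at x)"
   if "x \<in> S" for x
   using has_derivative_compose[OF dq[OF that] db'[of "q x"]] that \<beta>(3) by auto
  have "Ck_on k \<beta>' T" using Suc.prems unfolding \<beta>'_def by auto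
  then have "Ck_on k (\<lambda>x. \<beta>' (q x)) S" using Suc.IH Ck_on_SucD[OF Suc.prems(1)] by auto
  then show "Ck_on k (\<lambda>x. frechet_derivative q (at x) v .* \<beta>' (q x)) S" for v
   by (intro Ck_on_bilinear[OF S bounded_bilinear_scaleR]) (use Suc.prems in auto)
 qed
qed

lemma smooth_on_cong:
 "open S ==> (\<And>y. y \<in> S ==> f y = g y) ==> smooth_on S f ==> smooth_on S g"
 unfolding smooth_on_def using Ck_on_cong by blast

lemma smooth_on_subset: "smooth_on S f ==> open S ==> open S' ==> S' \<subseteq> S ==> smooth_on S' f"
 unfolding smooth_on_def using Ck_on_subset by blast

lemma smooth_on_const: "open S ==> smooth_on S (\<lambda>x. c)"
 unfolding smooth_on_def using Ck_on_const by blast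

lemma smooth_on_linear: "open S ==> bounded_linear f ==> smooth_on S f"
 unfolding smooth_on_def using Ck_on_linear by blast

lemma smooth_on_bounded_linear_compose:
 "open S ==> bounded_linear h ==> smooth_on S f ==> smooth_on S (\<lambda>x. h (f x))"
 unfolding smooth_on_def using Ck_on_bounded_linear_compose by blast

lemma smooth_on_add: "open S ==> smooth_on S f ==> smooth_on S g ==> smooth_on S (\<lambda>x. f x + g x)"
 unfolding smooth_on_def using Ck_on_add by blast

lemma smooth_on_bilinear:
 "open S ==> bounded_bilinear h ==> smooth_on S f ==> smooth_on S g ==> smooth_on S (\<lambda>x. h (f x) (g x))"
 unfolding smooth_on_def using Ck_on_bilinear by blast

lemmas smooth_on_inner = smooth_on_bilinear[OF _ bounded_bilinear_inner]
lemmas smooth_on_mult = smooth_on_bilinear[OF _ bounded_bilinear_mult]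

lemma smooth_on_prod:
 fixes f :: "'i => 'a::euclidean_space => real"
 assumes "open S" "finite I" "\<And>i. i \<in> I ==> smooth_on S (f i)"
 shows "smooth_on S (\<lambda>x. \<Prod>i\<in>I. f i x)"
 using assms(2,3) by (induction I) (auto simp: smooth_on_const smooth_on_mult assms(1))

lemma smooth_on_compose_real:
 fixes q :: "'a::euclidean_space => real" and \<beta> :: "real => 'b::euclidean_space"
 shows "open S ==> smooth_on S q ==> smooth_on UNIV \<beta> ==> smooth_on S (\<lambda>x. \<beta> (q x))"
 unfolding smooth_on_def using Ck_on_compose_real[where T=UNIV] by blast

lemma smooth_on_deriv: "smooth_on S f ==> smooth_on S (\<lambda>x. frechet_derivative f (at x) v)"
 unfolding smooth_on_def using Ck_on.simps(2) by blast

lemma smooth_on_imp_continuous_on: "smooth_on S f ==> continuous_on S f"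
 unfolding smooth_on_def using Ck_on.simps(1) by blast

lemma smooth_on_has_derivative:
 "open S ==> smooth_on S f ==> x \<in> S ==> (f has_derivative frechet_derivative f (at x)) (at x)"
 unfolding smooth_on_def using Ck_on_Suc_has_derivative by blast

lemma smooth_on_union:
 assumes "open A" "open B" "smooth_on A f" "smooth_on B f"
 shows "smooth_on (A \<union> B) f"
proof -
 have "Ck_on k f (A \<union> B)" if "Ck_on k f A" "Ck_on k f B" for k and f :: "'a => 'b"
  using that
 proof (induction k arbitrary: f)
  case 0
  then show ?case using assms by (auto intro: continuous_on_open_Un)
 next
  case (Suc k)
  have "f differentiable_on (A \<union> B)"
   using Suc.prems assms(1,2) by (auto simp: differentiable_on_eq_differentiable_at open_Un)
  then show ?case using Suc by auto
 qed
 then show ?thesis using assms by (auto simp: smooth_on_def)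
qed

text \<open>\<open>S\<close> and the complement of \<open>K\<close> are open and cover the space,
  and the extension is smooth on each. Smoothness is glued from the two instead of being examined at
  the boundary of \<open>S\<close>.\<close>

lemma smooth_on_extend_zero:
 fixes f :: "'a::euclidean_space => 'b::euclidean_space"
 assumes "open S" "compact K" "K \<subseteq> S" "smooth_on S f" "\<And>x. x \<in> S - K ==> f x = 0"
 shows "smooth_on UNIV (\<lambda>x. if x \<in> S then f x else 0)"
proof -
 have "smooth_on (S \<union> - K) (\<lambda>x. if x \<in> S then f x else 0)"
 proof (rule smooth_on_union)
  show "open (- K)" using assms by (simp add: compact_imp_closed open_Compl)
  show "smooth_on S (\<lambda>x. if x \<in> S then f x else 0)"
   by (rule smooth_on_cong[OF assms(1) _ assms(4)]) auto
  show "smooth_on (- K) (\<lambda>x. if x \<in> S then f x else 0)"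
   by (rule smooth_on_cong[OF \<open>open (- K)\<close> _ smooth_on_const[OF \<open>open (- K)\<close>, of 0]])
    (use assms in auto)
 qed (use assms in auto)
 moreover have "S \<union> - K = UNIV" using assms(3) by auto
 ultimately show ?thesis by simp
qed

text \<open>The one-dimensional profile: derivatives of \<open>exp (-1/x)\<close> have the form \<open>p (1/x) exp (-1/x)\<close>.\<close>

definition flat_exp :: "real poly => real => real" where
 "flat_exp p x = (if x \<le> 0 then 0 else poly p (1/x) * exp (-(1/x)))"

lemma poly_exp_tendsto_0: "((\<lambda>y. poly p y * exp (- y)) \<longlongrightarrow> (0::real)) at_top"
proof -
 have "((\<lambda>y. \<Sum>i\<le>degree p. coeff p i * (y ^ i/exp y)) \<longlongrightarrow> (\<Sum>i\<le>degree p. coeff p i * 0)) at_top"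
  by (intro tendsto_sum tendsto_mult tendsto_const tendsto_power_div_exp_0)
 then show ?thesis
  by (simp add: poly_altdef sum_divide_distrib exp_minus field_simps)
qed

text \<open>With y = 1/x the chain rule gives \<open>y^2 (p y - p' y) exp (- y)\<close>, and
  \<open>[:0,0,1:]\<close> is the factor y^2. At 0 the difference quotient is again of the form
  \<open>poly p y * exp (- y)\<close>, with \<open>pCons 0 p\<close>, and tends to 0.\<close>

lemma flat_exp_has_derivative:
 "(flat_exp p has_real_derivative flat_exp ([:0,0,1:] * (p - pderiv p)) x) (at x)"
proof -
 let ?q = "[:0,0,1:] * (p - pderiv p)"
 consider "x < 0" | "x = 0" | "x > 0" by linarith
 then show ?thesis
 proof cases
  case 1
  have "((\<lambda>x. 0) has_real_derivative 0) (at x)" by simp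
  then have "(flat_exp p has_real_derivative 0) (at x)"
   by (rule has_field_derivative_transform_within_open[where S="{..<0}"]) (use 1 in \<open>auto simp: flat_exp_def\<close>)
  then show ?thesis using 1 by (simp add: flat_exp_def)
 next
  case 3
  have "((\<lambda>x. poly p (1/x) * exp (-(1/x))) has_real_derivative flat_exp ?q x) (at x)"
   using 3 by (auto intro!: derivative_eq_intros simp: flat_exp_def field_simps power2_eq_square)
  then show ?thesis
   by (rule has_field_derivative_transform_within_open[where S="{0<..}"]) (use 3 in \<open>auto simp: flat_exp_def\<close>)
 next
  case 2
  have "((\<lambda>h. flat_exp p h/h) \<longlongrightarrow> 0) (at_right 0)"
  proof -
   have "((\<lambda>h. poly (pCons 0 p) (1/h) * exp (-(1/h))) \<longlongrightarrow> 0) (at_right (0::real))"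
    using filterlim_compose[OF poly_exp_tendsto_0[of "pCons 0 p"] filterlim_inverse_at_top_right]
    by (simp add: inverse_eq_divide)
   moreover have "\<forall>\<^sub>F h in at_right (0::real). poly (pCons 0 p) (1/h) * exp (-(1/h)) = flat_exp p h/h"
    unfolding eventually_at_filter by (rule always_eventually) (auto simp: flat_exp_def)
   ultimately show ?thesis by (rule Lim_transform_eventually)
  qed
  moreover have "((\<lambda>h. flat_exp p h/h) \<longlongrightarrow> 0) (at_left 0)"
  proof -
   have "\<forall>\<^sub>F h in at_left (0::real). 0 = flat_exp p h/h"
    unfolding eventually_at_filter by (rule always_eventually) (auto simp: flat_exp_def)
   then show ?thesis by (rule Lim_transform_eventually[OF tendsto_const])
  qed
  ultimately have "((\<lambda>h. flat_exp p h/h) \<longlongrightarrow> 0) (at 0)"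
   by (simp add: filterlim_split_at)
  then show ?thesis using 2 by (simp add: DERIV_def flat_exp_def)
 qed
qed

lemma smooth_flat_exp: "smooth_on UNIV (flat_exp p)"
proof -
 have "Ck_on k (flat_exp p) UNIV" for k
 proof (induction k arbitrary: p)
  case 0
  then show ?case
   using DERIV_isCont[OF flat_exp_has_derivative] by (simp add: continuous_at_imp_continuous_on)
 next
  case (Suc k)
  show ?case
  proof (rule Ck_on_SucI)
   show "(flat_exp p has_derivative (\<lambda>v. v * flat_exp ([:0,0,1:] * (p - pderiv p)) x)) (at x)" for x
    using flat_exp_has_derivative[of p x] unfolding has_field_derivative_def
    by (rule has_derivative_eq_rhs) (simp add: fun_eq_iff)
   show "Ck_on k (\<lambda>x. v * flat_exp ([:0,0,1:] * (p - pderiv p)) x) UNIV" for v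
    by (intro Ck_on_bilinear[OF _ bounded_bilinear_mult] Ck_on_const Suc.IH) auto
  qed auto
 qed
 then show ?thesis by (simp add: smooth_on_def)
qed

locale smooth_step =
 fixes \<beta> \<beta>' :: "real => real" and L :: real
 assumes \<beta>: "\<And>x. (\<beta> has_real_derivative \<beta>' x) (at x)" "continuous_on UNIV \<beta>'"
  "\<And>x. x \<le> 0 ==> \<beta> x = 0" "\<And>x. x \<ge> 1 ==> \<beta> x = 1" "\<And>x. 0 \<le> \<beta> x" "\<And>x. \<beta> x \<le> 1"
  "\<And>x. 0 \<le> \<beta>' x" "\<And>x. \<beta>' x \<le> L" "\<And>x. x \<le> 0 ==> \<beta>' x = 0" "\<And>x. x \<ge> 1 ==> \<beta>' x = 0" "L > 0"
  "smooth_on UNIV \<beta>"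

text \<open>A smooth step is the normalised primitive of \<open>exp (-1/x) exp (-1/(1-x))\<close>.\<close>

lemma smooth_step_exists: "\<exists>\<beta> \<beta>' L. smooth_step \<beta> \<beta>' L"
proof -
 define b where "b x = flat_exp 1 x * flat_exp 1 (1 - x)" for x
 have bs: "smooth_on UNIV b"
  unfolding b_def
 proof (rule smooth_on_mult[OF open_UNIV smooth_flat_exp])
  have "smooth_on UNIV (\<lambda>x::real. - x)"
   by (intro smooth_on_linear bounded_linear_minus bounded_linear_ident) simp
  then have "smooth_on UNIV (\<lambda>x::real. 1 + - x)"
   by (intro smooth_on_add smooth_on_const) auto
  then have "smooth_on UNIV (\<lambda>x::real. 1 - x)" by simp
  then show "smooth_on UNIV (\<lambda>x. flat_exp 1 (1 - x))"
   by (rule smooth_on_compose_real[OF open_UNIV _ smooth_flat_exp])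
 qed
 have bc: "continuous_on A b" for A
  using smooth_on_imp_continuous_on[OF bs] continuous_on_subset by blast
 have b0: "b x = 0" if "x \<le> 0 \<or> x \<ge> 1" for x using that by (auto simp: b_def flat_exp_def)
 have bp: "b x > 0" if "0 < x" "x < 1" for x using that by (auto simp: b_def flat_exp_def)
 have bn: "b x \<ge> 0" for x using b0 bp by (metis less_eq_real_def linorder_not_le)
 have b1: "b x \<le> 1" for x by (auto simp: b_def flat_exp_def mult_le_one)
 define J where "J x = integral {0..x} b" for x
 have int: "b integrable_on {p..q}" for p q using bc integrable_continuous_interval by blast
 have J0: "J x = 0" if "x \<le> 0" for x
 proof -
  have "J x = integral {0..x} (\<lambda>x. 0)" unfolding J_def
   by (rule Henstock_Kurzweil_Integration.integral_cong) (use that b0 in auto)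
  then show ?thesis by simp
 qed
 have Jd: "(J has_real_derivative b x) (at x)" for x
 proof (cases "x < 0")
  case True
  have "((\<lambda>x. 0) has_real_derivative 0) (at x)" by simp
  then have "(J has_real_derivative 0) (at x)"
   by (rule has_field_derivative_transform_within_open[where S="{..<0}"]) (use True J0 in auto)
  then show ?thesis using True b0 by simp
 next
  case False
  \<comment> \<open>The base point moves to -1, so that 0 lies inside the interval on which the
    fundamental theorem is applied.\<close>
  have eq: "J y = integral {-1..y} b" if "y > -1" for y
  proof (cases "y \<ge> 0")
   case True
   have "integral {-1..0} b = integral {-1..0} (\<lambda>x::real. 0)"
    by (rule Henstock_Kurzweil_Integration.integral_cong) (use b0 in auto)
   then show ?thesis
    using Henstock_Kurzweil_Integration.integral_combine[of "-1" 0 y b] True int by (simp add: J_def)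
  next
   case False
   have "integral {-1..y} b = integral {-1..y} (\<lambda>x::real. 0)"
    by (rule Henstock_Kurzweil_Integration.integral_cong) (use b0 False in auto)
   then show ?thesis using J0 False by simp
  qed
  have "((\<lambda>y. integral {-1..y} b) has_real_derivative b x) (at x within {-1..x+1})"
   by (rule integral_has_real_derivative[OF bc]) (use False in auto)
  then have "((\<lambda>y. integral {-1..y} b) has_real_derivative b x) (at x)"
   by (subst (asm) at_within_interior) (use False in auto)
  then show ?thesis
   by (rule has_field_derivative_transform_within_open[where S="{-1<..}"]) (use False eq in auto)
 qed
 define c where "c = J 1"
 have J1: "J x = c" if "x \<ge> 1" for x
 proof -
  have "integral {1..x} b = integral {1..x} (\<lambda>x::real. 0)"
   by (rule Henstock_Kurzweil_Integration.integral_cong) (use b0 in auto)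
  then show ?thesis
   using Henstock_Kurzweil_Integration.integral_combine[of 0 1 x b] that int by (simp add: J_def c_def)
 qed
 have cpos: "c > 0"
 proof -
  have "\<exists>z>0. z < 1 \<and> J 1 - J 0 = (1 - 0) * b z"
   using MVT2[of 0 1 J b] Jd by auto
  then show ?thesis using bp J0[of 0] by (auto simp: c_def)
 qed
 have mono: "J x \<le> J y" if "x \<le> y" for x y
  by (rule DERIV_nonneg_imp_nondecreasing[OF that]) (use Jd bn in blast)
 have Jn: "0 \<le> J x" for x using mono[of 0 x] J0[of 0] J0[of x] by (cases "x \<ge> 0") auto
 have Jc: "J x \<le> c" for x using mono[of x 1] J1[of x] by (cases "x \<ge> 1") (auto simp: c_def)
 define \<beta> where "\<beta> x = J x/c" for x
 have bd: "(\<beta> has_real_derivative b x/c) (at x)" for x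
  unfolding \<beta>_def using Jd by (rule DERIV_cdivide)
 have "Ck_on k \<beta> UNIV" for k
 proof (cases k)
  case 0
  then show ?thesis using bd DERIV_isCont by (auto intro!: continuous_at_imp_continuous_on)
 next
  case (Suc j)
  show ?thesis unfolding Suc
  proof (rule Ck_on_SucI)
   show "(\<beta> has_derivative (\<lambda>v. (v/c) * b x)) (at x)" for x
    using bd[of x] unfolding has_field_derivative_def
    by (rule has_derivative_eq_rhs) (simp add: fun_eq_iff)
   show "Ck_on j (\<lambda>x. (v/c) * b x) UNIV" for v
    using bs by (intro Ck_on_bilinear[OF _ bounded_bilinear_mult] Ck_on_const) (auto simp: smooth_on_def)
  qed auto
 qed
 then have sm: "smooth_on UNIV \<beta>" by (simp add: smooth_on_def)
 have "smooth_step \<beta> (\<lambda>x. b x/c) (1/c)"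
  by unfold_locales (use sm bd bc J0 J1 Jn Jc cpos b0 bn b1 in \<open>auto simp: \<beta>_def divide_simps intro!: continuous_intros\<close>)
 then show ?thesis by blast
qed

section \<open>Symmetry of second derivatives\<close>

lemma double_difference_mvt:
 fixes f :: "'a::euclidean_space => real"
 assumes S: "open S" "smooth_on S f" and h: "h > 0"
  and box: "\<And>s t. 0 \<le> s ==> s \<le> h ==> 0 \<le> t ==> t \<le> h ==> x + s .* v + t .* w \<in> S"
 shows "\<exists>s t. 0 < s \<and> s < h \<and> 0 < t \<and> t < h \<and>
  f (x + h .* v + h .* w) - f (x + h .* v) - f (x + h .* w) + f x
   = h * h * frechet_derivative (\<lambda>y. frechet_derivative f (at y) v) (at (x + s .* v + t .* w)) w"
proof -
 have d: "((\<lambda>s. f' (z + s .* u)) has_real_derivative frechet_derivative f' (at (z + s .* u)) u) (at s)"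
  if "z + s .* u \<in> S" "smooth_on S f'" for f' :: "'a => real" and z u s
 proof -
  note D = smooth_on_has_derivative[OF S(1) that(2) that(1)]
  have "((\<lambda>s. f' (z + s .* u)) has_derivative (\<lambda>r. frechet_derivative f' (at (z + s .* u)) (r .* u))) (at s)"
   by (rule has_derivative_compose[where f="\<lambda>s. z + s .* u" and g=f', OF _ D])
    (auto intro!: derivative_eq_intros)
  moreover have "(\<lambda>r. frechet_derivative f' (at (z + s .* u)) (r .* u)) = (*) (frechet_derivative f' (at (z + s .* u)) u)"
   using has_derivative_linear[OF D] by (auto simp: linear_scale mult.commute)
  ultimately show ?thesis by (simp add: has_field_derivative_def)
 qed
 let ?D = "\<lambda>y. frechet_derivative f (at y) v"
 let ?g = "\<lambda>s. f ((x + h .* w) + s .* v) - f (x + s .* v)"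
 have eq: "x + h .* w + s .* v = x + s .* v + h .* w" for s by simp
 \<comment> \<open>The double difference is the increment in direction \<open>v\<close> of a
   difference in direction \<open>w\<close>. One mean value step per direction turns it into a
   second derivative at an intermediate point.\<close>
 have "\<exists>s>0. s < h \<and> ?g h - ?g 0 = (h - 0) * (?D ((x + h .* w) + s .* v) - ?D (x + s .* v))"
 proof (rule MVT2[OF h])
  fix s assume s: "0 \<le> s" "s \<le> h"
  have "x + h .* w + s .* v \<in> S" "x + s .* v \<in> S"
   using box[of s h] box[of s 0] s h unfolding eq by auto
  then show "(?g has_real_derivative (?D ((x + h .* w) + s .* v) - ?D (x + s .* v))) (at s)"
   by (intro DERIV_diff d S)
 qed
 then obtain s where s: "0 < s" "s < h" and 1: "?g h - ?g 0 = h * (?D ((x + s .* v) + h .* w) - ?D ((x + s .* v) + 0 .* w))"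
  unfolding eq by auto
 have "\<exists>t>0. t < h \<and> ?D ((x + s .* v) + h .* w) - ?D ((x + s .* v) + 0 .* w)
   = (h - 0) * frechet_derivative ?D (at ((x + s .* v) + t .* w)) w"
 proof (rule MVT2[OF h])
  fix t assume "0 \<le> t" "t \<le> h"
  then show "((\<lambda>t. ?D ((x + s .* v) + t .* w)) has_real_derivative frechet_derivative ?D (at ((x + s .* v) + t .* w)) w) (at t)"
   using s box[of s t] by (intro d smooth_on_deriv S) auto
 qed
 then obtain t where t: "0 < t" "t < h"
  and 2: "?D ((x + s .* v) + h .* w) - ?D ((x + s .* v) + 0 .* w)
   = h * frechet_derivative ?D (at ((x + s .* v) + t .* w)) w" by auto
 have "?g h - ?g 0 = h * (h * frechet_derivative ?D (at ((x + s .* v) + t .* w)) w)"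
  unfolding 1 2 ..
 then show ?thesis
  using s t by (intro exI[of _ s] exI[of _ t]) (simp add: algebra_simps)
qed

text \<open>The same double difference is \<open>h * h\<close> times either mixed derivative, each
  taken at some point of one small parallelogram. Continuity of both mixed derivatives forces them
  to agree as the parallelogram shrinks.\<close>

lemma mixed_partials_commute_real:
 fixes f :: "'a::euclidean_space => real"
 assumes S: "open S" "smooth_on S f" "x \<in> S"
 shows "frechet_derivative (\<lambda>y. frechet_derivative f (at y) v) (at x) w
   = frechet_derivative (\<lambda>y. frechet_derivative f (at y) w) (at x) v"
proof -
 let ?A = "\<lambda>x. frechet_derivative (\<lambda>y. frechet_derivative f (at y) v) (at x) w"
 let ?B = "\<lambda>x. frechet_derivative (\<lambda>y. frechet_derivative f (at y) w) (at x) v"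
 have c: "continuous_on S ?A" "continuous_on S ?B"
  by (auto intro!: smooth_on_imp_continuous_on smooth_on_deriv S)
 have "\<bar>?A x - ?B x\<bar> \<le> e" if e: "e > 0" for e
 proof -
  obtain d1 where d1: "d1 > 0" "\<And>y. y \<in> S ==> dist y x < d1 ==> dist (?A y) (?A x) < e/2"
   using c(1)[unfolded continuous_on_iff, rule_format, OF S(3) half_gt_zero[OF e]] by blast
  obtain d2 where d2: "d2 > 0" "\<And>y. y \<in> S ==> dist y x < d2 ==> dist (?B y) (?B x) < e/2"
   using c(2)[unfolded continuous_on_iff, rule_format, OF S(3) half_gt_zero[OF e]] by blast
  obtain d3 where d3: "d3 > 0" "ball x d3 \<subseteq> S"
   using S openE by blast
  define d where "d = min d1 (min d2 d3)"
  \<comment> \<open>The summand 1 keeps \<open>n\<close> positive and the estimate by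
    \<open>h * n\<close> strict, even for vanishing directions.\<close>
  define n where "n = norm v + norm w + 1"
  have n: "n > 0" by (simp add: n_def add_nonneg_pos)
  define h where "h = d/(2 * n)"
  have dp: "d > 0" using d1 d2 d3 by (auto simp: d_def)
  have h: "h > 0" using dp n by (simp add: h_def)
  have near: "dist (x + s .* v + t .* w) x < d" if "0 \<le> s" "s \<le> h" "0 \<le> t" "t \<le> h" for s t
  proof -
   have "dist (x + s .* v + t .* w) x \<le> s * norm v + t * norm w"
    using norm_triangle_ineq[of "s .* v" "t .* w"] that by (simp add: dist_norm algebra_simps)
   also have "\<dots> \<le> h * norm v + h * norm w"
    using that by (intro add_mono mult_right_mono) auto
   also have "\<dots> < h * n" using h by (simp add: n_def algebra_simps)
   also have "\<dots> \<le> d" using n dp by (simp add: h_def)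
   finally show ?thesis .
  qed
  have nS: "x + s .* v + t .* w \<in> S" if "0 \<le> s" "s \<le> h" "0 \<le> t" "t \<le> h" for s t
   using near[OF that] d3 by (auto simp: d_def dist_commute)
  let ?X = "f (x + h .* v + h .* w) - f (x + h .* v) - f (x + h .* w) + f x"
  obtain s t where st: "0 < s" "s < h" "0 < t" "t < h" "?X = h * h * ?A (x + s .* v + t .* w)"
   using double_difference_mvt[OF S(1,2) h, of x v w] nS by auto
  have eq: "x + t .* v + s .* w = x + s .* w + t .* v" for s t by simp
  obtain s' t' where st': "0 < s'" "s' < h" "0 < t'" "t' < h"
   "f (x + h .* w + h .* v) - f (x + h .* w) - f (x + h .* v) + f x = h * h * ?B (x + s' .* w + t' .* v)"
   using double_difference_mvt[OF S(1,2) h, of x w v] nS unfolding eq by force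
  have "f (x + h .* w + h .* v) - f (x + h .* w) - f (x + h .* v) + f x = ?X"
   unfolding eq[of h h] by simp
  then have *: "?A (x + s .* v + t .* w) = ?B (x + s' .* w + t' .* v)"
   using st(5) st'(5) h by simp
  have "dist (?A (x + s .* v + t .* w)) (?A x) < e/2"
   using d1(2)[OF nS] near[of s t] st by (auto simp: d_def)
  moreover have "dist (?B (x + s' .* w + t' .* v)) (?B x) < e/2"
   using d2(2)[OF nS, of t' s'] near[of t' s'] st' unfolding eq by (auto simp: d_def)
  ultimately show ?thesis using * unfolding dist_real_def by linarith
 qed
 then show ?thesis using field_le_epsilon[of "\<bar>?A x - ?B x\<bar>" 0] by simp
qed

lemma frechet_derivative_inner_left:
 fixes f :: "'a::euclidean_space => 'b::euclidean_space"
 assumes "open S" "smooth_on S f" "x \<in> S"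
 shows "frechet_derivative (\<lambda>y. f y \<bullet> i) (at x) v = frechet_derivative f (at x) v \<bullet> i"
proof -
 have "((\<lambda>y. f y \<bullet> i) has_derivative (\<lambda>v. frechet_derivative f (at x) v \<bullet> i)) (at x)"
  using smooth_on_has_derivative[OF assms] by (rule has_derivative_inner_left)
 from frechet_derivative_at[OF this] show ?thesis by metis
qed

lemma mixed_partials_commute:
 fixes f :: "'a::euclidean_space => 'b::euclidean_space"
 assumes S: "open S" "smooth_on S f" "x \<in> S"
 shows "frechet_derivative (\<lambda>y. frechet_derivative f (at y) v) (at x) w
   = frechet_derivative (\<lambda>y. frechet_derivative f (at y) w) (at x) v"
proof (rule euclidean_eqI)
 fix i :: 'b
 have *: "frechet_derivative (\<lambda>y. frechet_derivative f (at y) v) (at x) w \<bullet> i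
  = frechet_derivative (\<lambda>y. frechet_derivative (\<lambda>y. f y \<bullet> i) (at y) v) (at x) w" for v w
 proof -
  have "frechet_derivative (\<lambda>y. frechet_derivative f (at y) v) (at x) w \<bullet> i
   = frechet_derivative (\<lambda>y. frechet_derivative f (at y) v \<bullet> i) (at x) w"
   using frechet_derivative_inner_left[OF S(1) smooth_on_deriv[OF S(2)] S(3)] by metis
  also have "frechet_derivative (\<lambda>y. frechet_derivative f (at y) v \<bullet> i) (at x) 
   = frechet_derivative (\<lambda>y. frechet_derivative (\<lambda>y. f y \<bullet> i) (at y) v) (at x)"
   by (rule frechet_derivative_cong_open[OF S(1,3)]) (simp add: frechet_derivative_inner_left[OF S(1,2)])
  finally show ?thesis .
 qed
 have "smooth_on S (\<lambda>y. f y \<bullet> i)"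
  by (rule smooth_on_bounded_linear_compose[OF S(1) bounded_linear_inner_left S(2)])
 from mixed_partials_commute_real[OF S(1) this S(3)]
 show "frechet_derivative (\<lambda>y. frechet_derivative f (at y) v) (at x) w \<bullet> i
  = frechet_derivative (\<lambda>y. frechet_derivative f (at y) w) (at x) v \<bullet> i"
  unfolding * .
qed

section \<open>Integration by parts and Fubini for Borel functions\<close>

abbreviation lborel_on :: "'a::euclidean_space set => 'a measure" where
 "lborel_on S \<equiv> restrict_space lborel S"

text \<open>Restrictions of \<open>lborel\<close> rather than \<open>lebesgue\<close>: on their
  product, continuous functions are measurable and Fubini's theorem is directly available. Lebesgue
  measurable data are replaced by Borel representatives before they enter.\<close>

abbreviation "lborel2 S B \<equiv> lborel_on S \<Otimes>\<^sub>M lborel_on B"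

lemma borel_measurable_lborel_on:
 fixes f :: "'a::euclidean_space => 'b::euclidean_space"
 shows "continuous_on S f ==> f \<in> borel_measurable (lborel_on S)"
 using borel_measurable_continuous_on_restrict[of S f]
 by (simp cong: measurable_cong_sets add: sets_restrict_space)

lemma integrable_compact_support:
 fixes f :: "'a::euclidean_space => 'b::euclidean_space"
 assumes "S \<in> sets borel" "compact K" "K \<subseteq> S" "continuous_on S f" "\<And>x. x \<in> S - K ==> f x = 0"
 shows "integrable (lborel_on S) f"
proof -
 have "integrable lborel (\<lambda>x. indicator K x .* f x)"
  using assms by (intro borel_integrable_compact continuous_on_subset[OF assms(4)])
 moreover have "(\<lambda>x. indicator K x .* f x) = (\<lambda>x. indicator S x .* f x)"
  using assms by (auto simp: fun_eq_iff indicator_def)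
 ultimately show ?thesis using assms(1) by (simp add: integrable_restrict_space)
qed

text \<open>Every difference quotient of \<open>F\<close> in direction \<open>b\<close> has integral
  0 by translation invariance. The quotients converge to the partial derivative and are dominated,
  via the mean value theorem, by a constant on a ball.\<close>

lemma integral_partial_zero_UNIV:
 fixes F :: "'a::euclidean_space => real"
 assumes K: "compact K" and d: "\<And>x. (F has_derivative F' x) (at x)"
  and c: "continuous_on UNIV (\<lambda>x. F' x b)" and z: "\<And>x. x \<notin> K ==> F x = 0"
 shows "LI lborel (\<lambda>x. F' x b) = 0"
proof -
 have Fc: "continuous_on UNIV F" 
  by (intro continuous_at_imp_continuous_on ballI has_derivative_continuous[OF d])
 have F'0: "F' x b = 0" if "x \<notin> K" for x
 proof -
  have "((\<lambda>x. 0) has_derivative (\<lambda>x. 0)) (at x)" by simp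
  then have "(F has_derivative (\<lambda>x. 0)) (at x)"
   by (rule has_derivative_transform_within_open[where s="- K"])
    (use K that z compact_imp_closed in \<open>auto simp: open_Compl\<close>)
  from has_derivative_unique[OF d this] show ?thesis by simp
 qed
 have "compact ((\<lambda>x. F' x b) ` K)"
  using K c compact_continuous_image continuous_on_subset by blast
 then obtain M where M: "\<And>x. x \<in> K ==> \<bar>F' x b\<bar> \<le> M" 
  using compact_imp_bounded bounded_iff by (metis (no_types, lifting) imageI real_norm_def)
 define M' where "M' = max M 0"
 have M': "\<bar>F' x b\<bar> \<le> M'" for x
  using M[of x] F'0[of x] by (cases "x \<in> K") (auto simp: M'_def)
 obtain r where r: "K \<subseteq> ball 0 r" using K compact_imp_bounded bounded_subset_ballD by metis
 define h where "h n = 1/real (Suc n)" for n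
 have h: "0 < h n" "h n \<le> 1" for n by (auto simp: h_def)
 define q where "q n x = (F (x + h n .* b) - F x)/h n" for n x
 have dl: "((\<lambda>s. F (x + s .* b)) has_real_derivative F' (x + s .* b) b) (at s)" for x s
 proof -
  have "((\<lambda>s. F (x + s .* b)) has_derivative (\<lambda>r. F' (x + s .* b) (r .* b))) (at s)"
   by (rule has_derivative_compose[where f="\<lambda>s. x + s .* b" and g=F, OF _ d])
    (auto intro!: derivative_eq_intros)
  moreover have "(\<lambda>r. F' (x + s .* b) (r .* b)) = (*) (F' (x + s .* b) b)"
   using has_derivative_linear[OF d] by (auto simp: linear_scale mult.commute)
  ultimately show ?thesis by (simp add: has_field_derivative_def)
 qed
 \<comment> \<open>The steps are at most 1, so a quotient vanishes farther than
   \<open>norm b\<close> from the ball that contains \<open>K\<close>.\<close>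
 have qb: "\<bar>q n x\<bar> \<le> M' * indicator (cball 0 (r + norm b)) x" for n x
 proof (cases "x \<in> cball 0 (r + norm b)")
  case True
  obtain s where "F (x + h n .* b) - F (x + 0 .* b) = (h n - 0) * F' (x + s .* b) b"
   using MVT2[OF h(1)[of n], of "\<lambda>s. F (x + s .* b)" "\<lambda>s. F' (x + s .* b) b"] dl by auto
  then have "q n x = F' (x + s .* b) b" using h(1)[of n] by (simp add: q_def)
  then show ?thesis using M' True by simp
 next
  case False
  have "norm x - norm (h n .* b) \<le> norm (x + h n .* b)" by (metis norm_diff_ineq)
  moreover have "norm (h n .* b) \<le> norm b" using h[of n] by (simp add: mult_left_le_one_le)
  moreover have "norm x > r + norm b" using False by simp
  ultimately have "norm (x + h n .* b) > r" "norm x > r" using norm_ge_zero[of b] by linarith+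
  then have "x + h n .* b \<notin> K" "x \<notin> K" using r by (auto simp: subset_iff)
  then show ?thesis using z M'_def by (simp add: q_def)
 qed
 have lim: "(\<lambda>n. q n x) ----> F' x b" for x
 proof -
  have "((\<lambda>s. (F (x + s .* b) - F x)/s) \<longlongrightarrow> F' x b) (at 0)"
   using dl[of x 0] by (simp add: DERIV_def)
  moreover have "filterlim h (at 0) sequentially"
   unfolding filterlim_at h_def using LIMSEQ_inverse_real_of_nat
   by (auto simp: inverse_eq_divide)
  ultimately show ?thesis unfolding q_def by (rule filterlim_compose)
 qed
 have qm: "q n \<in> borel_measurable lborel" for n
 proof -
  have "continuous_on UNIV (q n)" unfolding q_def
   by (intro continuous_intros continuous_on_compose2[OF Fc]) (use h[of n] in auto)
  then show ?thesis by (simp add: borel_measurable_continuous_onI)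
 qed
 have "(\<lambda>n. LI lborel (q n)) ----> LI lborel (\<lambda>x. F' x b)"
 proof (rule integral_dominated_convergence[where w="\<lambda>x. M' * indicator (cball 0 (r + norm b)) x"])
  show "integrable lborel (\<lambda>x. M' * indicat_real (cball 0 (r + norm b)) x)"
   by (intro integrable_mult_right integrable_real_indicator) (use emeasure_bounded_finite[OF bounded_cball] in auto)
 qed (use c qb lim qm in \<open>auto intro!: borel_measurable_continuous_onI\<close>)
 moreover have "LI lborel (q n) = 0" for n
 proof -
  have i: "integrable lborel F"
   using integrable_compact_support[of UNIV K F] K Fc z by (auto simp: integrable_restrict_space)
  have dist: "distr lborel borel ((+) (h n .* b)) = lborel" by (rule lborel_distr_plus)
  have Fm: "F \<in> borel_measurable borel" using Fc by (rule borel_measurable_continuous_onI)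
  have "LI lborel (\<lambda>x. F (x + h n .* b)) = LI lborel F"
   using integral_distr[of "(+) (h n .* b)" lborel borel F] Fm unfolding dist by (simp add: add.commute)
  moreover have "integrable lborel (\<lambda>x. F (x + h n .* b))"
   using i integrable_distr_eq[of "(+) (h n .* b)" lborel borel F] Fm unfolding dist by (simp add: add.commute)
  ultimately show ?thesis unfolding q_def using i by simp
 qed
 ultimately show ?thesis by (simp add: LIMSEQ_const_iff)
qed

text \<open>Extension by zero reduces this to the whole space. Uniqueness of derivatives makes the
  given \<open>f'\<close> vanish on \<open>S - K\<close>, so the extended derivative is continuous
  across the boundary of \<open>S\<close>.\<close>

lemma integral_partial_zero:
 fixes f :: "'a::euclidean_space => real"
 assumes S: "open S" and K: "compact K" "K \<subseteq> S"
  and d: "\<And>x. x \<in> S ==> (f has_derivative f' x) (at x)"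
  and c: "continuous_on S (\<lambda>x. f' x b)" and z: "\<And>x. x \<in> S - K ==> f x = 0"
 shows "LI (lborel_on S) (\<lambda>x. f' x b) = 0"
proof -
 define F where "F x = (if x \<in> S then f x else 0)" for x
 define F' where "F' x = (if x \<in> S then f' x else (\<lambda>_. 0))" for x
 have oK: "open (- K)" using K compact_imp_closed open_Compl by blast
 have d0: "(F has_derivative (\<lambda>x. 0)) (at x)" if "x \<notin> K" for x
 proof -
  have "((\<lambda>x. 0) has_derivative (\<lambda>x. 0)) (at x)" by simp
  then show ?thesis
   by (rule has_derivative_transform_within_open[where s="- K"])
    (use oK that z in \<open>auto simp: F_def\<close>)
 qed
 have dS: "(F has_derivative f' x) (at x)" if "x \<in> S" for x
  by (rule has_derivative_transform_within_open[OF d S]) (use that in \<open>auto simp: F_def\<close>)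
 have "f' x = (\<lambda>_. 0)" if "x \<in> S - K" for x
  using has_derivative_unique[OF dS d0] that by blast
 then have F'0: "F' x = (\<lambda>_. 0)" if "x \<notin> K" for x
  using that by (auto simp: F'_def)
 have "LI lborel (\<lambda>x. F' x b) = 0"
 proof (rule integral_partial_zero_UNIV[OF K(1), of F F'])
  show "(F has_derivative F' x) (at x)" for x
   using dS[of x] d0[of x] K(2) by (auto simp: F'_def)
  have "continuous_on (S \<union> - K) (\<lambda>x. F' x b)"
  proof (rule continuous_on_open_Un[OF S oK])
   show "continuous_on S (\<lambda>x. F' x b)" using c by (rule continuous_on_eq) (simp add: F'_def)
   show "continuous_on (- K) (\<lambda>x. F' x b)"
    by (rule continuous_on_eq[OF continuous_on_const[of _ 0]]) (simp add: F'0)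
  qed
  moreover have "S \<union> - K = UNIV" using K by auto
  ultimately show "continuous_on UNIV (\<lambda>x. F' x b)" by simp
  show "F x = 0" if "x \<notin> K" for x using that z by (auto simp: F_def)
 qed
 moreover have "LI (lborel_on S) (\<lambda>x. f' x b) = LI lborel (\<lambda>x. F' x b)"
  using S by (subst integral_restrict_space) (auto simp: F'_def intro!: L1_cong)
 ultimately show ?thesis by simp
qed

lemma sigma_finite_lborel_on: "S \<in> sets borel ==> sigma_finite_measure (lborel_on S)"
 by (rule sigma_finite_measure_restrict_space[OF sigma_finite_lborel]) simp

text \<open>The fundamental theorem is applied for each fixed \<open>x\<close> and the integrals are
  then exchanged. This avoids differentiation under the integral and asks only for integrability of
  \<open>F'\<close> on the product.\<close>

lemma time_FTC:
 fixes F F' :: "real => 'a::euclidean_space => real"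
 assumes S: "S \<in> sets borel" and ab: "a \<le> b"
  and d: "\<And>x t. x \<in> S ==> t \<in> {a..b} ==> ((\<lambda>t. F t x) has_real_derivative F' t x) (at t)"
  and c: "\<And>x. x \<in> S ==> continuous_on {a..b} (\<lambda>t. F' t x)"
  and i: "integrable (lborel2 {a..b} S) (\<lambda>(t,x). F' t x)"
  and ia: "integrable (lborel_on S) (F a)" and ib: "integrable (lborel_on S) (F b)"
 shows "LI (lborel_on S) (F b) - LI (lborel_on S) (F a)
  = (\<integral>t. (\<integral>x. F' t x \<partial>lborel_on S) \<partial>lborel_on {a..b})"
proof -
 interpret A: sigma_finite_measure "lborel_on {a..b}" by (rule sigma_finite_lborel_on) simp
 interpret B: sigma_finite_measure "lborel_on S" by (rule sigma_finite_lborel_on[OF S])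
 interpret pair_sigma_finite "lborel_on {a..b}" "lborel_on S" ..
 have ftc: "F b x - F a x = (\<integral>t. F' t x \<partial>lborel_on {a..b})" if "x \<in> S" for x
 proof -
  have "(\<integral>t. F' t x \<partial>lborel_on {a..b}) = (LINT t:{a..b}|lborel. F' t x)"
   by (subst integral_restrict_space) (auto simp: set_lebesgue_integral_def)
  also have "\<dots> = F b x - F a x"
  proof -
   have "((\<lambda>t. F' t x) has_integral F b x - F a x) {a..b}"
    using ab has_field_derivative_at_within[OF d[OF that]]
    by (intro fundamental_theorem_of_calculus) (auto simp: has_real_derivative_iff_has_vector_derivative[symmetric])
   moreover have "set_integrable lborel {a..b} (\<lambda>t. F' t x)"
    using c[OF that] by (rule borel_integrable_atLeastAtMost')
   ultimately show ?thesis
    using set_borel_integral_eq_integral(2) integral_unique by metis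
  qed
  finally show ?thesis ..
 qed
 have "LI (lborel_on S) (F b) - LI (lborel_on S) (F a) = (\<integral>x. F b x - F a x \<partial>lborel_on S)"
  using ia ib by simp
 also have "\<dots> = (\<integral>x. (\<integral>t. F' t x \<partial>lborel_on {a..b}) \<partial>lborel_on S)"
  by (rule L1_cong) (use ftc in \<open>auto simp: space_restrict_space\<close>)
 also have "\<dots> = (\<integral>t. (\<integral>x. F' t x \<partial>lborel_on S) \<partial>lborel_on {a..b})"
  using Fubini_integral[OF i] by simp
 finally show ?thesis .
qed

section \<open>Weak derivatives and Hardy's inequality\<close>

lemma AE_lebesgue_on:
 "S \<in> sets borel ==> (AE x in lebesgue_on S. P x) \<longleftrightarrow> (AE x in lborel_on S. P x)"
 by (simp add: AE_restrict_space_iff AE_completion_iff)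

lemma integral_lebesgue_on:
 fixes f :: "'a::euclidean_space => 'b::euclidean_space"
 assumes "S \<in> sets borel" "f \<in> borel_measurable (lborel_on S)"
 shows "LI (lebesgue_on S) f = LI (lborel_on S) f"
  and "integrable (lebesgue_on S) f \<longleftrightarrow> integrable (lborel_on S) f"
 using assms
 by (auto simp: integral_restrict_space integrable_restrict_space borel_measurable_restrict_space_iff
   intro!: integral_completion integrable_completion)

lemma nn_integral_lebesgue_on:
 assumes "S \<in> sets borel"
 shows "nn_integral (lebesgue_on S) f = nn_integral (lborel_on S) f"
 using assms by (simp add: nn_integral_restrict_space nn_integral_completion)

text \<open>Sobolev functions are only Lebesgue measurable; a Borel representative, found coordinate
  by coordinate, is what can enter integrals over the product of time and space.\<close>

lemma lebesgue_on_ex_borel: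
 fixes f :: "'a::euclidean_space => 'b::euclidean_space"
 assumes S: "S \<in> sets borel" and f: "f \<in> borel_measurable (lebesgue_on S)"
 obtains g where "g \<in> borel_measurable borel" "AE x in lborel_on S. f x = g x"
proof -
 have "(\<lambda>x. indicator S x .* f x) \<in> borel_measurable lebesgue"
  using f S by (subst (asm) borel_measurable_restrict_space_iff) auto
 then have "\<forall>i\<in>Basis. \<exists>g\<in>borel_measurable lborel. AE x in lborel. (indicator S x .* f x) \<bullet> i = g x"
  by (intro ballI completion_ex_borel_measurable_real borel_measurable_inner borel_measurable_const)
 then obtain G where G: "\<And>i. i \<in> Basis ==> G i \<in> borel_measurable lborel"
  "\<And>i. i \<in> Basis ==> AE x in lborel. (indicator S x .* f x) \<bullet> i = G i x" by metis
 have "AE x in lborel. \<forall>i\<in>Basis. (indicator S x .* f x) \<bullet> i = G i x"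
  using G(2) by (intro AE_finite_allI) auto
 then have "AE x in lborel. x \<in> S \<longrightarrow> f x = (\<Sum>i\<in>Basis. G i x .* i)"
 proof eventually_elim
  case (elim x)
  show ?case
  proof
   assume "x \<in> S"
   with elim have "G i x = f x \<bullet> i" if "i \<in> Basis" for i using that by auto
   then have "(\<Sum>i\<in>Basis. G i x .* i) = (\<Sum>i\<in>Basis. (f x \<bullet> i) .* i)" by simp
   then show "f x = (\<Sum>i\<in>Basis. G i x .* i)" by (simp add: euclidean_representation)
  qed
 qed
 then have "AE x in lborel_on S. f x = (\<Sum>i\<in>Basis. G i x .* i)"
  using S by (simp add: AE_restrict_space_iff)
 moreover have "(\<lambda>x. \<Sum>i\<in>Basis. G i x .* i) \<in> borel_measurable borel"
  using G(1) by (intro borel_measurable_sum borel_measurable_scaleR) auto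
 ultimately show ?thesis using that by blast
qed

lemma test_function_times_integrable:
 fixes g :: "'a::euclidean_space => 'b::euclidean_space" and \<phi> :: "'a => real"
 assumes \<Omega>: "open \<Omega>" and c: "continuous_on UNIV \<phi>" and K: "compact K" "K \<subseteq> \<Omega>" "\<And>x. x \<notin> K ==> \<phi> x = 0"
  and g: "locally_integrable_on \<Omega> g"
 shows "integrable (lebesgue_on \<Omega>) (\<lambda>x. \<phi> x .* g x)"
proof -
 have cK: "continuous_on K \<phi>" using c continuous_on_subset by blast
 obtain M where M: "\<And>x. x \<in> K ==> norm (\<phi> x) \<le> M"
  using K(1) compact_continuous_image[OF cK] compact_imp_bounded bounded_iff
  by (metis (no_types, lifting) imageI)
 have K': "K \<in> sets lebesgue" using K(1) by (simp add: compact_imp_closed)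
 have gK: "integrable (lebesgue_on K) g" using g K by (simp add: locally_integrable_on_def)
 have "integrable (lebesgue_on K) (\<lambda>x. \<phi> x .* g x)"
 proof (rule L1_bound)
  show "integrable (lebesgue_on K) (\<lambda>x. M .* g x)" using gK by simp
  show "(\<lambda>x. \<phi> x .* g x) \<in> borel_measurable (lebesgue_on K)"
   using gK c by (intro borel_measurable_scaleR continuous_imp_measurable_on_sets_lebesgue[OF cK K'] borel_measurable_integrable)
  show "AE x in lebesgue_on K. norm (\<phi> x .* g x) \<le> norm (M .* g x)"
  proof (rule AE_I2)
   fix x assume "x \<in> space (lebesgue_on K)"
   then have "\<bar>\<phi> x\<bar> \<le> M" using M by (simp add: space_restrict_space)
   then show "norm (\<phi> x .* g x) \<le> norm (M .* g x)"
    by (simp add: mult_right_mono)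
  qed
 qed
 then have "integrable lebesgue (\<lambda>x. indicator K x .* \<phi> x .* g x)"
  using K' by (subst (asm) integrable_restrict_space) auto
 moreover have "(\<lambda>x. indicator K x .* \<phi> x .* g x) = (\<lambda>x. indicator \<Omega> x .* \<phi> x .* g x)"
  using K by (auto simp: fun_eq_iff indicator_def)
 ultimately show ?thesis using \<Omega> by (simp add: integrable_restrict_space)
qed

lemma test_function_D:
 assumes "test_function \<Omega> \<phi>"
 obtains K where "compact K" "K \<subseteq> \<Omega>" "\<And>x. x \<notin> K ==> \<phi> x = 0" "\<And>x v. x \<notin> K ==> frechet_derivative \<phi> (at x) v = 0"
  "smooth_on UNIV \<phi>" "continuous_on UNIV \<phi>" "\<And>v. continuous_on UNIV (\<lambda>x. frechet_derivative \<phi> (at x) v)"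
  "\<And>x. (\<phi> has_derivative frechet_derivative \<phi> (at x)) (at x)"
proof -
 obtain K where K: "compact K" "K \<subseteq> \<Omega>" "\<And>x. x \<notin> K ==> \<phi> x = 0" and s: "smooth_on UNIV \<phi>"
  using assms by (auto simp: test_function_def)
 have "frechet_derivative \<phi> (at x) v = 0" if "x \<notin> K" for x v
 proof -
  have "frechet_derivative \<phi> (at x) = frechet_derivative (\<lambda>x. 0) (at x)"
   using K that by (intro frechet_derivative_cong_open[of "- K"]) (auto intro: compact_imp_closed)
  then show ?thesis by simp
 qed
 then show ?thesis
  using that[OF K] s smooth_on_imp_continuous_on[OF s] smooth_on_imp_continuous_on[OF smooth_on_deriv[OF s]]
   smooth_on_has_derivative[OF open_UNIV s] by auto
qed

text \<open>Products over the coordinates of smooth steps of scale \<open>1/n\<close> at both faces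
  are test functions supported in the box. They converge to the indicator of the open box, and
  dominated convergence applies; the faces are negligible.\<close>

lemma integral_box_zero_of_weak_zero:
 fixes g :: "'a::euclidean_space => 'b::euclidean_space"
 assumes \<Omega>: "open \<Omega>" and g: "locally_integrable_on \<Omega> g"
  and z: "\<And>\<phi>::'a => real. test_function \<Omega> \<phi> ==> (\<integral>x. \<phi> x .* g x \<partial>lebesgue_on \<Omega>) = 0"
  and box: "cbox a b \<subseteq> \<Omega>"
 shows "integral (cbox a b) g = 0"
proof -
 obtain \<beta> \<beta>' L where "smooth_step \<beta> \<beta>' L" using smooth_step_exists by blast
 then interpret smooth_step \<beta> \<beta>' L .
 define \<phi> where "\<phi> n x = (\<Prod>i\<in>Basis. \<beta> (real n * (x \<bullet> i - a \<bullet> i)) * \<beta> (real n * (b \<bullet> i - x \<bullet> i)))" for n and x :: 'a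
 have lin: "smooth_on UNIV (\<lambda>x::'a. c * (x \<bullet> i) + d)" for c d i
 proof (intro smooth_on_add smooth_on_const smooth_on_linear)
  show "bounded_linear (\<lambda>x. c * (x \<bullet> i))"
   by (intro bounded_linear_const_mult bounded_linear_inner_left)
 qed auto
 have s: "smooth_on UNIV (\<phi> n)" for n
  unfolding \<phi>_def
 proof (intro smooth_on_prod smooth_on_mult)
  fix i :: 'a
  show "smooth_on UNIV (\<lambda>x. \<beta> (real n * (x \<bullet> i - a \<bullet> i)))"
   by (rule smooth_on_compose_real[OF open_UNIV _ \<beta>(12)])
    (use lin[of "real n" i "- real n * (a \<bullet> i)"] in \<open>simp add: algebra_simps\<close>)
  show "smooth_on UNIV (\<lambda>x. \<beta> (real n * (b \<bullet> i - x \<bullet> i)))"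
   by (rule smooth_on_compose_real[OF open_UNIV _ \<beta>(12)])
    (use lin[of "- real n" i "real n * (b \<bullet> i)"] in \<open>simp add: algebra_simps\<close>)
 qed auto
 have out: "\<phi> n x = 0" if nb: "x \<notin> box a b" for n x
 proof -
  obtain i where i: "i \<in> Basis" "x \<bullet> i \<le> a \<bullet> i \<or> b \<bullet> i \<le> x \<bullet> i"
   using nb by (auto simp: mem_box not_less)
  then have "real n * (x \<bullet> i - a \<bullet> i) \<le> 0 \<or> real n * (b \<bullet> i - x \<bullet> i) \<le> 0"
   by (auto simp: mult_nonneg_nonpos)
  then show ?thesis unfolding \<phi>_def
   using i(1) \<beta>(3) by (intro prod_zero) (auto intro!: bexI[of _ i])
 qed
 have test: "test_function \<Omega> (\<phi> n)" for n
  unfolding test_function_def using s out[of _ n] box box_subset_cbox[of a b] by (intro conjI exI[of _ "cbox a b"]) auto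
 have bd: "\<bar>\<phi> n x\<bar> \<le> 1" for n x
 proof -
  have "0 \<le> \<phi> n x" "\<phi> n x \<le> 1" unfolding \<phi>_def
   using \<beta>(5,6) by (auto intro!: prod_nonneg prod_le_1 mult_le_one)
  then show ?thesis by simp
 qed
 have lim: "(\<lambda>n. \<phi> n x) ----> indicator (box a b) x" for x
 proof (cases "x \<in> box a b")
  case False
  then show ?thesis using out by simp
 next
  case True
  have "(\<lambda>n. \<beta> (real n * c)) ----> 1" if "c > 0" for c
  proof -
   have "\<forall>\<^sub>F n in sequentially. real n * c \<ge> 1"
    using that by real_asymp
   then have "\<forall>\<^sub>F n in sequentially. 1 = \<beta> (real n * c)"
    by eventually_elim (use \<beta>(4) in simp)
   then show ?thesis by (rule Lim_transform_eventually[OF tendsto_const])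
  qed
  then have "(\<lambda>n. \<phi> n x) ----> (\<Prod>i\<in>(Basis::'a set). 1 * 1)"
   unfolding \<phi>_def using True by (intro tendsto_prod tendsto_mult) (auto simp: mem_box)
  then show ?thesis using True by simp
 qed
 have cK: "cbox a b \<in> sets lebesgue" by simp
 have gi: "integrable (lebesgue_on (cbox a b)) g"
  using g box by (simp add: locally_integrable_on_def)
 have "(\<lambda>n. \<integral>x. \<phi> n x .* g x \<partial>lebesgue_on (cbox a b)) ----> (\<integral>x. indicator (box a b) x .* g x \<partial>lebesgue_on (cbox a b))"
 proof (rule integral_dominated_convergence[where w="\<lambda>x. norm (g x)"])
  show "(\<lambda>x. indicat_real (box a b) x .* g x) \<in> borel_measurable (lebesgue_on (cbox a b))"
   by (rule borel_measurable_scaleR[OF _ borel_measurable_integrable[OF gi]])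
    (intro measurable_restrict_space1 borel_measurable_indicator lmeasurable_box[THEN fmeasurableD])
  show "(\<lambda>x. \<phi> n x .* g x) \<in> borel_measurable (lebesgue_on (cbox a b))" for n
  proof (intro borel_measurable_scaleR borel_measurable_integrable[OF gi] continuous_imp_measurable_on_sets_lebesgue)
   show "continuous_on (cbox a b) (\<phi> n)"
    using smooth_on_imp_continuous_on[OF s] continuous_on_subset by blast
  qed auto
  show "AE x in lebesgue_on (cbox a b). (\<lambda>n. \<phi> n x .* g x) ----> indicat_real (box a b) x .* g x"
   by (intro AE_I2 tendsto_scaleR lim tendsto_const)
  show "AE x in lebesgue_on (cbox a b). norm (\<phi> n x .* g x) \<le> norm (g x)" for n
   using bd by (intro AE_I2) (simp add: mult_left_le_one_le)
 qed (use gi in auto)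
 moreover have "(\<integral>x. \<phi> n x .* g x \<partial>lebesgue_on (cbox a b)) = 0" for n
 proof -
  have "(\<integral>x. \<phi> n x .* g x \<partial>lebesgue_on (cbox a b)) = (\<integral>x. \<phi> n x .* g x \<partial>lebesgue_on \<Omega>)"
  proof -
   have "(\<lambda>x. indicator (cbox a b) x .* \<phi> n x .* g x) = (\<lambda>x. indicator \<Omega> x .* \<phi> n x .* g x)"
    using box out[of _ n] box_subset_cbox[of a b] by (force simp: fun_eq_iff indicator_def)
   then show ?thesis using \<Omega> by (simp add: integral_restrict_space)
  qed
  then show ?thesis using z[OF test] by simp
 qed
 ultimately have 0: "(\<integral>x. indicator (box a b) x .* g x \<partial>lebesgue_on (cbox a b)) = 0"
  by (simp add: LIMSEQ_const_iff)
 have "LI (lebesgue_on (cbox a b)) g = (\<integral>x. indicator (box a b) x .* g x \<partial>lebesgue_on (cbox a b))"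
 proof (rule integral_cong_AE)
  have "negligible (cbox a b - box a b)" by (rule negligible_frontier_interval)
  then have "AE x in lebesgue. x \<notin> cbox a b - box a b"
   using AE_not_in negligible_iff_null_sets by blast
  then have "AE x in lebesgue_on (cbox a b). x \<notin> cbox a b - box a b"
   by (simp add: AE_restrict_space_iff)
  then show "AE x in lebesgue_on (cbox a b). g x = indicat_real (box a b) x .* g x"
   using AE_space by eventually_elim (auto simp: space_restrict_space)
  show "(\<lambda>x. indicat_real (box a b) x .* g x) \<in> borel_measurable (lebesgue_on (cbox a b))"
   by (rule borel_measurable_scaleR[OF _ borel_measurable_integrable[OF gi]])
    (intro measurable_restrict_space1 borel_measurable_indicator lmeasurable_box[THEN fmeasurableD])
 qed (use gi in auto)
 then show ?thesis using 0 lebesgue_integral_eq_integral[OF gi cK] by simp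
qed

text \<open>Lebesgue's differentiation theorem: almost everywhere \<open>g x\<close> is the limit of
  its means over small cubes with corner \<open>x\<close>, and all these means are 0. Countably many
  boxes cover the open set.\<close>

lemma weak_zero_imp_AE_zero:
 fixes g :: "'a::euclidean_space => 'b::euclidean_space"
 assumes \<Omega>: "open \<Omega>" and g: "locally_integrable_on \<Omega> g"
  and z: "\<And>\<phi>::'a => real. test_function \<Omega> \<phi> ==> (\<integral>x. \<phi> x .* g x \<partial>lebesgue_on \<Omega>) = 0"
 shows "AE x in lebesgue_on \<Omega>. g x = 0"
proof -
 have local: "negligible {x \<in> cbox A B. g x \<noteq> 0}" if AB: "cbox A B \<subseteq> \<Omega>" for A B
 proof -
  define f where "f x = (if x \<in> cbox A B then g x else 0)" for x
  have gi: "g integrable_on cbox A B"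
   using g AB by (auto simp: locally_integrable_on_def intro!: integrable_on_lebesgue_on)
  then have "f integrable_on UNIV"
   unfolding f_def by (simp add: integrable_restrict_UNIV)
  then have "f integrable_on cbox a b" for a b
   by (rule integrable_on_subcbox) auto
  then obtain N where N: "negligible N"
   "\<And>x e. [|x \<notin> N; 0 < e|] ==> \<exists>d>0. \<forall>h. 0 < h \<and> h < d \<longrightarrow>
     norm (integral (cbox x (x + h .* One)) f /\<^sub>R h ^ DIM('a) - f x) < e"
   using integrable_ccontinuous_explicit[of f] by blast
  have zero: "g x = 0" if x: "x \<in> box A B" "x \<notin> N" for x
  proof (rule ccontr)
   assume "g x \<noteq> 0"
   moreover have fx: "f x = g x" using x box_subset_cbox by (auto simp: f_def)
   ultimately obtain d where d: "d > 0" "\<And>h. 0 < h ==> h < d ==>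
     norm (integral (cbox x (x + h .* One)) f /\<^sub>R h ^ DIM('a) - g x) < norm (g x)"
    using N(2)[OF x(2), of "norm (g x)"] by auto
   obtain r where r: "r > 0" "cball x r \<subseteq> box A B"
    using x(1) open_box open_contains_cball by blast
   \<comment> \<open>A cube of side h has diameter at most \<open>DIM('a) * h\<close>, so this
     choice keeps it inside the ball of radius \<open>r\<close>.\<close>
   define h where "h = min (d/2) (r/(1 + real DIM('a)))"
   have h: "0 < h" "h < d" using d(1) r(1) by (auto simp: h_def)
   have sub: "cbox x (x + h .* One) \<subseteq> box A B"
   proof
    fix y assume y: "y \<in> cbox x (x + h .* One)"
    have "norm (y - x) \<le> (\<Sum>i\<in>Basis. \<bar>(y - x) \<bullet> i\<bar>)" by (rule norm_le_l1)
    also have "\<dots> \<le> (\<Sum>i\<in>(Basis::'a set). h)"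
     using y by (intro sum_mono) (auto simp: mem_box inner_diff_left inner_add_left)
    also have "\<dots> \<le> r"
    proof -
     have "real DIM('a) * h \<le> (1 + real DIM('a)) * h" using h by (simp add: mult_right_mono)
     also have "\<dots> \<le> (1 + real DIM('a)) * (r/(1 + real DIM('a)))"
      by (intro mult_left_mono) (auto simp: h_def)
     also have "\<dots> = r" by (simp add: add_pos_nonneg)
     finally show ?thesis by simp
    qed
    finally have "y \<in> cball x r" by (simp add: dist_norm norm_minus_commute)
    then show "y \<in> box A B" using r(2) by blast
   qed
   have "integral (cbox x (x + h .* One)) f = integral (cbox x (x + h .* One)) g"
    using sub box_subset_cbox[of A B]
    by (intro Henstock_Kurzweil_Integration.integral_cong) (auto simp: f_def subset_iff)
   also have "\<dots> = 0"
    by (rule integral_box_zero_of_weak_zero[OF \<Omega> g z]) (use sub AB box_subset_cbox[of A B] in auto)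
   finally show False using d(2)[OF h] by simp
  qed
  have "{x \<in> cbox A B. g x \<noteq> 0} \<subseteq> N \<union> (cbox A B - box A B)" using zero by auto
  then show ?thesis
   using N(1) negligible_frontier_interval negligible_Un negligible_subset by metis
 qed
 obtain D where D: "countable D" "D \<subseteq> Pow \<Omega>" "\<And>X. X \<in> D ==> \<exists>a b. X = cbox a b" "\<Union>D = \<Omega>"
  using open_countable_Union_open_cbox[OF \<Omega>] by metis
 have "{x \<in> \<Omega>. g x \<noteq> 0} = \<Union>((\<lambda>X. {x \<in> X. g x \<noteq> 0}) ` D)" using D(4) by auto
 moreover have "negligible \<dots>"
 proof (rule negligible_countable_Union)
  show "countable ((\<lambda>X. {x \<in> X. g x \<noteq> 0}) ` D)" using D(1) by simp
  show "negligible S" if "S \<in> (\<lambda>X. {x \<in> X. g x \<noteq> 0}) ` D" for S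
   using that D(2,3) local by blast
 qed
 ultimately have "negligible {x \<in> \<Omega>. g x \<noteq> 0}" by simp
 then have "AE x in lebesgue. x \<notin> {x \<in> \<Omega>. g x \<noteq> 0}"
  using AE_not_in negligible_iff_null_sets by blast
 then show ?thesis using \<Omega> by (auto simp: AE_restrict_space_iff)
qed

lemma locally_integrable_on_diff:
 "locally_integrable_on \<Omega> f ==> locally_integrable_on \<Omega> g ==> locally_integrable_on \<Omega> (\<lambda>x. f x - g x)"
 by (auto simp: locally_integrable_on_def)

lemma has_weak_partial_diff:
 fixes f f' :: "'a::euclidean_space => 'b::euclidean_space"
 assumes \<Omega>: "open \<Omega>" and f: "has_weak_partial \<Omega> b f g" "has_weak_partial \<Omega> b f' g'"
 shows "has_weak_partial \<Omega> b (\<lambda>x. f x - f' x) (\<lambda>x. g x - g' x)"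
 unfolding has_weak_partial_def
proof (intro conjI allI impI)
 show "locally_integrable_on \<Omega> (\<lambda>x. f x - f' x)" "locally_integrable_on \<Omega> (\<lambda>x. g x - g' x)"
  using f by (auto simp: has_weak_partial_def intro: locally_integrable_on_diff)
 fix \<phi> :: "'a => real" assume t: "test_function \<Omega> \<phi>"
 obtain K where K: "compact K" "K \<subseteq> \<Omega>" "\<And>x. x \<notin> K ==> \<phi> x = 0" "\<And>x v. x \<notin> K ==> frechet_derivative \<phi> (at x) v = 0"
  "continuous_on UNIV \<phi>" "\<And>v. continuous_on UNIV (\<lambda>x. frechet_derivative \<phi> (at x) v)"
  using test_function_D[OF t] by metis
 have i: "integrable (lebesgue_on \<Omega>) (\<lambda>x. \<phi> x .* h x)" if "locally_integrable_on \<Omega> h" for h :: "'a => 'b"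
  by (rule test_function_times_integrable[OF \<Omega> K(5,1,2,3) that])
 have j: "integrable (lebesgue_on \<Omega>) (\<lambda>x. partial_deriv b \<phi> x .* h x)" if "locally_integrable_on \<Omega> h" for h :: "'a => 'b"
  unfolding partial_deriv_def by (rule test_function_times_integrable[OF \<Omega> K(6,1,2,4) that])
 show "(\<integral>x. partial_deriv b \<phi> x .* (f x - f' x) \<partial>lebesgue_on \<Omega>) = - (\<integral>x. \<phi> x .* (g x - g' x) \<partial>lebesgue_on \<Omega>)"
  using f t i j by (simp add: has_weak_partial_def scaleR_diff_right)
qed

lemma has_weak_partial_unique:
 fixes f :: "'a::euclidean_space => 'b::euclidean_space"
 assumes \<Omega>: "open \<Omega>" and f: "has_weak_partial \<Omega> b f g" "has_weak_partial \<Omega> b f h"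
 shows "AE x in lebesgue_on \<Omega>. g x = h x"
proof -
 have "AE x in lebesgue_on \<Omega>. g x - h x = 0"
  using has_weak_partial_diff[OF \<Omega> f]
  by (intro weak_zero_imp_AE_zero[OF \<Omega>]) (auto simp: has_weak_partial_def)
 then show ?thesis by simp
qed

lemma continuous_on_imp_locally_integrable_on:
 fixes f :: "'a::euclidean_space => 'b::euclidean_space"
 assumes "continuous_on \<Omega> f"
 shows "locally_integrable_on \<Omega> f"
 unfolding locally_integrable_on_def
proof (intro allI impI)
 fix K assume K: "compact K \<and> K \<subseteq> \<Omega>"
 have c: "continuous_on K f" using K assms continuous_on_subset by blast
 have KB: "K \<in> sets borel" using K by (simp add: compact_imp_closed borel_closed)
 have "integrable (lborel_on K) f"
  using K c KB by (intro integrable_compact_support[of K K]) auto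
 then show "integrable (lebesgue_on K) f"
  using integral_lebesgue_on(2)[OF KB borel_measurable_lborel_on[OF c]] by simp
qed

lemma smooth_on_has_weak_partial:
 fixes f :: "'a::euclidean_space => 'b::euclidean_space"
 assumes \<Omega>: "open \<Omega>" and f: "smooth_on \<Omega> f"
 shows "has_weak_partial \<Omega> b f (partial_deriv b f)"
 unfolding has_weak_partial_def
proof (intro conjI allI impI)
 have cf: "continuous_on \<Omega> f" "continuous_on \<Omega> (partial_deriv b f)"
  unfolding partial_deriv_def using f by (auto intro!: smooth_on_imp_continuous_on smooth_on_deriv)
 then show l: "locally_integrable_on \<Omega> f" "locally_integrable_on \<Omega> (partial_deriv b f)"
  by (auto intro: continuous_on_imp_locally_integrable_on)
 fix \<phi> :: "'a => real" assume t: "test_function \<Omega> \<phi>"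
 obtain K where K: "compact K" "K \<subseteq> \<Omega>" "\<And>x. x \<notin> K ==> \<phi> x = 0" "\<And>x v. x \<notin> K ==> frechet_derivative \<phi> (at x) v = 0"
  "continuous_on UNIV \<phi>" "\<And>v. continuous_on UNIV (\<lambda>x. frechet_derivative \<phi> (at x) v)"
  "\<And>x. (\<phi> has_derivative frechet_derivative \<phi> (at x)) (at x)"
  using test_function_D[OF t] by metis
 have i: "integrable (lebesgue_on \<Omega>) (\<lambda>x. \<phi> x .* partial_deriv b f x)"
  by (rule test_function_times_integrable[OF \<Omega> K(5,1,2,3) l(2)])
 have j: "integrable (lebesgue_on \<Omega>) (\<lambda>x. partial_deriv b \<phi> x .* f x)"
  unfolding partial_deriv_def by (rule test_function_times_integrable[OF \<Omega> K(6,1,2,4) l(1)])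
 have "(\<integral>x. partial_deriv b \<phi> x .* f x + \<phi> x .* partial_deriv b f x \<partial>lebesgue_on \<Omega>) = 0"
 proof (rule euclidean_eqI)
  fix i :: 'b
  have c: "continuous_on \<Omega> (\<lambda>x. partial_deriv b \<phi> x .* f x + \<phi> x .* partial_deriv b f x)"
   using cf K(5,6) continuous_on_subset unfolding partial_deriv_def[of b \<phi>]
   by (intro continuous_intros) blast+
  have "(\<integral>x. (frechet_derivative \<phi> (at x) b .* f x + \<phi> x .* frechet_derivative f (at x) b) \<bullet> i \<partial>lborel_on \<Omega>) = 0"
   using \<Omega> K(1,2)
  proof (rule integral_partial_zero[where f = "\<lambda>x. (\<phi> x .* f x) \<bullet> i" and
     f' = "\<lambda>x v. (frechet_derivative \<phi> (at x) v .* f x + \<phi> x .* frechet_derivative f (at x) v) \<bullet> i" and b = b])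
   show "((\<lambda>x. (\<phi> x .* f x) \<bullet> i) has_derivative
     (\<lambda>v. (frechet_derivative \<phi> (at x) v .* f x + \<phi> x .* frechet_derivative f (at x) v) \<bullet> i)) (at x)"
    if "x \<in> \<Omega>" for x
    by (rule derivative_eq_intros K(7) smooth_on_has_derivative[OF \<Omega> f that] refl)+ (simp add: add.commute)
   show "continuous_on \<Omega> (\<lambda>x. (frechet_derivative \<phi> (at x) b .* f x + \<phi> x .* frechet_derivative f (at x) b) \<bullet> i)"
    using c unfolding partial_deriv_def by (rule continuous_on_inner[OF _ continuous_on_const])
  qed (use K(3) in auto)
  then have "(\<integral>x. (partial_deriv b \<phi> x .* f x + \<phi> x .* partial_deriv b f x) \<bullet> i \<partial>lborel_on \<Omega>) = 0"
   by (simp add: partial_deriv_def)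
  then have "(\<integral>x. (partial_deriv b \<phi> x .* f x + \<phi> x .* partial_deriv b f x) \<bullet> i \<partial>lebesgue_on \<Omega>) = 0"
   using \<Omega> c by (subst integral_lebesgue_on) (auto intro!: borel_measurable_lborel_on continuous_intros)
  then show "(\<integral>x. partial_deriv b \<phi> x .* f x + \<phi> x .* partial_deriv b f x \<partial>lebesgue_on \<Omega>) \<bullet> i = 0 \<bullet> i"
   using i j by simp
 qed
 then show "(\<integral>x. partial_deriv b \<phi> x .* f x \<partial>lebesgue_on \<Omega>) = - (\<integral>x. \<phi> x .* partial_deriv b f x \<partial>lebesgue_on \<Omega>)"
  using i j by (simp add: eq_neg_iff_add_eq_0)
qed

section \<open>Hardy's inequality on the unit ball\<close>

lemma norm_sum_scaleR_Basis_sq: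
 fixes P :: "'a::euclidean_space => 'b::euclidean_space"
 shows "nsq (\<Sum>b\<in>Basis. (y \<bullet> b) .* P b) \<le> nsq y * (\<Sum>b\<in>Basis. nsq (P b))"
proof -
 have "norm (\<Sum>b\<in>Basis. (y \<bullet> b) .* P b) \<le> (\<Sum>b\<in>Basis. \<bar>y \<bullet> b\<bar> * norm (P b))"
  by (rule order_trans[OF norm_sum]) simp
 then have "nsq (\<Sum>b\<in>Basis. (y \<bullet> b) .* P b) \<le> (\<Sum>b\<in>Basis. \<bar>y \<bullet> b\<bar> * norm (P b))^2"
  by (intro power_mono) auto
 also have "\<dots> \<le> (\<Sum>b\<in>Basis. \<bar>y \<bullet> b\<bar>^2) * (\<Sum>b\<in>Basis. nsq (P b))"
  by (rule Cauchy_Schwarz_ineq_sum)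
 also have "(\<Sum>b\<in>Basis. \<bar>y \<bullet> b\<bar>^2) = nsq y"
  unfolding power2_norm_eq_inner[of y] euclidean_inner[of y y] by (simp add: power2_eq_square)
 finally show ?thesis .
qed

lemma norm_diff_sq_le: "nsq (a - b) \<le> 2 * nsq a + 2 * nsq (b::'a::real_inner)"
proof -
 have "0 \<le> nsq (a + b)" by simp
 then show ?thesis unfolding power2_norm_eq_inner by (simp add: inner_simps inner_commute)
qed

lemma norm_sq_less_1: "x \<in> ball 0 1 ==> nsq (x::'a::euclidean_space) < 1"
 by (simp add: power_less_one_iff abs_square_less_1)

text \<open>Integrating the divergence of \<open>|\<phi>|^2 x / (1 - |x|^2)\<close> gives Hardy's inequality with constant 1.\<close>

lemma hardy_test_function:
 fixes \<phi> :: "'a::euclidean_space => 'b::euclidean_space"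
 assumes t: "test_function (ball 0 1) \<phi>" and dim: "DIM('a) \<ge> 2"
 shows "integrable (lborel_on (ball 0 1)) (\<lambda>x. (norm (\<phi> x)/(1 - nsq x))^2)"
  and "integrable (lborel_on (ball 0 1)) (grad_sq \<phi>)"
  and "(\<integral>x. (norm (\<phi> x)/(1 - nsq x))^2 \<partial>lborel_on (ball 0 1)) \<le> (\<integral>x. grad_sq \<phi> x \<partial>lborel_on (ball 0 1))"
proof -
 let ?B = "ball (0::'a) 1"
 obtain K where K: "compact K" "K \<subseteq> ?B" "\<And>x. x \<notin> K ==> \<phi> x = 0" "\<And>x v. x \<notin> K ==> frechet_derivative \<phi> (at x) v = 0"
  "continuous_on UNIV \<phi>" "\<And>v. continuous_on UNIV (\<lambda>x. frechet_derivative \<phi> (at x) v)"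
  "\<And>x. (\<phi> has_derivative frechet_derivative \<phi> (at x)) (at x)"
  using test_function_D[OF t] by metis
 define D where "D b x = frechet_derivative \<phi> (at x) b" for b x
 define \<rho> where "\<rho> x = 1 - x \<bullet> x" for x :: 'a
 have rho: "1 - nsq x = \<rho> x" for x by (simp add: \<rho>_def power2_norm_eq_inner)
 have rp: "\<rho> x > 0" if "x \<in> ?B" for x using norm_sq_less_1[OF that] by (simp flip: rho)
 have cc: "continuous_on ?B \<phi>" "continuous_on ?B (D b)" "continuous_on ?B \<rho>" for b
  using continuous_on_subset[OF K(5)] continuous_on_subset[OF K(6)]
  unfolding D_def \<rho>_def by (auto intro!: continuous_intros)
 have gs: "grad_sq \<phi> = (\<lambda>x. \<Sum>b\<in>Basis. nsq (D b x))"
  by (simp add: grad_sq_def partial_deriv_def D_def fun_eq_iff)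
 have r0: "\<rho> x \<noteq> 0" if "x \<in> ?B" for x using rp[OF that] by simp
 show i1: "integrable (lborel_on ?B) (\<lambda>x. (norm (\<phi> x)/(1 - nsq x))^2)"
  unfolding rho using K(3) r0
  by (intro integrable_compact_support[OF _ K(1,2)] continuous_intros cc) auto
 show i2: "integrable (lborel_on ?B) (grad_sq \<phi>)"
  unfolding gs using K(4) by (intro integrable_compact_support[OF _ K(1,2)] continuous_intros cc) (auto simp: D_def)
 \<comment> \<open>\<open>Z b\<close> is the derivative in direction \<open>b\<close> of
   \<open>|\<phi>|^2 (x \<bullet> b)/\<rho>\<close>, so the sum over \<open>b\<close> is a
   divergence of compact support.\<close>
 define Z where "Z b x = 2 * (\<phi> x \<bullet> D b x) * (x \<bullet> b)/\<rho> x + (\<phi> x \<bullet> \<phi> x) * (1/\<rho> x + 2 * (x \<bullet> b)^2/(\<rho> x)^2)" for b x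
 have Zi: "integrable (lborel_on ?B) (Z b)" for b
  unfolding Z_def using K(3) r0
  by (intro integrable_compact_support[OF _ K(1,2)] continuous_intros cc) auto
 have dD: "(\<phi> has_derivative (\<lambda>v. D v x)) (at x)" for x
  using K(7) unfolding D_def by simp
 have Z0: "LI (lborel_on ?B) (Z b) = 0" if b: "b \<in> Basis" for b
 proof -
  have "LI (lborel_on ?B) (\<lambda>x. 2 * (\<phi> x \<bullet> D b x) * (x \<bullet> b)/\<rho> x + (\<phi> x \<bullet> \<phi> x) * ((b \<bullet> b)/\<rho> x + 2 * (x \<bullet> b) * (x \<bullet> b)/(\<rho> x)^2)) = 0"
  proof (rule integral_partial_zero[OF open_ball K(1,2), where f = "\<lambda>x. (\<phi> x \<bullet> \<phi> x) * ((x \<bullet> b)/\<rho> x)"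
    and f' = "\<lambda>x v. 2 * (\<phi> x \<bullet> D v x) * (x \<bullet> b)/\<rho> x + (\<phi> x \<bullet> \<phi> x) * ((v \<bullet> b)/\<rho> x + 2 * (x \<bullet> b) * (x \<bullet> v)/(\<rho> x)^2)" and b = b])
   show "continuous_on ?B (\<lambda>x. 2 * (\<phi> x \<bullet> D b x) * (x \<bullet> b)/\<rho> x + (\<phi> x \<bullet> \<phi> x) * ((b \<bullet> b)/\<rho> x + 2 * (x \<bullet> b) * (x \<bullet> b)/(\<rho> x)^2))"
    using r0 by (intro continuous_intros cc) auto
   show "((\<lambda>x. (\<phi> x \<bullet> \<phi> x) * ((x \<bullet> b)/\<rho> x)) has_derivative
    (\<lambda>v. 2 * (\<phi> x \<bullet> D v x) * (x \<bullet> b)/\<rho> x + (\<phi> x \<bullet> \<phi> x) * ((v \<bullet> b)/\<rho> x + 2 * (x \<bullet> b) * (x \<bullet> v)/(\<rho> x)^2))) (at x)"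
    if "x \<in> ?B" for x
   proof -
    have d\<rho>: "(\<rho> has_derivative (\<lambda>v. - (2 * (x \<bullet> v)))) (at x)"
     unfolding \<rho>_def by (auto intro!: derivative_eq_intros simp: inner_commute)
    note has_derivative_mult[OF has_derivative_inner[OF dD[of x] dD[of x]]
      has_derivative_divide'[OF has_derivative_inner_left[OF has_derivative_ident] d\<rho> r0[OF that]], of b]
    then show ?thesis
    proof (rule has_derivative_eq_rhs, intro ext)
     fix v
     let ?p = "\<phi> x \<bullet> D v x"
     have "D v x \<bullet> \<phi> x = ?p" by (rule inner_commute)
     then show "\<phi> x \<bullet> \<phi> x * ((v \<bullet> b * \<rho> x - x \<bullet> b * - (2 * (x \<bullet> v)))/(\<rho> x * \<rho> x)) +
      (?p + D v x \<bullet> \<phi> x) * (x \<bullet> b/\<rho> x)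
      = 2 * ?p * (x \<bullet> b)/\<rho> x + (\<phi> x \<bullet> \<phi> x) * ((v \<bullet> b)/\<rho> x + 2 * (x \<bullet> b) * (x \<bullet> v)/(\<rho> x)^2)"
      using r0[OF that] by (simp add: field_simps power2_eq_square)
    qed
   qed
  qed (use K(3) in auto)
  then show ?thesis using b by (simp add: Z_def[abs_def] power2_eq_square mult.assoc)
 qed
 have pw: "(norm (\<phi> x)/(1 - nsq x))^2 - grad_sq \<phi> x \<le> (\<Sum>b\<in>Basis. Z b x)" if x: "x \<in> ?B" for x
 proof -
  define X where "X = (\<Sum>b\<in>Basis. (x \<bullet> b) .* D b x)"
  have "nsq X \<le> nsq x * grad_sq \<phi> x"
   unfolding X_def gs by (rule norm_sum_scaleR_Basis_sq)
  also have "\<dots> \<le> 1 * grad_sq \<phi> x"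
   using norm_sq_less_1[OF x] by (intro mult_right_mono) (auto simp: gs sum_nonneg)
  finally have X: "nsq X \<le> grad_sq \<phi> x" by simp
  have "(\<Sum>b\<in>Basis. 2 * (\<phi> x \<bullet> D b x) * (x \<bullet> b)/\<rho> x) = 2 * (\<phi> x \<bullet> X)/\<rho> x"
   by (simp add: X_def inner_sum_right sum_distrib_left sum_divide_distrib mult_ac)
  moreover have "(\<Sum>b\<in>Basis. (\<phi> x \<bullet> \<phi> x) * (1/\<rho> x + 2 * (x \<bullet> b)^2/(\<rho> x)^2))
   = (\<phi> x \<bullet> \<phi> x) * (real DIM('a)/\<rho> x + 2 * (x \<bullet> x)/(\<rho> x)^2)"
   unfolding euclidean_inner[of x x]
   by (simp add: sum.distrib sum_distrib_left[symmetric] sum_divide_distrib[symmetric] power2_eq_square)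
  ultimately have S: "(\<Sum>b\<in>Basis. Z b x) = 2 * (\<phi> x \<bullet> X)/\<rho> x + (\<phi> x \<bullet> \<phi> x) * (real DIM('a)/\<rho> x + 2 * (x \<bullet> x)/(\<rho> x)^2)"
   unfolding Z_def sum.distrib by simp
  \<comment> \<open>Dimension at least 2 enters here: the divergence of \<open>x/\<rho>\<close> is
    at least \<open>2/\<rho>^2\<close>. One of the two copies of \<open>|\<phi>|^2/\<rho>^2\<close>
    absorbs the mixed term with the gradient, the other is the gain.\<close>
  have "2/(\<rho> x)^2 = 2/\<rho> x + 2 * (x \<bullet> x)/(\<rho> x)^2"
   using r0[OF x] by (simp add: field_simps power2_eq_square) (simp add: \<rho>_def algebra_simps)
  also have "\<dots> \<le> real DIM('a)/\<rho> x + 2 * (x \<bullet> x)/(\<rho> x)^2"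
   using dim rp[OF x] by (intro add_mono divide_right_mono) auto
  finally have "(\<phi> x \<bullet> \<phi> x) * (2/(\<rho> x)^2) \<le> (\<phi> x \<bullet> \<phi> x) * (real DIM('a)/\<rho> x + 2 * (x \<bullet> x)/(\<rho> x)^2)"
   by (rule mult_left_mono) simp
  moreover have "- (\<phi> x \<bullet> \<phi> x)/(\<rho> x)^2 - nsq X \<le> 2 * (\<phi> x \<bullet> X)/\<rho> x"
  proof -
   have "0 \<le> ((1/\<rho> x) .* \<phi> x + X) \<bullet> ((1/\<rho> x) .* \<phi> x + X)" by simp
   also have "\<dots> = (\<phi> x \<bullet> \<phi> x)/(\<rho> x)^2 + 2 * (\<phi> x \<bullet> X)/\<rho> x + X \<bullet> X"
    by (simp add: inner_simps inner_commute power2_eq_square)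
   finally show ?thesis by (simp add: power2_norm_eq_inner)
  qed
  moreover have "(norm (\<phi> x)/(1 - nsq x))^2 = (\<phi> x \<bullet> \<phi> x)/(\<rho> x)^2"
   unfolding rho by (simp add: power_divide power2_norm_eq_inner)
  moreover have "(\<phi> x \<bullet> \<phi> x) * (2/(\<rho> x)^2) = (\<phi> x \<bullet> \<phi> x)/(\<rho> x)^2 + (\<phi> x \<bullet> \<phi> x)/(\<rho> x)^2"
   by simp
  ultimately show ?thesis using X S by linarith
 qed
 have "(\<integral>x. (norm (\<phi> x)/(1 - nsq x))^2 - grad_sq \<phi> x \<partial>lborel_on ?B) \<le> (\<integral>x. (\<Sum>b\<in>Basis. Z b x) \<partial>lborel_on ?B)"
  using pw i1 i2 Zi by (intro integral_mono) (auto simp: space_restrict_space)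
 also have "\<dots> = 0" using Zi Z0 by simp
 finally show "(\<integral>x. (norm (\<phi> x)/(1 - nsq x))^2 \<partial>lborel_on ?B) \<le> (\<integral>x. grad_sq \<phi> x \<partial>lborel_on ?B)"
  using i1 i2 by simp
qed

text \<open>Lebesgue measure is complete, so measurability passes to every representative. This
  makes the arbitrary choice inside \<open>weak_partial\<close> measurable.\<close>

lemma borel_measurable_lebesgue_on_AE:
 fixes f :: "'a::euclidean_space => 'b::euclidean_space"
 assumes S: "S \<in> sets borel" and f: "f \<in> borel_measurable (lebesgue_on S)"
  and ae: "AE x in lebesgue_on S. f x = g x"
 shows "g \<in> borel_measurable (lebesgue_on S)"
proof -
 have S': "S \<in> sets lebesgue" using S by simp
 have "(\<lambda>x. indicator S x .* f x) \<in> borel_measurable lebesgue"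
  using f S' by (subst (asm) borel_measurable_restrict_space_iff) auto
 moreover have "AE x in lebesgue. indicator S x .* f x = indicator S x .* g x"
  using ae S' by (auto simp: AE_restrict_space_iff indicator_def elim: eventually_mono)
 ultimately have "(\<lambda>x. indicator S x .* g x) \<in> borel_measurable lebesgue"
  by (rule borel_measurable_AE)
 then show ?thesis
  using S' by (subst borel_measurable_restrict_space_iff) auto
qed

lemma L2_fun_diff:
 assumes "L2_fun M f" "L2_fun M g"
 shows "L2_fun M (\<lambda>x. f x - g x)"
 unfolding L2_fun_def
proof
 show m: "(\<lambda>x. f x - g x) \<in> borel_measurable M" using assms by (auto simp: L2_fun_def)
 show "integrable M (\<lambda>x. nsq (f x - g x))"
 proof (rule L1_bound)
  show "integrable M (\<lambda>x. 2 * nsq (f x) + 2 * nsq (g x))" using assms by (auto simp: L2_fun_def)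
  show "(\<lambda>x. nsq (f x - g x)) \<in> borel_measurable M" using m by measurable
  show "AE x in M. norm (nsq (f x - g x)) \<le> norm (2 * nsq (f x) + 2 * nsq (g x))"
   using norm_diff_sq_le by (intro AE_I2) (auto simp: abs_of_nonneg)
 qed
qed

lemma test_function_L2:
 assumes t: "test_function (ball 0 1) \<phi>"
 shows "L2_fun (lebesgue_on (ball 0 1)) \<phi>" "L2_fun (lebesgue_on (ball 0 1)) (partial_deriv b \<phi>)"
proof -
 let ?B = "ball (0::'a) 1"
 obtain K where K: "compact K" "K \<subseteq> ?B" "\<And>x. x \<notin> K ==> \<phi> x = 0" "\<And>x v. x \<notin> K ==> frechet_derivative \<phi> (at x) v = 0"
  "continuous_on UNIV \<phi>" "\<And>v. continuous_on UNIV (\<lambda>x. frechet_derivative \<phi> (at x) v)"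
  using test_function_D[OF t] by metis
 have *: "L2_fun (lebesgue_on ?B) f" if f: "continuous_on UNIV f" "\<And>x. x \<notin> K ==> f x = 0" for f :: "'a => 'b"
 proof -
  have c: "continuous_on ?B f" using f(1) continuous_on_subset by blast
  have "integrable (lborel_on ?B) (\<lambda>x. nsq (f x))"
   using f(2) by (intro integrable_compact_support[OF _ K(1,2)] continuous_intros c) auto
  moreover have "(\<lambda>x. nsq (f x)) \<in> borel_measurable (lborel_on ?B)"
   by (intro borel_measurable_lborel_on continuous_intros c)
  ultimately have "integrable (lebesgue_on ?B) (\<lambda>x. nsq (f x))"
   using integral_lebesgue_on(2)[of ?B "\<lambda>x. nsq (f x)"] by simp
  moreover have "f \<in> borel_measurable (lebesgue_on ?B)"
   by (rule continuous_imp_measurable_on_sets_lebesgue[OF c]) simp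
  ultimately show ?thesis by (simp add: L2_fun_def)
 qed
 show "L2_fun (lebesgue_on ?B) \<phi>" using *[OF K(5,3)] .
 show "L2_fun (lebesgue_on ?B) (partial_deriv b \<phi>)" using *[OF K(6,4)] unfolding partial_deriv_def .
qed

text \<open>Fatou's lemma along a subsequence of approximating test functions that converges almost
  everywhere. The factor 2 comes from passing from the gradient of an approximant to
  \<open>G\<close> by the parallelogram bound.\<close>

lemma hardy_H1_zero:
 fixes w :: "'a::euclidean_space => 'b::euclidean_space"
 assumes dim: "DIM('a) \<ge> 2" and w: "H1_zero (ball 0 1) w"
  and G: "\<And>b. b \<in> Basis ==> has_weak_partial (ball 0 1) b w (G b)"
  and GL: "\<And>b. b \<in> Basis ==> L2_fun (lebesgue_on (ball 0 1)) (G b)"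
 shows "(\<integral>\<^sup>+x. ennreal ((norm (w x)/(1 - nsq x))^2) \<partial>lebesgue_on (ball 0 1))
  \<le> ennreal (2 * (\<Sum>b\<in>Basis. \<integral>x. nsq (G b x) \<partial>lebesgue_on (ball 0 1)))"
proof -
 let ?B = "ball (0::'a) 1" and ?M = "lebesgue_on (ball (0::'a) 1)"
 obtain \<phi> where t: "\<And>n. test_function ?B (\<phi> n)" and lim: "(\<lambda>n. H1_norm ?B (\<lambda>x. \<phi> n x - w x)) ----> 0"
  using w unfolding H1_zero_def by blast
 have wL: "L2_fun ?M w" using w unfolding H1_zero_def by auto
 define e where "e n x = nsq (\<phi> n x - w x)" for n x
 define d where "d b n x = nsq (partial_deriv b (\<phi> n) x - G b x)" for b n x
 have ei: "integrable ?M (e n)" for n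
  using L2_fun_diff[OF test_function_L2(1)[OF t] wL] by (simp add: L2_fun_def e_def[abs_def])
 have dI: "integrable ?M (d b n)" if "b \<in> Basis" for b n
  using L2_fun_diff[OF test_function_L2(2)[OF t] GL[OF that]] by (simp add: L2_fun_def d_def[abs_def])
 \<comment> \<open>\<open>H1_norm\<close> is built from chosen weak derivatives; by uniqueness these
   agree almost everywhere with the explicit difference.\<close>
 have wp: "AE x in ?M. nsq (weak_partial ?B b (\<lambda>x. \<phi> n x - w x) x) = d b n x" if b: "b \<in> Basis" for b n
 proof -
  have "smooth_on ?B (\<phi> n)" using t[of n] smooth_on_subset by (auto simp: test_function_def)
  then have 1: "has_weak_partial ?B b (\<lambda>x. \<phi> n x - w x) (\<lambda>x. partial_deriv b (\<phi> n) x - G b x)"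
   by (intro has_weak_partial_diff smooth_on_has_weak_partial G b) auto
  then have "has_weak_partial ?B b (\<lambda>x. \<phi> n x - w x) (weak_partial ?B b (\<lambda>x. \<phi> n x - w x))"
   
   unfolding weak_partial_def by (rule someI[of "has_weak_partial ?B b (\<lambda>x. \<phi> n x - w x)"])
  from has_weak_partial_unique[OF _ this 1] show ?thesis
   by (auto simp: d_def elim: eventually_mono)
 qed
 have "H1_norm ?B (\<lambda>x. \<phi> n x - w x) = sqrt ((\<integral>x. e n x \<partial>?M) + (\<Sum>b\<in>Basis. \<integral>x. d b n x \<partial>?M))" for n
 proof -
  have "AE x in ?M. \<forall>b\<in>Basis. nsq (weak_partial ?B b (\<lambda>x. \<phi> n x - w x) x) = d b n x"
   using wp by (intro AE_finite_allI) auto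
  then have ae: "AE x in ?M. (\<Sum>b\<in>Basis. d b n x) = weak_grad_sq ?B (\<lambda>x. \<phi> n x - w x) x"
   by eventually_elim (simp add: weak_grad_sq_def)
  have m: "(\<lambda>x. \<Sum>b\<in>Basis. d b n x) \<in> borel_measurable ?M"
   using dI by (intro borel_measurable_sum borel_measurable_integrable) auto
  have "(\<integral>x. weak_grad_sq ?B (\<lambda>x. \<phi> n x - w x) x \<partial>?M) = (\<integral>x. (\<Sum>b\<in>Basis. d b n x) \<partial>?M)"
  proof (rule integral_cong_AE)
   show "AE x in ?M. weak_grad_sq ?B (\<lambda>x. \<phi> n x - w x) x = (\<Sum>b\<in>Basis. d b n x)"
    using ae by eventually_elim simp
   show "weak_grad_sq ?B (\<lambda>x. \<phi> n x - w x) \<in> borel_measurable ?M"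
    using borel_measurable_lebesgue_on_AE[OF _ m ae] by simp
  qed (rule m)
  then show ?thesis using dI by (simp add: H1_norm_def e_def)
 qed
 with lim have "(\<lambda>n. (sqrt ((\<integral>x. e n x \<partial>?M) + (\<Sum>b\<in>Basis. \<integral>x. d b n x \<partial>?M)))^2) ----> 0^2"
  by (intro tendsto_power) simp
 moreover have en: "(\<integral>x. e n x \<partial>?M) \<ge> 0" for n by (simp add: e_def)
 moreover have dn: "(\<Sum>b\<in>Basis. \<integral>x. d b n x \<partial>?M) \<ge> 0" for n by (intro sum_nonneg) (simp add: d_def)
 ultimately have L: "(\<lambda>n. (\<integral>x. e n x \<partial>?M) + (\<Sum>b\<in>Basis. \<integral>x. d b n x \<partial>?M)) ----> 0" by simp
 have Le: "(\<lambda>n. \<integral>x. e n x \<partial>?M) ----> 0"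
  by (rule tendsto_sandwich[OF _ _ tendsto_const L]) (use en dn in \<open>auto intro!: always_eventually\<close>)
 have Ld: "(\<lambda>n. \<Sum>b\<in>Basis. \<integral>x. d b n x \<partial>?M) ----> 0"
  by (rule tendsto_sandwich[OF _ _ tendsto_const L]) (use en dn in \<open>auto intro!: always_eventually\<close>)
 have "(\<lambda>n. \<integral>x. norm (e n x) \<partial>?M) ----> 0" using Le by (simp add: e_def)
 from tendsto_L1_AE_subseq[OF ei this] obtain r where r: "strict_mono r" "AE x in ?M. (\<lambda>n. e (r n) x) ----> 0"
  by auto
 let ?h = "\<lambda>f x. ennreal ((norm (f x)/(1 - nsq x))^2)"
 define S where "S = (\<Sum>b\<in>Basis. \<integral>x. nsq (G b x) \<partial>?M)"
 define c where "c n = 2 * S + 2 * (\<Sum>b\<in>Basis. \<integral>x. d b n x \<partial>?M)" for n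
 have hn: "nn_integral ?M (?h (\<phi> n)) \<le> ennreal (c n)" for n
 proof -
  note H = hardy_test_function[OF t[of n] dim]
  have cD: "continuous_on ?B (partial_deriv b (\<phi> n))" for b
   using smooth_on_subset[of UNIV "\<phi> n" ?B] t[of n] unfolding partial_deriv_def test_function_def
   by (intro smooth_on_imp_continuous_on smooth_on_deriv) auto
  have "nn_integral ?M (?h (\<phi> n)) = nn_integral (lborel_on ?B) (?h (\<phi> n))"
   by (simp add: nn_integral_lebesgue_on)
  also have "\<dots> = ennreal (\<integral>x. (norm (\<phi> n x)/(1 - nsq x))^2 \<partial>lborel_on ?B)"
   using H(1) by (intro nn_integral_eq_integral) auto
  also have "\<dots> \<le> ennreal (\<integral>x. grad_sq (\<phi> n) x \<partial>lborel_on ?B)"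
   using H(3) by (rule ennreal_leI)
  also have "(\<integral>x. grad_sq (\<phi> n) x \<partial>lborel_on ?B) = (\<integral>x. grad_sq (\<phi> n) x \<partial>?M)"
   using cD unfolding grad_sq_def
   by (intro integral_lebesgue_on(1)[symmetric] borel_measurable_lborel_on continuous_intros) auto
  also have "\<dots> = (\<Sum>b\<in>Basis. \<integral>x. nsq (partial_deriv b (\<phi> n) x) \<partial>?M)"
   using test_function_L2(2)[OF t[of n]] unfolding grad_sq_def L2_fun_def by simp
  also have "\<dots> \<le> (\<Sum>b\<in>Basis. 2 * (\<integral>x. nsq (G b x) \<partial>?M) + 2 * (\<integral>x. d b n x \<partial>?M))"
  proof (rule sum_mono)
   fix b :: 'a assume b: "b \<in> Basis"
   have "(\<integral>x. nsq (partial_deriv b (\<phi> n) x) \<partial>?M) \<le> (\<integral>x. 2 * nsq (G b x) + 2 * d b n x \<partial>?M)"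
   proof (rule integral_mono)
    show "nsq (partial_deriv b (\<phi> n) x) \<le> 2 * nsq (G b x) + 2 * d b n x" for x
     using norm_diff_sq_le[of "partial_deriv b (\<phi> n) x - G b x" "- G b x"] by (simp add: d_def)
   qed (use test_function_L2(2)[OF t[of n]] GL[OF b] dI[OF b] in \<open>auto simp: L2_fun_def\<close>)
   then show "(\<integral>x. nsq (partial_deriv b (\<phi> n) x) \<partial>?M) \<le> 2 * (\<integral>x. nsq (G b x) \<partial>?M) + 2 * (\<integral>x. d b n x \<partial>?M)"
    using GL[OF b] dI[OF b] by (simp add: L2_fun_def)
  qed
  also have "\<dots> = c n" by (simp add: c_def S_def sum.distrib sum_distrib_left)
  finally show ?thesis by (simp add: ennreal_leI)
 qed
 have "nn_integral ?M (?h w) \<le> (\<integral>\<^sup>+x. liminf (\<lambda>n. ?h (\<phi> (r n)) x) \<partial>?M)"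
 proof (rule nn_integral_mono_AE)
  show "AE x in ?M. ?h w x \<le> liminf (\<lambda>n. ?h (\<phi> (r n)) x)"
   using r(2)
  proof eventually_elim
   case (elim x)
   have "(\<lambda>n. \<phi> (r n) x - w x) ----> 0"
   proof (rule tendsto_norm_zero_cancel)
    have "(\<lambda>n. sqrt (e (r n) x)) ----> sqrt 0" using elim by (rule tendsto_real_sqrt)
    then show "(\<lambda>n. norm (\<phi> (r n) x - w x)) ----> 0" by (simp add: e_def)
   qed
   then have "(\<lambda>n. \<phi> (r n) x) ----> w x" by (simp add: LIM_zero_iff)
   then have "(\<lambda>n. ?h (\<phi> (r n)) x) ----> ?h w x"
    unfolding divide_inverse by (intro tendsto_intros)
   then show ?case using lim_imp_Liminf[OF sequentially_bot] by fastforce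
  qed
 qed
 also have "\<dots> \<le> liminf (\<lambda>n. nn_integral ?M (?h (\<phi> (r n))))"
 proof (rule nn_integral_liminf)
  fix n
  have "\<phi> (r n) \<in> borel_measurable ?M" using test_function_L2(1)[OF t] by (simp add: L2_fun_def)
  moreover have "(\<lambda>x. 1 - nsq x) \<in> borel_measurable ?M"
   by (intro continuous_imp_measurable_on_sets_lebesgue continuous_intros) simp
  ultimately show "(\<lambda>x. ?h (\<phi> (r n)) x) \<in> borel_measurable ?M"
   by measurable
 qed
 also have "\<dots> \<le> liminf (\<lambda>n. ennreal (c (r n)))"
  by (intro Liminf_mono always_eventually allI hn)
 also have "\<dots> = ennreal (2 * S)"
 proof -
  have "(\<lambda>n. c n) ----> 2 * S + 2 * 0" unfolding c_def by (intro tendsto_intros Ld)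
  then have "(\<lambda>n. c (r n)) ----> 2 * S" using r(1) LIMSEQ_subseq_LIMSEQ[of c] by (simp add: o_def)
  then have "(\<lambda>n. ennreal (c (r n))) ----> ennreal (2 * S)" by (intro tendsto_ennrealI)
  then show ?thesis by (intro lim_imp_Liminf) auto
 qed
 finally show ?thesis by (simp add: S_def)
qed

section \<open>Partial derivatives in space and time\<close>

definition dx :: "'a => (real \<times> 'a => 'b) => real \<times> 'a::euclidean_space => 'b::euclidean_space" where
 "dx v F z = frechet_derivative F (at z) (0, v)"

text \<open>Both partial derivatives are values of the full derivative of the joint map of (t, x).
  Smoothness is thus inherited from one hypothesis, and every commutation of derivatives is an
  instance of \<open>mixed_partials_commute\<close>.\<close>

definition dt :: "(real \<times> 'a => 'b) => real \<times> 'a::euclidean_space => 'b::euclidean_space" where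
 "dt F z = frechet_derivative F (at z) (1, 0)"

lemma smooth_on_dx: "smooth_on S F ==> smooth_on S (dx v F)"
 and smooth_on_dt: "smooth_on S F ==> smooth_on S (dt F)"
 unfolding dx_def[abs_def] dt_def[abs_def] by (rule smooth_on_deriv, assumption)+

lemma dx_dx_commute:
 assumes "open S" "smooth_on S F" "z \<in> S" shows "dx v (dx w F) z = dx w (dx v F) z"
 unfolding dx_def[abs_def] by (rule mixed_partials_commute[OF assms])

lemma dt_dx_commute:
 assumes "open S" "smooth_on S F" "z \<in> S" shows "dt (dx w F) z = dx w (dt F) z"
 unfolding dx_def[abs_def] dt_def[abs_def] by (rule mixed_partials_commute[OF assms])

lemma has_derivative_slice_x:
 assumes "open S" "smooth_on S F" "(t,x) \<in> S"
 shows "((\<lambda>x. F (t,x)) has_derivative (\<lambda>v. dx v F (t,x))) (at x)"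
 unfolding dx_def
 by (rule has_derivative_compose[where f="\<lambda>x. (t,x)" and g=F, OF _ smooth_on_has_derivative[OF assms]])
  (auto intro!: derivative_eq_intros)

lemma has_vector_derivative_slice_t:
 assumes "open S" "smooth_on S F" "(t,x) \<in> S"
 shows "((\<lambda>t. F (t,x)) has_vector_derivative dt F (t,x)) (at t)"
proof -
 note D = smooth_on_has_derivative[OF assms]
 have "((\<lambda>t. F (t,x)) has_derivative (\<lambda>r. frechet_derivative F (at (t,x)) (r, 0))) (at t)"
  by (rule has_derivative_compose[where f="\<lambda>t. (t,x)" and g=F, OF _ D])
   (auto intro!: derivative_eq_intros)
 moreover have "frechet_derivative F (at (t,x)) (r, 0) = r .* dt F (t,x)" for r
  using linear_scale[OF has_derivative_linear[OF D], of r "(1, 0)"] by (simp add: dt_def)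
 ultimately show ?thesis by (simp add: has_vector_derivative_def)
qed

lemma smooth_on_slice_x:
 fixes F :: "real \<times> 'a::euclidean_space => 'b::euclidean_space"
 assumes S: "open S" and F: "smooth_on S F" and O: "open O'" "\<And>x. x \<in> O' ==> (t,x) \<in> S"
 shows "smooth_on O' (\<lambda>x. F (t,x))"
proof -
 have "Ck_on k (\<lambda>x. F (t,x)) O'" for k
  using F
 proof (induction k arbitrary: F)
  case 0
  then show ?case using O(2) 
   by (auto intro!: continuous_on_compose2[OF smooth_on_imp_continuous_on[OF 0]] continuous_intros)
 next
  case (Suc k)
  show ?case
   by (rule Ck_on_SucI[OF O(1) has_derivative_slice_x[OF S Suc.prems O(2)]])
    (auto intro!: Suc.IH smooth_on_dx Suc.prems)
 qed
 then show ?thesis by (simp add: smooth_on_def)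
qed

lemma measurable_pair_continuous_on:
 fixes F :: "real \<times> 'a::euclidean_space => 'b::euclidean_space"
 assumes "continuous_on (I \<times> B) F"
 shows "F \<in> borel_measurable (lborel2 I B)"
proof -
 have "(\<lambda>z. z) \<in> (lborel2 I B) \<rightarrow>\<^sub>M restrict_space borel (I \<times> B)"
 proof (rule measurable_restrict_space2)
  show "(\<lambda>z. z) \<in> space (lborel2 I B) \<rightarrow> I \<times> B"
   by (auto simp: spaces)
  have "(\<lambda>z. (fst z, snd z)) \<in> borel_measurable (lborel2 I B)"
  proof (rule borel_measurable_Pair)
   have "(\<lambda>x. x) \<in> lborel_on S \<rightarrow>\<^sub>M borel" for S :: "'c::euclidean_space set"
    by (rule measurable_restrict_space1) simp
   from measurable_compose[OF measurable_fst this] measurable_compose[OF measurable_snd this]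
   show "fst \<in> borel_measurable (lborel2 I B)" "snd \<in> borel_measurable (lborel2 I B)"
    by auto
  qed
  then show "(\<lambda>z. z) \<in> borel_measurable (lborel2 I B)" by simp
 qed
 from measurable_compose[OF this borel_measurable_continuous_on_restrict[OF assms]] show ?thesis .
qed

lemma measurable_pair_snd_borel:
 fixes f :: "'a::euclidean_space => 'b::euclidean_space"
 assumes "f \<in> borel_measurable borel"
 shows "(\<lambda>z. f (snd z)) \<in> borel_measurable (lborel2 I B)"
proof -
 have "f \<in> borel_measurable (lborel_on B)" using assms by (intro measurable_restrict_space1) simp
 from measurable_compose[OF measurable_snd this] show ?thesis .
qed

lemma integrable_pair_compact_support:
 fixes F :: "real \<times> 'a::euclidean_space => real"
 assumes K: "compact K" "K \<subseteq> B" and B: "B \<in> sets borel"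
  and c: "continuous_on ({a..b} \<times> B) F" and z: "\<And>t x. t \<in> {a..b} ==> x \<in> B - K ==> F (t,x) = 0"
 shows "integrable (lborel2 {a..b} B) F"
proof -
 have cK: "compact ({a..b} \<times> K)" using K by (intro compact_Times) auto
 have "continuous_on ({a..b} \<times> K) F" using c by (rule continuous_on_subset) (use K in auto)
 from compact_continuous_image[OF this cK] obtain M where M: "\<And>z. z \<in> {a..b} \<times> K ==> norm (F z) \<le> M"
  using compact_imp_bounded bounded_iff by (metis (no_types, lifting) imageI)
 have KB: "K \<in> sets (lborel_on B)" using K B by (auto simp: sets_restrict_space_iff compact_imp_closed)
 interpret K: sigma_finite_measure "lborel_on B" by (rule sigma_finite_lborel_on[OF B])
 have em: "emeasure (lborel2 {a..b} B) ({a..b} \<times> K) < \<infinity>"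
 proof (subst K.emeasure_pair_measure_Times)
  have "emeasure (lborel_on {a..b}) {a..b} < \<infinity>" by (auto simp: emeasure_restrict_space emeasure_lborel_Icc_eq)
  moreover have "emeasure (lborel_on B) K < \<infinity>"
   using K B emeasure_bounded_finite[OF compact_imp_bounded[OF K(1)]]
   by (subst emeasure_restrict_space) auto
  ultimately show "emeasure (lborel_on {a..b}) {a..b} * emeasure (lborel_on B) K < \<infinity>"
   using ennreal_mult_less_top by auto
 qed (use KB in \<open>auto simp: sets_restrict_space_iff\<close>)
 show ?thesis
 proof (rule L1_bound)
  show "integrable (lborel2 {a..b} B) (\<lambda>z. \<bar>M\<bar> * indicator ({a..b} \<times> K) z)"
   using KB em by (intro integrable_mult_right integrable_real_indicator) (auto simp: sets_restrict_space_iff intro!: pair_measureI)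
  show "F \<in> borel_measurable (lborel2 {a..b} B)"
   by (rule measurable_pair_continuous_on[OF c])
  show "AE z in lborel2 {a..b} B. norm (F z) \<le> norm (\<bar>M\<bar> * indicator ({a..b} \<times> K) z)"
  proof (rule AE_I2)
   fix z assume "z \<in> space (lborel2 {a..b} B)"
   then obtain t x where tx: "z = (t,x)" "t \<in> {a..b}" "x \<in> B"
    by (auto simp: spaces)
   show "norm (F z) \<le> norm (\<bar>M\<bar> * indicator ({a..b} \<times> K) z)"
   proof (cases "x \<in> K")
    case True
    then have "norm (F z) \<le> M" using M tx by auto
    then show ?thesis using True tx by simp
   next
    case False
    then show ?thesis using z tx by simp
   qed
  qed
 qed
qed

text \<open>Cutoffs that exhaust the ball. The gradient blows up no faster than the Hardy weight, so
  an error term such as \<open>|d\<zeta>| |w| |grad u|\<close> has, uniformly in \<open>n\<close>,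
  the integrable majorant \<open>(|w|/(1 - |x|^2))^2 + |grad u|^2\<close> up to a constant, while it
  tends to 0 pointwise.\<close>

locale cutoffs =
 fixes \<zeta> :: "nat => 'a::euclidean_space => real" and d\<zeta> :: "nat => 'a => 'a => real" and KK :: "nat => 'a set" and L :: real
 assumes \<zeta>s: "\<And>n. smooth_on UNIV (\<zeta> n)"
  and \<zeta>: "\<And>n x. (\<zeta> n has_derivative d\<zeta> n x) (at x)" "\<And>n b. continuous_on UNIV (\<lambda>x. d\<zeta> n x b)"
  and KK: "\<And>n. compact (KK n)" "\<And>n. KK n \<subseteq> ball 0 1" "\<And>n x. x \<in> ball 0 1 ==> x \<notin> KK n ==> \<zeta> n x = 0"
   "\<And>n x. x \<in> ball 0 1 ==> x \<notin> KK n ==> d\<zeta> n x = (\<lambda>_. 0)"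
  and \<zeta>b: "\<And>n x. 0 \<le> \<zeta> n x" "\<And>n x. \<zeta> n x \<le> 1" "\<And>x. x \<in> ball 0 1 ==> (\<lambda>n. \<zeta> n x) ----> 1"
  and d\<zeta>b: "\<And>n x b. x \<in> ball 0 1 ==> b \<in> Basis ==> \<bar>d\<zeta> n x b\<bar> \<le> L/(1 - nsq x)"
   "\<And>x b. x \<in> ball 0 1 ==> (\<lambda>n. d\<zeta> n x b) ----> 0"
  and L: "L > 0"
begin

lemma \<zeta>c: "continuous_on S (\<zeta> n)" "continuous_on S (\<lambda>x. d\<zeta> n x b)"
 using \<zeta>(1) continuous_on_subset[OF \<zeta>(2)] by (auto intro!: continuous_at_imp_continuous_on has_derivative_continuous)

lemma \<zeta>c2: "continuous_on S (\<lambda>z. \<zeta> n (snd z))" "continuous_on S (\<lambda>z. d\<zeta> n (snd z) b)"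
 by (auto intro!: continuous_on_compose2[OF \<zeta>c(1)[of UNIV]] continuous_on_compose2[OF \<zeta>(2)] continuous_intros)

lemma ci:
 fixes f :: "'a => real"
 assumes "continuous_on (ball 0 1) f" "\<And>x. x \<in> ball 0 1 ==> x \<notin> KK n ==> f x = 0"
 shows "integrable (lborel_on (ball 0 1)) f"
 using assms by (intro integrable_compact_support[OF _ KK(1,2)]) auto

end

text \<open>For \<open>\<zeta> n = \<beta> ((n + 1) (1 - |x|^2) - 1)\<close> the step is active only
  where \<open>(n + 1) (1 - |x|^2)\<close> lies between 1 and 2, and there the steepness
  \<open>n + 1\<close> is at most \<open>2/(1 - |x|^2)\<close>. The other factor 2 in
  \<open>4 * L\<close> is the gradient of \<open>|x|^2\<close>.\<close>

lemma cutoffs_exist: "\<exists>\<zeta> d\<zeta> (K :: nat => 'a::euclidean_space set) L. cutoffs \<zeta> d\<zeta> K L"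
proof -
 obtain \<beta> \<beta>' L where "smooth_step \<beta> \<beta>' L" using smooth_step_exists by blast
 then interpret smooth_step \<beta> \<beta>' L .
 define \<rho> where "\<rho> x = 1 - x \<bullet> x" for x :: 'a
 have rho: "1 - nsq x = \<rho> x" for x by (simp add: \<rho>_def power2_norm_eq_inner)
 have rp: "\<rho> x > 0" if "x \<in> ball 0 1" for x using norm_sq_less_1[OF that] by (simp flip: rho)
 define q where "q n x = real (Suc n) * \<rho> x - 1" for n x
 define \<zeta> where "\<zeta> n x = \<beta> (q n x)" for n x
 define d\<zeta> where "d\<zeta> n x v = \<beta>' (q n x) * (real (Suc n) * (- 2 * (x \<bullet> v)))" for n x v
 define K where "K n = {x \<in> cball (0::'a) 1. \<rho> x \<ge> 1/real (Suc n)}" for n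
 have dq: "(q n has_derivative (\<lambda>v. real (Suc n) * (- 2 * (x \<bullet> v)))) (at x)" for n x
  unfolding q_def \<rho>_def by (auto intro!: derivative_eq_intros simp: inner_commute)
 have qs: "smooth_on UNIV (q n)" for n
 proof -
  have "smooth_on UNIV (\<lambda>x::'a. (- real (Suc n)) * (x \<bullet> x) + real n)"
   by (intro smooth_on_add smooth_on_mult smooth_on_const smooth_on_inner smooth_on_linear bounded_linear_ident) auto
  moreover have "q n = (\<lambda>x. (- real (Suc n)) * (x \<bullet> x) + real n)" by (auto simp: q_def \<rho>_def fun_eq_iff algebra_simps)
  ultimately show ?thesis by simp
 qed
 have qc: "continuous_on UNIV (q n)" for n using smooth_on_imp_continuous_on[OF qs] .
 have out: "q n x \<le> 0" if "x \<in> ball 0 1" "x \<notin> K n" for n x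
 proof -
  have "\<rho> x < 1/real (Suc n)" using that by (auto simp: K_def)
  then have "\<rho> x * real (Suc n) < 1" by (subst (asm) pos_less_divide_eq) auto
  then show ?thesis by (simp add: q_def mult.commute)
 qed
 have ev: "\<forall>\<^sub>F n in sequentially. q n x \<ge> 1" if "x \<in> ball 0 1" for x
 proof -
  have "\<rho> x > 0" by (rule rp[OF that])
  then have "\<forall>\<^sub>F n in sequentially. real (Suc n) * \<rho> x - 1 \<ge> 1" by real_asymp
  then show ?thesis by (simp add: q_def)
 qed
 have "cutoffs \<zeta> d\<zeta> K (4 * L)"
 proof unfold_locales
  show "smooth_on UNIV (\<zeta> n)" for n unfolding \<zeta>_def by (rule smooth_on_compose_real[OF open_UNIV qs \<beta>(12)])
  show "(\<zeta> n has_derivative d\<zeta> n x) (at x)" for n x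
   unfolding \<zeta>_def d\<zeta>_def
   using has_derivative_compose[OF dq \<beta>(1)[unfolded has_field_derivative_def]] by simp
  show "continuous_on UNIV (\<lambda>x. d\<zeta> n x b)" for n b
   unfolding d\<zeta>_def by (intro continuous_intros continuous_on_compose2[OF \<beta>(2) qc]) auto
  show "compact (K n)" for n
  proof -
   have "closed {x. 1/real (Suc n) \<le> \<rho> x}"
    unfolding \<rho>_def by (intro closed_Collect_le continuous_intros)
   moreover have "K n = cball 0 1 \<inter> {x. 1/real (Suc n) \<le> \<rho> x}" by (auto simp: K_def)
   ultimately show ?thesis by (simp add: compact_Int_closed)
  qed
  show "K n \<subseteq> ball 0 1" for n
  proof
   fix x assume "x \<in> K n"
   then have "\<rho> x > 0" by (auto simp: K_def intro: less_le_trans[rotated])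
   then have "nsq x < 1" by (simp flip: rho)
   then show "x \<in> ball 0 1" using abs_square_less_1[of "norm x"] by simp
  qed
  show "\<zeta> n x = 0" if "x \<in> ball 0 1" "x \<notin> K n" for n x
   using out[OF that] \<beta>(3) by (simp add: \<zeta>_def)
  show "d\<zeta> n x = (\<lambda>_. 0)" if "x \<in> ball 0 1" "x \<notin> K n" for n x
   using out[OF that] \<beta>(9) by (simp add: d\<zeta>_def fun_eq_iff)
  show "(\<lambda>n. \<zeta> n x) ----> 1" if "x \<in> ball 0 1" for x
   by (rule tendsto_eventually) (use ev[OF that] \<beta>(4) in \<open>auto simp: \<zeta>_def elim: eventually_mono\<close>)
  show "(\<lambda>n. d\<zeta> n x b) ----> 0" if "x \<in> ball 0 1" for x b
   by (rule tendsto_eventually) (use ev[OF that] \<beta>(10) in \<open>auto simp: d\<zeta>_def elim: eventually_mono\<close>)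
  show "\<bar>d\<zeta> n x b\<bar> \<le> 4 * L/(1 - nsq x)" if x: "x \<in> ball 0 1" and b: "b \<in> Basis" for n x b
  proof (cases "q n x \<le> 1")
   case False
   then show ?thesis using \<beta>(10,11) rp[OF x] by (simp add: d\<zeta>_def rho)
  next
   case True
   then have "real (Suc n) \<le> 2/\<rho> x" using rp[OF x] by (simp add: q_def field_simps)
   moreover have "\<bar>x \<bullet> b\<bar> \<le> 1" using Basis_le_norm[OF b, of x] x by simp
   ultimately have m: "real (Suc n) * (2 * \<bar>x \<bullet> b\<bar>) \<le> (2/\<rho> x) * 2"
    using rp[OF x] by (intro mult_mono) auto
   have "\<beta>' (q n x) * (real (Suc n) * (2 * \<bar>x \<bullet> b\<bar>)) \<le> L * ((2/\<rho> x) * 2)"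
    by (rule mult_mono[OF \<beta>(8) m]) (use \<beta>(11) in auto)
   moreover have "\<bar>d\<zeta> n x b\<bar> = \<bar>\<beta>' (q n x)\<bar> * (\<bar>real (Suc n)\<bar> * (\<bar>- 2\<bar> * \<bar>x \<bullet> b\<bar>))"
    unfolding d\<zeta>_def abs_mult ..
   moreover have "\<bar>\<beta>' (q n x)\<bar> = \<beta>' (q n x)" "\<bar>real (Suc n)\<bar> = real (Suc n)" "\<bar>- 2\<bar> = (2::real)" "L * ((2/\<rho> x) * 2) = 4 * L/\<rho> x"
    using \<beta>(7) by auto
   ultimately show ?thesis by (simp only: rho)
  qed
 qed (use \<beta> in \<open>auto simp: \<zeta>_def\<close>)
 then show ?thesis by blast
qed

text \<open>The divergence theorem for the field \<open>\<zeta> (q \<bullet> p b)\<close>. With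
  \<open>p b\<close> the partial derivatives of u, the left side pairs \<open>q\<close> with the
  Laplacian, and the last integral is the boundary error left by the cutoff.\<close>

lemma green_cutoff:
 fixes q :: "'a::euclidean_space => 'b::euclidean_space"
 assumes S: "open S" and K: "compact K" "K \<subseteq> S"
  and \<zeta>: "\<And>x. (\<zeta> has_derivative d\<zeta> x) (at x)" "\<And>b. continuous_on UNIV (\<lambda>x. d\<zeta> x b)"
   "\<And>x. x \<in> S ==> x \<notin> K ==> \<zeta> x = 0" "\<And>x. x \<in> S ==> x \<notin> K ==> d\<zeta> x = (\<lambda>_. 0)"
  and q: "\<And>x. x \<in> S ==> (q has_derivative q' x) (at x)" "\<And>b. continuous_on S (\<lambda>x. q' x b)"
  and p: "\<And>b x. x \<in> S ==> (p b has_derivative p' b x) (at x)" "\<And>b. continuous_on S (\<lambda>x. p' b x b)"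
 shows "(\<integral>x. \<zeta> x * (q x \<bullet> (\<Sum>b\<in>Basis. p' b x b)) \<partial>lborel_on S)
  = - (\<integral>x. \<zeta> x * (\<Sum>b\<in>Basis. q' x b \<bullet> p b x) \<partial>lborel_on S)
   - (\<integral>x. (\<Sum>b\<in>Basis. d\<zeta> x b * (q x \<bullet> p b x)) \<partial>lborel_on S)"
proof -
 have c: "continuous_on S \<zeta>" "continuous_on S (\<lambda>x. d\<zeta> x b)" "continuous_on S q" "continuous_on S (p b)" for b
  using \<zeta>(1) q(1) p(1) continuous_on_subset[OF \<zeta>(2)]
  by (auto intro!: continuous_at_imp_continuous_on has_derivative_continuous)
 have SB: "S \<in> sets borel" using S by simp
 have i: "integrable (lborel_on S) (\<lambda>x. \<zeta> x * (q x \<bullet> (\<Sum>b\<in>Basis. p' b x b)))"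
  "integrable (lborel_on S) (\<lambda>x. \<zeta> x * (\<Sum>b\<in>Basis. q' x b \<bullet> p b x))"
  "integrable (lborel_on S) (\<lambda>x. (\<Sum>b\<in>Basis. d\<zeta> x b * (q x \<bullet> p b x)))"
  by (rule integrable_compact_support[OF SB K]; (intro continuous_intros c q p)?; use \<zeta>(3,4) in auto)+
 have ib: "integrable (lborel_on S) (\<lambda>x. d\<zeta> x b * (q x \<bullet> p b x) + \<zeta> x * (q x \<bullet> p' b x b + q' x b \<bullet> p b x))" for b
  by (rule integrable_compact_support[OF SB K]; (intro continuous_intros c q p)?; use \<zeta>(3,4) in auto)+
 have "(\<integral>x. d\<zeta> x b * (q x \<bullet> p b x) + \<zeta> x * (q x \<bullet> p' b x b + q' x b \<bullet> p b x) \<partial>lborel_on S) = 0" for b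
 proof (rule integral_partial_zero[OF S K, where f="\<lambda>x. \<zeta> x * (q x \<bullet> p b x)" and b=b and
   f'="\<lambda>x v. d\<zeta> x v * (q x \<bullet> p b x) + \<zeta> x * (q x \<bullet> p' b x v + q' x v \<bullet> p b x)"])
  show "((\<lambda>x. \<zeta> x * (q x \<bullet> p b x)) has_derivative
    (\<lambda>v. d\<zeta> x v * (q x \<bullet> p b x) + \<zeta> x * (q x \<bullet> p' b x v + q' x v \<bullet> p b x))) (at x)" if "x \<in> S" for x
   using has_derivative_mult[OF \<zeta>(1)[of x] has_derivative_inner[OF q(1)[OF that] p(1)[OF that, of b]]]
   by (rule has_derivative_eq_rhs) (simp add: fun_eq_iff)
  show "continuous_on S (\<lambda>x. d\<zeta> x b * (q x \<bullet> p b x) + \<zeta> x * (q x \<bullet> p' b x b + q' x b \<bullet> p b x))"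
   by (intro continuous_intros c q p)
 qed (use \<zeta>(3) in auto)
 then have "(\<integral>x. (\<Sum>b\<in>Basis. d\<zeta> x b * (q x \<bullet> p b x) + \<zeta> x * (q x \<bullet> p' b x b + q' x b \<bullet> p b x)) \<partial>lborel_on S) = 0"
  using ib by (simp add: L1_sum)
 also have "(\<lambda>x. (\<Sum>b\<in>Basis. d\<zeta> x b * (q x \<bullet> p b x) + \<zeta> x * (q x \<bullet> p' b x b + q' x b \<bullet> p b x)))
  = (\<lambda>x. (\<Sum>b\<in>Basis. d\<zeta> x b * (q x \<bullet> p b x)) + \<zeta> x * (q x \<bullet> (\<Sum>b\<in>Basis. p' b x b)) + \<zeta> x * (\<Sum>b\<in>Basis. q' x b \<bullet> p b x))"
  by (simp add: fun_eq_iff sum.distrib inner_sum_right sum_distrib_left distrib_left)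
 finally show ?thesis using i by simp
qed

section \<open>The flow with Borel data\<close>

lemma kappa_bounds: "t \<ge> 0 ==> 0 \<le> kappa t" "kappa t < 1/2"
proof -
 show "0 \<le> kappa t" if "t \<ge> 0" using that by (simp add: kappa_def)
 have "arctan t < pi/2" by (rule arctan_ubound)
 then show "kappa t < 1/2" by (simp add: kappa_def field_simps)
qed

lemma powr_kappa_le: "lam > 0 ==> t \<ge> 0 ==> lam powr (1 - kappa t) \<le> max 1 lam"
proof (cases "lam \<ge> 1")
 case True
 assume "t \<ge> 0"
 then have "lam powr (1 - kappa t) \<le> lam powr 1"
  using True kappa_bounds(1)[of t] by (intro powr_mono) auto
 then show ?thesis using True by simp
next
 case False
 assume "lam > 0" "t \<ge> 0"
 then have "lam powr (1 - kappa t) \<le> 1"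
  using False kappa_bounds(2)[of t] by (intro powr_le1) auto
 then show ?thesis by simp
qed

text \<open>Between 2 and 4 only a bound from compactness is available, since the sign of
  \<open>deriv chi\<close> is unknown there.\<close>

lemma cutoff_deriv:
 assumes "cutoff chi"
 shows "x < 2 ==> deriv chi x = 1" and "x > 4 ==> deriv chi x = 0"
  and "\<exists>C\<ge>0. \<forall>x\<in>{2..4}. \<bar>deriv chi x\<bar> \<le> C" (is ?c3) and "(chi has_real_derivative deriv chi x) (at x)" (is ?c4)
  and "continuous_on UNIV (deriv chi)"
proof -
 have s: "smooth_on UNIV chi" using assms by (simp add: cutoff_def)
 have d: "(chi has_real_derivative frechet_derivative chi (at x) 1) (at x)" for x
 proof -
  note D = smooth_on_has_derivative[OF open_UNIV s UNIV_I, of x]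
  have "frechet_derivative chi (at x) v = frechet_derivative chi (at x) 1 * v" for v
   using linear_scale[OF has_derivative_linear[OF D], of v 1] by simp
  then have "frechet_derivative chi (at x) = (*) (frechet_derivative chi (at x) 1)" by (rule ext)
  then show ?thesis using D by (simp add: has_field_derivative_def)
 qed
 then have eq: "deriv chi = (\<lambda>x. frechet_derivative chi (at x) 1)" using DERIV_imp_deriv by blast
 show ?c4 using d by (simp add: eq)
 show c: "continuous_on UNIV (deriv chi)"
  unfolding eq by (rule smooth_on_imp_continuous_on[OF smooth_on_deriv[OF s]])
 show "deriv chi x = 1" if "x < 2"
 proof -
  have "(chi has_real_derivative 1) (at x)"
   by (rule has_field_derivative_transform_within_open[OF DERIV_ident, of "{..<2}"])
    (use assms that in \<open>auto simp: cutoff_def\<close>)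
  then show ?thesis by (rule DERIV_imp_deriv)
 qed
 show "deriv chi x = 0" if "x > 4"
 proof -
  have "(chi has_real_derivative 0) (at x)"
   by (rule has_field_derivative_transform_within_open[OF DERIV_const[of 3], of "{4<..}"])
    (use assms that in \<open>auto simp: cutoff_def\<close>)
  then show ?thesis by (rule DERIV_imp_deriv)
 qed
 have "compact (deriv chi ` {2..4})"
  by (rule compact_continuous_image[OF continuous_on_subset[OF c]]) auto
 then obtain C where "\<And>x. x \<in> {2..4} ==> \<bar>deriv chi x\<bar> \<le> C"
  using compact_imp_bounded bounded_iff by (metis (no_types, lifting) imageI real_norm_def)
 then show ?c3
  by (intro exI[of _ "\<bar>C\<bar>"]) force
qed

section \<open>Integrals over space-time cylinders\<close>

lemma measurable_pair_subset:
 fixes F :: "real \<times> 'a::euclidean_space => 'b::topological_space"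
 assumes "F \<in> borel_measurable (lborel2 J B)" "I \<subseteq> J"
 shows "F \<in> borel_measurable (lborel2 I B)"
proof -
 have "(\<lambda>x. x) \<in> lborel_on I \<rightarrow>\<^sub>M lborel_on J"
  using assms(2) by (intro measurable_restrict_space2 measurable_restrict_space1) (auto simp: space_restrict_space)
 then have "(\<lambda>z. (fst z, snd z)) \<in> (lborel2 I B) \<rightarrow>\<^sub>M (lborel2 J B)"
  by (intro measurable_Pair measurable_compose[OF measurable_fst] measurable_snd)
 from measurable_compose[OF this assms(1)] show ?thesis by simp
qed

lemma pair_sigma_finite_lborel_on:
 "I \<in> sets borel ==> B \<in> sets borel ==> pair_sigma_finite (lborel_on I) (lborel_on B)"
 by (simp add: pair_sigma_finite_def sigma_finite_lborel_on)

lemma nn_integral_pair: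
 fixes F :: "real \<times> 'a::euclidean_space => ennreal"
 assumes "I \<in> sets borel" "B \<in> sets borel" "F \<in> borel_measurable (lborel2 I B)"
 shows "nn_integral (lborel2 I B) F = (\<integral>\<^sup>+t. (\<integral>\<^sup>+x. F (t,x) \<partial>lborel_on B) \<partial>lborel_on I)"
proof -
 interpret pair_sigma_finite "lborel_on I" "lborel_on B" by (rule pair_sigma_finite_lborel_on[OF assms(1,2)])
 show ?thesis using M2.nn_integral_fst[OF assms(3)] by simp
qed

lemma integrable_pair_subset:
 fixes F :: "real \<times> 'a::euclidean_space => real"
 assumes "integrable (lborel2 J B) F" and IJ: "I \<subseteq> J" "I \<in> sets borel" "J \<in> sets borel" "B \<in> sets borel"
 shows "integrable (lborel2 I B) F"
proof -
 have m: "F \<in> borel_measurable (lborel2 J B)" using assms(1) by simp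
 note m' = measurable_pair_subset[OF m IJ(1)]
 have "(\<integral>\<^sup>+z. norm (F z) \<partial>(lborel2 I B)) = (\<integral>\<^sup>+t. (\<integral>\<^sup>+x. norm (F (t,x)) \<partial>lborel_on B) \<partial>lborel_on I)"
  using m' by (intro nn_integral_pair IJ) auto
 also have "\<dots> \<le> (\<integral>\<^sup>+t. (\<integral>\<^sup>+x. norm (F (t,x)) \<partial>lborel_on B) \<partial>lborel_on J)"
  using IJ by (auto simp: nn_integral_restrict_space intro!: nn_integral_mono split: split_indicator)
 also have "\<dots> = (\<integral>\<^sup>+z. norm (F z) \<partial>(lborel2 J B))"
  using m by (intro nn_integral_pair[symmetric] IJ) auto
 also have "\<dots> < \<infinity>" using assms(1) by (simp add: integrable_iff_bounded)
 finally show ?thesis using m' by (simp add: integrable_iff_bounded)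
qed

lemma time_FTC_le:
 fixes F F' E :: "real => 'a::euclidean_space => real"
 assumes S: "S \<in> sets borel" and ab: "a \<le> b"
  and d: "\<And>x t. x \<in> S ==> t \<in> {a..b} ==> ((\<lambda>t. F t x) has_real_derivative F' t x) (at t)"
  and c: "\<And>x. x \<in> S ==> continuous_on {a..b} (\<lambda>t. F' t x)"
  and i: "integrable (lborel2 {a..b} S) (\<lambda>(t,x). F' t x)"
  and ia: "integrable (lborel_on S) (F a)" and ib: "integrable (lborel_on S) (F b)"
  and E: "integrable (lborel2 {a..b} S) (\<lambda>(t,x). E t x)"
  and le: "AE t in lborel_on {a..b}. LI (lborel_on S) (F' t) \<le> LI (lborel_on S) (E t)"
 shows "LI (lborel_on S) (F b) - LI (lborel_on S) (F a)
  \<le> LI (lborel2 {a..b} S) (\<lambda>(t,x). E t x)"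
proof -
 interpret pair_sigma_finite "lborel_on {a..b}" "lborel_on S" using S by (intro pair_sigma_finite_lborel_on) auto
 have "LI (lborel_on S) (F b) - LI (lborel_on S) (F a)
  = (\<integral>t. (\<integral>x. F' t x \<partial>lborel_on S) \<partial>lborel_on {a..b})"
  by (rule time_FTC[OF S ab d c i ia ib])
 also have "\<dots> \<le> (\<integral>t. (\<integral>x. E t x \<partial>lborel_on S) \<partial>lborel_on {a..b})"
  using integrable_fst'[OF i] integrable_fst'[OF E] le by (intro integral_mono_AE) auto
 also have "\<dots> = LI (lborel2 {a..b} S) (\<lambda>(t,x). E t x)"
  using integral_fst'[OF E] by simp
 finally show ?thesis .
qed

lemma finite_measure_lborel_on:
 "S \<in> sets borel ==> bounded S ==> finite_measure (lborel_on S)"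
 using emeasure_bounded_finite[of S]
 by (auto intro!: finite_measureI simp: space_restrict_space emeasure_restrict_space)

text \<open>The flow with Borel data: \<open>v0\<close> represents the initial map and
  \<open>g b\<close> its weak derivatives. The lateral boundary condition survives only as
  \<open>hardy\<close>, the bound that Hardy's inequality draws from membership in the zero-trace
  space; this is the form in which the cutoff errors need it.\<close>

locale glh =
 fixes T lam :: real and chi :: "real => real"
  and U :: "real \<times> 'a::euclidean_space => 'b::euclidean_space" and v0 :: "'a => 'b" and g :: "'a => 'a => 'b"
 assumes dim: "DIM('a) \<ge> 2" and T: "T > 0" and lam: "lam > 0" and chi: "cutoff chi"
  and smooth: "smooth_on ({0<..<T} \<times> ball 0 1) U"
  and pde: "\<And>z. z \<in> {0<..<T} \<times> ball 0 1 ==> dt U z = (\<Sum>b\<in>Basis. dx b (dx b U) z)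
   - (lam powr (1 - kappa (fst z)) * deriv chi ((nsq (U z) - 1)^2) * (nsq (U z) - 1)) .* U z"
  and v0m: "v0 \<in> borel_measurable borel" and v01: "AE x in lborel_on (ball 0 1). norm (v0 x) = 1"
  and gm: "\<And>b. b \<in> Basis ==> g b \<in> borel_measurable borel"
  and gi: "\<And>b. b \<in> Basis ==> integrable (lborel_on (ball 0 1)) (\<lambda>x. nsq (g b x))"
  and weak: "\<And>b (\<phi>::'a => real). b \<in> Basis ==> test_function (ball 0 1) \<phi> ==>
    (\<integral>x. partial_deriv b \<phi> x .* v0 x \<partial>lborel_on (ball 0 1)) = - (\<integral>x. \<phi> x .* g b x \<partial>lborel_on (ball 0 1))"
  and grad_fin: "(\<integral>\<^sup>+t. (\<integral>\<^sup>+x. ennreal (\<Sum>b\<in>Basis. nsq (dx b U (t,x))) \<partial>lborel_on (ball 0 1)) \<partial>lborel_on {0<..<T}) < \<infinity>"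
  and hardy: "AE t in lborel_on {0<..<T}. (\<integral>\<^sup>+x. ennreal ((norm (U (t,x) - v0 x)/(1 - nsq x))^2) \<partial>lborel_on (ball 0 1))
   \<le> ennreal (4 * (\<Sum>b\<in>Basis. \<integral>x. nsq (g b x) \<partial>lborel_on (ball 0 1)))
    + 4 * (\<integral>\<^sup>+x. ennreal (\<Sum>b\<in>Basis. nsq (dx b U (t,x))) \<partial>lborel_on (ball 0 1))"
  and init: "((\<lambda>t. \<integral>\<^sup>+x. ennreal (nsq (U (t,x) - v0 x)) \<partial>lborel_on (ball 0 1)) \<longlongrightarrow> 0) (at_right 0)"
begin

abbreviation "BB \<equiv> ball (0::'a) 1"
abbreviation "MB \<equiv> lborel_on BB"
abbreviation "MT \<equiv> lborel_on {0<..<T}"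
abbreviation "PJ a b \<equiv> lborel2 {a..b} BB"
abbreviation "Q \<equiv> {0<..<T} \<times> BB"
definition "gsq z = (\<Sum>b\<in>Basis. nsq (dx b U z))"
text \<open>The Dirichlet integral of the initial map; all energy bounds are multiples of
  it.\<close>

definition "M0 = (\<Sum>b\<in>Basis. \<integral>x. nsq (g b x) \<partial>MB)"
definition "\<rho> x = 1 - nsq x" for x :: 'a
definition "w z = U z - v0 (snd z)"

lemma open_Q: "open Q" by (intro open_Times) auto

lemma rho_pos: "x \<in> BB ==> \<rho> x > 0"
 using norm_sq_less_1 by (simp add: \<rho>_def)

lemma smooths: "smooth_on Q U" "smooth_on Q (dx b U)" "smooth_on Q (dt U)" "smooth_on Q (dx c (dx b U))"
 "smooth_on Q (dt (dx b U))" "smooth_on Q (dx b (dt U))"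
 using smooth smooth_on_dx smooth_on_dt by blast+

lemmas conts = smooths[THEN smooth_on_imp_continuous_on]

lemma slice_cont_x: "continuous_on Q F ==> t \<in> {0<..<T} ==> continuous_on BB (\<lambda>x. F (t,x))"
 by (rule continuous_on_compose2[of Q F]) (auto intro!: continuous_intros)

lemma slice_cont_t: "continuous_on Q F ==> x \<in> BB ==> 0 < a ==> b < T ==> continuous_on {a..b} (\<lambda>t. F (t,x))"
 by (rule continuous_on_compose2[of Q F]) (auto intro!: continuous_intros)

lemma slice_deriv_x: "smooth_on Q F ==> t \<in> {0<..<T} ==> x \<in> BB ==>
  ((\<lambda>x. F (t,x)) has_derivative (\<lambda>v. dx v F (t,x))) (at x)"
 by (rule has_derivative_slice_x[OF open_Q]) auto

lemma slice_deriv_t: "smooth_on Q F ==> t \<in> {0<..<T} ==> x \<in> BB ==>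
  ((\<lambda>t. F (t,x)) has_vector_derivative dt F (t,x)) (at t)"
 by (rule has_vector_derivative_slice_t[OF open_Q]) auto

lemma meas_Q: "continuous_on Q F ==> I \<subseteq> {0<..<T} ==> F \<in> borel_measurable (lborel2 I BB)"
 for F :: "real \<times> 'a => 'c::euclidean_space"
 by (rule measurable_pair_continuous_on, rule continuous_on_subset[of Q F]) auto

lemma meas_x: "continuous_on Q F ==> t \<in> {0<..<T} ==> (\<lambda>x. F (t,x)) \<in> borel_measurable MB"
 for F :: "real \<times> 'a => 'c::euclidean_space"
 by (intro borel_measurable_lborel_on slice_cont_x)

lemma cont_gsq: "continuous_on Q gsq"
 unfolding gsq_def[abs_def] by (intro continuous_intros conts)

lemma cont_rho_snd: "continuous_on S (\<lambda>z. \<rho> (snd z))"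
 unfolding \<rho>_def by (intro continuous_intros)

lemma rho_nz: "z \<in> Q ==> \<rho> (snd z) \<noteq> 0" 
 using rho_pos by force

lemma gsq_nonneg: "gsq z \<ge> 0" by (simp add: gsq_def sum_nonneg)

lemma M0_nonneg: "M0 \<ge> 0" by (simp add: M0_def sum_nonneg)

lemma w_meas: "I \<subseteq> {0<..<T} ==> w \<in> borel_measurable (lborel2 I BB)"
 unfolding w_def[abs_def] by (intro borel_measurable_diff meas_Q conts measurable_pair_snd_borel v0m)

lemma v0_meas: "v0 \<in> borel_measurable MB"
 using v0m by (intro measurable_restrict_space1) simp

lemma w_meas_x: "t \<in> {0<..<T} ==> (\<lambda>x. w (t,x)) \<in> borel_measurable MB"
 unfolding w_def snd_conv by (rule borel_measurable_diff[OF meas_x[OF conts(1)] v0_meas])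

lemma rho_meas: "(\<lambda>z. \<rho> (snd z)) \<in> borel_measurable (lborel_on (I :: real set) \<Otimes>\<^sub>M MB)"
 by (rule measurable_pair_continuous_on[OF cont_rho_snd])

lemma finite_MB: "finite_measure MB" and finite_MT: "finite_measure MT"
 by (auto intro!: finite_measure_lborel_on)

lemma gsq_integrable: "integrable (lborel2 {0<..<T} BB) gsq"
proof -
 have m: "gsq \<in> borel_measurable (lborel2 {0<..<T} BB)" by (rule meas_Q[OF cont_gsq]) simp
 have "(\<integral>\<^sup>+z. ennreal (gsq z) \<partial>(lborel2 {0<..<T} BB)) < \<infinity>"
  using grad_fin[folded gsq_def] m by (subst nn_integral_pair) auto
 then show ?thesis using m by (intro integrableI_nonneg) (auto simp: gsq_nonneg)
qed

text \<open>The squared Hardy quotient of \<open>u - u0\<close>. Its integrability over the cylinder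
  stands in for vanishing boundary values.\<close>

definition "hq z = (norm (w z)/\<rho> (snd z))^2"

lemma hq_meas: "I \<subseteq> {0<..<T} ==> hq \<in> borel_measurable (lborel2 I BB)"
 using w_meas[of I] rho_meas[of I] unfolding hq_def[abs_def] by measurable

lemma hq_integrable: "integrable (lborel2 {0<..<T} BB) hq"
proof -
 have m: "hq \<in> borel_measurable (lborel2 {0<..<T} BB)" by (rule hq_meas) simp
 have mg: "gsq \<in> borel_measurable (lborel2 {0<..<T} BB)" by (rule meas_Q[OF cont_gsq]) simp
 interpret pair_sigma_finite MT MB by (intro pair_sigma_finite_lborel_on) auto
 have mt: "(\<lambda>t. \<integral>\<^sup>+x. ennreal (gsq (t,x)) \<partial>MB) \<in> borel_measurable MT"
  using M2.borel_measurable_nn_integral_fst[of "\<lambda>z. ennreal (gsq z)" MT] mg by simp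
 have "(\<integral>\<^sup>+z. ennreal (hq z) \<partial>(lborel2 {0<..<T} BB)) = (\<integral>\<^sup>+t. (\<integral>\<^sup>+x. ennreal (hq (t,x)) \<partial>MB) \<partial>MT)"
  using m by (subst nn_integral_pair) auto
 also have "\<dots> \<le> (\<integral>\<^sup>+t. ennreal (4 * M0) + 4 * (\<integral>\<^sup>+x. ennreal (gsq (t,x)) \<partial>MB) \<partial>MT)"
  using hardy by (intro nn_integral_mono_AE) (simp add: hq_def w_def \<rho>_def gsq_def M0_def)
 also have "\<dots> = ennreal (4 * M0) * emeasure MT (space MT) + 4 * (\<integral>\<^sup>+t. (\<integral>\<^sup>+x. ennreal (gsq (t,x)) \<partial>MB) \<partial>MT)"
  using mt by (simp add: nn_integral_add nn_integral_cmult)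
 also have "\<dots> < \<infinity>"
  using grad_fin finite_measure.emeasure_finite[OF finite_MT, of "space MT"]
  by (auto simp: gsq_def less_top[symmetric] ennreal_mult_less_top ennreal_mult_eq_top_iff)
 finally show ?thesis using m by (intro integrableI_nonneg) (auto simp: hq_def)
qed

lemma AE_good_t: "AE t in MT. integrable MB (\<lambda>x. gsq (t,x)) \<and> integrable MB (\<lambda>x. hq (t,x))"
proof -
 interpret pair_sigma_finite MT MB by (intro pair_sigma_finite_lborel_on) auto
 show ?thesis using AE_integrable_fst'[OF gsq_integrable] AE_integrable_fst'[OF hq_integrable] by auto
qed

lemma init_tendsto:
 assumes "\<And>t. t \<in> {0<..<T} ==> (\<lambda>x. f t x) \<in> borel_measurable MB"
  and "\<And>t. t \<in> {0<..<T} ==> AE x in MB. 0 \<le> f t x \<and> f t x \<le> C * nsq (w (t,x))" and C: "C \<ge> 0"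
 shows "((\<lambda>t. \<integral>\<^sup>+x. ennreal (f t x) \<partial>MB) \<longlongrightarrow> 0) (at_right 0)"
proof -
 have ev: "\<forall>\<^sub>F t in at_right 0. t \<in> {0<..<T}"
  using T eventually_at_right_less[of 0] eventually_at_right_field[of "\<lambda>t. t \<in> {0<..<T}" 0] by auto
 have *: "((\<lambda>t. ennreal C * (\<integral>\<^sup>+x. ennreal (nsq (w (t,x))) \<partial>MB)) \<longlongrightarrow> ennreal C * 0) (at_right 0)"
  using init by (intro ennreal_tendsto_cmult) (auto simp: w_def)
 show ?thesis
 proof (rule tendsto_sandwich[OF _ _ tendsto_const])
  show "((\<lambda>t. ennreal C * (\<integral>\<^sup>+x. ennreal (nsq (w (t,x))) \<partial>MB)) \<longlongrightarrow> 0) (at_right 0)" using * by simp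
  show "\<forall>\<^sub>F t in at_right 0. (\<integral>\<^sup>+x. ennreal (f t x) \<partial>MB) \<le> ennreal C * (\<integral>\<^sup>+x. ennreal (nsq (w (t,x))) \<partial>MB)"
   using ev
  proof eventually_elim
   case (elim t)
   have "(\<integral>\<^sup>+x. ennreal (f t x) \<partial>MB) \<le> (\<integral>\<^sup>+x. ennreal C * ennreal (nsq (w (t,x))) \<partial>MB)"
    using assms(2)[OF elim] C
    by (intro nn_integral_mono_AE) (auto simp: ennreal_mult[symmetric] intro!: ennreal_leI elim: eventually_mono)
   also have "\<dots> = ennreal C * (\<integral>\<^sup>+x. ennreal (nsq (w (t,x))) \<partial>MB)"
    using w_meas_x[OF elim] by (intro nn_integral_cmult) auto
   finally show ?case .
  qed
 qed auto
qed

end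

section \<open>The maximum principle\<close>

text \<open>\<open>F0\<close> is the convex profile \<open>r exp (- 1/r)\<close>; \<open>F1\<close>
  and \<open>F2\<close> are its first two derivatives \<open>(1 + y) exp (- y)\<close> and
  \<open>y^3 exp (- y)\<close> with y = 1/r, encoded as \<open>flat_exp\<close> of a polynomial in
  y.\<close>

definition "F0 r = r * flat_exp 1 r"
definition "F1 = flat_exp [:1, 1:]"
definition "F2 = flat_exp [:0, 0, 0, 1:]"

lemma F0_deriv: "(F0 has_real_derivative F1 r) (at r)"
proof -
 have "(F0 has_real_derivative 1 * flat_exp 1 r + flat_exp ([:0,0,1:] * (1 - pderiv 1)) r * r) (at r)"
  unfolding F0_def[abs_def] by (rule DERIV_mult[OF DERIV_ident flat_exp_has_derivative])
 moreover have "1 * flat_exp 1 r + flat_exp ([:0,0,1:] * (1 - pderiv 1)) r * r = F1 r"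
  by (simp add: F1_def flat_exp_def field_simps)
 ultimately show ?thesis by simp
qed

lemma F1_deriv: "(F1 has_real_derivative F2 r) (at r)"
proof -
 have "[:0,0,1:] * ([:1,1:] - pderiv [:1,1:]) = ([:0,0,0,1:]::real poly)"
  by (simp add: pderiv_pCons)
 then show ?thesis
  unfolding F1_def F2_def using flat_exp_has_derivative[of "[:1,1:]" r] by simp
qed

lemma F_zero: "r \<le> 0 ==> F0 r = 0" "r \<le> 0 ==> F1 r = 0"
 by (auto simp: F0_def F1_def flat_exp_def)

lemma F_nonneg: "F0 r \<ge> 0" "F1 r \<ge> 0" "F2 r \<ge> 0"
 by (auto simp: F0_def F1_def F2_def flat_exp_def)

lemma F0_pos: "r > 0 ==> F0 r > 0"
 by (simp add: F0_def flat_exp_def)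

text \<open>The reason for this profile: for \<open>r \<ge> 1\<close> it gives
  \<open>r F' \<le> 2 F\<close>, so a zero-order term of the wrong sign is at most a multiple of
  \<open>F\<close> itself and an exponential weight in time absorbs it.\<close>

lemma F1_F0: "r > 0 ==> F1 r * r = (1 + 1/r) * F0 r"
 by (simp add: F0_def F1_def flat_exp_def field_simps)

lemma F1_le: "F1 r \<le> 1" "r \<ge> 0 ==> F1 r \<le> 2 * r"
proof -
 have *: "F1 r \<le> 1 \<and> F1 r \<le> 2 * r" if r: "r > 0"
 proof -
  define y where "y = 1/r"
  have y: "y > 0" using r by (simp add: y_def)
  have F: "F1 r = (1 + y)/exp y" using r by (simp add: F1_def flat_exp_def y_def exp_minus field_simps)
  have e1: "1 + y \<le> exp y" by (rule exp_ge_add_one_self)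
  have "1 + y + y^2/2 \<le> exp y" using exp_lower_Taylor_quadratic[of y] y by simp
  then have "(1 + y) * y \<le> 2 * exp y" using y by (simp add: algebra_simps power2_eq_square)
  then have "(1 + y)/exp y \<le> 2/y" using y by (simp add: field_simps)
  then show ?thesis using F e1 by (simp add: y_def)
 qed
 show "F1 r \<le> 1" using * F_zero(2)[of r] by (cases "r > 0") auto
 show "F1 r \<le> 2 * r" if "r \<ge> 0" using * F_zero(2)[of r] that by (cases "r > 0") auto
qed

lemma F0_le: "r \<ge> 0 ==> F0 r \<le> r" "F0 r \<le> r^2"
proof -
 show "F0 r \<le> r" if "r \<ge> 0" using that by (auto simp: F0_def flat_exp_def intro: mult_left_le)
 show "F0 r \<le> r^2"
 proof (cases "r > 0")
  case True
  have "1/r \<le> exp (1/r)" using exp_ge_add_one_self[of "1/r"] by linarith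
  then have "exp (- (1/r)) \<le> r" using True by (simp add: exp_minus field_simps)
  then show ?thesis using True by (simp add: F0_def flat_exp_def power2_eq_square)
 qed (simp add: F_zero)
qed

text \<open>The test function must be bounded by the excess of |u| over 1, since that excess is at
  most \<open>|u - u0|\<close> and has an integrable Hardy quotient. Flatness of \<open>F1\<close>
  serves near 1 and boundedness far away; for \<open>s < 2\<close> the constant is
  \<open>2 * 3 * 2\<close>.\<close>

lemma F1_norm_le:
 assumes "s \<ge> 0" shows "F1 (s^2 - 1) * s \<le> 12 * max (s - 1) 0"
proof -
 consider "s \<le> 1" | "1 < s" "s < 2" | "s \<ge> 2" by linarith
 then show ?thesis
 proof cases
  case 1
  then have "s^2 - 1 \<le> 0" using assms by (simp add: power_le_one)
  then show ?thesis by (simp add: F_zero)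
 next
  case 2
  have eq: "s^2 - 1 = (s - 1) * (s + 1)" by (simp add: power2_eq_square algebra_simps)
  have "F1 (s^2 - 1) \<le> 2 * ((s - 1) * (s + 1))" using F1_le(2)[of "s^2 - 1"] 2 unfolding eq by simp
  also have "\<dots> \<le> 2 * ((s - 1) * 3)" using 2 by (intro mult_left_mono) auto
  finally have "F1 (s^2 - 1) * s \<le> (2 * ((s - 1) * 3)) * 2" using 2 by (intro mult_mono) auto
  then show ?thesis using 2 by simp
 next
  case 3
  have "F1 (s^2 - 1) * s \<le> 1 * s" using F1_le(1) 3 by (intro mult_right_mono) auto
  also have "\<dots> \<le> 12 * max (s - 1) 0" using 3 by simp
  finally show ?thesis .
 qed
qed

text \<open>Quadratic control makes the tested quantity vanish as t tends to 0, where only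
  convergence in L^2 is known.\<close>

lemma F0_norm_le:
 assumes "s \<ge> 0" shows "F0 (s^2 - 1) \<le> 9 * (max (s - 1) 0)^2"
proof -
 consider "s \<le> 1" | "1 < s" "s < 2" | "s \<ge> 2" by linarith
 then show ?thesis
 proof cases
  case 1
  then have "s^2 - 1 \<le> 0" using assms by (simp add: power_le_one)
  then show ?thesis by (simp add: F_zero)
 next
  case 2
  have eq: "s^2 - 1 = (s - 1) * (s + 1)" by (simp add: power2_eq_square algebra_simps)
  have "F0 (s^2 - 1) \<le> (s^2 - 1)^2" by (rule F0_le)
  also have "\<dots> = (s - 1)^2 * (s + 1)^2" unfolding eq by (rule power_mult_distrib)
  also have "\<dots> \<le> (s - 1)^2 * 3^2" using 2 by (intro mult_left_mono power_mono) auto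
  finally show ?thesis using 2 by simp
 next
  case 3
  have "F0 (s^2 - 1) \<le> s^2 - 1" using 3 power_mono[of 1 s 2] by (intro F0_le) auto
  also have "\<dots> \<le> s^2" by simp
  also have "s^2 \<le> (3 * (s - 1))^2" using 3 by (intro power_mono) auto
  also have "\<dots> = 9 * (s - 1)^2" unfolding power_mult_distrib by simp
  finally show ?thesis using 3 by simp
 qed
qed

lemma AE_zero_imp_zero_open:
 fixes f :: "'a::euclidean_space => real"
 assumes S: "open S" and c: "continuous_on S f" and ae: "AE x in lborel_on S. f x = 0" and x: "x \<in> S"
 shows "f x = 0"
proof (rule ccontr)
 assume "f x \<noteq> 0"
 define N where "N = S \<inter> f -` (- {0})"
 have "open N" unfolding N_def using c S by (intro continuous_open_preimage) auto
 moreover have "x \<in> N" using x \<open>f x \<noteq> 0\<close> by (simp add: N_def)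
 ultimately have nn: "\<not> negligible N" using open_not_negligible by blast
 have "AE x in lborel. x \<in> S \<longrightarrow> f x = 0" using ae S by (simp add: AE_restrict_space_iff)
 then have "AE x in lborel. x \<notin> N" by eventually_elim (auto simp: N_def)
 then have "AE x in lebesgue. x \<notin> N" by (rule AE_completion)
 then have "negligible N"
  unfolding completion.AE_iff_null_sets negligible_iff_null_sets by simp
 with nn show False by simp
qed

context glh begin

definition "D z = max (norm (U z) - 1) 0"

lemma D_cont: "continuous_on Q D"
 unfolding D_def[abs_def] by (intro continuous_intros conts)

text \<open>The initial map has norm 1, so the excess \<open>|u| - 1\<close> is a difference of
  norms and the triangle inequality applies. Thus the excess inherits the Hardy bound and the
  initial condition of \<open>w\<close>.\<close>

lemma D_le_w: "AE x in MB. D (t,x) \<le> norm (w (t,x))"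
 using v01
proof eventually_elim
 case (elim x)
 have "norm (U (t,x)) - norm (v0 x) \<le> norm (U (t,x) - v0 x)" by (rule norm_triangle_ineq2)
 then show ?case using elim by (simp add: D_def w_def)
qed

lemma Dq_integrable: "integrable (lborel2 {0<..<T} BB) (\<lambda>z. (D z/\<rho> (snd z))^2)"
proof -
 have m: "(\<lambda>z. (D z/\<rho> (snd z))^2) \<in> borel_measurable (lborel2 {0<..<T} BB)"
  by (rule meas_Q[OF _ order_refl]) (intro continuous_intros D_cont cont_rho_snd ballI rho_nz)
 have "(\<integral>\<^sup>+z. ennreal ((D z/\<rho> (snd z))^2) \<partial>(lborel2 {0<..<T} BB)) = (\<integral>\<^sup>+t. (\<integral>\<^sup>+x. ennreal ((D (t,x)/\<rho> x)^2) \<partial>MB) \<partial>MT)"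
  using m by (subst nn_integral_pair) auto
 also have "\<dots> \<le> (\<integral>\<^sup>+t. (\<integral>\<^sup>+x. ennreal (hq (t,x)) \<partial>MB) \<partial>MT)"
 proof (rule nn_integral_mono, rule nn_integral_mono_AE)
  fix t
  show "AE x in MB. ennreal ((D (t,x)/\<rho> x)^2) \<le> ennreal (hq (t,x))"
   using D_le_w[of t] AE_space
  proof eventually_elim
   case (elim x)
   then have "\<rho> x > 0" by (intro rho_pos) (simp add: space_restrict_space)
   then have "(D (t,x)/\<rho> x)^2 \<le> (norm (w (t,x))/\<rho> x)^2"
    using elim by (intro power_mono divide_right_mono) (auto simp: D_def)
   then show ?case by (simp add: hq_def ennreal_leI)
  qed
 qed
 also have "\<dots> = (\<integral>\<^sup>+z. ennreal (hq z) \<partial>(lborel2 {0<..<T} BB))"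
  using hq_meas[of "{0<..<T}"] by (subst nn_integral_pair) auto
 also have "\<dots> < \<infinity>" using hq_integrable by (simp add: integrable_iff_bounded hq_def)
 finally show ?thesis using m by (intro integrableI_nonneg) auto
qed

text \<open>With r = |U|^2 - 1, convexity of \<open>F0\<close> gives the gradient terms a sign. The
  zero-order term has the good sign for r^2 < 2, where \<open>deriv chi\<close> is 1, and vanishes
  for r^2 > 4. In between its sign is unknown, but it is at most \<open>K F0 (r)\<close>, which the
  weight \<open>exp (- K t)\<close> cancels.\<close>

theorem max_principle:
 assumes z: "z \<in> Q" shows "norm (U z) \<le> 1"
proof -
 obtain C where C: "C \<ge> 0" "\<And>x. 2 \<le> x ==> x \<le> 4 ==> \<bar>deriv chi x\<bar> \<le> C"
  using cutoff_deriv(3)[OF chi] by auto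
 \<comment> \<open>For 1 \<le> r \<le> 2 the factors are: 2 from \<open>1 + 1/r\<close>, 3 from
   \<open>r + 1 = |U|^2\<close>, and 2 from differentiating |U|^2.\<close>
 define K where "K = 12 * max 1 lam * C"
 have K0: "K \<ge> 0" using C by (simp add: K_def)
 obtain \<zeta> d\<zeta> L and KK :: "nat => 'a set" where "cutoffs \<zeta> d\<zeta> KK L" using cutoffs_exist by blast
 then interpret cutoffs \<zeta> d\<zeta> KK L .
 define r where "r z = U z \<bullet> U z - 1" for z
 define c where "c z = lam powr (1 - kappa (fst z)) * deriv chi ((nsq (U z) - 1)^2) * (nsq (U z) - 1)" for z
 define Lap where "Lap z = (\<Sum>b\<in>Basis. dx b (dx b U) z)" for z
 define q where "q z = (2 * F1 (r z)) .* U z" for z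
 have rn: "nsq (U z) - 1 = r z" for z by (simp add: r_def power2_norm_eq_inner)
 have F0c: "continuous_on A F0" and F1c: "continuous_on A F1" and F2c: "continuous_on A F2" for A
  using F0_deriv F1_deriv DERIV_isCont smooth_on_imp_continuous_on[OF smooth_flat_exp, of "[:0,0,0,1:]"]
   continuous_on_subset unfolding F2_def[symmetric]
  by (blast intro: continuous_at_imp_continuous_on)+
 have rc: "continuous_on Q r" unfolding r_def[abs_def] by (intro continuous_intros conts)
 have Frc: "continuous_on Q (\<lambda>z. F0 (r z))" "continuous_on Q (\<lambda>z. F1 (r z))" "continuous_on Q (\<lambda>z. F2 (r z))"
  by (auto intro!: continuous_on_compose2[OF F0c rc] continuous_on_compose2[OF F1c rc] continuous_on_compose2[OF F2c rc])
 have Lapc: "continuous_on Q Lap" unfolding Lap_def[abs_def] by (intro continuous_intros conts)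
 have qc: "continuous_on Q q" unfolding q_def[abs_def] by (intro continuous_intros conts Frc)
 have bad: "- (2 * F1 (r z) * c z * (U z \<bullet> U z)) - K * F0 (r z) \<le> 0" if z: "z \<in> Q" for z
 proof -
  let ?L = "lam powr (1 - kappa (fst z))"
  have Lb: "0 \<le> ?L" "?L \<le> max 1 lam" using powr_kappa_le[OF lam] z by auto
  have s: "U z \<bullet> U z = r z + 1" by (simp add: r_def)
  have cz: "c z = ?L * deriv chi ((r z)^2) * r z" by (simp add: c_def rn)
  consider "r z \<le> 0" | "r z > 0" "(r z)^2 < 2" | "r z > 0" "(r z)^2 \<ge> 2" "(r z)^2 \<le> 4" | "r z > 0" "(r z)^2 > 4" by linarith
  then show ?thesis
  proof cases
   case 1
   then show ?thesis by (simp add: F_zero)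
  next
   case 2
   then have "c z \<ge> 0" using cutoff_deriv(1)[OF chi] Lb by (simp add: cz)
   then have "2 * F1 (r z) * c z * (U z \<bullet> U z) \<ge> 0" using F_nonneg by simp
   then show ?thesis using K0 F_nonneg(1)[of "r z"] by (smt (verit) mult_nonneg_nonneg)
  next
   case 4
   then have "c z = 0" using cutoff_deriv(2)[OF chi] by (simp add: cz)
   then show ?thesis using K0 F_nonneg(1)[of "r z"] by simp
  next
   case 3
   have r1: "r z \<ge> 1" using 3 by (smt (verit) power_le_one)
   have r2: "r z \<le> 2" using 3 power2_le_imp_le[of "r z" 2] by simp
   have Cb: "\<bar>deriv chi ((r z)^2)\<bar> \<le> C" using C 3 by simp
   have "- (2 * F1 (r z) * c z * (U z \<bullet> U z)) = (F1 (r z) * r z) * (2 * (?L * - deriv chi ((r z)^2)) * (r z + 1))"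
    by (simp add: cz s)
   also have "\<dots> = ((1 + 1/r z) * F0 (r z)) * (2 * (?L * - deriv chi ((r z)^2)) * (r z + 1))"
    using F1_F0 3 by simp
   also have "\<dots> \<le> ((1 + 1/r z) * F0 (r z)) * (2 * (max 1 lam * C) * 3)"
   proof (rule mult_left_mono)
    have "?L * - deriv chi ((r z)^2) \<le> ?L * C" using Cb Lb by (intro mult_left_mono) auto
    also have "\<dots> \<le> max 1 lam * C" using C Lb by (intro mult_right_mono) auto
    finally have l: "?L * - deriv chi ((r z)^2) \<le> max 1 lam * C" .
    have "2 * (?L * - deriv chi ((r z)^2)) * (r z + 1) \<le> 2 * (max 1 lam * C) * (r z + 1)"
     by (intro mult_right_mono mult_left_mono l) (use r1 in auto)
    also have "\<dots> \<le> 2 * (max 1 lam * C) * 3" using r2 C by (intro mult_left_mono) auto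
    finally show "2 * (?L * - deriv chi ((r z)^2)) * (r z + 1) \<le> 2 * (max 1 lam * C) * 3" .
   qed (use r1 F_nonneg in auto)
   also have "\<dots> \<le> (2 * F0 (r z)) * (2 * (max 1 lam * C) * 3)"
    using r1 C F_nonneg(1)[of "r z"] by (intro mult_right_mono) auto
   also have "\<dots> = K * F0 (r z)" by (simp add: K_def)
   finally show ?thesis by simp
  qed
 qed
 \<comment> \<open>The error of the spatial cutoff: 24 is twice the constant of
   \<open>F1_norm_le\<close>, the test function being \<open>2 F1 (r) U\<close>.\<close>
 define E where "E n z = (\<Sum>b\<in>Basis. \<bar>d\<zeta> n (snd z) b\<bar> * (24 * D z * norm (dx b U z)))" for n z
 have Ec: "continuous_on Q (E n)" for n unfolding E_def[abs_def] by (intro continuous_intros \<zeta>c2 D_cont conts)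
 have E0: "E n z \<ge> 0" for n z unfolding E_def by (intro sum_nonneg) (auto simp: D_def)
 have En: "E n z \<le> (\<Sum>b\<in>(Basis::'a set). 12 * L * ((D z/\<rho> (snd z))^2 + gsq z))" if z: "z \<in> Q" for n z
  unfolding E_def
 proof (rule sum_mono)
  fix b :: 'a assume b: "b \<in> Basis"
  have x: "snd z \<in> BB" using z by auto
  have D0: "D z \<ge> 0" by (simp add: D_def)
  have "\<bar>d\<zeta> n (snd z) b\<bar> * (24 * D z * norm (dx b U z)) \<le> (L/\<rho> (snd z)) * (24 * D z * norm (dx b U z))"
   using d\<zeta>b(1)[OF x b] D0 by (intro mult_right_mono) (auto simp: \<rho>_def)
  also have "\<dots> = 12 * L * (2 * (D z/\<rho> (snd z)) * norm (dx b U z))" by simp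
  also have "\<dots> \<le> 12 * L * ((D z/\<rho> (snd z))^2 + nsq (dx b U z))"
   using L by (intro mult_left_mono sum_squares_bound) auto
  also have "\<dots> \<le> 12 * L * ((D z/\<rho> (snd z))^2 + gsq z)"
   using L b unfolding gsq_def by (intro mult_left_mono add_left_mono member_le_sum) auto
  finally show "\<bar>d\<zeta> n (snd z) b\<bar> * (24 * D z * norm (dx b U z)) \<le> 12 * L * ((D z/\<rho> (snd z))^2 + gsq z)" .
 qed
 have step: "(\<integral>x. \<zeta> n x * (exp (- K * b) * F0 (r (b, x))) \<partial>MB) - (\<integral>x. \<zeta> n x * (exp (- K * a) * F0 (r (a, x))) \<partial>MB)
  \<le> LI (PJ a b) (E n)" 
  and Eint: "integrable (PJ a b) (E n)"
  if ab: "0 < a" "a < b" "b < T" for a b n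
 proof -
  have sub: "{a..b} \<subseteq> {0<..<T}" using ab by auto
  have I1: "integrable (PJ a b) (\<lambda>z. \<Sum>b\<in>(Basis::'a set). 12 * L * ((D z/\<rho> (snd z))^2 + gsq z))"
   using integrable_pair_subset[OF Dq_integrable sub] integrable_pair_subset[OF gsq_integrable sub] by simp
  show Ei: "integrable (PJ a b) (E n)"
  proof (rule L1_bound[OF I1 meas_Q[OF Ec sub]], rule AE_I2)
   fix z assume "z \<in> space (PJ a b)"
   then have "z \<in> Q" using sub by (auto simp: spaces)
   from En[OF this, of n] E0[of n z] show "norm (E n z) \<le> norm (\<Sum>b\<in>(Basis::'a set). 12 * L * ((D z/\<rho> (snd z))^2 + gsq z))"
    by simp
  qed
  define \<Phi> where "\<Phi> t x = \<zeta> n x * (exp (- K * t) * F0 (r (t,x)))" for t x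
  define \<Phi>' where "\<Phi>' t x = \<zeta> n x * (exp (- K * t) * (F1 (r (t,x)) * (2 * (U (t,x) \<bullet> dt U (t,x))) - K * F0 (r (t,x))))" for t x
  have ci: "integrable MB (\<lambda>x. f x)" if "continuous_on BB f" "\<And>x. x \<in> BB ==> x \<notin> KK n ==> f x = 0" for f :: "'a => real"
   using that by (intro integrable_compact_support[OF _ KK(1,2)]) auto
  have cs: "continuous_on BB (\<lambda>x. F0 (r (t,x)))" "continuous_on BB (\<lambda>x. F1 (r (t,x)))" "continuous_on BB (\<lambda>x. F2 (r (t,x)))"
   "continuous_on BB (\<lambda>x. q (t,x))" "continuous_on BB (\<lambda>x. Lap (t,x))" "continuous_on BB (\<lambda>x. U (t,x))"
   "continuous_on BB (\<lambda>x. dt U (t,x))" "continuous_on BB (\<lambda>x. dx v U (t,x))" "continuous_on BB (\<lambda>x. E n (t,x))"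
   "continuous_on BB (\<lambda>x. dx v (dx v U) (t,x))"
   if "t \<in> {0<..<T}" for t v
   using that by (auto intro!: slice_cont_x Frc qc Lapc conts Ec)
  have "LI MB (\<Phi> b) - LI MB (\<Phi> a) \<le> LI (PJ a b) (\<lambda>(t,x). E n (t,x))"
  proof (rule time_FTC_le)
   show "((\<lambda>t. \<Phi> t x) has_real_derivative \<Phi>' t x) (at t)" if "x \<in> BB" "t \<in> {a..b}" for x t
   proof -
    have t: "t \<in> {0<..<T}" using that sub by auto
    have dU: "((\<lambda>t. U (t,x)) has_derivative (\<lambda>h. h .* dt U (t,x))) (at t)"
     using slice_deriv_t[OF smooth t that(1)] by (simp add: has_vector_derivative_def)
    have "((\<lambda>t. r (t,x)) has_derivative (\<lambda>h. h * (2 * (U (t,x) \<bullet> dt U (t,x))))) (at t)"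
     unfolding r_def by (rule derivative_eq_intros dU refl)+ (simp add: fun_eq_iff inner_commute)
    then have dr: "((\<lambda>t. r (t,x)) has_real_derivative (2 * (U (t,x) \<bullet> dt U (t,x)))) (at t)"
     by (simp add: has_field_derivative_def mult_commute_abs)
    have "((\<lambda>t. F0 (r (t,x))) has_real_derivative F1 (r (t,x)) * (2 * (U (t,x) \<bullet> dt U (t,x)))) (at t)"
     using DERIV_chain2[OF F0_deriv dr] .
    then show ?thesis unfolding \<Phi>_def \<Phi>'_def
     by (auto intro!: derivative_eq_intros simp: algebra_simps)
   qed
   show "continuous_on {a..b} (\<lambda>t. \<Phi>' t x)" if "x \<in> BB" for x
    unfolding \<Phi>'_def using that ab
    by (intro continuous_intros slice_cont_t[OF Frc(1)] slice_cont_t[OF Frc(2)] slice_cont_t[OF conts(1)] slice_cont_t[OF conts(3)]) auto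
   show "integrable (PJ a b) (\<lambda>(t,x). \<Phi>' t x)"
   proof (rule integrable_pair_compact_support[OF KK(1,2)])
    have *: "continuous_on ({a..b} \<times> BB) F" if "continuous_on Q F" for F :: "real \<times> 'a => 'c::topological_space"
     by (rule continuous_on_subset[OF that]) (use sub in auto)
    show "continuous_on ({a..b} \<times> BB) (\<lambda>(t,x). \<Phi>' t x)"
     unfolding \<Phi>'_def case_prod_beta prod.collapse
     by (intro continuous_intros \<zeta>c2 *[OF Frc(1)] *[OF Frc(2)] *[OF conts(1)] *[OF conts(3)])
   qed (use KK(3) in \<open>auto simp: \<Phi>'_def\<close>)
   show "integrable MB (\<Phi> a)" "integrable MB (\<Phi> b)"
    unfolding \<Phi>_def using ab KK(3) by (auto intro!: ci continuous_intros \<zeta>c cs)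
   show "integrable (PJ a b) (\<lambda>(t,x). E n (t,x))" using Ei by simp
   show "AE t in lborel_on {a..b}. LI MB (\<Phi>' t) \<le> (\<integral>x. E n (t,x) \<partial>MB)"
   proof (rule AE_I2)
    fix t assume "t \<in> space (lborel_on {a..b})"
    then have t: "t \<in> {0<..<T}" using sub by (auto simp: space_restrict_space)
    define q' where "q' x v = (4 * F2 (r (t,x)) * (U (t,x) \<bullet> dx v U (t,x))) .* U (t,x) + (2 * F1 (r (t,x))) .* dx v U (t,x)" for x v
    have dU: "((\<lambda>x. U (t,x)) has_derivative (\<lambda>v. dx v U (t,x))) (at x)" if "x \<in> BB" for x
     by (rule slice_deriv_x[OF smooth t that])
    have dq: "((\<lambda>x. q (t,x)) has_derivative q' x) (at x)" if x: "x \<in> BB" for x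
    proof -
     have dr: "((\<lambda>x. r (t,x)) has_derivative (\<lambda>v. 2 * (U (t,x) \<bullet> dx v U (t,x)))) (at x)"
      unfolding r_def by (rule derivative_eq_intros dU[OF x] refl)+ (simp add: fun_eq_iff inner_commute)
     have "((\<lambda>x. F1 (r (t,x))) has_derivative (\<lambda>v. F2 (r (t,x)) * (2 * (U (t,x) \<bullet> dx v U (t,x))))) (at x)"
      using has_derivative_compose[OF dr F1_deriv[unfolded has_field_derivative_def]] .
     then show ?thesis unfolding q_def q'_def
      by (auto intro!: derivative_eq_intros dU[OF x] simp: fun_eq_iff algebra_simps)
    qed
    have "(\<integral>x. \<zeta> n x * (q (t,x) \<bullet> (\<Sum>b\<in>Basis. dx b (dx b U) (t,x))) \<partial>MB)
     = - (\<integral>x. \<zeta> n x * (\<Sum>b\<in>Basis. q' x b \<bullet> dx b U (t,x)) \<partial>MB)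
      - (\<integral>x. (\<Sum>b\<in>Basis. d\<zeta> n x b * (q (t,x) \<bullet> dx b U (t,x))) \<partial>MB)"
    proof (rule green_cutoff[OF open_ball KK(1,2) \<zeta> KK(3,4) dq, where p' = "\<lambda>b x v. dx v (dx b U) (t,x)"])
     show "continuous_on BB (\<lambda>x. q' x b)" for b
      unfolding q'_def by (intro continuous_intros cs t)
     show "((\<lambda>x. dx b U (t,x)) has_derivative (\<lambda>v. dx v (dx b U) (t,x))) (at x)" if "x \<in> BB" for b x
      by (rule slice_deriv_x[OF smooths(2) t that])
     show "continuous_on BB (\<lambda>x. dx b (dx b U) (t,x))" for b by (intro cs t)
    qed auto
    moreover have "(\<integral>x. \<zeta> n x * (\<Sum>b\<in>Basis. q' x b \<bullet> dx b U (t,x)) \<partial>MB) \<ge> 0"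
    proof (rule L1_nonneg)
     fix x
     have "q' x b \<bullet> dx b U (t,x) = 4 * F2 (r (t,x)) * (U (t,x) \<bullet> dx b U (t,x))^2 + 2 * F1 (r (t,x)) * (dx b U (t,x) \<bullet> dx b U (t,x))" for b
      by (simp add: q'_def inner_simps power2_eq_square)
     then have "q' x b \<bullet> dx b U (t,x) \<ge> 0" for b using F_nonneg by simp
     then show "0 \<le> \<zeta> n x * (\<Sum>b\<in>Basis. q' x b \<bullet> dx b U (t,x))" using \<zeta>b by (intro mult_nonneg_nonneg sum_nonneg) auto
    qed
    ultimately have 1: "(\<integral>x. \<zeta> n x * (q (t,x) \<bullet> Lap (t,x)) \<partial>MB) \<le> (\<integral>x. - (\<Sum>b\<in>Basis. d\<zeta> n x b * (q (t,x) \<bullet> dx b U (t,x))) \<partial>MB)"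
     by (simp add: Lap_def)
    have i1: "integrable MB (\<lambda>x. \<zeta> n x * (q (t,x) \<bullet> Lap (t,x)))"
     using KK(3) by (intro ci continuous_intros \<zeta>c cs t) auto
    have i2: "integrable MB (\<lambda>x. - (\<Sum>b\<in>Basis. d\<zeta> n x b * (q (t,x) \<bullet> dx b U (t,x))))"
     using KK(4) by (intro ci continuous_intros \<zeta>c cs t) auto
    have i3: "integrable MB (\<lambda>x. E n (t,x))"
     using KK(4) by (intro ci cs t) (auto simp: E_def)
    have i4: "integrable MB (\<Phi>' t)"
     unfolding \<Phi>'_def using KK(3) by (intro ci continuous_intros \<zeta>c cs t) auto
    have "LI MB (\<Phi>' t) \<le> (\<integral>x. exp (- K * t) * (\<zeta> n x * (q (t,x) \<bullet> Lap (t,x))) \<partial>MB)"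
    proof (rule integral_mono[OF i4 integrable_mult_right])
     fix x assume "x \<in> space MB"
     then have zQ: "(t,x) \<in> Q" using t by (auto simp: space_restrict_space)
     have dU: "dt U (t,x) = Lap (t,x) - c (t,x) .* U (t,x)"
      using pde[OF zQ] by (simp add: Lap_def c_def)
     have "F1 (r (t,x)) * (2 * (U (t,x) \<bullet> dt U (t,x))) - K * F0 (r (t,x))
      = q (t,x) \<bullet> Lap (t,x) + (- (2 * F1 (r (t,x)) * c (t,x) * (U (t,x) \<bullet> U (t,x))) - K * F0 (r (t,x)))"
      by (simp add: dU q_def inner_simps algebra_simps)
     also have "\<dots> \<le> q (t,x) \<bullet> Lap (t,x)" using bad[OF zQ] by simp
     finally have "exp (- K * t) * (\<zeta> n x * (F1 (r (t,x)) * (2 * (U (t,x) \<bullet> dt U (t,x))) - K * F0 (r (t,x))))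
      \<le> exp (- K * t) * (\<zeta> n x * (q (t,x) \<bullet> Lap (t,x)))"
      using \<zeta>b(1) by (intro mult_left_mono) auto
     then show "\<Phi>' t x \<le> exp (- K * t) * (\<zeta> n x * (q (t,x) \<bullet> Lap (t,x)))"
      by (simp add: \<Phi>'_def mult.left_commute)
    qed (rule i1)
    also have "\<dots> = exp (- K * t) * (\<integral>x. \<zeta> n x * (q (t,x) \<bullet> Lap (t,x)) \<partial>MB)" by simp
    also have "\<dots> \<le> exp (- K * t) * (\<integral>x. E n (t,x) \<partial>MB)"
    proof (rule mult_left_mono)
     have "(\<integral>x. - (\<Sum>b\<in>Basis. d\<zeta> n x b * (q (t,x) \<bullet> dx b U (t,x))) \<partial>MB) \<le> (\<integral>x. E n (t,x) \<partial>MB)"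
     proof (rule integral_mono[OF i2 i3])
      fix x
      have "- (d\<zeta> n x b * (q (t,x) \<bullet> dx b U (t,x))) \<le> \<bar>d\<zeta> n x b\<bar> * (24 * D (t,x) * norm (dx b U (t,x)))" for b
      proof -
       have "\<bar>q (t,x) \<bullet> dx b U (t,x)\<bar> \<le> norm (q (t,x)) * norm (dx b U (t,x))" by (rule Cauchy_Schwarz_ineq2)
       also have "norm (q (t,x)) = 2 * (F1 (nsq (U (t,x)) - 1) * norm (U (t,x)))"
        using F_nonneg by (simp add: q_def rn)
       also have "\<dots> \<le> 2 * (12 * D (t,x))" unfolding D_def by (intro mult_left_mono F1_norm_le) auto
       finally have "\<bar>q (t,x) \<bullet> dx b U (t,x)\<bar> \<le> 24 * D (t,x) * norm (dx b U (t,x))" by (simp add: mult_right_mono)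
       then have "\<bar>d\<zeta> n x b * (q (t,x) \<bullet> dx b U (t,x))\<bar> \<le> \<bar>d\<zeta> n x b\<bar> * (24 * D (t,x) * norm (dx b U (t,x)))"
        unfolding abs_mult by (intro mult_left_mono) auto
       then show ?thesis by linarith
      qed
      then show "- (\<Sum>b\<in>Basis. d\<zeta> n x b * (q (t,x) \<bullet> dx b U (t,x))) \<le> E n (t,x)"
       unfolding E_def sum_negf[symmetric] by (intro sum_mono) simp
     qed
     with 1 show "(\<integral>x. \<zeta> n x * (q (t,x) \<bullet> Lap (t,x)) \<partial>MB) \<le> (\<integral>x. E n (t,x) \<partial>MB)" by simp
    qed simp
    also have "\<dots> \<le> 1 * (\<integral>x. E n (t,x) \<partial>MB)"
     using K0 t E0 by (intro mult_right_mono L1_nonneg) auto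
    finally show "LI MB (\<Phi>' t) \<le> (\<integral>x. E n (t,x) \<partial>MB)" by simp
   qed
  qed (use ab in auto)
  then show "(\<integral>x. \<zeta> n x * (exp (- K * b) * F0 (r (b, x))) \<partial>MB) - (\<integral>x. \<zeta> n x * (exp (- K * a) * F0 (r (a, x))) \<partial>MB)
  \<le> LI (PJ a b) (E n)"
   by (simp add: \<Phi>_def[abs_def])
 qed
 have Elim: "(\<lambda>n. LI (PJ a b) (E n)) ----> 0"
  if ab: "0 < a" "a < b" "b < T" for a b
 proof -
  have sub: "{a..b} \<subseteq> {0<..<T}" using ab by auto
  have I1: "integrable (PJ a b) (\<lambda>z. \<Sum>b\<in>(Basis::'a set). 12 * L * ((D z/\<rho> (snd z))^2 + gsq z))"
   using integrable_pair_subset[OF Dq_integrable sub] integrable_pair_subset[OF gsq_integrable sub] by simp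
  have sp: "z \<in> Q" if "z \<in> space (PJ a b)" for z
   using that sub by (auto simp: spaces)
  have "(\<lambda>n. LI (PJ a b) (E n)) ----> (\<integral>z. 0 \<partial>(PJ a b))"
  proof (rule integral_dominated_convergence[OF _ _ I1])
   show "AE z in PJ a b. (\<lambda>n. E n z) ----> 0"
   proof (rule AE_I2)
    fix z assume "z \<in> space (PJ a b)"
    then have "z \<in> Q" by (rule sp)
    then have x: "snd z \<in> BB" by auto
    have "(\<lambda>n. E n z) ----> (\<Sum>b\<in>Basis. \<bar>0\<bar> * (24 * D z * norm (dx b U z)))"
     unfolding E_def by (intro tendsto_intros d\<zeta>b(2)[OF x])
    then show "(\<lambda>n. E n z) ----> 0" by simp
   qed
   show "AE z in PJ a b. norm (E n z) \<le> (\<Sum>b\<in>(Basis::'a set). 12 * L * ((D z/\<rho> (snd z))^2 + gsq z))" for n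
    using En[OF sp] E0 by (intro AE_I2) auto
  qed (use meas_Q[OF Ec sub] in auto)
  then show ?thesis by simp
 qed
 have F0m: "(\<lambda>x. F0 (r (t,x))) \<in> borel_measurable MB" if "t \<in> {0<..<T}" for t
  by (rule meas_x[OF Frc(1) that])
 \<comment> \<open>The cutoff is removed by Fatou's lemma at the later time, while at the earlier
   time it is simply bounded by 1. In this form the earlier integral may be infinite a
   priori.\<close>
 have mono: "(\<integral>\<^sup>+x. ennreal (exp (- K * b) * F0 (r (b, x))) \<partial>MB) \<le> (\<integral>\<^sup>+x. ennreal (F0 (r (a, x))) \<partial>MB)"
  if ab: "0 < a" "a < b" "b < T" for a b
 proof -
  let ?X = "\<integral>\<^sup>+x. ennreal (F0 (r (a, x))) \<partial>MB"
  let ?\<epsilon> = "\<lambda>n. LI (PJ a b) (E n)"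
  have t: "a \<in> {0<..<T}" "b \<in> {0<..<T}" using ab by auto
  have ci: "integrable MB (\<lambda>x. \<zeta> n x * (exp (- K * t) * F0 (r (t,x))))" if "t \<in> {0<..<T}" for t n
   using that KK(3) by (intro integrable_compact_support[OF _ KK(1,2)] continuous_intros \<zeta>c slice_cont_x[OF Frc(1)]) auto
  have n0: "\<zeta> n x * (exp (- K * t) * F0 (r (t,x))) \<ge> 0" for n x t using \<zeta>b F_nonneg by simp
  have le: "(\<integral>\<^sup>+x. ennreal (\<zeta> n x * (exp (- K * b) * F0 (r (b, x)))) \<partial>MB) \<le> ?X + ennreal (?\<epsilon> n)" for n
  proof -
   have "(\<integral>\<^sup>+x. ennreal (\<zeta> n x * (exp (- K * b) * F0 (r (b, x)))) \<partial>MB) = ennreal (\<integral>x. \<zeta> n x * (exp (- K * b) * F0 (r (b, x))) \<partial>MB)"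
    using n0 by (intro nn_integral_eq_integral ci t) auto
   also have "\<dots> \<le> ennreal ((\<integral>x. \<zeta> n x * (exp (- K * a) * F0 (r (a, x))) \<partial>MB) + ?\<epsilon> n)"
    using step[OF ab, of n] by (intro ennreal_leI) simp
   also have "\<dots> = ennreal (\<integral>x. \<zeta> n x * (exp (- K * a) * F0 (r (a, x))) \<partial>MB) + ennreal (?\<epsilon> n)"
    using n0 E0 by (intro ennreal_plus L1_nonneg) auto
   also have "ennreal (\<integral>x. \<zeta> n x * (exp (- K * a) * F0 (r (a, x))) \<partial>MB) = (\<integral>\<^sup>+x. ennreal (\<zeta> n x * (exp (- K * a) * F0 (r (a, x)))) \<partial>MB)"
    using n0 by (intro nn_integral_eq_integral[symmetric] ci t) auto
   also have "\<dots> \<le> ?X"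
   proof (intro nn_integral_mono ennreal_leI)
    fix x
    have "exp (- K * a) * F0 (r (a, x)) \<le> 1 * F0 (r (a, x))" using K0 ab F_nonneg by (intro mult_right_mono) auto
    then have "\<zeta> n x * (exp (- K * a) * F0 (r (a, x))) \<le> 1 * F0 (r (a, x))"
     using \<zeta>b F_nonneg by (intro mult_mono) auto
    then show "\<zeta> n x * (exp (- K * a) * F0 (r (a, x))) \<le> F0 (r (a, x))" by simp
   qed
   finally show ?thesis by (simp add: add_right_mono)
  qed
  have "(\<integral>\<^sup>+x. ennreal (exp (- K * b) * F0 (r (b, x))) \<partial>MB)
    \<le> (\<integral>\<^sup>+x. liminf (\<lambda>n. ennreal (\<zeta> n x * (exp (- K * b) * F0 (r (b, x))))) \<partial>MB)"
  proof (rule nn_integral_mono)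
   fix x assume "x \<in> space MB"
   then have "(\<lambda>n. \<zeta> n x) ----> 1" by (intro \<zeta>b) (simp add: space_restrict_space)
   then have "(\<lambda>n. ennreal (\<zeta> n x * (exp (- K * b) * F0 (r (b, x))))) ----> ennreal (1 * (exp (- K * b) * F0 (r (b, x))))"
    by (intro tendsto_intros)
   then show "ennreal (exp (- K * b) * F0 (r (b, x))) \<le> liminf (\<lambda>n. ennreal (\<zeta> n x * (exp (- K * b) * F0 (r (b, x)))))"
    using lim_imp_Liminf[OF sequentially_bot] by fastforce
  qed
  also have "\<dots> \<le> liminf (\<lambda>n. \<integral>\<^sup>+x. ennreal (\<zeta> n x * (exp (- K * b) * F0 (r (b, x)))) \<partial>MB)"
   by (intro nn_integral_liminf measurable_compose[OF borel_measurable_integrable[OF ci[OF t(2)]] measurable_ennreal])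
  also have "\<dots> \<le> liminf (\<lambda>n. ?X + ennreal (?\<epsilon> n))"
   by (intro Liminf_mono always_eventually allI le)
  also have "\<dots> = ?X + ennreal 0"
   by (intro lim_imp_Liminf tendsto_add tendsto_const tendsto_ennrealI Elim ab) simp
  finally show ?thesis by simp
 qed
 obtain b x where zb: "z = (b, x)" "0 < b" "b < T" "x \<in> BB" using z by (cases z) auto
 have b: "b \<in> {0<..<T}" using zb by simp
 \<comment> \<open>The earlier time now tends to 0 and the right side vanishes, so
   \<open>F0 (r)\<close> is 0 almost everywhere at time b; continuity and positivity of
   \<open>F0\<close> on positive arguments finish the proof.\<close>
 have "((\<lambda>a. \<integral>\<^sup>+x. ennreal (F0 (r (a, x))) \<partial>MB) \<longlongrightarrow> 0) (at_right 0)"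
 proof (rule init_tendsto[where C=9])
  show "AE x in MB. 0 \<le> F0 (r (t,x)) \<and> F0 (r (t,x)) \<le> 9 * nsq (w (t,x))" for t
   using D_le_w[of t]
  proof eventually_elim
   case (elim x)
   have "F0 (r (t,x)) \<le> 9 * (D (t,x))^2" unfolding rn[symmetric] D_def by (rule F0_norm_le) simp
   also have "\<dots> \<le> 9 * nsq (w (t,x))" using elim by (intro mult_left_mono power_mono) (auto simp: D_def)
   finally show ?case using F_nonneg by simp
  qed
 qed (use F0m in auto)
 moreover have "\<forall>\<^sub>F a in at_right 0. (\<integral>\<^sup>+x. ennreal (exp (- K * b) * F0 (r (b, x))) \<partial>MB) \<le> (\<integral>\<^sup>+x. ennreal (F0 (r (a, x))) \<partial>MB)"
  unfolding eventually_at_right_field using mono zb by (intro exI[of _ b]) auto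
 ultimately have "(\<integral>\<^sup>+x. ennreal (exp (- K * b) * F0 (r (b, x))) \<partial>MB) \<le> 0"
  by (intro tendsto_lowerbound) auto
 then have "(\<integral>\<^sup>+x. ennreal (exp (- K * b) * F0 (r (b, x))) \<partial>MB) = 0" by simp
 then have "AE x in MB. ennreal (exp (- K * b) * F0 (r (b, x))) = 0"
  using F0m[OF b] by (subst (asm) nn_integral_0_iff_AE) auto
 then have "AE x in MB. F0 (r (b, x)) = 0"
 proof eventually_elim
  case (elim x)
  then have "exp (- K * b) * F0 (r (b, x)) \<le> 0" by (simp only: ennreal_eq_0_iff)
  then have "F0 (r (b, x)) \<le> 0" by (simp add: mult_le_0_iff)
  then show ?case using F_nonneg(1)[of "r (b, x)"] by simp
 qed
 then have "F0 (r (b, x)) = 0"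
  by (rule AE_zero_imp_zero_open[OF open_ball slice_cont_x[OF Frc(1) b] _ zb(4)])
 then have "F0 (r z) = 0" by (simp add: zb(1))
 then have "r z \<le> 0" using F0_pos[of "r z"] by linarith
 then have "nsq (U z) \<le> 1" unfolding rn[symmetric] by simp
 then show ?thesis using abs_square_le_1[of "norm (U z)"] by simp
qed

end

lemma mult_le_sum_squares:
 fixes a b :: real
 assumes "0 \<le> a" "0 \<le> b" shows "a * b \<le> a^2 + b^2"
proof -
 have "2 * a * b \<le> a^2 + b^2" by (rule sum_squares_bound)
 moreover have "0 \<le> a * b" using assms by simp
 ultimately show ?thesis by linarith
qed

context glh begin

section \<open>The flow with values in the closed unit ball\<close>

definition "Lc t = lam powr (1 - kappa t)"
definition "fz z = (Lc (fst z) * (nsq (U z) - 1)) .* U z"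
definition "Lap z = (\<Sum>b\<in>Basis. dx b (dx b U) z)"

lemma Lc_bounds: "0 < Lc t" "t \<ge> 0 ==> Lc t \<le> max 1 lam"
 using powr_kappa_le[OF lam] lam by (auto simp: Lc_def)

text \<open>The maximum principle keeps the argument of \<open>deriv chi\<close> in [0, 1], where it
  is 1, so chi disappears from the equation.\<close>

lemma pde': "z \<in> Q ==> dt U z = Lap z - fz z"
proof -
 assume z: "z \<in> Q"
 have "nsq (U z) \<le> 1" using max_principle[OF z] by (simp add: power_le_one)
 then have "(nsq (U z) - 1)^2 \<le> 1" by (simp add: abs_square_le_1)
 then have "deriv chi ((nsq (U z) - 1)^2) = 1" by (intro cutoff_deriv(1)[OF chi]) simp
 then show ?thesis using pde[OF z] by (simp add: Lap_def fz_def Lc_def)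
qed

lemma Lc_cont: "continuous_on S Lc"
 unfolding Lc_def kappa_def using lam by (intro continuous_intros) auto

lemma Lc_cont_fst: "continuous_on S (\<lambda>z. Lc (fst z))"
 by (rule continuous_on_compose2[OF Lc_cont[of UNIV]]) (auto intro!: continuous_intros)

lemma fz_cont: "continuous_on Q fz"
 unfolding fz_def[abs_def] by (intro continuous_intros Lc_cont_fst conts)

lemma Lap_cont: "continuous_on Q Lap"
 unfolding Lap_def[abs_def] by (intro continuous_intros conts)

lemma fz_bound: "z \<in> Q ==> norm (fz z) \<le> Lc (fst z) * (1 - nsq (U z))"
proof -
 assume z: "z \<in> Q"
 have 1: "norm (U z) \<le> 1" by (rule max_principle[OF z])
 then have 2: "nsq (U z) \<le> 1" by (simp add: power_le_one)
 have "norm (fz z) = Lc (fst z) * (1 - nsq (U z)) * norm (U z)"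
  using Lc_bounds(1)[of "fst z"] 2 by (simp add: fz_def abs_mult)
 also have "\<dots> \<le> Lc (fst z) * (1 - nsq (U z)) * 1"
  using Lc_bounds(1)[of "fst z"] 1 2 by (intro mult_left_mono) auto
 finally show ?thesis by simp
qed

lemma fz_bounded: "z \<in> Q ==> norm (fz z) \<le> max 1 lam"
proof -
 assume z: "z \<in> Q"
 have 2: "nsq (U z) \<le> 1" using max_principle[OF z] by (simp add: power_le_one)
 have "norm (fz z) \<le> Lc (fst z) * (1 - nsq (U z))" by (rule fz_bound[OF z])
 also have "\<dots> \<le> max 1 lam * 1" using Lc_bounds[of "fst z"] z 2 by (intro mult_mono) auto
 finally show ?thesis by simp
qed

lemma w_bounds: "t \<in> {0<..<T} ==> AE x in MB. norm (w (t,x)) \<le> 2 \<and> 1 - nsq (U (t,x)) \<le> 2 * norm (w (t,x)) \<and> norm (v0 x) = 1"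
 using v01 AE_space
proof eventually_elim
 case (elim x)
 then have z: "(t,x) \<in> Q" by (auto simp: space_restrict_space)
 have 1: "norm (U (t,x)) \<le> 1" by (rule max_principle[OF z])
 have v: "norm (v0 x) = 1" using elim by simp
 have a: "norm (w (t,x)) \<le> norm (U (t,x)) + norm (v0 x)" by (simp add: w_def norm_triangle_ineq4)
 have b: "norm (v0 x) - norm (U (t,x)) \<le> norm (w (t,x))"
  using norm_triangle_ineq2[of "v0 x" "U (t,x)"] by (simp add: w_def norm_minus_commute)
 have "0 \<le> (1 - norm (U (t,x)))^2" by simp
 then have c: "1 - nsq (U (t,x)) \<le> 2 * (1 - norm (U (t,x)))"
  by (simp add: power2_diff)
 have "norm (w (t,x)) \<le> 2" using a v 1 by linarith
 moreover have "1 - nsq (U (t,x)) \<le> 2 * norm (w (t,x))"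
  by (rule order_trans[OF c]) (use b v in simp)
 ultimately show ?case using v by blast
qed

lemma w_sq_integrable: "t \<in> {0<..<T} ==> integrable MB (\<lambda>x. nsq (w (t,x)))"
proof -
 assume t: "t \<in> {0<..<T}"
 interpret finite_measure MB by (rule finite_MB)
 show ?thesis
 proof (rule integrable_const_bound[where B=4])
  show "AE x in MB. norm (nsq (w (t,x))) \<le> 4"
   using w_bounds[OF t] by eventually_elim (use power_mono[of _ 2 2] in fastforce)
 qed (use w_meas_x[OF t] in measurable)
qed

definition "W t = (\<integral>x. nsq (w (t,x)) \<partial>MB)"

lemma W_nonneg: "W t \<ge> 0" by (simp add: W_def)

lemma W_tendsto: "(W \<longlongrightarrow> 0) (at_right 0)"
proof -
 have ev: "\<forall>\<^sub>F t in at_right 0. t \<in> {0<..<T}"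
  using T eventually_at_right_field[of "\<lambda>t. t \<in> {0<..<T}" 0] by auto
 have "((\<lambda>t. ennreal (W t)) \<longlongrightarrow> ennreal 0) (at_right 0)"
 proof (rule Lim_transform_eventually)
  show "((\<lambda>t. \<integral>\<^sup>+x. ennreal (nsq (w (t,x))) \<partial>MB) \<longlongrightarrow> ennreal 0) (at_right 0)"
   using init by (simp add: w_def)
  show "\<forall>\<^sub>F t in at_right 0. (\<integral>\<^sup>+x. ennreal (nsq (w (t,x))) \<partial>MB) = ennreal (W t)"
   using ev by eventually_elim (auto simp: W_def intro!: nn_integral_eq_integral w_sq_integrable)
 qed
 then show ?thesis
  by (rule tendsto_ennrealD) (auto simp: W_nonneg)
qed

text \<open>The counterpart of \<open>green_cutoff\<close> for the initial map, which has only weak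
  derivatives. The flow supplies the smooth factor \<open>p\<close>, so the products of cutoff and
  coordinates of \<open>p\<close> are admissible scalar test functions.\<close>

lemma weak_green:
 assumes \<zeta>: "smooth_on UNIV \<zeta>" "\<And>x. (\<zeta> has_derivative d\<zeta> x) (at x)" "\<And>b. continuous_on UNIV (\<lambda>x. d\<zeta> x b)"
  and K: "compact K" "K \<subseteq> BB" and z: "\<And>x. x \<in> BB ==> x \<notin> K ==> \<zeta> x = 0" "\<And>x. x \<in> BB ==> x \<notin> K ==> d\<zeta> x = (\<lambda>_. 0)"
  and p: "\<And>b. smooth_on BB (p b)" "\<And>b x. x \<in> BB ==> (p b has_derivative p' b x) (at x)" "\<And>b. continuous_on BB (\<lambda>x. p' b x b)"
 shows "integrable MB (\<lambda>x. \<zeta> x * (v0 x \<bullet> (\<Sum>b\<in>Basis. p' b x b)))" (is ?c1)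
  and "integrable MB (\<lambda>x. \<zeta> x * (\<Sum>b\<in>Basis. g b x \<bullet> p b x))" (is ?c2)
  and "integrable MB (\<lambda>x. \<Sum>b\<in>Basis. d\<zeta> x b * (v0 x \<bullet> p b x))" (is ?c3)
  and "(\<integral>x. \<zeta> x * (v0 x \<bullet> (\<Sum>b\<in>Basis. p' b x b)) \<partial>MB)
   = - (\<integral>x. \<zeta> x * (\<Sum>b\<in>Basis. g b x \<bullet> p b x) \<partial>MB) - (\<integral>x. (\<Sum>b\<in>Basis. d\<zeta> x b * (v0 x \<bullet> p b x)) \<partial>MB)" (is ?c4)
proof -
 let ?q = "\<lambda>b x. d\<zeta> x b .* p b x + \<zeta> x .* p' b x b"
 have cz: "continuous_on BB \<zeta>" "continuous_on BB (\<lambda>x. d\<zeta> x b)" for b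
  using smooth_on_imp_continuous_on[OF \<zeta>(1)] \<zeta>(3) continuous_on_subset by blast+
 have cp: "continuous_on BB (p b)" for b using smooth_on_imp_continuous_on[OF p(1)] .
 have iv: "integrable MB (\<lambda>x. h x \<bullet> v0 x)" if h: "continuous_on BB h" "\<And>x. x \<in> BB - K ==> h x = 0" for h :: "'a => 'b"
 proof (rule L1_bound)
  show "integrable MB h" by (rule integrable_compact_support[OF _ K h]) simp
  then show "(\<lambda>x. h x \<bullet> v0 x) \<in> borel_measurable MB" using v0_meas by (intro borel_measurable_inner) auto
  show "AE x in MB. norm (h x \<bullet> v0 x) \<le> norm (h x)"
   using v01 by eventually_elim (metis Cauchy_Schwarz_ineq2 mult.right_neutral real_norm_def)
 qed
 have ig: "integrable MB (\<lambda>x. h x \<bullet> g b x)" if h: "continuous_on BB h" "\<And>x. x \<in> BB - K ==> h x = 0" and b: "b \<in> Basis" for h :: "'a => 'b" and b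
 proof (rule L1_bound)
  have "integrable MB (\<lambda>x. nsq (h x))"
   by (rule integrable_compact_support[OF _ K]) (auto intro!: continuous_intros h)
  then show "integrable MB (\<lambda>x. nsq (h x) + nsq (g b x))" using gi[OF b] by simp
  have "g b \<in> borel_measurable MB" using gm[OF b] by (intro measurable_restrict_space1) simp
  then show "(\<lambda>x. h x \<bullet> g b x) \<in> borel_measurable MB" using borel_measurable_lborel_on[OF h(1)] by (intro borel_measurable_inner) auto
  show "AE x in MB. norm (h x \<bullet> g b x) \<le> norm (nsq (h x) + nsq (g b x))"
  proof (rule AE_I2)
   fix x
   have "\<bar>h x \<bullet> g b x\<bar> \<le> norm (h x) * norm (g b x)" by (rule Cauchy_Schwarz_ineq2)
   also have "\<dots> \<le> nsq (h x) + nsq (g b x)"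
    by (intro mult_le_sum_squares) auto
   finally show "norm (h x \<bullet> g b x) \<le> norm (nsq (h x) + nsq (g b x))" by simp
  qed
 qed
 have iv1: "integrable MB (\<lambda>x. (d\<zeta> x b .* p b x) \<bullet> v0 x)" for b
  by (rule iv, intro continuous_intros cz cp p(3), use z in auto)
 have iv2: "integrable MB (\<lambda>x. (\<zeta> x .* p' b x b) \<bullet> v0 x)" for b
  by (rule iv, intro continuous_intros cz cp p(3), use z in auto)
 have ig1: "integrable MB (\<lambda>x. (\<zeta> x .* p b x) \<bullet> g b x)" if "b \<in> Basis" for b
  by (rule ig[OF _ _ that], intro continuous_intros cz cp, use z in auto)
 have key: "(\<integral>x. ?q b x \<bullet> v0 x \<partial>MB) = - (\<integral>x. (\<zeta> x .* p b x) \<bullet> g b x \<partial>MB)" if b: "b \<in> Basis" for b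
 proof -
  have comp: "(\<integral>x. (?q b x \<bullet> i) * (v0 x \<bullet> i) \<partial>MB) = - (\<integral>x. ((\<zeta> x .* p b x) \<bullet> i) * (g b x \<bullet> i) \<partial>MB)"
   (is ?A) and i1: "integrable MB (\<lambda>x. (?q b x \<bullet> i) * (v0 x \<bullet> i))" (is ?B)
   and i2: "integrable MB (\<lambda>x. ((\<zeta> x .* p b x) \<bullet> i) * (g b x \<bullet> i))" (is ?C) if i: "i \<in> Basis" for i
  proof -
   \<comment> \<open>Test functions are scalar and defined on the whole space: hence one coordinate
     at a time, extended by zero off the ball.\<close>
   define \<phi> where "\<phi> x = (if x \<in> BB then \<zeta> x * (p b x \<bullet> i) else 0)" for x
   have "smooth_on BB (\<lambda>x. \<zeta> x * (p b x \<bullet> i))"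
    by (intro smooth_on_mult smooth_on_subset[OF \<zeta>(1)] smooth_on_bounded_linear_compose[OF _ bounded_linear_inner_left] p(1)) auto
   then have "smooth_on UNIV \<phi>" unfolding \<phi>_def
    by (rule smooth_on_extend_zero[OF open_ball K]) (use z in auto)
   then have t: "test_function BB \<phi>" unfolding test_function_def
    using K z by (intro conjI exI[of _ K]) (auto simp: \<phi>_def)
   have pd: "partial_deriv b \<phi> x = ?q b x \<bullet> i" if x: "x \<in> BB" for x
   proof -
    have "((\<lambda>x. \<zeta> x * (p b x \<bullet> i)) has_derivative (\<lambda>v. \<zeta> x * (p' b x v \<bullet> i) + d\<zeta> x v * (p b x \<bullet> i))) (at x)"
     by (rule has_derivative_mult[OF \<zeta>(2) has_derivative_inner_left[OF p(2)[OF x]]])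
    then have "(\<phi> has_derivative (\<lambda>v. \<zeta> x * (p' b x v \<bullet> i) + d\<zeta> x v * (p b x \<bullet> i))) (at x)"
     by (rule has_derivative_transform_within_open[OF _ open_ball x]) (simp add: \<phi>_def)
    from frechet_derivative_at[OF this, symmetric] show ?thesis
     by (simp add: partial_deriv_def inner_simps)
   qed
   have m: "integrable MB (\<lambda>x. \<zeta> x)" using z by (intro integrable_compact_support[OF _ K] cz) auto
   have "integrable MB (\<lambda>x. ((?q b x \<bullet> i) .* i) \<bullet> v0 x)"
    using z by (intro iv continuous_intros cz cp p(3)) auto
   then show ?B by (simp add: inner_commute)
   have "integrable MB (\<lambda>x. (((\<zeta> x .* p b x) \<bullet> i) .* i) \<bullet> g b x)"
    using z by (intro ig[OF _ _ b] continuous_intros cz cp) auto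
   then show ?C by (simp add: inner_commute)
   have "integrable MB (\<lambda>x. partial_deriv b \<phi> x .* v0 x)"
   proof (rule L1_bound)
    show "integrable MB (\<lambda>x. ?q b x \<bullet> i)"
     using z by (intro integrable_compact_support[OF _ K] continuous_intros cz cp p(3)) auto
    then have m: "(\<lambda>x. ?q b x \<bullet> i) \<in> borel_measurable MB" by simp
    have "partial_deriv b \<phi> \<in> borel_measurable MB"
     using m by (subst measurable_cong[where g="\<lambda>x. ?q b x \<bullet> i"]) (auto simp: pd space_restrict_space)
    then show "(\<lambda>x. partial_deriv b \<phi> x .* v0 x) \<in> borel_measurable MB" using v0_meas by measurable
    show "AE x in MB. norm (partial_deriv b \<phi> x .* v0 x) \<le> norm (?q b x \<bullet> i)"
     using v01 AE_space by eventually_elim (simp add: pd space_restrict_space)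
   qed
   then have 1: "(\<integral>x. partial_deriv b \<phi> x .* v0 x \<partial>MB) \<bullet> i = (\<integral>x. (partial_deriv b \<phi> x .* v0 x) \<bullet> i \<partial>MB)"
    by (intro integral_inner_left[symmetric])
   have "integrable MB (\<lambda>x. \<phi> x .* g b x)"
   proof (rule L1_bound)
    have c\<phi>: "continuous_on BB (\<lambda>x. \<zeta> x * (p b x \<bullet> i))" by (intro continuous_intros cz cp)
    show "integrable MB (\<lambda>x. (\<zeta> x * (p b x \<bullet> i))^2 + nsq (g b x))"
     using z by (intro Bochner_Integration.integrable_add gi[OF b] integrable_compact_support[OF _ K] continuous_intros cz cp) auto
    have "\<phi> \<in> borel_measurable MB"
     using borel_measurable_lborel_on[OF c\<phi>] by (subst measurable_cong[where g="\<lambda>x. \<zeta> x * (p b x \<bullet> i)"]) (auto simp: \<phi>_def space_restrict_space)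
    moreover have "g b \<in> borel_measurable MB" using gm[OF b] by (intro measurable_restrict_space1) simp
    ultimately show "(\<lambda>x. \<phi> x .* g b x) \<in> borel_measurable MB" by measurable
    show "AE x in MB. norm (\<phi> x .* g b x) \<le> norm ((\<zeta> x * (p b x \<bullet> i))^2 + nsq (g b x))"
    proof (rule AE_I2)
     fix x assume "x \<in> space MB"
     then have "\<phi> x = \<zeta> x * (p b x \<bullet> i)" by (simp add: \<phi>_def space_restrict_space)
     then have "norm (\<phi> x .* g b x) = \<bar>\<zeta> x * (p b x \<bullet> i)\<bar> * norm (g b x)" by simp
     also have "\<dots> \<le> \<bar>\<zeta> x * (p b x \<bullet> i)\<bar>^2 + nsq (g b x)"
      by (intro mult_le_sum_squares) auto
     finally show "norm (\<phi> x .* g b x) \<le> norm ((\<zeta> x * (p b x \<bullet> i))^2 + nsq (g b x))" by simp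
    qed
   qed
   then have 2: "(\<integral>x. \<phi> x .* g b x \<partial>MB) \<bullet> i = (\<integral>x. (\<phi> x .* g b x) \<bullet> i \<partial>MB)"
    by (intro integral_inner_left[symmetric])
   have "(\<integral>x. (partial_deriv b \<phi> x .* v0 x) \<bullet> i \<partial>MB) = - (\<integral>x. (\<phi> x .* g b x) \<bullet> i \<partial>MB)"
    unfolding 1[symmetric] 2[symmetric] weak[OF b t] by simp
   moreover have "(\<integral>x. (partial_deriv b \<phi> x .* v0 x) \<bullet> i \<partial>MB) = (\<integral>x. (?q b x \<bullet> i) * (v0 x \<bullet> i) \<partial>MB)"
    by (rule L1_cong) (auto simp: pd space_restrict_space)
   moreover have "(\<integral>x. (\<phi> x .* g b x) \<bullet> i \<partial>MB) = (\<integral>x. ((\<zeta> x .* p b x) \<bullet> i) * (g b x \<bullet> i) \<partial>MB)"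
    by (rule L1_cong) (auto simp: \<phi>_def space_restrict_space)
   ultimately show ?A by simp
  qed
  have "(\<integral>x. ?q b x \<bullet> v0 x \<partial>MB) = (\<Sum>i\<in>Basis. \<integral>x. (?q b x \<bullet> i) * (v0 x \<bullet> i) \<partial>MB)"
   unfolding euclidean_inner[of _ "v0 _"] using i1 by (intro L1_sum)
  also have "\<dots> = - (\<Sum>i\<in>Basis. \<integral>x. ((\<zeta> x .* p b x) \<bullet> i) * (g b x \<bullet> i) \<partial>MB)"
   using comp by (simp add: sum_negf)
  also have "(\<Sum>i\<in>Basis. \<integral>x. ((\<zeta> x .* p b x) \<bullet> i) * (g b x \<bullet> i) \<partial>MB) = (\<integral>x. (\<zeta> x .* p b x) \<bullet> g b x \<partial>MB)"
   unfolding euclidean_inner[of _ "g b _"] using i2 by (intro L1_sum[symmetric])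
  finally show ?thesis .
 qed
 have e1: "(\<lambda>x. \<zeta> x * (v0 x \<bullet> (\<Sum>b\<in>Basis. p' b x b))) = (\<lambda>x. \<Sum>b\<in>Basis. (\<zeta> x .* p' b x b) \<bullet> v0 x)"
  by (simp add: fun_eq_iff inner_sum_right sum_distrib_left inner_commute)
 have e2: "(\<lambda>x. \<zeta> x * (\<Sum>b\<in>Basis. g b x \<bullet> p b x)) = (\<lambda>x. \<Sum>b\<in>Basis. (\<zeta> x .* p b x) \<bullet> g b x)"
  by (simp add: fun_eq_iff sum_distrib_left inner_commute)
 have e3: "(\<lambda>x. \<Sum>b\<in>Basis. d\<zeta> x b * (v0 x \<bullet> p b x)) = (\<lambda>x. \<Sum>b\<in>Basis. (d\<zeta> x b .* p b x) \<bullet> v0 x)"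
  by (simp add: fun_eq_iff inner_commute)
 show ?c1 unfolding e1 using iv2 by simp
 show ?c2 unfolding e2 using ig1 by simp
 show ?c3 unfolding e3 using iv1 by simp
 have "(\<integral>x. (\<zeta> x .* p' b x b) \<bullet> v0 x \<partial>MB) = - (\<integral>x. (\<zeta> x .* p b x) \<bullet> g b x \<partial>MB) - (\<integral>x. (d\<zeta> x b .* p b x) \<bullet> v0 x \<partial>MB)" if "b \<in> Basis" for b
 proof -
  have "(\<integral>x. ?q b x \<bullet> v0 x \<partial>MB) = (\<integral>x. (d\<zeta> x b .* p b x) \<bullet> v0 x \<partial>MB) + (\<integral>x. (\<zeta> x .* p' b x b) \<bullet> v0 x \<partial>MB)"
   unfolding inner_add_left using iv1 iv2 by (rule Bochner_Integration.integral_add)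
  then show ?thesis using key[OF that] by simp
 qed
 then show ?c4
  unfolding e1 e2 e3 using iv1 iv2 ig1
  by (subst (1 2 3) L1_sum) (auto simp: sum_negf[symmetric] sum_subtractf[symmetric] intro!: sum.cong)
qed

lemma integrable_snd_finite:
 fixes h :: "'a => real"
 assumes h: "integrable MB h" and ab: "a \<le> b"
 shows "integrable (PJ a b) (\<lambda>z. h (snd z))" (is ?c1)
  and "LI (PJ a b) (\<lambda>z. h (snd z)) = (b - a) * LI MB h" (is ?c2)
proof -
 interpret pair_sigma_finite "lborel_on {a..b}" MB by (intro pair_sigma_finite_lborel_on) auto
 have m: "(\<lambda>z. h (snd z)) \<in> borel_measurable (PJ a b)"
  using h by (intro measurable_compose[OF measurable_snd borel_measurable_integrable])
 have "(\<integral>\<^sup>+z. norm (h (snd z)) \<partial>(PJ a b)) = (\<integral>\<^sup>+t. (\<integral>\<^sup>+x. norm (h x) \<partial>MB) \<partial>lborel_on {a..b})"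
  using m by (subst nn_integral_pair) auto
 also have "\<dots> = (\<integral>\<^sup>+x. norm (h x) \<partial>MB) * ennreal (b - a)"
  using ab by (simp add: space_restrict_space emeasure_restrict_space)
 also have "\<dots> < \<infinity>" using h by (simp add: integrable_iff_bounded ennreal_mult_less_top)
 finally show i: ?c1 using m by (simp add: integrable_iff_bounded)
 have "measure (lborel_on {a..b}) {a..b} = b - a"
  using ab by (simp add: measure_restrict_space)
 then show ?c2
  using integral_fst'[OF i] by (simp add: space_restrict_space)
qed

definition "gg x = (\<Sum>b\<in>Basis. nsq (g b x))"

lemma gg_integrable: "integrable MB gg" and gg_integral: "LI MB gg = M0"
 using gi unfolding gg_def[abs_def] M0_def by auto

lemma gg_nonneg: "gg x \<ge> 0" by (simp add: gg_def sum_nonneg)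

lemma AE_pair_w_bounds:
 assumes I: "I \<subseteq> {0<..<T}" "I \<in> sets borel"
 shows "AE z in lborel2 I BB. z \<in> Q \<and> norm (w z) \<le> 2 \<and> 1 - nsq (U z) \<le> 2 * norm (w z) \<and> norm (v0 (snd z)) = 1"
proof -
 interpret pair_sigma_finite "lborel_on I" MB using I by (intro pair_sigma_finite_lborel_on) auto
 have 1: "AE z in lborel2 I BB. z \<in> Q"
  using I by (intro AE_I2) (auto simp: spaces)
 have "AE z in lborel2 I BB. norm (w z) \<le> 2 \<and> 1 - nsq (U z) \<le> 2 * norm (w z) \<and> norm (v0 (snd z)) = 1"
 proof (rule AE_pair_measure)
  have [measurable]: "w \<in> borel_measurable (lborel2 I BB)" "U \<in> borel_measurable (lborel2 I BB)"
   "(\<lambda>z. v0 (snd z)) \<in> borel_measurable (lborel2 I BB)"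
   using w_meas[OF I(1)] meas_Q[OF conts(1) I(1)] measurable_pair_snd_borel[OF v0m] by auto
  show "{z \<in> space (lborel2 I BB). norm (w z) \<le> 2 \<and> 1 - nsq (U z) \<le> 2 * norm (w z) \<and> norm (v0 (snd z)) = 1}
   \<in> sets (lborel2 I BB)" by measurable
  show "AE t in lborel_on I. AE x in MB. norm (w (t,x)) \<le> 2 \<and> 1 - nsq (U (t,x)) \<le> 2 * norm (w (t,x)) \<and> norm (v0 (snd (t,x))) = 1"
  proof (rule AE_I2)
   fix t assume "t \<in> space (lborel_on I)"
   then have "t \<in> {0<..<T}" using I by (auto simp: space_restrict_space)
   from w_bounds[OF this] show "AE x in MB. norm (w (t,x)) \<le> 2 \<and> 1 - nsq (U (t,x)) \<le> 2 * norm (w (t,x)) \<and> norm (v0 (snd (t,x))) = 1"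
    by simp
  qed
 qed
 with 1 show ?thesis by eventually_elim blast
qed

text \<open>Since |u0| = 1, the defect \<open>1 - |u|^2\<close> is at most \<open>2 |w|\<close>. The
  nonlinearity is therefore of first order in \<open>w\<close> and its product with \<open>w\<close>
  can be absorbed by an exponential weight.\<close>

lemma w_fz_bound:
 assumes "z \<in> Q" "1 - nsq (U z) \<le> 2 * norm (w z)"
 shows "\<bar>w z \<bullet> fz z\<bar> \<le> 2 * max 1 lam * (w z \<bullet> w z)"
proof -
 have "norm (fz z) \<le> Lc (fst z) * (1 - nsq (U z))" by (rule fz_bound[OF assms(1)])
 also have "\<dots> \<le> max 1 lam * (2 * norm (w z))"
  using Lc_bounds[of "fst z"] assms max_principle[OF assms(1)] by (intro mult_mono) (auto simp: power_le_one)
 finally have "norm (w z) * norm (fz z) \<le> norm (w z) * (max 1 lam * (2 * norm (w z)))"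
  by (intro mult_left_mono) auto
 moreover have "\<bar>w z \<bullet> fz z\<bar> \<le> norm (w z) * norm (fz z)" by (rule Cauchy_Schwarz_ineq2)
 ultimately show ?thesis by (simp add: dot_square_norm power2_eq_square mult_ac)
qed

section \<open>Energy estimates\<close>

text \<open>The equation is tested with \<open>exp (- c t) \<zeta> w\<close>. Young's inequality on
  \<open>grad u . grad u0\<close> keeps half of |grad u|^2 and charges half of |grad u0|^2. The
  coefficient of M0 matters: the limit over short intervals will turn it into the initial energy
  M0/2.\<close>

theorem weighted_L2_estimate:
 assumes ab: "0 < a" "a < b" "b < T"
 shows "exp (- (4 * max 1 lam) * b) * (W b/2 + LI (PJ a b) gsq/2) \<le> W a/2 + (b - a) * M0/2"
proof -
 \<comment> \<open>\<open>\<Phi>\<close> carries a factor 1/2, so the weight contributes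
   \<open>c/2 |w|^2\<close>, which is exactly the bound in \<open>w_fz_bound\<close>.\<close>
 define c where "c = 4 * max 1 lam"
 have c0: "c > 0" by (simp add: c_def)
 obtain \<zeta> d\<zeta> L and KK :: "nat => 'a set" where "cutoffs \<zeta> d\<zeta> KK L" using cutoffs_exist by blast
 then interpret cutoffs \<zeta> d\<zeta> KK L .
 have sub: "{a..b} \<subseteq> {0<..<T}" using ab by auto
 let ?P = "PJ a b"
 have spQ: "z \<in> Q" if "z \<in> space ?P" for z
  using that sub by (auto simp: spaces)
 have \<zeta>m: "\<zeta> n \<in> borel_measurable MB" "(\<lambda>x. d\<zeta> n x b) \<in> borel_measurable MB" for n b
  by (intro borel_measurable_lborel_on \<zeta>c)+
 have \<zeta>mP: "(\<lambda>z. \<zeta> n (snd z)) \<in> borel_measurable ?P" "(\<lambda>z. d\<zeta> n (snd z) b) \<in> borel_measurable ?P" for n b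
  by (intro measurable_pair_continuous_on \<zeta>c2)+
 have cs: "continuous_on BB (\<lambda>x. Lap (t,x))" "continuous_on BB (\<lambda>x. U (t,x))" "continuous_on BB (\<lambda>x. gsq (t,x))"
   "continuous_on BB (\<lambda>x. dt U (t,x))" "continuous_on BB (\<lambda>x. dx v U (t,x))" 
   "continuous_on BB (\<lambda>x. dx v (dx v U) (t,x))" "continuous_on BB (\<lambda>x. fz (t,x))"
   if "t \<in> {0<..<T}" for t v
   using that by (auto intro!: slice_cont_x Lap_cont conts cont_gsq fz_cont)
 define err where "err n z = (\<Sum>b\<in>Basis. \<bar>d\<zeta> n (snd z) b\<bar> * (norm (dx b U z) * norm (w z)))" for n z
 define E where "E n z = exp (- c * fst z) * (\<zeta> n (snd z) * (gg (snd z)/2 - gsq z/2)) + err n z" for n z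
 have err0: "err n z \<ge> 0" for n z unfolding err_def by (intro sum_nonneg) auto
 have errb: "err n z \<le> (\<Sum>b\<in>(Basis::'a set). L * (hq z + gsq z))" if z: "z \<in> Q" for n z
  unfolding err_def
 proof (rule sum_mono)
  fix b :: 'a assume b: "b \<in> Basis"
  have x: "snd z \<in> BB" using z by auto
  have "\<bar>d\<zeta> n (snd z) b\<bar> * (norm (dx b U z) * norm (w z)) \<le> (L/\<rho> (snd z)) * (norm (dx b U z) * norm (w z))"
   using d\<zeta>b(1)[OF x b] by (intro mult_right_mono) (auto simp: \<rho>_def)
  also have "\<dots> = L * ((norm (w z)/\<rho> (snd z)) * norm (dx b U z))" by simp
  also have "\<dots> \<le> L * (hq z + nsq (dx b U z))"
   unfolding hq_def using L rho_pos[OF x] by (intro mult_left_mono mult_le_sum_squares) auto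
  also have "\<dots> \<le> L * (hq z + gsq z)"
   using L b unfolding gsq_def by (intro mult_left_mono add_left_mono member_le_sum) auto
  finally show "\<bar>d\<zeta> n (snd z) b\<bar> * (norm (dx b U z) * norm (w z)) \<le> L * (hq z + gsq z)" .
 qed
 have gP: "integrable ?P gsq" "integrable ?P hq"
  using integrable_pair_subset[OF gsq_integrable sub] integrable_pair_subset[OF hq_integrable sub] by auto
 have ggP: "integrable ?P (\<lambda>z. gg (snd z))" "LI ?P (\<lambda>z. gg (snd z)) = (b - a) * M0"
  using integrable_snd_finite[OF gg_integrable, of a b] ab by (auto simp: gg_integral)
 have I1: "integrable ?P (\<lambda>z. gg (snd z) + gsq z + (\<Sum>b\<in>(Basis::'a set). L * (hq z + gsq z)))"
  using gP ggP by simp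
 have dxm: "dx v U \<in> borel_measurable ?P" for v by (rule meas_Q[OF conts(2) sub])
 have em: "(\<lambda>z. exp (- c * fst z)) \<in> borel_measurable ?P"
  by (intro measurable_pair_continuous_on continuous_intros)
 have errm: "err n \<in> borel_measurable ?P" for n
  unfolding err_def[abs_def]
  by (intro borel_measurable_sum borel_measurable_times borel_measurable_abs \<zeta>mP measurable_compose[OF dxm borel_measurable_norm] measurable_compose[OF w_meas[OF sub] borel_measurable_norm])
 have Em: "E n \<in> borel_measurable ?P" for n
  unfolding E_def[abs_def] using gP ggP
  by (intro borel_measurable_add borel_measurable_times em \<zeta>mP errm borel_measurable_diff borel_measurable_divide borel_measurable_const) auto
 have Eb: "\<bar>E n z\<bar> \<le> gg (snd z) + gsq z + (\<Sum>b\<in>(Basis::'a set). L * (hq z + gsq z))" if z: "z \<in> Q" for n z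
 proof -
  have "\<bar>exp (- c * fst z) * (\<zeta> n (snd z) * (gg (snd z)/2 - gsq z/2))\<bar> = exp (- c * fst z) * (\<zeta> n (snd z) * \<bar>gg (snd z)/2 - gsq z/2\<bar>)"
   using \<zeta>b(1) by (simp add: abs_mult)
  also have "\<dots> \<le> 1 * (1 * (gg (snd z) + gsq z))"
  proof (rule mult_mono)
   show "exp (- c * fst z) \<le> 1" using c0 z by (simp add: mem_Times_iff)
   show "\<zeta> n (snd z) * \<bar>gg (snd z)/2 - gsq z/2\<bar> \<le> 1 * (gg (snd z) + gsq z)"
    by (intro mult_mono) (use \<zeta>b(1,2) gg_nonneg[of "snd z"] gsq_nonneg[of z] in auto)
  qed (use \<zeta>b(1) in simp_all)
  finally have "\<bar>exp (- c * fst z) * (\<zeta> n (snd z) * (gg (snd z)/2 - gsq z/2))\<bar> \<le> gg (snd z) + gsq z" by simp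
  then show ?thesis using errb[OF z, of n] err0[of n z] unfolding E_def by linarith
 qed
 have EP: "integrable ?P (E n)" for n
 proof (rule L1_bound[OF I1 Em], rule AE_I2)
  fix z assume "z \<in> space ?P"
  from Eb[OF spQ[OF this], of n]
  show "norm (E n z) \<le> norm (gg (snd z) + gsq z + (\<Sum>b\<in>(Basis::'a set). L * (hq z + gsq z)))"
   unfolding real_norm_def by (rule order_trans[OF _ abs_ge_self])
 qed
 define \<Phi> where "\<Phi> n t x = \<zeta> n x * (exp (- c * t) * ((w (t,x) \<bullet> w (t,x))/2))" for n t x
 define \<Phi>' where "\<Phi>' n t x = \<zeta> n x * (exp (- c * t) * (w (t,x) \<bullet> dt U (t,x) - c/2 * (w (t,x) \<bullet> w (t,x))))" for n t x
 have ww: "w z \<bullet> w z = nsq (w z)" for z by (simp add: dot_square_norm)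
 have wwi: "integrable MB (\<lambda>x. w (t,x) \<bullet> w (t,x))" if "t \<in> {0<..<T}" for t
  unfolding ww by (rule w_sq_integrable[OF that])
 have \<Phi>i: "integrable MB (\<Phi> n t)" if t: "t \<in> {0<..<T}" for n t
 proof (rule L1_bound[OF wwi[OF t]])
  show "\<Phi> n t \<in> borel_measurable MB" unfolding \<Phi>_def
   using \<zeta>m borel_measurable_integrable[OF wwi[OF t]] by (intro borel_measurable_times borel_measurable_divide borel_measurable_const) auto
  show "AE x in MB. norm (\<Phi> n t x) \<le> norm (w (t,x) \<bullet> w (t,x))"
  proof (rule AE_I2)
   fix x
   have "\<Phi> n t x \<le> 1 * (1 * ((w (t,x) \<bullet> w (t,x))/1))" unfolding \<Phi>_def
    using \<zeta>b c0 t by (intro mult_mono divide_left_mono) auto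
   moreover have "\<Phi> n t x \<ge> 0" unfolding \<Phi>_def using \<zeta>b by simp
   ultimately show "norm (\<Phi> n t x) \<le> norm (w (t,x) \<bullet> w (t,x))" by simp
  qed
 qed
 have bdi: "integrable MB (\<lambda>x. f x)" if t: "t \<in> {0<..<T}" and f: "f \<in> borel_measurable MB" and h: "integrable MB h"
  and le: "\<And>x. x \<in> BB ==> norm (w (t,x)) \<le> 2 ==> \<bar>f x\<bar> \<le> h x" for f h :: "'a => real" and t
 proof (rule L1_bound[OF h f])
  show "AE x in MB. norm (f x) \<le> norm (h x)"
   using w_bounds[OF t] AE_space by eventually_elim (use le in \<open>force simp: space_restrict_space\<close>)
 qed
 have step: "LI MB (\<Phi> n b) - LI MB (\<Phi> n a) \<le> LI ?P (\<lambda>(t,x). E n (t,x))" for n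
 proof (rule time_FTC_le)
  show "((\<lambda>t. \<Phi> n t x) has_real_derivative \<Phi>' n t x) (at t)" if "x \<in> BB" "t \<in> {a..b}" for x t
  proof -
   have t: "t \<in> {0<..<T}" using that sub by auto
   have dU: "((\<lambda>t. U (t,x)) has_derivative (\<lambda>h. h .* dt U (t,x))) (at t)"
    using slice_deriv_t[OF smooth t that(1)] by (simp add: has_vector_derivative_def)
   have dw: "((\<lambda>t. w (t,x)) has_derivative (\<lambda>h. h .* dt U (t,x))) (at t)"
    using has_derivative_diff[OF dU has_derivative_const[of "v0 x"]] by (simp add: w_def)
   have d2: "((\<lambda>t. w (t,x) \<bullet> w (t,x)) has_real_derivative (2 * (w (t,x) \<bullet> dt U (t,x)))) (at t)"
    unfolding has_field_derivative_def
    by (rule has_derivative_eq_rhs[OF has_derivative_inner[OF dw dw]]) (simp add: fun_eq_iff inner_commute)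
   show ?thesis unfolding \<Phi>_def \<Phi>'_def
    by (auto intro!: derivative_eq_intros d2 simp: field_simps)
  qed
  show "continuous_on {a..b} (\<lambda>t. \<Phi>' n t x)" if "x \<in> BB" for x
   unfolding \<Phi>'_def w_def using that ab
   by (intro continuous_intros slice_cont_t[OF conts(1)] slice_cont_t[OF conts(3)]) auto
  show "integrable ?P (\<lambda>(t,x). \<Phi>' n t x)"
  proof (rule L1_bound)
   have *: "continuous_on ({a..b} \<times> BB) F" if "continuous_on Q F" for F :: "real \<times> 'a => 'c::topological_space"
    by (rule continuous_on_subset[OF that]) (use sub in auto)
   show "integrable ?P (\<lambda>z. \<zeta> n (snd z) * (2 * norm (dt U z) + c/2 * 4))"
    by (rule integrable_pair_compact_support[OF KK(1,2)[of n]])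
     (use KK(3) in \<open>auto intro!: continuous_intros \<zeta>c2 *[OF conts(3)]\<close>)
   have [measurable]: "w \<in> borel_measurable ?P" "dt U \<in> borel_measurable ?P" "(\<lambda>z. \<zeta> n (snd z)) \<in> borel_measurable ?P"
    "(\<lambda>z. exp (- c * fst z)) \<in> borel_measurable ?P"
    using w_meas[OF sub] meas_Q[OF conts(3) sub] \<zeta>mP em by auto
   have "(\<lambda>z. \<zeta> n (snd z) * (exp (- c * fst z) * (w z \<bullet> dt U z - c/2 * (w z \<bullet> w z)))) \<in> borel_measurable ?P"
    by measurable
   then show "(\<lambda>(t,x). \<Phi>' n t x) \<in> borel_measurable ?P" by (simp only: \<Phi>'_def case_prod_beta' prod.collapse)
   show "AE z in ?P. norm (case z of (t,x) => \<Phi>' n t x) \<le> norm (\<zeta> n (snd z) * (2 * norm (dt U z) + c/2 * 4))"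
    using AE_pair_w_bounds[OF sub borel_closed[OF closed_atLeastAtMost]]
   proof eventually_elim
    case (elim z)
    have "\<bar>w z \<bullet> dt U z\<bar> \<le> norm (w z) * norm (dt U z)" by (rule Cauchy_Schwarz_ineq2)
    also have "\<dots> \<le> 2 * norm (dt U z)" using elim by (intro mult_right_mono) auto
    finally have 1: "\<bar>w z \<bullet> dt U z\<bar> \<le> 2 * norm (dt U z)" .
    have "nsq (w z) \<le> 2^2" using elim by (intro power_mono) auto
    then have 2: "c/2 * (w z \<bullet> w z) \<le> c/2 * 4" using c0 by (intro mult_left_mono) (auto simp: ww)
    have "0 \<le> c/2 * (w z \<bullet> w z)" using c0 by simp
    with 1 2 have 3: "\<bar>w z \<bullet> dt U z - c/2 * (w z \<bullet> w z)\<bar> \<le> 2 * norm (dt U z) + c/2 * 4" by linarith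
    have "exp (- c * fst z) * \<bar>w z \<bullet> dt U z - c/2 * (w z \<bullet> w z)\<bar> \<le> 1 * (2 * norm (dt U z) + c/2 * 4)"
     using 3 c0 elim by (intro mult_mono) (auto simp: mem_Times_iff)
    then have "\<zeta> n (snd z) * (exp (- c * fst z) * \<bar>w z \<bullet> dt U z - c/2 * (w z \<bullet> w z)\<bar>) \<le> \<zeta> n (snd z) * (2 * norm (dt U z) + c/2 * 4)"
     using \<zeta>b(1) by (intro mult_left_mono) auto
    then show ?case using \<zeta>b(1) c0 by (cases z) (simp add: \<Phi>'_def abs_mult)
   qed
  qed
  show "integrable MB (\<Phi> n a)" "integrable MB (\<Phi> n b)" using ab by (auto intro!: \<Phi>i)
  show "integrable ?P (\<lambda>(t,x). E n (t,x))" using EP by simp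
  show "AE t in lborel_on {a..b}. LI MB (\<Phi>' n t) \<le> (\<integral>x. E n (t,x) \<partial>MB)"
  proof (rule AE_I2)
   fix t assume "t \<in> space (lborel_on {a..b})"
   then have t: "t \<in> {0<..<T}" using sub by (auto simp: space_restrict_space)
   have [measurable]: "(\<lambda>x. w (t,x)) \<in> borel_measurable MB" "(\<lambda>x. dt U (t,x)) \<in> borel_measurable MB"
    "(\<lambda>x. Lap (t,x)) \<in> borel_measurable MB" "\<And>b. (\<lambda>x. dx b U (t,x)) \<in> borel_measurable MB" "\<zeta> n \<in> borel_measurable MB"
    "\<And>b. (\<lambda>x. d\<zeta> n x b) \<in> borel_measurable MB"
    using w_meas_x[OF t] cs[OF t] \<zeta>m by (auto intro!: borel_measurable_lborel_on)
   have G1: "(\<integral>x. \<zeta> n x * (U (t,x) \<bullet> (\<Sum>b\<in>Basis. dx b (dx b U) (t,x))) \<partial>MB)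
     = - (\<integral>x. \<zeta> n x * (\<Sum>b\<in>Basis. dx b U (t,x) \<bullet> dx b U (t,x)) \<partial>MB)
      - (\<integral>x. (\<Sum>b\<in>Basis. d\<zeta> n x b * (U (t,x) \<bullet> dx b U (t,x))) \<partial>MB)"
    by (rule green_cutoff[OF open_ball KK(1,2) \<zeta> KK(3,4) slice_deriv_x[OF smooth t], where p' = "\<lambda>b x v. dx v (dx b U) (t,x)"])
     (auto intro!: cs t slice_deriv_x[OF smooths(2) t])
   have ps: "smooth_on BB (\<lambda>x. dx b U (t,x))" for b
    by (rule smooth_on_slice_x[OF open_Q smooths(2)]) (use t in auto)
   have pd: "((\<lambda>x. dx b U (t,x)) has_derivative (\<lambda>v. dx v (dx b U) (t,x))) (at x)" if "x \<in> BB" for b x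
    by (rule slice_deriv_x[OF smooths(2) t that])
   have pc: "continuous_on BB (\<lambda>x. dx b (dx b U) (t,x))" for b by (rule cs[OF t])
   have WG: "integrable MB (\<lambda>x. \<zeta> n x * (v0 x \<bullet> (\<Sum>b\<in>Basis. dx b (dx b U) (t,x))))"
    "integrable MB (\<lambda>x. \<zeta> n x * (\<Sum>b\<in>Basis. g b x \<bullet> dx b U (t,x)))"
    "integrable MB (\<lambda>x. \<Sum>b\<in>Basis. d\<zeta> n x b * (v0 x \<bullet> dx b U (t,x)))"
    "(\<integral>x. \<zeta> n x * (v0 x \<bullet> (\<Sum>b\<in>Basis. dx b (dx b U) (t,x))) \<partial>MB)
     = - (\<integral>x. \<zeta> n x * (\<Sum>b\<in>Basis. g b x \<bullet> dx b U (t,x)) \<partial>MB) - (\<integral>x. (\<Sum>b\<in>Basis. d\<zeta> n x b * (v0 x \<bullet> dx b U (t,x))) \<partial>MB)"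
    by (rule weak_green[OF \<zeta>s[of n] \<zeta> KK(1,2)[of n], where p = "\<lambda>b x. dx b U (t,x)" and p' = "\<lambda>b x v. dx v (dx b U) (t,x)"]; use KK(3,4) ps pd pc in blast)+
   have i1: "integrable MB (\<lambda>x. \<zeta> n x * (U (t,x) \<bullet> (\<Sum>b\<in>Basis. dx b (dx b U) (t,x))))"
    "integrable MB (\<lambda>x. \<zeta> n x * (\<Sum>b\<in>Basis. dx b U (t,x) \<bullet> dx b U (t,x)))"
    "integrable MB (\<lambda>x. \<Sum>b\<in>Basis. d\<zeta> n x b * (U (t,x) \<bullet> dx b U (t,x)))"
    by (rule ci[where n=n], intro continuous_intros \<zeta>c cs[OF t], use KK in force)+
   have Lapw: "\<zeta> n x * (w (t,x) \<bullet> Lap (t,x)) = \<zeta> n x * (U (t,x) \<bullet> (\<Sum>b\<in>Basis. dx b (dx b U) (t,x))) - \<zeta> n x * (v0 x \<bullet> (\<Sum>b\<in>Basis. dx b (dx b U) (t,x)))" for x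
    by (simp add: w_def Lap_def inner_diff_left right_diff_distrib)
   have iL: "integrable MB (\<lambda>x. \<zeta> n x * (w (t,x) \<bullet> Lap (t,x)))"
    unfolding Lapw using i1(1) WG(1) by (rule L1_diff)
   define R where "R x = - (\<zeta> n x * (\<Sum>b\<in>Basis. dx b U (t,x) \<bullet> dx b U (t,x))) - (\<Sum>b\<in>Basis. d\<zeta> n x b * (U (t,x) \<bullet> dx b U (t,x)))
     + \<zeta> n x * (\<Sum>b\<in>Basis. g b x \<bullet> dx b U (t,x)) + (\<Sum>b\<in>Basis. d\<zeta> n x b * (v0 x \<bullet> dx b U (t,x)))" for x
   have Ri: "integrable MB R" unfolding R_def using i1 WG(1-3) by simp
   have "(\<integral>x. \<zeta> n x * (w (t,x) \<bullet> Lap (t,x)) \<partial>MB) = LI MB R"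
    unfolding Lapw R_def using i1 WG G1 by simp
   have i\<Phi>: "integrable MB (\<Phi>' n t)"
   proof (rule bdi[OF t])
    show "\<Phi>' n t \<in> borel_measurable MB" unfolding \<Phi>'_def by measurable
    show "integrable MB (\<lambda>x. \<zeta> n x * (2 * norm (dt U (t,x)) + c/2 * 4))"
     by (rule ci[where n=n], intro continuous_intros \<zeta>c cs[OF t]) (use KK in auto)
    fix x assume x: "x \<in> BB" and le: "norm (w (t,x)) \<le> 2"
    let ?z = "(t,x)"
    have "\<bar>w ?z \<bullet> dt U ?z\<bar> \<le> norm (w ?z) * norm (dt U ?z)" by (rule Cauchy_Schwarz_ineq2)
    also have "\<dots> \<le> 2 * norm (dt U ?z)" using le by (intro mult_right_mono) auto
    finally have 1: "\<bar>w ?z \<bullet> dt U ?z\<bar> \<le> 2 * norm (dt U ?z)" .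
    have "nsq (w ?z) \<le> 2^2" using le by (intro power_mono) auto
    then have 2: "c/2 * (w ?z \<bullet> w ?z) \<le> c/2 * 4" using c0 by (intro mult_left_mono) (auto simp: ww)
    have "0 \<le> c/2 * (w ?z \<bullet> w ?z)" using c0 by simp
    with 1 2 have 3: "\<bar>w ?z \<bullet> dt U ?z - c/2 * (w ?z \<bullet> w ?z)\<bar> \<le> 2 * norm (dt U ?z) + c/2 * 4" by linarith
    have "exp (- c * t) * \<bar>w ?z \<bullet> dt U ?z - c/2 * (w ?z \<bullet> w ?z)\<bar> \<le> 1 * (2 * norm (dt U ?z) + c/2 * 4)"
     using 3 c0 t by (intro mult_mono) auto
    then have "\<zeta> n x * (exp (- c * t) * \<bar>w ?z \<bullet> dt U ?z - c/2 * (w ?z \<bullet> w ?z)\<bar>) \<le> \<zeta> n x * (2 * norm (dt U ?z) + c/2 * 4)"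
     using \<zeta>b(1) by (intro mult_left_mono) auto
    then show "\<bar>\<Phi>' n t x\<bar> \<le> \<zeta> n x * (2 * norm (dt U ?z) + c/2 * 4)" using \<zeta>b(1) by (simp add: \<Phi>'_def abs_mult)
   qed
   have ierr: "integrable MB (\<lambda>x. err n (t,x))"
   proof (rule bdi[OF t])
    show "(\<lambda>x. err n (t,x)) \<in> borel_measurable MB" unfolding err_def by simp
    show "integrable MB (\<lambda>x. \<Sum>b\<in>Basis. \<bar>d\<zeta> n x b\<bar> * (norm (dx b U (t,x)) * 2))"
     by (rule ci[where n=n], intro continuous_intros \<zeta>c cs[OF t]) (use KK in auto)
    fix x assume "norm (w (t,x)) \<le> 2"
    then show "\<bar>err n (t,x)\<bar> \<le> (\<Sum>b\<in>Basis. \<bar>d\<zeta> n x b\<bar> * (norm (dx b U (t,x)) * 2))"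
     using err0[of n "(t,x)"] unfolding err_def by (auto intro!: sum_mono mult_left_mono)
   qed
   have igg: "integrable MB (\<lambda>x. \<zeta> n x * gg x)"
   proof (rule L1_bound[OF gg_integrable])
    show "(\<lambda>x. \<zeta> n x * gg x) \<in> borel_measurable MB" using borel_measurable_integrable[OF gg_integrable] by measurable
    show "AE x in MB. norm (\<zeta> n x * gg x) \<le> norm (gg x)"
     using \<zeta>b gg_nonneg by (intro AE_I2) (simp add: abs_mult mult_left_le_one_le)
   qed
   have igs: "integrable MB (\<lambda>x. \<zeta> n x * gsq (t,x))"
    by (rule ci[where n=n], intro continuous_intros \<zeta>c cs[OF t], use KK in force)
   have Esplit: "E n (t,x) = exp (- c * t) * ((\<zeta> n x * gg x)/2 - (\<zeta> n x * gsq (t,x))/2) + err n (t,x)" for x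
    by (simp add: E_def algebra_simps diff_divide_distrib)
   have iE: "integrable MB (\<lambda>x. E n (t,x))"
    unfolding Esplit using igg igs ierr by simp
   have "LI MB (\<Phi>' n t) \<le> (\<integral>x. exp (- c * t) * (\<zeta> n x * (w (t,x) \<bullet> Lap (t,x))) \<partial>MB)"
   proof (rule integral_mono_AE[OF i\<Phi> integrable_mult_right])
    show "AE x in MB. \<Phi>' n t x \<le> exp (- c * t) * (\<zeta> n x * (w (t,x) \<bullet> Lap (t,x)))"
     using w_bounds[OF t] AE_space
    proof eventually_elim
     case (elim x)
     then have z: "(t,x) \<in> Q" using t by (auto simp: space_restrict_space)
     have "\<bar>w (t,x) \<bullet> fz (t,x)\<bar> \<le> 2 * max 1 lam * (w (t,x) \<bullet> w (t,x))"
      by (rule w_fz_bound[OF z]) (use elim in auto)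
     then have "w (t,x) \<bullet> dt U (t,x) - c/2 * (w (t,x) \<bullet> w (t,x)) \<le> w (t,x) \<bullet> Lap (t,x)"
      using pde'[OF z] by (simp add: inner_diff_right c_def)
     then have "exp (- c * t) * (\<zeta> n x * (w (t,x) \<bullet> dt U (t,x) - c/2 * (w (t,x) \<bullet> w (t,x)))) \<le> exp (- c * t) * (\<zeta> n x * (w (t,x) \<bullet> Lap (t,x)))"
      using \<zeta>b(1) by (intro mult_left_mono) auto
     then show ?case by (simp add: \<Phi>'_def mult.left_commute)
    qed
   qed (rule iL)
   also have "\<dots> = exp (- c * t) * LI MB R"
    using \<open>(\<integral>x. \<zeta> n x * (w (t, x) \<bullet> Lap (t, x)) \<partial>MB) = LI MB R\<close> by simp
   also have "\<dots> = (\<integral>x. exp (- c * t) * R x \<partial>MB)" by simp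
   also have "\<dots> \<le> (\<integral>x. E n (t,x) \<partial>MB)"
   proof (rule integral_mono[OF integrable_mult_right[OF Ri] iE])
    fix x
    have a1: "(\<Sum>b\<in>Basis. g b x \<bullet> dx b U (t,x)) \<le> gg x/2 + gsq (t,x)/2"
    proof -
     have "g b x \<bullet> dx b U (t,x) \<le> nsq (g b x)/2 + nsq (dx b U (t,x))/2" for b
     proof -
      have "0 \<le> nsq (g b x - dx b U (t,x))" by simp
      then show ?thesis unfolding power2_norm_eq_inner by (simp add: inner_simps inner_commute)
     qed
     then have "(\<Sum>b\<in>Basis. g b x \<bullet> dx b U (t,x)) \<le> (\<Sum>b\<in>Basis. nsq (g b x)/2 + nsq (dx b U (t,x))/2)" by (rule sum_mono)
     then show ?thesis by (simp add: gg_def gsq_def sum.distrib sum_divide_distrib)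
    qed
    have a2: "(\<Sum>b\<in>Basis. dx b U (t,x) \<bullet> dx b U (t,x)) = gsq (t,x)" by (simp add: gsq_def dot_square_norm)
    have a3: "- (\<Sum>b\<in>Basis. d\<zeta> n x b * (U (t,x) \<bullet> dx b U (t,x))) + (\<Sum>b\<in>Basis. d\<zeta> n x b * (v0 x \<bullet> dx b U (t,x))) \<le> err n (t,x)"
    proof -
     have "- (\<Sum>b\<in>Basis. d\<zeta> n x b * (U (t,x) \<bullet> dx b U (t,x))) + (\<Sum>b\<in>Basis. d\<zeta> n x b * (v0 x \<bullet> dx b U (t,x)))
      = (\<Sum>b\<in>Basis. - (d\<zeta> n x b * (w (t,x) \<bullet> dx b U (t,x))))"
      by (simp add: w_def inner_diff_left right_diff_distrib sum_subtractf sum_negf)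
     also have "\<dots> \<le> err n (t,x)" unfolding err_def
     proof (rule sum_mono)
      fix b
      have "\<bar>w (t,x) \<bullet> dx b U (t,x)\<bar> \<le> norm (dx b U (t,x)) * norm (w (t,x))"
       using Cauchy_Schwarz_ineq2[of "w (t,x)" "dx b U (t,x)"] by (simp add: mult.commute)
      then have "\<bar>d\<zeta> n x b * (w (t,x) \<bullet> dx b U (t,x))\<bar> \<le> \<bar>d\<zeta> n x b\<bar> * (norm (dx b U (t,x)) * norm (w (t,x)))"
       unfolding abs_mult by (intro mult_left_mono) auto
      then show "- (d\<zeta> n x b * (w (t,x) \<bullet> dx b U (t,x))) \<le> \<bar>d\<zeta> n (snd (t,x)) b\<bar> * (norm (dx b U (t,x)) * norm (w (t,x)))"
       by simp
     qed
     finally show ?thesis .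
    qed
    have "R x \<le> \<zeta> n x * (gg x/2 - gsq (t,x)/2) + err n (t,x)"
    proof -
     have "\<zeta> n x * (\<Sum>b\<in>Basis. g b x \<bullet> dx b U (t,x)) \<le> \<zeta> n x * (gg x/2 + gsq (t,x)/2)"
      using a1 \<zeta>b(1) by (rule mult_left_mono)
     moreover have "\<zeta> n x * (gg x/2 + gsq (t,x)/2) - \<zeta> n x * gsq (t,x) = \<zeta> n x * (gg x/2 - gsq (t,x)/2)"
      by (simp add: algebra_simps)
     ultimately show ?thesis using a3 unfolding R_def a2 by linarith
    qed
    then have "exp (- c * t) * R x \<le> exp (- c * t) * (\<zeta> n x * (gg x/2 - gsq (t,x)/2) + err n (t,x))"
     by (intro mult_left_mono) auto
    also have "\<dots> \<le> E n (t,x)"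
    proof -
     have "exp (- c * t) * err n (t,x) \<le> 1 * err n (t,x)" using err0 c0 t by (intro mult_right_mono) auto
     then show ?thesis by (simp add: E_def distrib_left)
    qed
    finally show "exp (- c * t) * R x \<le> E n (t,x)" .
   qed
   finally show "LI MB (\<Phi>' n t) \<le> (\<integral>x. E n (t,x) \<partial>MB)" .
  qed
 qed (use ab in auto)
 have lim\<Phi>: "(\<lambda>n. LI MB (\<Phi> n t)) ----> exp (- c * t) * (W t/2)" if t: "t \<in> {0<..<T}" for t
 proof -
  have "(\<lambda>n. LI MB (\<Phi> n t)) ----> (\<integral>x. 1 * (exp (- c * t) * ((w (t,x) \<bullet> w (t,x))/2)) \<partial>MB)"
  proof (rule integral_dominated_convergence[OF _ _ wwi[OF t]])
   show "AE x in MB. (\<lambda>n. \<Phi> n t x) ----> 1 * (exp (- c * t) * ((w (t,x) \<bullet> w (t,x))/2))"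
    unfolding \<Phi>_def using \<zeta>b(3) by (intro AE_I2 tendsto_intros) (auto simp: space_restrict_space)
   show "AE x in MB. norm (\<Phi> n t x) \<le> w (t,x) \<bullet> w (t,x)" for n
   proof (rule AE_I2)
    fix x
    have "\<Phi> n t x \<le> 1 * (1 * ((w (t,x) \<bullet> w (t,x))/1))" unfolding \<Phi>_def
     using \<zeta>b c0 t by (intro mult_mono divide_left_mono) auto
    moreover have "\<Phi> n t x \<ge> 0" unfolding \<Phi>_def using \<zeta>b by simp
    ultimately show "norm (\<Phi> n t x) \<le> w (t,x) \<bullet> w (t,x)" by simp
   qed
   show "\<Phi> n t \<in> borel_measurable MB" for n using \<Phi>i[OF t] by simp
  qed (use borel_measurable_integrable[OF wwi[OF t]] in measurable)
  then show ?thesis using wwi[OF t] by (simp add: W_def ww)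
 qed
 have limE: "(\<lambda>n. LI ?P (E n)) ----> (\<integral>z. exp (- c * fst z) * (1 * (gg (snd z)/2 - gsq z/2)) \<partial>?P)"
 proof (rule integral_dominated_convergence[OF _ _ I1])
  show "AE z in ?P. (\<lambda>n. E n z) ----> exp (- c * fst z) * (1 * (gg (snd z)/2 - gsq z/2))"
  proof (rule AE_I2)
   fix z assume "z \<in> space ?P"
   then have "z \<in> Q" by (rule spQ)
   then have x: "snd z \<in> BB" by auto
   have "(\<lambda>n. E n z) ----> exp (- c * fst z) * (1 * (gg (snd z)/2 - gsq z/2)) + (\<Sum>b\<in>Basis. \<bar>0\<bar> * (norm (dx b U z) * norm (w z)))"
    unfolding E_def err_def by (intro tendsto_intros \<zeta>b(3)[OF x] d\<zeta>b(2)[OF x])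
   then show "(\<lambda>n. E n z) ----> exp (- c * fst z) * (1 * (gg (snd z)/2 - gsq z/2))" by simp
  qed
  show "AE z in ?P. norm (E n z) \<le> gg (snd z) + gsq z + (\<Sum>b\<in>(Basis::'a set). L * (hq z + gsq z))" for n
   using Eb spQ by (intro AE_I2) auto
  show "(\<lambda>z. exp (- c * fst z) * (1 * (gg (snd z)/2 - gsq z/2))) \<in> borel_measurable ?P"
   using gP ggP by (intro borel_measurable_times em borel_measurable_diff borel_measurable_divide borel_measurable_const) auto
 qed (use Em in auto)
 have "exp (- c * b) * (W b/2) - exp (- c * a) * (W a/2) \<le> (\<integral>z. exp (- c * fst z) * (1 * (gg (snd z)/2 - gsq z/2)) \<partial>?P)"
 proof (rule LIMSEQ_le[OF tendsto_diff[OF lim\<Phi> lim\<Phi>] limE])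
  show "\<exists>N. \<forall>n\<ge>N. LI MB (\<Phi> n b) - LI MB (\<Phi> n a) \<le> LI ?P (E n)"
   using step by simp
 qed (use ab in auto)
 \<comment> \<open>The weight is bounded above by 1 where it multiplies the data, and below by its
   value at \<open>b\<close> where it multiplies the gradient of the flow.\<close>
 also have "\<dots> \<le> (\<integral>z. gg (snd z)/2 - exp (- c * b) * (gsq z/2) \<partial>?P)"
 proof (rule integral_mono)
  show "integrable ?P (\<lambda>z. exp (- c * fst z) * (1 * (gg (snd z)/2 - gsq z/2)))"
  proof (rule L1_bound)
   show "integrable ?P (\<lambda>z. gg (snd z) + gsq z)" using gP ggP by simp
   show "(\<lambda>z. exp (- c * fst z) * (1 * (gg (snd z)/2 - gsq z/2))) \<in> borel_measurable ?P"
    using gP ggP by (intro borel_measurable_times em borel_measurable_diff borel_measurable_divide borel_measurable_const) auto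
   show "AE z in ?P. norm (exp (- c * fst z) * (1 * (gg (snd z)/2 - gsq z/2))) \<le> norm (gg (snd z) + gsq z)"
   proof (rule AE_I2)
    fix z assume "z \<in> space ?P"
    then have "fst z > 0" using spQ[of z] by (simp add: mem_Times_iff)
    then have "exp (- c * fst z) * \<bar>gg (snd z)/2 - gsq z/2\<bar> \<le> 1 * (gg (snd z) + gsq z)"
     using c0 gg_nonneg[of "snd z"] gsq_nonneg[of z] by (intro mult_mono) auto
    then show "norm (exp (- c * fst z) * (1 * (gg (snd z)/2 - gsq z/2))) \<le> norm (gg (snd z) + gsq z)"
     using gg_nonneg[of "snd z"] gsq_nonneg[of z] by (simp add: abs_mult)
   qed
  qed
  show "integrable ?P (\<lambda>z. gg (snd z)/2 - exp (- c * b) * (gsq z/2))" using gP ggP by simp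
  fix z assume z: "z \<in> space ?P"
  then have f: "fst z > 0" using spQ[of z] by (simp add: mem_Times_iff)
  have fb: "fst z \<le> b" using z by (auto simp: spaces)
  have "exp (- c * fst z) * (gg (snd z)/2) \<le> 1 * (gg (snd z)/2)"
   using c0 f gg_nonneg by (intro mult_right_mono) auto
  moreover have "exp (- c * b) * (gsq z/2) \<le> exp (- c * fst z) * (gsq z/2)"
   using c0 fb gsq_nonneg by (intro mult_right_mono) auto
  ultimately show "exp (- c * fst z) * (1 * (gg (snd z)/2 - gsq z/2)) \<le> gg (snd z)/2 - exp (- c * b) * (gsq z/2)"
   by (simp add: right_diff_distrib)
 qed
 also have "\<dots> = (b - a) * M0/2 - exp (- c * b) * (LI ?P gsq/2)"
  using gP ggP by simp
 finally have "exp (- c * b) * (W b/2) + exp (- c * b) * (LI ?P gsq/2) \<le> exp (- c * a) * (W a/2) + (b - a) * M0/2"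
  by linarith
 moreover have "exp (- c * a) * (W a/2) \<le> 1 * (W a/2)"
  using c0 ab W_nonneg by (intro mult_right_mono) auto
 ultimately show ?thesis by (simp add: c_def distrib_left)
qed

end

lemma integral_pair_mono_set:
 fixes F :: "real \<times> 'a::euclidean_space => real"
 assumes F: "integrable (lborel2 J B) F" and F0: "\<And>z. F z \<ge> 0"
  and IJ: "I \<subseteq> J" "I \<in> sets borel" "J \<in> sets borel" "B \<in> sets borel"
 shows "LI (lborel2 I B) F \<le> LI (lborel2 J B) F"
proof -
 have m: "F \<in> borel_measurable (lborel2 J B)" using F by simp
 note m' = measurable_pair_subset[OF m IJ(1)]
 have iI: "integrable (lborel2 I B) F" by (rule integrable_pair_subset[OF F IJ])
 have "ennreal (LI (lborel2 I B) F) = (\<integral>\<^sup>+z. F z \<partial>(lborel2 I B))"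
  using F0 by (intro nn_integral_eq_integral[symmetric] iI) auto
 also have "\<dots> = (\<integral>\<^sup>+t. (\<integral>\<^sup>+x. F (t,x) \<partial>lborel_on B) \<partial>lborel_on I)"
  using m' by (intro nn_integral_pair IJ) auto
 also have "\<dots> \<le> (\<integral>\<^sup>+t. (\<integral>\<^sup>+x. F (t,x) \<partial>lborel_on B) \<partial>lborel_on J)"
  using IJ by (auto simp: nn_integral_restrict_space intro!: nn_integral_mono split: split_indicator)
 also have "\<dots> = (\<integral>\<^sup>+z. F z \<partial>(lborel2 J B))"
  using m by (intro nn_integral_pair[symmetric] IJ) auto
 also have "\<dots> = ennreal (LI (lborel2 J B) F)"
  using F0 by (intro nn_integral_eq_integral F) auto
 finally show ?thesis using F0 by (subst (asm) ennreal_le_iff) (auto intro!: L1_nonneg)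
qed

context glh begin

text \<open>The starting time of the previous estimate is pushed to 0, where \<open>W\<close>
  vanishes; the gradient integral only grows as the interval does.\<close>

lemma weighted_L2_limit:
 assumes ab: "0 < a" "a < b" "b < T"
 shows "exp (- (4 * max 1 lam) * b) * (W b/2 + LI (PJ a b) gsq/2) \<le> b * M0/2"
proof -
 have "\<forall>\<^sub>F s in at_right 0. s \<in> {0<..<a}"
  using ab eventually_at_right_field[of "\<lambda>s. s \<in> {0<..<a}" 0] by auto
 then have "\<forall>\<^sub>F s in at_right 0. exp (- (4 * max 1 lam) * b) * (W b/2 + LI (PJ a b) gsq/2) \<le> W s/2 + (b - s) * M0/2"
 proof eventually_elim
  case (elim s)
  have "LI (PJ a b) gsq \<le> LI (PJ s b) gsq"
   using elim ab gsq_nonneg by (intro integral_pair_mono_set integrable_pair_subset[OF gsq_integrable]) auto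
  then have "exp (- (4 * max 1 lam) * b) * (W b/2 + LI (PJ a b) gsq/2)
   \<le> exp (- (4 * max 1 lam) * b) * (W b/2 + LI (PJ s b) gsq/2)"
   by (intro mult_left_mono) auto
  also have "\<dots> \<le> W s/2 + (b - s) * M0/2"
   using elim ab by (intro weighted_L2_estimate) auto
  finally show ?case .
 qed
 moreover have "((\<lambda>s. W s/2 + (b - s) * M0/2) \<longlongrightarrow> 0/2 + (b - 0) * M0/2) (at_right 0)"
  by (intro tendsto_intros W_tendsto) auto
 ultimately show ?thesis by (intro tendsto_lowerbound[of "\<lambda>s. W s/2 + (b - s) * M0/2"]) auto
qed

lemma W_le:
 assumes "0 < b" "b < T" shows "W b \<le> exp (4 * max 1 lam * b) * b * M0"
proof -
 have "LI (lborel2 {b/2..b} BB) gsq \<ge> 0" using gsq_nonneg by simp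
 then have "exp (- (4 * max 1 lam) * b) * (W b/2) \<le> exp (- (4 * max 1 lam) * b) * (W b/2 + LI (lborel2 {b/2..b} BB) gsq/2)"
  by (intro mult_left_mono) auto
 also have "\<dots> \<le> b * M0/2" using assms by (intro weighted_L2_limit) auto
 finally show ?thesis by (simp add: exp_minus field_simps)
qed

text \<open>Divided by \<open>b\<close>, the bound tends to \<open>M0\<close> as \<open>b\<close>
  tends to 0, and the factor depending on \<open>lam\<close> disappears. This replaces continuity of
  the energy at time 0.\<close>

lemma gsq_time_integral_le:
 assumes "0 < a" "a < b" "b < T"
 shows "LI (PJ a b) gsq \<le> exp (4 * max 1 lam * b) * b * M0"
proof -
 have "exp (- (4 * max 1 lam) * b) * (LI (PJ a b) gsq/2) \<le> exp (- (4 * max 1 lam) * b) * (W b/2 + LI (PJ a b) gsq/2)"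
  using W_nonneg by (intro mult_left_mono) auto
 also have "\<dots> \<le> b * M0/2" using assms by (intro weighted_L2_limit) auto
 finally show ?thesis by (simp add: exp_minus field_simps)
qed

section \<open>Steklov averages in time\<close>

definition "good t \<longleftrightarrow> t \<in> {0<..<T} \<and> integrable MB (\<lambda>x. gsq (t,x)) \<and> integrable MB (\<lambda>x. hq (t,x))"

text \<open>The equation is integrated over [t, t + h] against the increment
  \<open>z = u (t + h) - u t\<close>, which does not depend on the running time. At good times both
  maps have the boundary values of u0 in the sense of Hardy's inequality, so \<open>z\<close> has
  zero boundary values and the cutoff errors vanish.\<close>

lemma steklov_slice:
 assumes h: "h > 0" and gt: "good t" "good (t + h)"
 defines "z \<equiv> \<lambda>x. U (t + h, x) - U (t,x)" and "dz \<equiv> \<lambda>b x. dx b U (t + h, x) - dx b U (t,x)"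
 shows "integrable (lborel2 {t..t+h} BB) (\<lambda>y. (\<Sum>b\<in>Basis. dz b (snd y) \<bullet> dx b U y) + fz y \<bullet> z (snd y))"
  and "(\<integral>x. z x \<bullet> z x \<partial>MB) = - (\<integral>y. (\<Sum>b\<in>Basis. dz b (snd y) \<bullet> dx b U y) + fz y \<bullet> z (snd y) \<partial>(lborel2 {t..t+h} BB))"
proof -
 have tT: "t \<in> {0<..<T}" "t + h \<in> {0<..<T}" using gt by (auto simp: good_def)
 obtain \<zeta> d\<zeta> L and KK :: "nat => 'a set" where "cutoffs \<zeta> d\<zeta> KK L" using cutoffs_exist by blast
 then interpret cutoffs \<zeta> d\<zeta> KK L .
 have sub: "{t..t+h} \<subseteq> {0<..<T}" using tT by auto
 let ?P = "lborel2 {t..t+h} BB"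
 interpret pair_sigma_finite "lborel_on {t..t+h}" MB by (intro pair_sigma_finite_lborel_on) auto
 have spQ: "y \<in> Q" if "y \<in> space ?P" for y
  using that sub by (auto simp: spaces)
 have cs: "continuous_on BB (\<lambda>x. Lap (t,x))" "continuous_on BB (\<lambda>x. U (t,x))" 
   "continuous_on BB (\<lambda>x. dt U (t,x))" "continuous_on BB (\<lambda>x. dx v U (t,x))" 
   "continuous_on BB (\<lambda>x. dx v (dx v U) (t,x))" "continuous_on BB (\<lambda>x. fz (t,x))"
   if "t \<in> {0<..<T}" for t v
   using that by (auto intro!: slice_cont_x Lap_cont conts fz_cont)
 have zc: "continuous_on BB z" "continuous_on BB (dz b)" for b
  unfolding z_def dz_def by (intro continuous_intros cs tT)+
 have zc2: "continuous_on Q (\<lambda>y. z (snd y))" "continuous_on Q (\<lambda>y. dz b (snd y))" for b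
  by (auto intro!: continuous_on_compose2[OF zc(1)] continuous_on_compose2[OF zc(2)] continuous_intros)
 have zd: "(z has_derivative (\<lambda>v. dz v x)) (at x)" if "x \<in> BB" for x
  unfolding z_def dz_def by (intro has_derivative_diff slice_deriv_x smooth tT that)
 \<comment> \<open>\<open>z\<close> is the difference of two values of \<open>w\<close>, so its
   Hardy quotient is controlled by those at \<open>t\<close> and \<open>t + h\<close>.\<close>
 define Y where "Y x = 2 * hq (t + h, x) + 2 * hq (t,x)" for x
 define X where "X x = 2 * gsq (t + h, x) + 2 * gsq (t,x)" for x
 have Xi: "integrable MB X" and Yi: "integrable MB Y"
  using gt unfolding X_def Y_def good_def by auto
 have Yb: "(norm (z x)/\<rho> x)^2 \<le> Y x" for x
 proof -
  have "z x = w (t + h, x) - w (t,x)" by (simp add: z_def w_def)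
  then have "nsq (z x) \<le> 2 * nsq (w (t + h, x)) + 2 * nsq (w (t,x))" by (simp add: norm_diff_sq_le)
  then have "nsq (z x)/(\<rho> x)^2 \<le> (2 * nsq (w (t + h, x)) + 2 * nsq (w (t,x)))/(\<rho> x)^2"
   by (rule divide_right_mono) simp
  then show ?thesis by (simp add: Y_def hq_def power_divide add_divide_distrib)
 qed
 have Xb: "(\<Sum>b\<in>Basis. nsq (dz b x)) \<le> X x" for x
 proof -
  have "(\<Sum>b\<in>Basis. nsq (dz b x)) \<le> (\<Sum>b\<in>Basis. 2 * nsq (dx b U (t + h, x)) + 2 * nsq (dx b U (t,x)))"
   unfolding dz_def by (intro sum_mono norm_diff_sq_le)
  then show ?thesis by (simp add: X_def gsq_def sum.distrib sum_distrib_left)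
 qed
 have XP: "integrable ?P (\<lambda>y. X (snd y))" and YP: "integrable ?P (\<lambda>y. Y (snd y))"
  using integrable_snd_finite(1)[OF Xi, of t "t + h"] integrable_snd_finite(1)[OF Yi, of t "t + h"] h by auto
 have gP: "integrable ?P gsq" by (rule integrable_pair_subset[OF gsq_integrable sub]) auto
 interpret MBf: finite_measure MB by (rule finite_MB)
 have cP: "integrable ?P (\<lambda>y. k)" for k :: real
  using integrable_snd_finite(1)[OF MBf.integrable_const, of t "t + h" k] h by simp
 have zbd: "norm (z x) \<le> 2" if "x \<in> BB" for x
 proof -
  have "norm (U (t + h, x)) \<le> 1" "norm (U (t,x)) \<le> 1" using that tT by (auto intro!: max_principle)
  then show ?thesis unfolding z_def using norm_triangle_ineq4[of "U (t + h, x)" "U (t,x)"] by linarith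
 qed
 define R where "R y = (\<Sum>b\<in>Basis. dz b (snd y) \<bullet> dx b U y) + fz y \<bullet> z (snd y)" for y
 define err where "err n y = (\<Sum>b\<in>Basis. d\<zeta> n (snd y) b * (z (snd y) \<bullet> dx b U y))" for n y
 define E where "E n y = - (\<zeta> n (snd y) * R y) - err n y" for n y
 have Rc: "continuous_on Q R" unfolding R_def[abs_def] by (intro continuous_intros zc2 conts fz_cont)
 have errc: "continuous_on Q (err n)" for n unfolding err_def[abs_def] by (intro continuous_intros zc2 conts \<zeta>c2)
 have Ec: "continuous_on Q (E n)" for n unfolding E_def[abs_def] by (intro continuous_intros \<zeta>c2 Rc errc)
 define Dm where "Dm y = X (snd y) + gsq y + max 1 lam * 2" for y
 have DmP: "integrable ?P Dm" unfolding Dm_def using XP gP cP by simp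
 have Rb: "\<bar>R y\<bar> \<le> Dm y" if y: "y \<in> Q" for y
 proof -
  have "\<bar>\<Sum>b\<in>Basis. dz b (snd y) \<bullet> dx b U y\<bar> \<le> (\<Sum>b\<in>Basis. nsq (dz b (snd y)) + nsq (dx b U y))"
  proof (rule order_trans[OF sum_abs], rule sum_mono)
   fix b
   have "\<bar>dz b (snd y) \<bullet> dx b U y\<bar> \<le> norm (dz b (snd y)) * norm (dx b U y)" by (rule Cauchy_Schwarz_ineq2)
   also have "\<dots> \<le> nsq (dz b (snd y)) + nsq (dx b U y)" by (intro mult_le_sum_squares) auto
   finally show "\<bar>dz b (snd y) \<bullet> dx b U y\<bar> \<le> nsq (dz b (snd y)) + nsq (dx b U y)" .
  qed
  then have 1: "\<bar>\<Sum>b\<in>Basis. dz b (snd y) \<bullet> dx b U y\<bar> \<le> X (snd y) + gsq y"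
   using Xb[of "snd y"] by (simp add: sum.distrib gsq_def)
  have "\<bar>fz y \<bullet> z (snd y)\<bar> \<le> norm (fz y) * norm (z (snd y))" by (rule Cauchy_Schwarz_ineq2)
  also have "\<dots> \<le> max 1 lam * 2" using fz_bounded[OF y] zbd[of "snd y"] y by (intro mult_mono) auto
  finally show ?thesis using 1 unfolding R_def Dm_def by linarith
 qed
 have errb: "\<bar>err n y\<bar> \<le> (\<Sum>b\<in>(Basis::'a set). L * (Y (snd y) + gsq y))" if y: "y \<in> Q" for n y
  unfolding err_def
 proof (rule order_trans[OF sum_abs], rule sum_mono)
  fix b :: 'a assume b: "b \<in> Basis"
  have x: "snd y \<in> BB" using y by auto
  have "\<bar>d\<zeta> n (snd y) b * (z (snd y) \<bullet> dx b U y)\<bar> = \<bar>d\<zeta> n (snd y) b\<bar> * \<bar>z (snd y) \<bullet> dx b U y\<bar>" by (rule abs_mult)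
  also have "\<dots> \<le> (L/\<rho> (snd y)) * (norm (z (snd y)) * norm (dx b U y))"
   using d\<zeta>b(1)[OF x b, of n] L rho_pos[OF x] by (intro mult_mono Cauchy_Schwarz_ineq2) (auto simp: \<rho>_def)
  also have "\<dots> = L * ((norm (z (snd y))/\<rho> (snd y)) * norm (dx b U y))" by simp
  also have "\<dots> \<le> L * ((norm (z (snd y))/\<rho> (snd y))^2 + nsq (dx b U y))"
   using L rho_pos[OF x] by (intro mult_left_mono mult_le_sum_squares) auto
  also have "\<dots> \<le> L * (Y (snd y) + gsq y)"
   using L b Yb[of "snd y"] unfolding gsq_def by (intro mult_left_mono add_mono member_le_sum) auto
  finally show "\<bar>d\<zeta> n (snd y) b * (z (snd y) \<bullet> dx b U y)\<bar> \<le> L * (Y (snd y) + gsq y)" .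
 qed
 have I1: "integrable ?P (\<lambda>y. Dm y + (\<Sum>b\<in>(Basis::'a set). L * (Y (snd y) + gsq y)))"
  using DmP YP gP by simp
 have Eb: "\<bar>E n y\<bar> \<le> Dm y + (\<Sum>b\<in>(Basis::'a set). L * (Y (snd y) + gsq y))" if y: "y \<in> Q" for n y
 proof -
  have "\<bar>\<zeta> n (snd y) * R y\<bar> \<le> 1 * Dm y"
   unfolding abs_mult using \<zeta>b Rb[OF y] by (intro mult_mono) auto
  then show ?thesis using errb[OF y, of n] unfolding E_def by linarith
 qed
 have EP: "integrable ?P (E n)" for n
 proof (rule L1_bound[OF I1 meas_Q[OF Ec sub]], rule AE_I2)
  fix y assume "y \<in> space ?P"
  from Eb[OF spQ[OF this], of n]
  show "norm (E n y) \<le> norm (Dm y + (\<Sum>b\<in>(Basis::'a set). L * (Y (snd y) + gsq y)))"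
   unfolding real_norm_def by (rule order_trans[OF _ abs_ge_self])
 qed
 have RP: "integrable ?P R"
 proof (rule L1_bound[OF DmP meas_Q[OF Rc sub]], rule AE_I2)
  fix y assume "y \<in> space ?P"
  from Rb[OF spQ[OF this]]
  show "norm (R y) \<le> norm (Dm y)" unfolding real_norm_def by (rule order_trans[OF _ abs_ge_self])
 qed
 then show "integrable ?P (\<lambda>y. (\<Sum>b\<in>Basis. dz b (snd y) \<bullet> dx b U y) + fz y \<bullet> z (snd y))" by (simp add: R_def[abs_def])
 have step: "(\<integral>x. \<zeta> n x * (z x \<bullet> z x) \<partial>MB) = LI ?P (E n)" for n
 proof -
  define \<Phi> where "\<Phi> s x = \<zeta> n x * (U (s, x) \<bullet> z x)" for s x
  define \<Phi>' where "\<Phi>' s x = \<zeta> n x * (dt U (s, x) \<bullet> z x)" for s x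
  have \<Phi>i: "integrable MB (\<Phi> s)" if "s \<in> {0<..<T}" for s
   unfolding \<Phi>_def by (rule ci[where n=n], intro continuous_intros \<zeta>c zc cs[OF that]) (use KK(3) in auto)
  have "LI MB (\<Phi> (t + h)) - LI MB (\<Phi> t) = (\<integral>s. (\<integral>x. \<Phi>' s x \<partial>MB) \<partial>lborel_on {t..t+h})"
  proof (rule time_FTC)
   show "((\<lambda>s. \<Phi> s x) has_real_derivative \<Phi>' s x) (at s)" if "x \<in> BB" "s \<in> {t..t+h}" for x s
   proof -
    have s: "s \<in> {0<..<T}" using that sub by auto
    have dU: "((\<lambda>s. U (s, x)) has_derivative (\<lambda>k. k .* dt U (s, x))) (at s)"
     using slice_deriv_t[OF smooth s that(1)] by (simp add: has_vector_derivative_def)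
    have "((\<lambda>s. U (s, x) \<bullet> z x) has_real_derivative (dt U (s, x) \<bullet> z x)) (at s)"
     unfolding has_field_derivative_def
     by (rule has_derivative_eq_rhs[OF has_derivative_inner_left[OF dU]]) (simp add: fun_eq_iff)
    then show ?thesis unfolding \<Phi>_def \<Phi>'_def by (rule DERIV_cmult)
   qed
   show "continuous_on {t..t+h} (\<lambda>s. \<Phi>' s x)" if "x \<in> BB" for x
    unfolding \<Phi>'_def using that tT by (intro continuous_intros slice_cont_t[OF conts(3)]) auto
   show "integrable ?P (\<lambda>(s, x). \<Phi>' s x)"
   proof (rule integrable_pair_compact_support[OF KK(1,2)])
    have *: "continuous_on ({t..t+h} \<times> BB) F" if "continuous_on Q F" for F :: "real \<times> 'a => 'c::topological_space"
     by (rule continuous_on_subset[OF that]) (use sub in auto)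
    show "continuous_on ({t..t+h} \<times> BB) (\<lambda>(s, x). \<Phi>' s x)"
     unfolding \<Phi>'_def case_prod_beta prod.collapse
     by (intro continuous_intros \<zeta>c2 *[OF zc2(1)] *[OF conts(3)])
   qed (use KK(3) in \<open>auto simp: \<Phi>'_def\<close>)
  qed (use h tT in \<open>auto intro!: \<Phi>i\<close>)
  also have "(\<integral>s. (\<integral>x. \<Phi>' s x \<partial>MB) \<partial>lborel_on {t..t+h}) = (\<integral>s. (\<integral>x. E n (s, x) \<partial>MB) \<partial>lborel_on {t..t+h})"
  proof (rule L1_cong[OF refl])
   fix s assume "s \<in> space (lborel_on {t..t+h})"
   then have s: "s \<in> {0<..<T}" using sub by (auto simp: space_restrict_space)
   have G: "(\<integral>x. \<zeta> n x * (z x \<bullet> (\<Sum>b\<in>Basis. dx b (dx b U) (s, x))) \<partial>MB)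
     = - (\<integral>x. \<zeta> n x * (\<Sum>b\<in>Basis. dz b x \<bullet> dx b U (s, x)) \<partial>MB)
      - (\<integral>x. (\<Sum>b\<in>Basis. d\<zeta> n x b * (z x \<bullet> dx b U (s, x))) \<partial>MB)"
    by (rule green_cutoff[OF open_ball KK(1,2) \<zeta> KK(3,4) zd, where p' = "\<lambda>b x v. dx v (dx b U) (s, x)"])
     (auto intro!: cs s zc slice_deriv_x[OF smooths(2) s])
   have i1: "integrable MB (\<lambda>x. \<zeta> n x * (z x \<bullet> (\<Sum>b\<in>Basis. dx b (dx b U) (s, x))))"
    by (rule ci[where n=n], intro continuous_intros \<zeta>c cs[OF s] zc) (use KK(3) in auto)
   have i2: "integrable MB (\<lambda>x. \<zeta> n x * (\<Sum>b\<in>Basis. dz b x \<bullet> dx b U (s, x)))"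
    by (rule ci[where n=n], intro continuous_intros \<zeta>c cs[OF s] zc) (use KK(3) in auto)
   have i3: "integrable MB (\<lambda>x. \<Sum>b\<in>Basis. d\<zeta> n x b * (z x \<bullet> dx b U (s, x)))"
    by (rule ci[where n=n], intro continuous_intros \<zeta>c cs[OF s] zc) (use KK(4) in auto)
   have i4: "integrable MB (\<lambda>x. \<zeta> n x * (fz (s, x) \<bullet> z x))"
    by (rule ci[where n=n], intro continuous_intros \<zeta>c cs[OF s] zc) (use KK(3) in auto)
   have "(\<integral>x. \<Phi>' s x \<partial>MB) = (\<integral>x. \<zeta> n x * (z x \<bullet> (\<Sum>b\<in>Basis. dx b (dx b U) (s, x))) - \<zeta> n x * (fz (s, x) \<bullet> z x) \<partial>MB)"
   proof (rule L1_cong[OF refl])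
    fix x assume "x \<in> space MB"
    then have "(s, x) \<in> Q" using s by (auto simp: space_restrict_space)
    from pde'[OF this] show "\<Phi>' s x = \<zeta> n x * (z x \<bullet> (\<Sum>b\<in>Basis. dx b (dx b U) (s, x))) - \<zeta> n x * (fz (s, x) \<bullet> z x)"
     by (simp add: \<Phi>'_def Lap_def inner_diff_right right_diff_distrib inner_commute[of _ "z x"])
   qed
   also have "\<dots> = - (\<integral>x. \<zeta> n x * (\<Sum>b\<in>Basis. dz b x \<bullet> dx b U (s, x)) \<partial>MB)
      - (\<integral>x. (\<Sum>b\<in>Basis. d\<zeta> n x b * (z x \<bullet> dx b U (s, x))) \<partial>MB) - (\<integral>x. \<zeta> n x * (fz (s, x) \<bullet> z x) \<partial>MB)"
    using i1 i4 G by simp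
   also have "\<dots> = (\<integral>x. - (\<zeta> n x * (\<Sum>b\<in>Basis. dz b x \<bullet> dx b U (s, x))) - (\<Sum>b\<in>Basis. d\<zeta> n x b * (z x \<bullet> dx b U (s, x))) - \<zeta> n x * (fz (s, x) \<bullet> z x) \<partial>MB)"
    using i2 i3 i4 by simp
   also have "\<dots> = (\<integral>x. E n (s, x) \<partial>MB)"
    by (rule L1_cong) (auto simp: E_def R_def err_def distrib_left)
   finally show "(\<integral>x. \<Phi>' s x \<partial>MB) = (\<integral>x. E n (s, x) \<partial>MB)" .
  qed
  also have "\<dots> = LI ?P (E n)" by (rule integral_fst'[OF EP])
  also have "LI MB (\<Phi> (t + h)) - LI MB (\<Phi> t) = (\<integral>x. \<Phi> (t + h) x - \<Phi> t x \<partial>MB)"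
   using \<Phi>i[OF tT(1)] \<Phi>i[OF tT(2)] by simp
  also have "\<dots> = (\<integral>x. \<zeta> n x * (z x \<bullet> z x) \<partial>MB)"
   by (rule L1_cong) (auto simp: \<Phi>_def z_def inner_diff_left right_diff_distrib)
  finally show ?thesis .
 qed
 have l1: "(\<lambda>n. \<integral>x. \<zeta> n x * (z x \<bullet> z x) \<partial>MB) ----> (\<integral>x. 1 * (z x \<bullet> z x) \<partial>MB)"
 proof (rule integral_dominated_convergence[where w="\<lambda>x. 4"])
  show "AE x in MB. (\<lambda>n. \<zeta> n x * (z x \<bullet> z x)) ----> 1 * (z x \<bullet> z x)"
   using \<zeta>b(3) by (intro AE_I2 tendsto_intros) (auto simp: space_restrict_space)
  show "AE x in MB. norm (\<zeta> n x * (z x \<bullet> z x)) \<le> 4" for n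
  proof (rule AE_I2)
   fix x assume "x \<in> space MB"
   then have "nsq (z x) \<le> 2^2" using zbd by (intro power_mono) (auto simp: space_restrict_space)
   then have "\<zeta> n x * (z x \<bullet> z x) \<le> 1 * 4" using \<zeta>b by (intro mult_mono) (auto simp: dot_square_norm)
   then show "norm (\<zeta> n x * (z x \<bullet> z x)) \<le> 4" using \<zeta>b(1)[of n x] by simp
  qed
  show "(\<lambda>x. 1 * (z x \<bullet> z x)) \<in> borel_measurable MB" by (intro borel_measurable_lborel_on continuous_intros zc)
  show "(\<lambda>x. \<zeta> n x * (z x \<bullet> z x)) \<in> borel_measurable MB" for n by (intro borel_measurable_lborel_on continuous_intros zc \<zeta>c)
 qed simp
 have l2: "(\<lambda>n. LI ?P (E n)) ----> (\<integral>y. - (1 * R y) \<partial>?P)"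
 proof (rule integral_dominated_convergence[OF _ _ I1])
  show "AE y in ?P. (\<lambda>n. E n y) ----> - (1 * R y)"
  proof (rule AE_I2)
   fix y assume "y \<in> space ?P"
   then have x: "snd y \<in> BB" using spQ[of y] by (simp add: mem_Times_iff)
   have "(\<lambda>n. E n y) ----> - (1 * R y) - (\<Sum>b\<in>Basis. 0 * (z (snd y) \<bullet> dx b U y))"
    unfolding E_def err_def by (intro tendsto_intros \<zeta>b(3)[OF x] d\<zeta>b(2)[OF x])
   then show "(\<lambda>n. E n y) ----> - (1 * R y)" by simp
  qed
  show "AE y in ?P. norm (E n y) \<le> Dm y + (\<Sum>b\<in>(Basis::'a set). L * (Y (snd y) + gsq y))" for n
   using Eb spQ by (intro AE_I2) auto
 qed (use meas_Q[OF Ec sub] meas_Q[OF Rc sub] in auto)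
 have "(\<integral>x. 1 * (z x \<bullet> z x) \<partial>MB) = (\<integral>y. - (1 * R y) \<partial>?P)"
  using l1 l2 unfolding step by (rule LIMSEQ_unique)
 then have "(\<integral>x. z x \<bullet> z x \<partial>MB) = - LI ?P R" by simp
 then show "(\<integral>x. z x \<bullet> z x \<partial>MB) = - (\<integral>y. (\<Sum>b\<in>Basis. dz b (snd y) \<bullet> dx b U y) + fz y \<bullet> z (snd y) \<partial>?P)"
  unfolding R_def .
qed

end

lemma nn_integral_lborel_on_shift:
 assumes k: "k \<in> borel_measurable (lborel_on {a + h..b + h})"
 shows "(\<integral>\<^sup>+t. k (t + h) \<partial>lborel_on {a..b}) = (\<integral>\<^sup>+t. k t \<partial>lborel_on {a + h..b + (h::real)})"
proof -
 let ?k = "\<lambda>t. k t * indicator {a + h..b + h} t"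
 have m: "?k \<in> borel_measurable borel"
  using k by (subst (asm) borel_measurable_restrict_space_iff_ennreal) auto
 have "(\<integral>\<^sup>+t. k t \<partial>lborel_on {a + h..b + h}) = (\<integral>\<^sup>+t. ?k t \<partial>lborel)"
  by (simp add: nn_integral_restrict_space)
 also have "\<dots> = (\<integral>\<^sup>+t. ?k t \<partial>distr lborel borel ((+) h))" by (simp add: lborel_distr_plus)
 also have "\<dots> = (\<integral>\<^sup>+t. ?k (h + t) \<partial>lborel)"
  using m by (intro nn_integral_distr) auto
 also have "\<dots> = (\<integral>\<^sup>+t. k (t + h) * indicator {a..b} t \<partial>lborel)"
  by (intro nn_integral_cong) (auto simp: indicator_def add.commute)
 also have "\<dots> = (\<integral>\<^sup>+t. k (t + h) \<partial>lborel_on {a..b})"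
  by (simp add: nn_integral_restrict_space)
 finally show ?thesis ..
qed

lemma AE_lborel_shift:
 assumes "AE t in lborel. P t" shows "AE t in lborel. P (t + (h::real))"
proof -
 have "AE t in distr lborel borel ((+) h). P t" using assms unfolding lborel_distr_plus .
 then have "AE t in lborel. P (h + t)" by (rule AE_distrD[rotated]) simp
 then show ?thesis by (simp add: add.commute)
qed

lemma integral_lborel_on_eq:
 fixes f :: "real => 'c::euclidean_space"
 assumes "continuous_on {a..b} f"
 shows "integrable (lborel_on {a..b}) f" "LI (lborel_on {a..b}) f = integral {a..b} f" (is ?c2)
proof -
 show i: "integrable (lborel_on {a..b}) f"
  using assms by (intro integrable_compact_support[of _ "{a..b}"]) auto
 have "set_integrable lborel {a..b} f" using borel_integrable_atLeastAtMost'[OF assms] .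
 then show ?c2
  using set_borel_integral_eq_integral(2)[of "{a..b}" f]
  by (simp add: integral_restrict_space set_lebesgue_integral_def)
qed

text \<open>The Cauchy-Schwarz inequality in time, read off from the nonnegative integral of
  \<open>(|f| - I/h)^2\<close>, where \<open>I/h\<close> is the mean of \<open>|f|\<close>.\<close>

lemma norm_integral_sq_le:
 fixes f :: "real => 'c::euclidean_space"
 assumes c: "continuous_on {t..t + h} f" and h: "h > 0"
 shows "nsq (integral {t..t + h} f) \<le> h * LI (lborel_on {t..t + h}) (\<lambda>s. nsq (f s))"
proof -
 let ?M = "lborel_on {t..t + h}"
 define I where "I = LI ?M (\<lambda>s. norm (f s))"
 have i1: "integrable ?M (\<lambda>s. norm (f s))" and i2: "integrable ?M (\<lambda>s. nsq (f s))"
  by (auto intro!: integral_lborel_on_eq continuous_intros c)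
 interpret finite_measure ?M by (rule finite_measure_lborel_on) auto
 have mh: "measure ?M (space ?M) = h"
  using h by (simp add: space_restrict_space measure_restrict_space)
 have "0 \<le> LI ?M (\<lambda>s. (norm (f s) - I/h)^2)" by simp
 also have "\<dots> = LI ?M (\<lambda>s. nsq (f s) - 2 * (I/h) * norm (f s) + (I/h)^2)"
 proof -
  have "(norm (f s) - I/h)^2 = nsq (f s) - 2 * (I/h) * norm (f s) + (I/h)^2" for s
   unfolding power2_diff by (simp add: mult_ac)
  then show ?thesis by simp
 qed
 also have "\<dots> = LI ?M (\<lambda>s. nsq (f s)) - 2 * (I/h) * I + (I/h)^2 * h"
  using i1 i2 mh by (simp add: I_def)
 also have "\<dots> = LI ?M (\<lambda>s. nsq (f s)) - I^2/h"
  using h by (simp add: power2_eq_square field_simps)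
 finally have *: "I^2 \<le> h * LI ?M (\<lambda>s. nsq (f s))" using h by (simp add: field_simps)
 have "norm (integral {t..t + h} f) \<le> I"
  unfolding I_def integral_lborel_on_eq(2)[OF c, symmetric] by (rule integral_norm_bound)
 then have "nsq (integral {t..t + h} f) \<le> I^2" by (intro power_mono) auto
 with * show ?thesis by simp
qed

text \<open>The Steklov average over [t, t + h] without the factor 1/h. The integral is taken over
  the fixed interval [0, h], so that continuity in (t, x) follows from continuity of parameter
  integrals.\<close>

definition SA :: "real => (real \<times> 'a => 'c) => real \<times> 'a::euclidean_space => 'c::euclidean_space" where
 "SA h F z = integral {0..h} (\<lambda>s. F (fst z + s, snd z))"

lemma SA_eq: "SA h F (t,x) = integral {t..t + h} (\<lambda>s. F (s, x))"
 using integral_shift_Icc_real[of 0 h "\<lambda>s. F (s, x)" t] by (simp add: SA_def o_def add.commute)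

context glh begin

lemma SA_cont:
 fixes F :: "real \<times> 'a => 'c::euclidean_space"
 assumes F: "continuous_on Q F" and h: "h > 0"
 shows "continuous_on ({0<..<T - h} \<times> BB) (SA h F)"
 unfolding SA_def[abs_def]
proof (rule integral_continuous_on_param[of _ 0 h, unfolded cbox_interval])
 show "continuous_on (({0<..<T - h} \<times> BB) \<times> {0..h}) (\<lambda>(z, s). F (fst z + s, snd z))"
  unfolding case_prod_beta
  by (rule continuous_on_compose2[OF F]) (auto intro!: continuous_intros)
qed

lemma SA_cont_x:
 fixes F :: "real \<times> 'a => 'c::euclidean_space"
 assumes "continuous_on Q F" "h > 0" "t \<in> {0<..<T - h}"
 shows "continuous_on BB (\<lambda>x. SA h F (t,x))"
 by (rule continuous_on_compose2[OF SA_cont[OF assms(1,2)]]) (use assms in \<open>auto intro!: continuous_intros\<close>)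

lemma slice_cont_t': "continuous_on Q F ==> x \<in> BB ==> {a..b} \<subseteq> {0<..<T} ==> continuous_on {a..b} (\<lambda>t. F (t,x))"
 by (rule continuous_on_compose2[of Q F]) (auto intro!: continuous_intros)

text \<open>Averaging turns the time derivative into a plain increment, so the energy of averages
  can be differentiated although nothing is yet known about integrability of u_t.\<close>

lemma SA_deriv:
 fixes F :: "real \<times> 'a => 'c::euclidean_space"
 assumes F: "continuous_on Q F" and h: "h > 0" and t: "0 < t" "t + h < T" and x: "x \<in> BB"
 shows "((\<lambda>t. SA h F (t,x)) has_vector_derivative F (t + h, x) - F (t,x)) (at t)"
proof -
 define c where "c = t/2"
 define d where "d = (t + h + T)/2"
 have cd: "0 < c" "c < t" "t + h < d" "d < T" using t by (auto simp: c_def d_def)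
 define f where "f s = F (s, x)" for s
 have fc: "continuous_on {c..d} f" unfolding f_def using cd by (intro slice_cont_t'[OF F x]) auto
 have fi: "f integrable_on {p..q}" if "c \<le> p" "q \<le> d" for p q
  using fc that by (intro integrable_continuous_interval continuous_on_subset[OF fc]) auto
 define P where "P u = integral {c..u} f" for u
 have Pd: "(P has_vector_derivative f u) (at u)" if "c < u" "u < d" for u
 proof -
  have "(P has_vector_derivative f u) (at u within {c..d})"
   unfolding P_def by (rule integral_has_vector_derivative[OF fc]) (use that in auto)
  then show ?thesis by (subst (asm) at_within_interior) (use that in auto)
 qed
 have "((\<lambda>u. P (u + h)) has_vector_derivative f (t + h)) (at t)"
 proof -
  have "((\<lambda>u. u + h) has_vector_derivative 1) (at t)" by (auto intro!: derivative_eq_intros)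
  moreover have "(P has_vector_derivative f (t + h)) (at (t + h))" using Pd cd h by simp
  ultimately show ?thesis using vector_diff_chain_at[of "\<lambda>u. u + h" 1 t P "f (t + h)"] by (simp add: o_def)
 qed
 moreover have "(P has_vector_derivative f t) (at t)" using Pd cd h by simp
 ultimately have "((\<lambda>u. P (u + h) - P u) has_vector_derivative f (t + h) - f t) (at t)"
  by (rule has_vector_derivative_diff)
 then have "((\<lambda>u. SA h F (u, x)) has_vector_derivative f (t + h) - f t) (at t)"
 proof (rule has_vector_derivative_transform_within_open[where S="{c<..<d - h}"])
  fix u assume u: "u \<in> {c<..<d - h}"
  have "integral {c..u} f + integral {u..u + h} f = integral {c..u + h} f"
   using u h by (intro Henstock_Kurzweil_Integration.integral_combine fi) auto
  then show "P (u + h) - P u = SA h F (u, x)"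
   unfolding SA_eq P_def f_def by (simp add: algebra_simps)
 qed (use cd in auto)
 then show ?thesis by (simp add: f_def)
qed

lemma SA_eq_lborel:
 fixes F :: "real \<times> 'a => 'c::euclidean_space"
 assumes F: "continuous_on Q F" and h: "h > 0" and t: "0 < t" "t + h < T" and x: "x \<in> BB"
 shows "SA h F (t,x) = (\<integral>s. F (s, x) \<partial>lborel_on {t..t + h})" (is ?c1) "integrable (lborel_on {t..t + h}) (\<lambda>s. F (s, x))"
proof -
 have "continuous_on {t..t + h} (\<lambda>s. F (s, x))" using t by (intro slice_cont_t'[OF F x]) auto
 from integral_lborel_on_eq[OF this] show ?c1 "integrable (lborel_on {t..t + h}) (\<lambda>s. F (s, x))"
  by (auto simp: SA_eq)
qed

lemma SA_bound:
 fixes F :: "real \<times> 'a => 'c::euclidean_space"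
 assumes F: "continuous_on Q F" and h: "h > 0" and t: "0 < t" "t + h < T" and x: "x \<in> BB"
  and M: "\<And>z. z \<in> Q ==> norm (F z) \<le> M"
 shows "norm (SA h F (t,x)) \<le> h * M"
proof -
 have "(t,x) \<in> Q" using t x h by simp
 from M[OF this] have "M \<ge> 0" using norm_ge_zero[of "F (t,x)"] by linarith
 then have "norm (integral {t..t + h} (\<lambda>s. F (s, x))) \<le> M * (t + h - t)"
  using h t x by (intro integral_bound slice_cont_t'[OF F x]) (auto intro!: M)
 then show ?thesis by (simp add: SA_eq mult.commute)
qed

definition "agsq h z = (\<Sum>b\<in>Basis. nsq (SA h (dx b U) z))"

lemma agsq_le:
 assumes h: "h > 0" and t: "0 < t" "t + h < T" and x: "x \<in> BB"
 shows "agsq h (t,x) \<le> h * (\<integral>s. gsq (s, x) \<partial>lborel_on {t..t + h})"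
proof -
 have c: "continuous_on {t..t + h} (\<lambda>s. dx b U (s, x))" for b
  using t by (intro slice_cont_t'[OF conts(2) x]) auto
 have "agsq h (t,x) \<le> (\<Sum>b\<in>Basis. h * (\<integral>s. nsq (dx b U (s, x)) \<partial>lborel_on {t..t + h}))"
  unfolding agsq_def SA_eq by (intro sum_mono norm_integral_sq_le c h)
 also have "\<dots> = h * (\<Sum>b\<in>Basis. \<integral>s. nsq (dx b U (s, x)) \<partial>lborel_on {t..t + h})"
  by (simp add: sum_distrib_left)
 also have "(\<Sum>b\<in>Basis. \<integral>s. nsq (dx b U (s, x)) \<partial>lborel_on {t..t + h}) = (\<integral>s. gsq (s, x) \<partial>lborel_on {t..t + h})"
  unfolding gsq_def by (rule L1_sum[symmetric])
   (intro integral_lborel_on_eq continuous_intros c)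
 finally show ?thesis .
qed

lemma agsq_nonneg: "agsq h z \<ge> 0" by (simp add: agsq_def sum_nonneg)

lemma agsq_slice:
 assumes h: "h > 0" and t: "0 < t" "t + h < T"
 shows "integrable MB (\<lambda>x. agsq h (t,x))" (is ?c1)
  and "(\<integral>x. agsq h (t,x) \<partial>MB) \<le> h * LI (lborel2 {t..t + h} BB) gsq" (is ?c2)
proof -
 have sub: "{t..t+h} \<subseteq> {0<..<T}" using t by auto
 interpret pair_sigma_finite "lborel_on {t..t+h}" MB by (intro pair_sigma_finite_lborel_on) auto
 have gP: "integrable (lborel2 {t..t + h} BB) gsq" by (rule integrable_pair_subset[OF gsq_integrable sub]) auto
 have gP': "integrable (lborel2 {t..t + h} BB) (\<lambda>(s, x). gsq (s, x))" using gP by simp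
 have iS: "integrable MB (\<lambda>x. h * (\<integral>s. gsq (s, x) \<partial>lborel_on {t..t + h}))"
  using integrable_snd[OF gP'] by simp
 have m: "(\<lambda>x. agsq h (t,x)) \<in> borel_measurable MB"
  unfolding agsq_def using h t by (intro borel_measurable_lborel_on continuous_intros SA_cont_x conts) auto
 show i: ?c1
 proof (rule L1_bound[OF iS m], rule AE_I2)
  fix x assume "x \<in> space MB"
  then have "agsq h (t,x) \<le> h * (\<integral>s. gsq (s, x) \<partial>lborel_on {t..t + h})"
   by (intro agsq_le h t) (simp add: space_restrict_space)
  then show "norm (agsq h (t,x)) \<le> norm (h * (\<integral>s. gsq (s, x) \<partial>lborel_on {t..t + h}))"
   using agsq_nonneg[of h "(t,x)"] by simp
 qed
 have "(\<integral>x. agsq h (t,x) \<partial>MB) \<le> (\<integral>x. h * (\<integral>s. gsq (s, x) \<partial>lborel_on {t..t + h}) \<partial>MB)"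
  using i iS by (rule integral_mono) (intro agsq_le h t, simp add: space_restrict_space)
 also have "\<dots> = h * LI (lborel2 {t..t + h} BB) gsq"
  using integral_snd[OF gP'] by simp
 finally show ?c2 .
qed

lemma agsq_integrable:
 assumes ab: "0 < a" "a < b" "h > 0" "b + h < T"
 shows "integrable (PJ a b) (agsq h)"
proof -
 have m: "agsq h \<in> borel_measurable (PJ a b)"
  unfolding agsq_def[abs_def] using ab
  by (intro measurable_pair_continuous_on continuous_intros continuous_on_subset[OF SA_cont[OF conts(2)]]) auto
 let ?G = "LI (lborel2 {0<..<T} BB) gsq"
 have "(\<integral>\<^sup>+z. ennreal (agsq h z) \<partial>(PJ a b)) = (\<integral>\<^sup>+t. (\<integral>\<^sup>+x. ennreal (agsq h (t,x)) \<partial>MB) \<partial>lborel_on {a..b})"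
  using m by (intro nn_integral_pair) auto
 also have "\<dots> \<le> (\<integral>\<^sup>+t. ennreal (h * ?G) \<partial>lborel_on {a..b})"
 proof (rule nn_integral_mono)
  fix t assume "t \<in> space (lborel_on {a..b})"
  then have t: "0 < t" "t + h < T" using ab by (auto simp: space_restrict_space)
  have "(\<integral>\<^sup>+x. ennreal (agsq h (t,x)) \<partial>MB) = ennreal (\<integral>x. agsq h (t,x) \<partial>MB)"
   using agsq_slice(1)[OF ab(3) t] agsq_nonneg by (intro nn_integral_eq_integral) auto
  also have "\<dots> \<le> ennreal (h * ?G)"
  proof (rule ennreal_leI, rule order_trans[OF agsq_slice(2)[OF ab(3) t]], rule mult_left_mono)
   show "LI (lborel2 {t..t + h} BB) gsq \<le> ?G"
    using t ab gsq_nonneg by (intro integral_pair_mono_set gsq_integrable) auto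
  qed (use ab in simp)
  finally show "(\<integral>\<^sup>+x. ennreal (agsq h (t,x)) \<partial>MB) \<le> ennreal (h * ?G)" .
 qed
 also have "\<dots> < \<infinity>" using ab by (simp add: space_restrict_space emeasure_restrict_space ennreal_mult_less_top)
 finally show ?thesis using m by (intro integrableI_nonneg) (auto simp: agsq_nonneg)
qed

lemma gsq_shift_integrable:
 assumes ab: "0 < a" "h > 0" "b + h < T"
 shows "integrable (PJ a b) (\<lambda>z. gsq (fst z + h, snd z))"
proof -
 have m: "(\<lambda>z. gsq (fst z + h, snd z)) \<in> borel_measurable (PJ a b)"
  using ab by (intro measurable_pair_continuous_on continuous_on_compose2[OF cont_gsq]) (auto intro!: continuous_intros)
 have sub: "{a + h..b + h} \<subseteq> {0<..<T}" using ab by auto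
 have mg: "gsq \<in> borel_measurable (lborel2 {a + h..b + h} BB)" by (rule meas_Q[OF cont_gsq sub])
 interpret pair_sigma_finite "lborel_on {a + h..b + h}" MB by (intro pair_sigma_finite_lborel_on) auto
 have gP: "integrable (lborel2 {a + h..b + h} BB) gsq" by (rule integrable_pair_subset[OF gsq_integrable sub]) auto
 have "(\<integral>\<^sup>+z. ennreal (gsq (fst z + h, snd z)) \<partial>(PJ a b)) = (\<integral>\<^sup>+t. (\<integral>\<^sup>+x. ennreal (gsq (t + h, x)) \<partial>MB) \<partial>lborel_on {a..b})"
  using m by (subst nn_integral_pair) auto
 also have "\<dots> = (\<integral>\<^sup>+t. (\<integral>\<^sup>+x. ennreal (gsq (t,x)) \<partial>MB) \<partial>lborel_on {a + h..b + h})"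
  using M2.borel_measurable_nn_integral_fst[of "\<lambda>z. ennreal (gsq z)" "lborel_on {a + h..b + h}"] mg
  by (intro nn_integral_lborel_on_shift[where k="\<lambda>t. \<integral>\<^sup>+x. ennreal (gsq (t,x)) \<partial>MB"]) simp
 also have "\<dots> = (\<integral>\<^sup>+z. ennreal (gsq z) \<partial>(lborel2 {a + h..b + h} BB))"
  using mg by (subst nn_integral_pair) auto
 also have "\<dots> < \<infinity>" using gP gsq_nonneg by (simp add: integrable_iff_bounded)
 finally show ?thesis using m by (intro integrableI_nonneg) (auto simp: gsq_nonneg)
qed

lemma AE_good: "AE t in lborel. t \<in> {0<..<T} \<longrightarrow> good t"
proof -
 have "AE t in lborel. t \<in> {0<..<T} \<longrightarrow> integrable MB (\<lambda>x. gsq (t,x)) \<and> integrable MB (\<lambda>x. hq (t,x))"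
  by (rule AE_restrict_space_iff[THEN iffD1, OF _ AE_good_t]) simp
 then show ?thesis by eventually_elim (simp add: good_def)
qed

lemma AE_good_pair:
 assumes ab: "0 < a" "h > 0" "b + h < T"
 shows "AE t in lborel_on {a..b}. good t \<and> good (t + h)"
proof -
 have "AE t in lborel. (t \<in> {0<..<T} \<longrightarrow> good t) \<and> (t + h \<in> {0<..<T} \<longrightarrow> good (t + h))"
  using AE_good AE_lborel_shift[OF AE_good, of h] by auto
 then have "AE t in lborel. t \<in> {a..b} \<longrightarrow> good t \<and> good (t + h)"
  by eventually_elim (use ab in auto)
 then show ?thesis by (rule AE_restrict_space_iff[THEN iffD2, rotated]) simp
qed

text \<open>The time derivative of half the averaged Dirichlet energy is
  \<open>SA (grad u) . grad z\<close>, with \<open>z\<close> the increment. Integrating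
  \<open>steklov_slice\<close> over the running time expresses the same quantity by
  \<open>z . z\<close> and \<open>SA fz . z\<close>, which gives an exact discrete energy
  identity.\<close>

theorem steklov_energy:
 assumes ab: "0 < a" "a < b" "h > 0" "b + h < T"
 defines "z \<equiv> \<lambda>y. U (fst y + h, snd y) - U y"
 shows "integrable (PJ a b) (\<lambda>y. z y \<bullet> z y + SA h fz y \<bullet> z y)"
  and "(\<integral>y. z y \<bullet> z y + SA h fz y \<bullet> z y \<partial>(PJ a b)) + (\<integral>x. agsq h (b, x) \<partial>MB)/2
   = (\<integral>x. agsq h (a, x) \<partial>MB)/2"
proof -
 let ?P = "PJ a b"
 interpret pair_sigma_finite "lborel_on {a..b}" MB by (intro pair_sigma_finite_lborel_on) auto
 interpret MBf: finite_measure MB by (rule finite_MB)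
 have sub: "{a..b} \<subseteq> {0<..<T}" using ab by auto
 have tt: "0 < t" "t + h < T" "t \<in> {0<..<T}" "t + h \<in> {0<..<T}" "t \<in> {0<..<T - h}" if "t \<in> {a..b}" for t using that ab by auto
 have subh: "{a..b} \<times> BB \<subseteq> {0<..<T - h} \<times> BB" using ab by auto
 have shc: "continuous_on ({a..b} \<times> BB) (\<lambda>y. F (fst y + h, snd y))" if "continuous_on Q F" for F :: "real \<times> 'a => 'c::euclidean_space"
  by (rule continuous_on_compose2[OF that]) (use ab in \<open>auto intro!: continuous_intros\<close>)
 have Qc: "continuous_on ({a..b} \<times> BB) F" if "continuous_on Q F" for F :: "real \<times> 'a => 'c::euclidean_space"
  by (rule continuous_on_subset[OF that]) (use sub in auto)
 have SAc: "continuous_on ({a..b} \<times> BB) (SA h F)" if "continuous_on Q F" for F :: "real \<times> 'a => 'c::euclidean_space"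
  by (rule continuous_on_subset[OF SA_cont[OF that ab(3)] subh])
 have zc: "continuous_on ({a..b} \<times> BB) z" unfolding z_def by (intro continuous_intros shc Qc conts)
 have zb: "norm (z (t,x)) \<le> 2" if "t \<in> {a..b}" "x \<in> BB" for t x
 proof -
  have "norm (U (t + h, x)) \<le> 1" "norm (U (t,x)) \<le> 1" using that tt by (auto intro!: max_principle)
  then show ?thesis unfolding z_def using norm_triangle_ineq4[of "U (t + h, x)" "U (t,x)"] by simp
 qed
 define Z where "Z y = z y \<bullet> z y + SA h fz y \<bullet> z y" for y
 have Zc: "continuous_on ({a..b} \<times> BB) Z" unfolding Z_def[abs_def] by (intro continuous_intros zc SAc fz_cont)
 have Zb: "\<bar>Z (t,x)\<bar> \<le> 4 + h * max 1 lam * 2" if "t \<in> {a..b}" "x \<in> BB" for t x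
 proof -
  have "nsq (z (t,x)) \<le> 2^2" using zb[OF that] by (intro power_mono) auto
  then have 1: "\<bar>z (t,x) \<bullet> z (t,x)\<bar> \<le> 4" by (simp add: dot_square_norm)
  have "\<bar>SA h fz (t,x) \<bullet> z (t,x)\<bar> \<le> norm (SA h fz (t,x)) * norm (z (t,x))" by (rule Cauchy_Schwarz_ineq2)
  also have "\<dots> \<le> (h * max 1 lam) * 2"
   using tt[OF that(1)] that zb ab by (intro mult_mono SA_bound[OF fz_cont] fz_bounded) auto
  finally show ?thesis using 1 unfolding Z_def by linarith
 qed
 have cP: "integrable ?P (\<lambda>y. k)" for k :: real
  using integrable_snd_finite(1)[OF MBf.integrable_const, of a b k] ab by simp
 have ZP: "integrable ?P Z"
 proof (rule L1_bound[OF cP[of "4 + h * max 1 lam * 2"]])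
  show "Z \<in> borel_measurable ?P" by (rule measurable_pair_continuous_on[OF Zc])
  show "AE y in ?P. norm (Z y) \<le> norm (4 + h * max 1 lam * 2)"
  proof (rule AE_I2)
   fix y assume "y \<in> space ?P"
   then obtain t x where "y = (t,x)" "t \<in> {a..b}" "x \<in> BB" by (auto simp: spaces)
   then show "norm (Z y) \<le> norm (4 + h * max 1 lam * 2)"
    using Zb unfolding real_norm_def by (auto intro: order_trans[OF _ abs_ge_self])
  qed
 qed
 then show "integrable ?P (\<lambda>y. z y \<bullet> z y + SA h fz y \<bullet> z y)" by (simp add: Z_def[abs_def])
 define dz where "dz b y = dx b U (fst y + h, snd y) - dx b U y" for b y
 define e' where "e' y = (\<Sum>b\<in>Basis. SA h (dx b U) y \<bullet> dz b y)" for y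
 have e'c: "continuous_on ({a..b} \<times> BB) e'"
  unfolding e'_def dz_def by (intro continuous_intros SAc shc Qc conts)
 have e'P: "integrable ?P e'"
 proof (rule L1_bound)
  show "integrable ?P (\<lambda>y. agsq h y + (2 * gsq (fst y + h, snd y) + 2 * gsq y))"
   using agsq_integrable[OF ab] gsq_shift_integrable[OF ab(1,3,4)] integrable_pair_subset[OF gsq_integrable sub] by simp
  show "e' \<in> borel_measurable ?P" by (rule measurable_pair_continuous_on[OF e'c])
  show "AE y in ?P. norm (e' y) \<le> norm (agsq h y + (2 * gsq (fst y + h, snd y) + 2 * gsq y))"
  proof (rule AE_I2)
   fix y
   have "\<bar>e' y\<bar> \<le> (\<Sum>b\<in>Basis. nsq (SA h (dx b U) y) + (2 * nsq (dx b U (fst y + h, snd y)) + 2 * nsq (dx b U y)))"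
    unfolding e'_def
   proof (rule order_trans[OF sum_abs], rule sum_mono)
    fix b
    have "\<bar>SA h (dx b U) y \<bullet> dz b y\<bar> \<le> norm (SA h (dx b U) y) * norm (dz b y)" by (rule Cauchy_Schwarz_ineq2)
    also have "\<dots> \<le> nsq (SA h (dx b U) y) + nsq (dz b y)" by (intro mult_le_sum_squares) auto
    also have "nsq (dz b y) \<le> 2 * nsq (dx b U (fst y + h, snd y)) + 2 * nsq (dx b U y)"
     unfolding dz_def by (rule norm_diff_sq_le)
    finally show "\<bar>SA h (dx b U) y \<bullet> dz b y\<bar> \<le> nsq (SA h (dx b U) y) + (2 * nsq (dx b U (fst y + h, snd y)) + 2 * nsq (dx b U y))"
     by simp
   qed
   also have "\<dots> = agsq h y + (2 * gsq (fst y + h, snd y) + 2 * gsq y)"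
    by (simp add: agsq_def gsq_def sum.distrib sum_distrib_left)
   finally show "norm (e' y) \<le> norm (agsq h y + (2 * gsq (fst y + h, snd y) + 2 * gsq y))" by simp
  qed
 qed
 have "(\<integral>x. agsq h (b, x)/2 \<partial>MB) - (\<integral>x. agsq h (a, x)/2 \<partial>MB) = (\<integral>t. (\<integral>x. e' (t,x) \<partial>MB) \<partial>lborel_on {a..b})"
 proof (rule time_FTC)
  show "((\<lambda>t. agsq h (t,x)/2) has_real_derivative e' (t,x)) (at t)" if x: "x \<in> BB" and t: "t \<in> {a..b}" for x t
  proof -
   have dS: "((\<lambda>t. SA h (dx b U) (t,x)) has_derivative (\<lambda>k. k .* dz b (t,x))) (at t)" for b
    using SA_deriv[OF conts(2) ab(3) tt(1,2)[OF t] x, of b] by (simp add: has_vector_derivative_def dz_def)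
   have "((\<lambda>t. agsq h (t,x)) has_real_derivative (\<Sum>b\<in>Basis. 2 * (SA h (dx b U) (t,x) \<bullet> dz b (t,x)))) (at t)"
    unfolding agsq_def power2_norm_eq_inner
   proof (rule DERIV_sum)
    fix b
    show "((\<lambda>t. SA h (dx b U) (t,x) \<bullet> SA h (dx b U) (t,x)) has_real_derivative 2 * (SA h (dx b U) (t,x) \<bullet> dz b (t,x))) (at t)"
     unfolding has_field_derivative_def
     by (rule has_derivative_eq_rhs[OF has_derivative_inner[OF dS dS]]) (simp add: fun_eq_iff inner_commute)
   qed
   from DERIV_cdivide[OF this, of 2] show ?thesis by (simp add: e'_def sum_distrib_left[symmetric])
  qed
  show "continuous_on {a..b} (\<lambda>t. e' (t,x))" if "x \<in> BB" for x
   by (rule continuous_on_compose2[OF e'c]) (use that in \<open>auto intro!: continuous_intros\<close>)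
  show "integrable ?P (\<lambda>(t,x). e' (t,x))" using e'P by simp
  show "integrable MB (\<lambda>x. agsq h (a, x)/2)" "integrable MB (\<lambda>x. agsq h (b, x)/2)"
   using agsq_slice(1)[OF ab(3), of a] agsq_slice(1)[OF ab(3), of b] ab by auto
 qed (use ab in auto)
 \<comment> \<open>The two time densities agree for almost every t, namely where both t and t + h
   are good.\<close>
 also have "\<dots> = (\<integral>t. - (\<integral>x. Z (t,x) \<partial>MB) \<partial>lborel_on {a..b})"
 proof (rule integral_cong_AE)
  show "(\<lambda>t. \<integral>x. e' (t,x) \<partial>MB) \<in> borel_measurable (lborel_on {a..b})" using integrable_fst'[OF e'P] by simp
  show "(\<lambda>t. - (\<integral>x. Z (t,x) \<partial>MB)) \<in> borel_measurable (lborel_on {a..b})" using integrable_fst'[OF ZP] by simp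
  have "AE t in lborel_on {a..b}. t \<in> {a..b}" by (rule AE_I2) (simp add: space_restrict_space)
  moreover have "AE t in lborel_on {a..b}. integrable MB (\<lambda>x. Z (t,x))" using AE_integrable_fst'[OF ZP] by simp
  moreover have "AE t in lborel_on {a..b}. integrable MB (\<lambda>x. e' (t,x))" using AE_integrable_fst'[OF e'P] by simp
  ultimately show "AE t in lborel_on {a..b}. (\<integral>x. e' (t,x) \<partial>MB) = - (\<integral>x. Z (t,x) \<partial>MB)"
   using AE_good_pair[OF ab(1,3,4)]
  proof eventually_elim
   case (elim t)
   note t = tt[OF elim(1)]
   let ?PP = "lborel2 {t..t + h} BB"
   interpret PP: pair_sigma_finite "lborel_on {t..t + h}" MB by (intro pair_sigma_finite_lborel_on) auto
   define R where "R y = (\<Sum>b\<in>Basis. (dx b U (t + h, snd y) - dx b U (t, snd y)) \<bullet> dx b U y) + fz y \<bullet> (U (t + h, snd y) - U (t, snd y))" for y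
   have gg: "good t" "good (t + h)" using elim by auto
   have RP: "integrable ?PP R"
    using steklov_slice(1)[OF ab(3) gg] by (simp add: R_def[abs_def])
   have eq: "(\<integral>x. z (t,x) \<bullet> z (t,x) \<partial>MB) = - LI ?PP R"
    using steklov_slice(2)[OF ab(3) gg] by (simp add: R_def[abs_def] z_def)
   have RP': "integrable ?PP (\<lambda>(s, x). R (s, x))" using RP by simp
   have "LI ?PP R = (\<integral>x. (\<integral>s. R (s, x) \<partial>lborel_on {t..t + h}) \<partial>MB)"
    using PP.integral_snd[OF RP'] by simp
   also have "\<dots> = (\<integral>x. e' (t,x) + SA h fz (t,x) \<bullet> z (t,x) \<partial>MB)"
   proof (rule L1_cong[OF refl])
    fix x assume "x \<in> space MB"
    then have x: "x \<in> BB" by (simp add: space_restrict_space)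
    note S1 = SA_eq_lborel[OF conts(2) ab(3) t(1,2) x]
    note S2 = SA_eq_lborel[OF fz_cont ab(3) t(1,2) x]
    have "(\<integral>s. R (s, x) \<partial>lborel_on {t..t + h}) = (\<Sum>b\<in>Basis. dz b (t,x) \<bullet> SA h (dx b U) (t,x)) + SA h fz (t,x) \<bullet> z (t,x)"
     unfolding R_def S1(1) S2(1) dz_def z_def using S1(2) S2(2) by simp
    then show "(\<integral>s. R (s, x) \<partial>lborel_on {t..t + h}) = e' (t,x) + SA h fz (t,x) \<bullet> z (t,x)"
     by (simp add: e'_def inner_commute)
   qed
   finally have R: "LI ?PP R = (\<integral>x. e' (t,x) + SA h fz (t,x) \<bullet> z (t,x) \<partial>MB)" .
   have zi: "integrable MB (\<lambda>x. z (t,x) \<bullet> z (t,x))"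
   proof (rule MBf.integrable_const_bound[where B=4])
    show "(\<lambda>x. z (t,x) \<bullet> z (t,x)) \<in> borel_measurable MB"
     by (intro borel_measurable_lborel_on continuous_intros continuous_on_compose2[OF zc, of BB "\<lambda>x. (t,x)"]) (use elim(1) in auto)
    show "AE x in MB. norm (z (t,x) \<bullet> z (t,x)) \<le> 4"
    proof (rule AE_I2)
     fix x assume "x \<in> space MB"
     then have "nsq (z (t,x)) \<le> 2^2" using zb[OF elim(1)] by (intro power_mono) (auto simp: space_restrict_space)
     then show "norm (z (t,x) \<bullet> z (t,x)) \<le> 4" by (simp add: dot_square_norm)
    qed
   qed
   have si: "integrable MB (\<lambda>x. SA h fz (t,x) \<bullet> z (t,x))"
    using L1_diff[OF elim(2) zi] by (simp add: Z_def)
   have "LI ?PP R = (\<integral>x. e' (t,x) \<partial>MB) + (\<integral>x. SA h fz (t,x) \<bullet> z (t,x) \<partial>MB)"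
    unfolding R using elim(3) si by (rule Bochner_Integration.integral_add)
   moreover have "(\<integral>x. Z (t,x) \<partial>MB) = (\<integral>x. z (t,x) \<bullet> z (t,x) \<partial>MB) + (\<integral>x. SA h fz (t,x) \<bullet> z (t,x) \<partial>MB)"
    unfolding Z_def using zi si by (rule Bochner_Integration.integral_add)
   ultimately show "(\<integral>x. e' (t,x) \<partial>MB) = - (\<integral>x. Z (t,x) \<partial>MB)" using eq by linarith
  qed
 qed
 also have "\<dots> = - LI ?P Z" using integral_fst'[OF ZP] by simp
 finally show "(\<integral>y. z y \<bullet> z y + SA h fz y \<bullet> z y \<partial>?P) + (\<integral>x. agsq h (b, x) \<partial>MB)/2 = (\<integral>x. agsq h (a, x) \<partial>MB)/2"
  by (simp add: Z_def[abs_def])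
qed

end

lemma ennreal_liminf_add_le:
 fixes X Y :: "nat => ennreal"
 shows "liminf X + liminf Y \<le> liminf (\<lambda>n. X n + Y n)"
proof -
 have inc: "incseq (\<lambda>n. INF k\<in>{n..}. Z k)" for Z :: "nat => ennreal"
  by (intro monoI INF_superset_mono) auto
 have "liminf X + liminf Y = (SUP n. (INF k\<in>{n..}. X k) + (INF k\<in>{n..}. Y k))"
  unfolding liminf_SUP_INF using inc by (intro ennreal_SUP_add[symmetric])
 also have "\<dots> \<le> (SUP n. INF k\<in>{n..}. X k + Y k)"
  by (intro SUP_mono) (auto intro!: INF_greatest add_mono INF_lower exI)
 also have "\<dots> = liminf (\<lambda>n. X n + Y n)" by (simp add: liminf_SUP_INF)
 finally show ?thesis .
qed

lemma nn_integral_pair_restrict: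
 fixes F :: "real \<times> 'a::euclidean_space => ennreal"
 assumes F: "F \<in> borel_measurable (lborel2 J B)"
  and IJ: "I \<subseteq> J" "I \<in> sets borel" "J \<in> sets borel" "B \<in> sets borel"
 shows "(\<integral>\<^sup>+z. indicator I (fst z) * F z \<partial>(lborel2 J B)) = (\<integral>\<^sup>+z. F z \<partial>(lborel2 I B))"
proof -
 interpret pair_sigma_finite "lborel_on J" "lborel_on B" using IJ by (intro pair_sigma_finite_lborel_on)
 have [measurable]: "F \<in> borel_measurable (lborel2 J B)" by (rule F)
 have IJs: "I \<in> sets (lborel_on J)" using IJ by (auto simp: sets_restrict_space_iff)
 have [measurable]: "(\<lambda>z. indicator I (fst z) :: ennreal) \<in> borel_measurable (lborel2 J B)"
  using IJs by (intro measurable_compose[OF measurable_fst borel_measurable_indicator])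
 have "(\<integral>\<^sup>+z. indicator I (fst z) * F z \<partial>(lborel2 J B))
  = (\<integral>\<^sup>+t. (\<integral>\<^sup>+x. indicator I t * F (t,x) \<partial>lborel_on B) \<partial>lborel_on J)"
  using IJ by (subst nn_integral_pair) auto
 also have "\<dots> = (\<integral>\<^sup>+t. indicator I t * (\<integral>\<^sup>+x. F (t,x) \<partial>lborel_on B) \<partial>lborel_on J)"
  by (intro nn_integral_cong) (simp split: split_indicator)
 also have "\<dots> = (\<integral>\<^sup>+t. (\<integral>\<^sup>+x. F (t,x) \<partial>lborel_on B) \<partial>lborel_on I)"
  using IJ by (auto simp: nn_integral_restrict_space intro!: nn_integral_cong split: split_indicator)
 also have "\<dots> = (\<integral>\<^sup>+z. F z \<partial>(lborel2 I B))"
  using IJ measurable_pair_subset[OF F IJ(1)] by (intro nn_integral_pair[symmetric]) auto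
 finally show ?thesis .
qed

lemma integral_pair_restrict:
 fixes F :: "real \<times> 'a::euclidean_space => real"
 assumes F: "integrable (lborel2 J B) F"
  and IJ: "I \<subseteq> J" "I \<in> sets borel" "J \<in> sets borel" "B \<in> sets borel"
 shows "(\<integral>z. indicator I (fst z) * F z \<partial>(lborel2 J B)) = (\<integral>z. F z \<partial>(lborel2 I B))"
proof -
 interpret J: pair_sigma_finite "lborel_on J" "lborel_on B" using IJ by (intro pair_sigma_finite_lborel_on)
 interpret I: pair_sigma_finite "lborel_on I" "lborel_on B" using IJ by (intro pair_sigma_finite_lborel_on)
 have IJs: "I \<in> sets (lborel_on J)" using IJ by (auto simp: sets_restrict_space_iff)
 have im: "(\<lambda>z. indicator I (fst z) :: real) \<in> borel_measurable (lborel2 J B)"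
  using IJs by (intro measurable_compose[OF measurable_fst borel_measurable_indicator])
 have i: "integrable (lborel2 J B) (\<lambda>z. indicator I (fst z) * F z)"
  by (rule L1_bound[OF F])
   (use im F in \<open>auto simp: indicator_def intro!: borel_measurable_times\<close>)
 have "(\<integral>z. indicator I (fst z) * F z \<partial>(lborel2 J B)) = (\<integral>t. (\<integral>x. indicator I t * F (t,x) \<partial>lborel_on B) \<partial>lborel_on J)"
  using J.integral_fst'[OF i] by simp
 also have "\<dots> = (\<integral>t. (\<integral>x. F (t,x) \<partial>lborel_on B) \<partial>lborel_on I)"
  using IJ by (auto simp: integral_restrict_space intro!: L1_cong split: split_indicator)
 also have "\<dots> = (\<integral>z. F z \<partial>(lborel2 I B))"
  by (rule I.integral_fst'[OF integrable_pair_subset[OF F IJ]])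
 finally show ?thesis .
qed

context glh begin

lemma SA_lim:
 fixes F :: "real \<times> 'a => 'c::euclidean_space"
 assumes F: "continuous_on Q F" and t: "(t,x) \<in> Q" and h: "\<And>k. h k > 0" "h ----> 0"
 shows "(\<lambda>k. (1/h k) .* SA (h k) F (t,x)) ----> F (t,x)"
proof (rule LIMSEQ_I)
 fix e :: real assume e: "e > 0"
 have tx: "t \<in> {0<..<T}" "x \<in> BB" using t by auto
 have c: "continuous_on {0<..<T} (\<lambda>s. F (s, x))"
  by (rule continuous_on_compose2[OF F]) (use tx in \<open>auto intro!: continuous_intros\<close>)
 then obtain d where d: "d > 0" "\<And>s. s \<in> {0<..<T} ==> dist s t < d ==> dist (F (s, x)) (F (t,x)) < e/2"
  using tx(1) half_gt_zero[OF e] unfolding continuous_on_iff by meson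
 have "\<forall>\<^sub>F k in sequentially. h k < min d (T - t)"
  using h(2) by (rule order_tendstoD) (use d tx in auto)
 then obtain N where N: "\<And>k. k \<ge> N ==> h k < min d (T - t)" by (auto simp: eventually_sequentially)
 show "\<exists>N. \<forall>k\<ge>N. norm ((1/h k) .* SA (h k) F (t,x) - F (t,x)) < e"
 proof (intro exI[of _ N] allI impI)
  fix k assume "k \<ge> N"
  then have hk: "h k < d" "h k < T - t" "h k > 0" using N h by auto
  have cc: "continuous_on {t..t + h k} (\<lambda>s. F (s, x))"
   using hk tx by (intro continuous_on_subset[OF c]) auto
  have "integral {t..t + h k} (\<lambda>s. F (s, x) - F (t,x)) = SA (h k) F (t,x) - h k .* F (t,x)"
   using hk cc by (subst Henstock_Kurzweil_Integration.integral_diff) (auto simp: SA_eq intro!: integrable_continuous_interval)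
  moreover have "norm (integral {t..t + h k} (\<lambda>s. F (s, x) - F (t,x))) \<le> (e/2) * (t + h k - t)"
  proof (rule integral_bound)
   fix s assume "s \<in> {t..t + h k}"
   then have "dist (F (s, x)) (F (t,x)) < e/2" using hk tx by (intro d(2)) (auto simp: dist_real_def)
   then show "norm (F (s, x) - F (t,x)) \<le> e/2" by (simp add: dist_norm)
  qed (use hk cc in \<open>auto intro!: continuous_intros\<close>)
  ultimately have "norm (SA (h k) F (t,x) - h k .* F (t,x)) \<le> (e/2) * h k" by simp
  moreover have "(1/h k) .* SA (h k) F (t,x) - F (t,x) = (1/h k) .* (SA (h k) F (t,x) - h k .* F (t,x))"
   using hk by (simp add: scaleR_diff_right)
  ultimately have "norm ((1/h k) .* SA (h k) F (t,x) - F (t,x)) \<le> (1/h k) * ((e/2) * h k)"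
   using hk by (simp only: norm_scaleR) (simp add: pos_divide_le_eq)
  also have "\<dots> = e/2" using hk by simp
  finally have "norm ((1/h k) .* SA (h k) F (t,x) - F (t,x)) \<le> e/2" .
  then show "norm ((1/h k) .* SA (h k) F (t,x) - F (t,x)) < e" using e by simp
 qed
qed

lemma SA_dt:
 assumes "0 < t" "t + h < T" "h > 0" "x \<in> BB"
 shows "SA h (dt U) (t,x) = U (t + h, x) - U (t,x)"
proof -
 have "((\<lambda>s. dt U (s, x)) has_integral U (t + h, x) - U (t,x)) {t..t + h}"
  using assms by (intro fundamental_theorem_of_calculus has_vector_derivative_at_within[OF slice_deriv_t[OF smooth]]) auto
 then show ?thesis by (simp add: SA_eq integral_unique)
qed

text \<open>The discrete identity is divided by h^2 and h tends to 0. The term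
  \<open>fz . u_t\<close> has no sign, so it is first completed to a square: Fatou's lemma then
  applies to both terms on the left, while the square added on the right converges because
  \<open>fz\<close> is bounded.\<close>

theorem energy_ineq_raw:
 assumes b: "0 < b" "b < T"
 shows "(\<integral>\<^sup>+y. ennreal (nsq (dt U y + (1/2) .* fz y)) \<partial>(lborel2 {0<..b} BB))
   + (\<integral>\<^sup>+x. ennreal (gsq (b, x)/2) \<partial>MB)
  \<le> ennreal (M0/2) + (\<integral>\<^sup>+y. ennreal (nsq (fz y)/4) \<partial>(lborel2 {0<..b} BB))"
proof -
 let ?P = "lborel2 {0<..b} BB"
 interpret MBf: finite_measure MB by (rule finite_MB)
 define \<delta> where "\<delta> = min 1 (min ((T - b)/2) (b/2))"
 define h where "h k = \<delta>/real (Suc k)" for k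
 \<comment> \<open>The starting time must be small compared with h: the initial term is at most
   \<open>exp (c (a + h)) (a + h)/h\<close> times M0/2, and \<open>a = h^2\<close> makes the
   quotient \<open>1 + h\<close>.\<close>
 define a where "a k = (h k)^2" for k
 have \<delta>: "\<delta> > 0" "\<delta> \<le> 1" "\<delta> < T - b" "\<delta> < b" using b by (auto simp: \<delta>_def min_def)
 have h: "h k > 0" "h k \<le> \<delta>" for k using \<delta> by (auto simp: h_def field_simps)
 have h0: "h ----> 0" unfolding h_def by real_asymp
 have a: "0 < a k" "a k \<le> h k" "a k < b" for k
 proof -
  show "0 < a k" using h[of k] by (simp add: a_def)
  have "h k * h k \<le> 1 * h k" using h[of k] \<delta> by (intro mult_right_mono) auto
  then show "a k \<le> h k" by (simp add: a_def power2_eq_square)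
  then show "a k < b" using h[of k] \<delta> by simp
 qed
 have a0: "a ----> 0"
  by (rule tendsto_sandwich[OF _ _ tendsto_const h0]) (use a in \<open>auto intro!: always_eventually less_imp_le\<close>)
 have bh: "b + h k < T" for k using h[of k] \<delta> by simp
 define c where "c = 4 * max 1 lam"
 define r where "r k = exp (c * (a k + h k)) * (1 + h k) * M0/2" for k
 have r_lim: "r ----> M0/2"
 proof -
  have "r ----> exp (c * (0 + 0)) * (1 + 0) * M0/2"
   unfolding r_def by (intro tendsto_intros a0 h0) auto
  then show ?thesis by simp
 qed
 define z where "z k y = U (fst y + h k, snd y) - U y" for k y
 \<comment> \<open>The approximation of \<open>u_t + fz/2\<close>. Its square is the integrand of
   \<open>steklov_energy\<close> over h^2, plus \<open>S\<close>.\<close>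
 define G where "G k y = (1/h k) .* z k y + (1/2) .* ((1/h k) .* SA (h k) fz y)" for k y
 define S where "S k y = nsq ((1/h k) .* SA (h k) fz y)/4" for k y
 have subJ: "{0<..b} \<subseteq> {0<..<T}" using b by auto
 have subh: "{0<..b} \<times> BB \<subseteq> {0<..<T - h k} \<times> BB" for k using bh[of k] by auto
 have Sc: "continuous_on ({0<..b} \<times> BB) (S k)" for k
  unfolding S_def[abs_def] by (intro continuous_intros continuous_on_subset[OF SA_cont[OF fz_cont h(1)] subh]) auto
 have zc: "continuous_on ({0<..b} \<times> BB) (z k)" for k
 proof -
  have "continuous_on ({0<..b} \<times> BB) (\<lambda>y. U (fst y + h k, snd y))"
   by (rule continuous_on_compose2[OF conts(1)]) (use bh[of k] h[of k] in \<open>auto intro!: continuous_intros add_pos_pos\<close>)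
  then show ?thesis unfolding z_def
   by (intro continuous_intros continuous_on_subset[OF conts(1)]) (use subJ in auto)
 qed
 have Gc: "continuous_on ({0<..b} \<times> BB) (G k)" for k
  unfolding G_def[abs_def] by (intro continuous_intros zc continuous_on_subset[OF SA_cont[OF fz_cont h(1)] subh])
 have Sm: "(\<lambda>y. ennreal (S k y)) \<in> borel_measurable ?P" for k
  using measurable_pair_continuous_on[OF Sc[of k]] by simp
 have Gm: "(\<lambda>y. ennreal (nsq (G k y))) \<in> borel_measurable ?P" for k
  using measurable_pair_continuous_on[OF Gc[of k]] by simp
 define M where "M = (max 1 lam)^2/4"
 have SM: "S k (t,x) \<le> M" if "t \<in> {0<..b}" "x \<in> BB" for k t x
 proof -
  have "norm (SA (h k) fz (t,x)) \<le> h k * max 1 lam"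
   using that bh[of k] h[of k] by (intro SA_bound[OF fz_cont] fz_bounded) auto
  then have "norm ((1/h k) .* SA (h k) fz (t,x)) \<le> max 1 lam" using h[of k] by (simp add: field_simps)
  then have "nsq ((1/h k) .* SA (h k) fz (t,x)) \<le> (max 1 lam)^2" by (intro power_mono) auto
  then show ?thesis unfolding S_def M_def by (intro divide_right_mono) auto
 qed
 have S0: "S k y \<ge> 0" for k y by (simp add: S_def)
 let ?ind = "\<lambda>k y. indicator {a k..b} (fst y) :: ennreal"
 have key: "(\<integral>\<^sup>+y. ?ind k y * ennreal (nsq (G k y)) \<partial>?P) + (\<integral>\<^sup>+x. ennreal (agsq (h k) (b, x)/(2 * (h k)^2)) \<partial>MB)
   \<le> ennreal (r k) + (\<integral>\<^sup>+y. ?ind k y * ennreal (S k y) \<partial>?P)" for k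
 proof -
  let ?h = "h k" and ?a = "a k"
  let ?Pa = "PJ ?a b"
  interpret PP: pair_sigma_finite "lborel_on {?a..b}" MB by (intro pair_sigma_finite_lborel_on) auto
  have suba: "{?a..b} \<subseteq> {0<..b}" using a[of k] by auto
  have cP: "integrable ?Pa (\<lambda>y. m)" for m :: real
   using integrable_snd_finite(1)[OF MBf.integrable_const, of ?a b m] a[of k] by simp
  have Si: "integrable ?Pa (S k)"
  proof (rule L1_bound[OF cP[of M]])
   show "S k \<in> borel_measurable ?Pa" by (rule measurable_pair_continuous_on[OF continuous_on_subset[OF Sc]]) (use suba in auto)
   show "AE y in ?Pa. norm (S k y) \<le> norm M"
   proof (rule AE_I2)
    fix y assume "y \<in> space ?Pa"
    then obtain t x where "y = (t,x)" "t \<in> {0<..b}" "x \<in> BB" using suba by (auto simp: spaces)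
    then show "norm (S k y) \<le> norm M" using SM[of t x k] S0[of k y] by simp
   qed
  qed
  define Zk where "Zk y = z k y \<bullet> z k y + SA ?h fz y \<bullet> z k y" for y
  note SE = steklov_energy[OF a(1)[of k] a(3)[of k] h(1)[of k] bh[of k]]
  have Zi: "integrable ?Pa Zk" using SE(1) by (simp add: Zk_def[abs_def] z_def)
  have G2: "nsq (G k y) = (1/?h^2) * Zk y + S k y" for y
   using h(1)[of k] unfolding G_def Zk_def S_def power2_norm_eq_inner
   by (simp add: inner_simps inner_commute power2_eq_square field_simps)
  have Gi: "integrable ?Pa (\<lambda>y. nsq (G k y))" unfolding G2 using Zi Si by simp
  have as: "integrable MB (\<lambda>x. agsq ?h (b, x))" "integrable MB (\<lambda>x. agsq ?h (?a, x))"
   using agsq_slice(1)[OF h(1)[of k], of b] agsq_slice(1)[OF h(1)[of k], of ?a] b bh[of k] a[of k] by auto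
  have ah: "?a + ?h < T" using a[of k] bh[of k] by simp
  have "(\<integral>x. agsq ?h (?a, x) \<partial>MB) \<le> ?h * LI (lborel2 {?a..?a + ?h} BB) gsq"
   by (rule agsq_slice(2)[OF h(1) a(1) ah])
  also have "\<dots> \<le> ?h * (exp (c * (?a + ?h)) * (?a + ?h) * M0)"
   unfolding c_def using h[of k] a[of k] ah by (intro mult_left_mono gsq_time_integral_le) auto
  also have "\<dots> = 2 * ?h^2 * r k"
   by (simp add: r_def a_def power2_eq_square algebra_simps)
  finally have ra: "(\<integral>x. agsq ?h (?a, x) \<partial>MB)/2 \<le> ?h^2 * r k" by simp
  have "LI ?Pa Zk + (\<integral>x. agsq ?h (b, x) \<partial>MB)/2 \<le> ?h^2 * r k"
   using SE(2) ra by (simp add: Zk_def[abs_def] z_def)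
  then have "(1/?h^2) * (LI ?Pa Zk + (\<integral>x. agsq ?h (b, x) \<partial>MB)/2) \<le> (1/?h^2) * (?h^2 * r k)"
   by (intro mult_left_mono) auto
  then have m: "(1/?h^2) * LI ?Pa Zk + (\<integral>x. agsq ?h (b, x) \<partial>MB)/(2 * ?h^2) \<le> r k"
   using h[of k] by (simp add: distrib_left)
  have "(\<integral>y. nsq (G k y) \<partial>?Pa) + (\<integral>x. agsq ?h (b, x)/(2 * ?h^2) \<partial>MB) \<le> r k + LI ?Pa (S k)"
   unfolding G2 using Zi Si m by simp
  then have "ennreal ((\<integral>y. nsq (G k y) \<partial>?Pa) + (\<integral>x. agsq ?h (b, x)/(2 * ?h^2) \<partial>MB)) \<le> ennreal (r k + LI ?Pa (S k))"
   by (rule ennreal_leI)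
  moreover have "r k \<ge> 0" using h[of k] M0_nonneg by (simp add: r_def)
  ultimately have "ennreal (\<integral>y. nsq (G k y) \<partial>?Pa) + ennreal (\<integral>x. agsq ?h (b, x)/(2 * ?h^2) \<partial>MB) \<le> ennreal (r k) + ennreal (LI ?Pa (S k))"
   using S0 agsq_nonneg by (simp add: ennreal_plus[symmetric] del: ennreal_plus)
  moreover have "ennreal (\<integral>y. nsq (G k y) \<partial>?Pa) = (\<integral>\<^sup>+y. ennreal (nsq (G k y)) \<partial>?Pa)"
   using Gi by (intro nn_integral_eq_integral[symmetric]) auto
  moreover have "ennreal (\<integral>x. agsq ?h (b, x)/(2 * ?h^2) \<partial>MB) = (\<integral>\<^sup>+x. ennreal (agsq ?h (b, x)/(2 * ?h^2)) \<partial>MB)"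
   using as agsq_nonneg by (intro nn_integral_eq_integral[symmetric]) auto
  moreover have "ennreal (LI ?Pa (S k)) = (\<integral>\<^sup>+y. ennreal (S k y) \<partial>?Pa)"
   using Si S0 by (intro nn_integral_eq_integral[symmetric]) auto
  moreover have "(\<integral>\<^sup>+y. ?ind k y * ennreal (nsq (G k y)) \<partial>?P) = (\<integral>\<^sup>+y. ennreal (nsq (G k y)) \<partial>?Pa)"
   by (rule nn_integral_pair_restrict[OF Gm suba]) auto
  moreover have "(\<integral>\<^sup>+y. ?ind k y * ennreal (S k y) \<partial>?P) = (\<integral>\<^sup>+y. ennreal (S k y) \<partial>?Pa)"
   by (rule nn_integral_pair_restrict[OF Sm suba]) auto
  ultimately show ?thesis by simp
 qed
 have sp: "\<exists>t x. y = (t,x) \<and> t \<in> {0<..b} \<and> x \<in> BB \<and> (t,x) \<in> Q" if "y \<in> space ?P" for y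
  using that subJ by (auto simp: spaces)
 have indm: "(\<lambda>y. ?ind k y) \<in> borel_measurable ?P" for k
  by (intro measurable_compose[OF measurable_fst borel_measurable_indicator]) (use a[of k] in \<open>auto simp: sets_restrict_space_iff\<close>)
 have ind1: "(\<lambda>k. ?ind k y) ----> 1" if y: "y \<in> space ?P" for y
 proof (rule tendsto_eventually)
  have "fst y > 0" "fst y \<le> b" using sp[OF y] by auto
  then have "\<forall>\<^sub>F k in sequentially. a k < fst y" using a0 by (intro order_tendstoD) auto
  then show "\<forall>\<^sub>F k in sequentially. ?ind k y = 1" by eventually_elim (use \<open>fst y \<le> b\<close> in auto)
 qed
 have Glim: "(\<lambda>k. G k y) ----> dt U y + (1/2) .* fz y" if y: "y \<in> space ?P" for y
 proof -
  obtain t x where tx: "y = (t,x)" "t \<in> {0<..b}" "x \<in> BB" "(t,x) \<in> Q" using sp[OF y] by blast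
  have zeq: "z k (t,x) = SA (h k) (dt U) (t,x)" for k
   using tx bh[of k] h[of k] by (subst SA_dt) (auto simp: z_def)
  show ?thesis unfolding G_def tx(1) zeq
   by (intro tendsto_add tendsto_scaleR[OF tendsto_const] SA_lim[OF conts(3) tx(4) h(1) h0] SA_lim[OF fz_cont tx(4) h(1) h0])
 qed
 have "(\<integral>\<^sup>+y. ennreal (nsq (dt U y + (1/2) .* fz y)) \<partial>?P) \<le> (\<integral>\<^sup>+y. liminf (\<lambda>k. ?ind k y * ennreal (nsq (G k y))) \<partial>?P)"
 proof (rule nn_integral_mono)
  fix y assume y: "y \<in> space ?P"
  have "(\<lambda>k. ?ind k y * ennreal (nsq (G k y))) ----> 1 * ennreal (nsq (dt U y + (1/2) .* fz y))"
   by (intro tendsto_mult_ennreal tendsto_ennrealI tendsto_power tendsto_norm ind1 Glim y) auto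
  from lim_imp_Liminf[OF sequentially_bot this]
  show "ennreal (nsq (dt U y + (1/2) .* fz y)) \<le> liminf (\<lambda>k. ?ind k y * ennreal (nsq (G k y)))" by simp
 qed
 also have "\<dots> \<le> liminf (\<lambda>k. \<integral>\<^sup>+y. ?ind k y * ennreal (nsq (G k y)) \<partial>?P)"
  by (intro nn_integral_liminf borel_measurable_times_ennreal indm Gm)
 finally have L1: "(\<integral>\<^sup>+y. ennreal (nsq (dt U y + (1/2) .* fz y)) \<partial>?P) \<le> liminf (\<lambda>k. \<integral>\<^sup>+y. ?ind k y * ennreal (nsq (G k y)) \<partial>?P)" .
 have "(\<integral>\<^sup>+x. ennreal (gsq (b, x)/2) \<partial>MB) \<le> (\<integral>\<^sup>+x. liminf (\<lambda>k. ennreal (agsq (h k) (b, x)/(2 * (h k)^2))) \<partial>MB)"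
 proof (rule nn_integral_mono)
  fix x assume "x \<in> space MB"
  then have q: "(b, x) \<in> Q" using b by (simp add: space_restrict_space)
  have "(\<lambda>k. (\<Sum>c\<in>Basis. nsq ((1/h k) .* SA (h k) (dx c U) (b, x)))/2) ----> (\<Sum>c\<in>Basis. nsq (dx c U (b, x)))/2"
   by (intro tendsto_divide tendsto_sum tendsto_power tendsto_norm SA_lim[OF conts(2) q h(1) h0] tendsto_const) auto
  moreover have "(\<Sum>c\<in>Basis. nsq ((1/h k) .* SA (h k) (dx c U) (b, x)))/2 = agsq (h k) (b, x)/(2 * (h k)^2)" for k
   using h(1)[of k] by (simp add: agsq_def power_mult_distrib power_divide sum_divide_distrib mult.commute)
  ultimately have "(\<lambda>k. ennreal (agsq (h k) (b, x)/(2 * (h k)^2))) ----> ennreal (gsq (b, x)/2)"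
   unfolding gsq_def by (intro tendsto_ennrealI) (simp only:)
  from lim_imp_Liminf[OF sequentially_bot this]
  show "ennreal (gsq (b, x)/2) \<le> liminf (\<lambda>k. ennreal (agsq (h k) (b, x)/(2 * (h k)^2)))" by simp
 qed
 also have "\<dots> \<le> liminf (\<lambda>k. \<integral>\<^sup>+x. ennreal (agsq (h k) (b, x)/(2 * (h k)^2)) \<partial>MB)"
 proof (rule nn_integral_liminf)
  fix k
  have "integrable MB (\<lambda>x. agsq (h k) (b, x))" by (rule agsq_slice(1)[OF h(1) b(1) bh])
  then show "(\<lambda>x. ennreal (agsq (h k) (b, x)/(2 * (h k)^2))) \<in> borel_measurable MB" by measurable
 qed
 finally have L2: "(\<integral>\<^sup>+x. ennreal (gsq (b, x)/2) \<partial>MB) \<le> liminf (\<lambda>k. \<integral>\<^sup>+x. ennreal (agsq (h k) (b, x)/(2 * (h k)^2)) \<partial>MB)" .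
 have L3: "(\<lambda>k. \<integral>\<^sup>+y. ?ind k y * ennreal (S k y) \<partial>?P) ----> (\<integral>\<^sup>+y. ennreal (nsq (fz y)/4) \<partial>?P)"
 proof (rule nn_integral_dominated_convergence[where w="\<lambda>_. ennreal M"])
  show "(\<lambda>y. ?ind k y * ennreal (S k y)) \<in> borel_measurable ?P" for k by (intro borel_measurable_times_ennreal indm Sm)
  show "(\<lambda>y. ennreal (nsq (fz y)/4)) \<in> borel_measurable ?P" using meas_Q[OF fz_cont subJ] by simp
  show "AE y in ?P. ?ind k y * ennreal (S k y) \<le> ennreal M" for k
  proof (rule AE_I2)
   fix y assume "y \<in> space ?P"
   then obtain t x where "y = (t,x)" "t \<in> {0<..b}" "x \<in> BB" using sp by blast
   then show "?ind k y * ennreal (S k y) \<le> ennreal M" using SM[of t x k] by (auto simp: indicator_def intro: ennreal_leI)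
  qed
  have "(\<integral>\<^sup>+y. ennreal M \<partial>?P) = (\<integral>\<^sup>+t. (\<integral>\<^sup>+x. ennreal M \<partial>MB) \<partial>lborel_on {0<..b})"
   by (rule nn_integral_pair) auto
  also have "\<dots> < \<infinity>"
   using b MBf.emeasure_finite[of BB] 
   by (simp add: space_restrict_space emeasure_restrict_space ennreal_mult_eq_top_iff less_top[symmetric])
  finally show "(\<integral>\<^sup>+y. ennreal M \<partial>?P) < \<infinity>" .
  show "AE y in ?P. (\<lambda>k. ?ind k y * ennreal (S k y)) ----> ennreal (nsq (fz y)/4)"
  proof (rule AE_I2)
   fix y assume y: "y \<in> space ?P"
   obtain t x where tx: "y = (t,x)" "(t,x) \<in> Q" using sp[OF y] by blast
   have "(\<lambda>k. ?ind k y * ennreal (S k y)) ----> 1 * ennreal (nsq (fz y)/4)"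
    unfolding S_def tx(1)
    by (intro tendsto_mult_ennreal tendsto_ennrealI tendsto_divide tendsto_power tendsto_norm SA_lim[OF fz_cont tx(2) h(1) h0] tendsto_const
      ind1[OF y, unfolded tx(1)]) auto
   then show "(\<lambda>k. ?ind k y * ennreal (S k y)) ----> ennreal (nsq (fz y)/4)" by simp
  qed
 qed (rule borel_measurable_const)
 let ?X = "\<lambda>k. \<integral>\<^sup>+y. ?ind k y * ennreal (nsq (G k y)) \<partial>?P"
 let ?Y = "\<lambda>k. \<integral>\<^sup>+x. ennreal (agsq (h k) (b, x)/(2 * (h k)^2)) \<partial>MB"
 have "(\<integral>\<^sup>+y. ennreal (nsq (dt U y + (1/2) .* fz y)) \<partial>?P) + (\<integral>\<^sup>+x. ennreal (gsq (b, x)/2) \<partial>MB) \<le> liminf ?X + liminf ?Y"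
  by (rule add_mono[OF L1 L2])
 also have "\<dots> \<le> liminf (\<lambda>k. ?X k + ?Y k)" by (rule ennreal_liminf_add_le)
 also have "\<dots> \<le> liminf (\<lambda>k. ennreal (r k) + (\<integral>\<^sup>+y. ?ind k y * ennreal (S k y) \<partial>?P))"
  by (intro Liminf_mono always_eventually allI key)
 also have "\<dots> = ennreal (M0/2) + (\<integral>\<^sup>+y. ennreal (nsq (fz y)/4) \<partial>?P)"
  by (intro lim_imp_Liminf sequentially_bot tendsto_add tendsto_ennrealI r_lim L3)
 finally show ?thesis .
qed

end

section \<open>The potential and the uniform energy bound\<close>

lemma abs_ln_powr_half_le: "0 < l ==> l \<le> 1 ==> - ln l * l powr (1/2) \<le> (1::real)"
proof -
 assume l: "0 < l" "l \<le> 1"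
 define x where "x = - ln l"
 have x: "x \<ge> 0" using l by (simp add: x_def)
 have "1 + x/2 + (x/2)^2/2 \<le> exp (x/2)" using x by (intro exp_lower_Taylor_quadratic) simp
 moreover have "x \<le> 1 + x/2 + (x/2)^2/2"
 proof -
  have "0 \<le> (x - 2)^2" by simp
  then show ?thesis by (simp add: power2_eq_square algebra_simps)
 qed
 ultimately have "x \<le> exp (x/2)" by linarith
 then have "x * exp (- (x/2)) \<le> 1" by (simp add: exp_minus field_simps)
 moreover have "l powr (1/2) = exp (- (x/2))" using l by (simp add: powr_def x_def)
 ultimately show ?thesis by (simp add: x_def)
qed

context glh begin

text \<open>The potential part of the energy density, with chi replaced by the identity as the
  maximum principle permits; \<open>kp\<close> below is the derivative of
  \<open>kappa\<close>.\<close>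

definition "V y = Lc (fst y)/4 * (nsq (U y) - 1)^2"
definition "kp t = 1/(pi * (1 + t^2))" for t :: real

lemma kp_bounds: "0 \<le> kp t" "kp t \<le> 1"
proof -
 show "0 \<le> kp t" by (simp add: kp_def)
 have "1 * 1 \<le> pi * (1 + t^2)" using pi_gt3 by (intro mult_mono) auto
 then show "kp t \<le> 1" by (simp add: kp_def)
qed

lemma kp_cont: "continuous_on S (\<lambda>y. kp (fst y))"
proof -
 have "1 + x^2 \<noteq> 0" for x :: real by (metis add_pos_nonneg less_irrefl zero_le_power2 zero_less_one)
 then show ?thesis unfolding kp_def by (intro continuous_intros) auto
qed

lemma Lc_deriv: "(Lc has_real_derivative - (kp t * ln lam * Lc t)) (at t)"
proof -
 have "Lc = (\<lambda>t. exp ((1 - arctan t/pi) * ln lam))"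
  using lam by (simp add: fun_eq_iff Lc_def kappa_def powr_def)
 moreover have "((\<lambda>t. exp ((1 - arctan t/pi) * ln lam)) has_real_derivative
   exp ((1 - arctan t/pi) * ln lam) * ((- (inverse (1 + t^2)/pi)) * ln lam)) (at t)"
  by (auto intro!: derivative_eq_intros)
 ultimately show ?thesis by (simp add: kp_def inverse_eq_divide mult_ac)
qed

lemma V_cont: "continuous_on Q V"
 unfolding V_def[abs_def] by (intro continuous_intros Lc_cont_fst conts) auto

lemma V_nonneg: "V y \<ge> 0"
 using Lc_bounds(1)[of "fst y"] by (simp add: V_def)

lemma V_le: "y \<in> Q ==> V y \<le> max 1 lam"
proof -
 assume y: "y \<in> Q"
 have "nsq (U y) \<le> 1" using max_principle[OF y] by (simp add: power_le_one)
 then have "(nsq (U y) - 1)^2 \<le> 1" by (simp add: abs_square_le_1)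
 moreover have "Lc (fst y) \<le> max 1 lam" "0 < Lc (fst y)" using Lc_bounds[of "fst y"] y by auto
 ultimately have "Lc (fst y)/4 * (nsq (U y) - 1)^2 \<le> (max 1 lam/1) * 1"
  by (intro mult_mono frac_le) auto
 then show ?thesis by (simp add: V_def)
qed

lemma V_le_w: "y \<in> Q ==> 1 - nsq (U y) \<le> 2 * norm (w y) ==> V y \<le> Lc (fst y) * nsq (w y)"
proof -
 assume y: "y \<in> Q" and le: "1 - nsq (U y) \<le> 2 * norm (w y)"
 have "nsq (U y) \<le> 1" using max_principle[OF y] by (simp add: power_le_one)
 then have "(1 - nsq (U y))^2 \<le> (2 * norm (w y))^2" using le by (intro power_mono) auto
 then have "(nsq (U y) - 1)^2/4 \<le> nsq (w y)" by (simp add: power_mult_distrib power2_commute)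
 then have "Lc (fst y) * ((nsq (U y) - 1)^2/4) \<le> Lc (fst y) * nsq (w y)"
  using Lc_bounds(1)[of "fst y"] by (intro mult_left_mono) auto
 then show ?thesis by (simp add: V_def)
qed

lemma V_deriv:
 assumes t: "t \<in> {0<..<T}" and x: "x \<in> BB"
 shows "((\<lambda>t. V (t,x)) has_real_derivative (fz (t,x) \<bullet> dt U (t,x) - kp t * ln lam * V (t,x))) (at t)"
proof -
 have dU: "((\<lambda>t. U (t,x)) has_derivative (\<lambda>h. h .* dt U (t,x))) (at t)"
  using slice_deriv_t[OF smooth t x] by (simp add: has_vector_derivative_def)
 have d2: "((\<lambda>t. U (t,x) \<bullet> U (t,x)) has_real_derivative (2 * (U (t,x) \<bullet> dt U (t,x)))) (at t)"
  unfolding has_field_derivative_def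
  by (rule has_derivative_eq_rhs[OF has_derivative_inner[OF dU dU]]) (simp add: fun_eq_iff inner_commute)
 have "((\<lambda>t. Lc t/4 * (U (t,x) \<bullet> U (t,x) - 1)^2) has_real_derivative
  (- (kp t * ln lam * Lc t))/4 * (U (t,x) \<bullet> U (t,x) - 1)^2 + (2 * (U (t,x) \<bullet> U (t,x) - 1) * (2 * (U (t,x) \<bullet> dt U (t,x)))) * (Lc t/4)) (at t)"
  by (auto intro!: derivative_eq_intros Lc_deriv d2)
 then show ?thesis
  unfolding V_def fz_def power2_norm_eq_inner fst_conv
  by (rule DERIV_cong) (simp add: algebra_simps)
qed

abbreviation PB :: "real => (real \<times> 'a) measure" where
 "PB b \<equiv> lborel2 {0<..b} BB"

lemma sub_b: "b < T ==> {0<..b} \<subseteq> {0<..<T}" by auto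

lemma PB_space: "b < T ==> y \<in> space (PB b) ==> y \<in> Q"
 by (auto simp: spaces)

lemma PB_const: "0 < b ==> integrable (PB b) (\<lambda>_. k :: real)"
proof -
 assume b: "0 < b"
 interpret MBf: finite_measure MB by (rule finite_MB)
 have "integrable (PJ 0 b) (\<lambda>_. k)"
  using integrable_snd_finite(1)[OF MBf.integrable_const, of 0 b k] b by simp
 then show ?thesis by (rule integrable_pair_subset) auto
qed

lemma PB_bounded:
 fixes F :: "real \<times> 'a => real"
 assumes b: "0 < b" "b < T" and F: "continuous_on Q F" and C: "\<And>y. y \<in> Q ==> \<bar>F y\<bar> \<le> C"
 shows "integrable (PB b) F"
proof (rule L1_bound[OF PB_const[OF b(1), of C]])
 show "F \<in> borel_measurable (PB b)" by (rule meas_Q[OF F sub_b[OF b(2)]])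
 show "AE y in PB b. norm (F y) \<le> norm C"
  using C[OF PB_space[OF b(2)]] by (intro AE_I2) force
qed

lemma w_sq_PB:
 assumes b: "0 < b" "b < T"
 shows "integrable (PB b) (\<lambda>y. nsq (w y))" (is ?c1)
  and "LI (PB b) (\<lambda>y. nsq (w y)) \<le> b * (exp (4 * max 1 lam * b) * b * M0)" (is ?c2)
proof -
 interpret pair_sigma_finite "lborel_on {0<..b}" MB by (intro pair_sigma_finite_lborel_on) auto
 show i: ?c1
 proof (rule L1_bound[OF PB_const[OF b(1), of 4]])
  show "(\<lambda>y. nsq (w y)) \<in> borel_measurable (PB b)" using w_meas[OF sub_b[OF b(2)]] by measurable
  have "AE y in PB b. norm (w y) \<le> 2"
   using AE_pair_w_bounds[OF sub_b[OF b(2)]] by (auto elim: eventually_mono)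
  then show "AE y in PB b. norm (nsq (w y)) \<le> norm (4::real)"
   by eventually_elim (use power_mono[of _ 2 2] in fastforce)
 qed
 have "LI (PB b) (\<lambda>y. nsq (w y)) = (\<integral>t. W t \<partial>lborel_on {0<..b})"
  using integral_fst'[OF i] by (simp add: W_def)
 also have "\<dots> \<le> (\<integral>t. exp (4 * max 1 lam * b) * b * M0 \<partial>lborel_on {0<..b})"
 proof (rule integral_mono)
  show "integrable (lborel_on {0<..b}) W" using integrable_fst'[OF i] by (simp add: W_def[abs_def])
  interpret F: finite_measure "lborel_on {0<..b}" by (rule finite_measure_lborel_on) auto
  show "integrable (lborel_on {0<..b}) (\<lambda>t. exp (4 * max 1 lam * b) * b * M0)" by simp
  fix t assume "t \<in> space (lborel_on {0<..b})"
  then have t: "0 < t" "t \<le> b" by (auto simp: space_restrict_space)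
  have "W t \<le> exp (4 * max 1 lam * t) * t * M0" using t b by (intro W_le) auto
  also have "\<dots> \<le> exp (4 * max 1 lam * b) * b * M0"
   using t M0_nonneg by (intro mult_right_mono mult_mono) (auto intro!: mult_left_mono)
  finally show "W t \<le> exp (4 * max 1 lam * b) * b * M0" .
 qed
 also have "\<dots> = b * (exp (4 * max 1 lam * b) * b * M0)"
  using b by (simp add: space_restrict_space measure_restrict_space)
 finally show ?c2 .
qed

text \<open>The raw inequality first yields finiteness, from which u_t and its product with
  \<open>fz\<close> are integrable. Only then may the square be expanded and the auxiliary term
  cancelled on both sides.\<close>

lemma energy_ineq_real:
 assumes b: "0 < b" "b < T"
 shows "integrable (PB b) (\<lambda>y. nsq (dt U y))" (is ?c1) "integrable (PB b) (\<lambda>y. fz y \<bullet> dt U y)" (is ?c2)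
  "integrable MB (\<lambda>x. gsq (b, x))" (is ?c3)
  "LI (PB b) (\<lambda>y. nsq (dt U y)) + LI (PB b) (\<lambda>y. fz y \<bullet> dt U y) + (\<integral>x. gsq (b, x) \<partial>MB)/2 \<le> M0/2" (is ?c4)
proof -
 note R = energy_ineq_raw[OF b]
 have bT: "b \<in> {0<..<T}" using b by simp
 have f2i: "integrable (PB b) (\<lambda>y. nsq (fz y)/4)"
 proof (rule PB_bounded[OF b])
  show "continuous_on Q (\<lambda>y. nsq (fz y)/4)" by (intro continuous_intros fz_cont) auto
  show "\<bar>nsq (fz y)/4\<bar> \<le> (max 1 lam)^2" if "y \<in> Q" for y
  proof -
   have "nsq (fz y) \<le> (max 1 lam)^2" using fz_bounded[OF that] by (intro power_mono) auto
   moreover have "\<bar>nsq (fz y)/4\<bar> = nsq (fz y)/4" by simp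
   ultimately show ?thesis using zero_le_power2[of "norm (fz y)"] by linarith
  qed
 qed
 then have f2: "(\<integral>\<^sup>+y. ennreal (nsq (fz y)/4) \<partial>PB b) = ennreal (\<integral>y. nsq (fz y)/4 \<partial>PB b)"
  by (intro nn_integral_eq_integral) auto
 have Gc: "continuous_on Q (\<lambda>y. nsq (dt U y + (1/2) .* fz y))" by (intro continuous_intros conts fz_cont)
 have Gi: "integrable (PB b) (\<lambda>y. nsq (dt U y + (1/2) .* fz y))"
 proof (rule integrableI_nonneg)
  have "(\<integral>\<^sup>+y. ennreal (nsq (dt U y + (1/2) .* fz y)) \<partial>PB b) \<le> ennreal (M0/2) + (\<integral>\<^sup>+y. ennreal (nsq (fz y)/4) \<partial>PB b)"
   using R by (rule order_trans[rotated]) simp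
  also have "\<dots> < \<infinity>" unfolding f2 by simp
  finally show "(\<integral>\<^sup>+y. ennreal (nsq (dt U y + (1/2) .* fz y)) \<partial>PB b) < \<infinity>" .
 qed (use meas_Q[OF Gc sub_b[OF b(2)]] in auto)
 show gi': ?c3
 proof -
  have "integrable MB (\<lambda>x. gsq (b, x)/2)"
  proof (rule integrableI_nonneg)
   have "(\<integral>\<^sup>+x. ennreal (gsq (b, x)/2) \<partial>MB) \<le> ennreal (M0/2) + (\<integral>\<^sup>+y. ennreal (nsq (fz y)/4) \<partial>PB b)"
    using R by (rule order_trans[rotated]) simp
   also have "\<dots> < \<infinity>" unfolding f2 by simp
   finally show "(\<integral>\<^sup>+x. ennreal (gsq (b, x)/2) \<partial>MB) < \<infinity>" .
  qed (use meas_x[OF cont_gsq bT] gsq_nonneg in auto)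
  then have "integrable MB (\<lambda>x. 2 * (gsq (b, x)/2))" by (rule integrable_mult_right)
  then show ?thesis by simp
 qed
 have dtm: "dt U \<in> borel_measurable (PB b)" by (rule meas_Q[OF conts(3) sub_b[OF b(2)]])
 show d2: ?c1
 proof (rule L1_bound)
  show "integrable (PB b) (\<lambda>y. 2 * nsq (dt U y + (1/2) .* fz y) + 2 * (nsq (fz y)/4))"
   by (intro Bochner_Integration.integrable_add integrable_mult_right Gi f2i)
  show "(\<lambda>y. nsq (dt U y)) \<in> borel_measurable (PB b)" using dtm by measurable
  show "AE y in PB b. norm (nsq (dt U y)) \<le> norm (2 * nsq (dt U y + (1/2) .* fz y) + 2 * (nsq (fz y)/4))"
  proof (rule AE_I2)
   fix y
   have "nsq (dt U y) \<le> 2 * nsq (dt U y + (1/2) .* fz y) + 2 * nsq ((1/2) .* fz y)"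
    using norm_diff_sq_le[of "dt U y + (1/2) .* fz y" "(1/2) .* fz y"] by simp
   then show "norm (nsq (dt U y)) \<le> norm (2 * nsq (dt U y + (1/2) .* fz y) + 2 * (nsq (fz y)/4))"
    by (simp add: power_divide)
  qed
 qed
 have id: "nsq (dt U y + (1/2) .* fz y) = nsq (dt U y) + fz y \<bullet> dt U y + nsq (fz y)/4" for y
  unfolding power2_norm_eq_inner by (simp add: inner_simps inner_commute)
 have "integrable (PB b) (\<lambda>y. nsq (dt U y + (1/2) .* fz y) - nsq (dt U y) - nsq (fz y)/4)"
  using Gi d2 f2i by simp
 then show fd: ?c2 unfolding id by simp
 have "ennreal (\<integral>y. nsq (dt U y + (1/2) .* fz y) \<partial>PB b) + ennreal (\<integral>x. gsq (b, x)/2 \<partial>MB) \<le> ennreal (M0/2) + ennreal (\<integral>y. nsq (fz y)/4 \<partial>PB b)"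
  using R unfolding f2 using Gi gi' gsq_nonneg by (simp add: nn_integral_eq_integral)
 then have "(\<integral>y. nsq (dt U y + (1/2) .* fz y) \<partial>PB b) + (\<integral>x. gsq (b, x)/2 \<partial>MB) \<le> M0/2 + (\<integral>y. nsq (fz y)/4 \<partial>PB b)"
  using M0_nonneg gsq_nonneg by (simp add: ennreal_plus[symmetric] ennreal_le_iff del: ennreal_plus)
 then show ?c4
  unfolding id using d2 fd f2i by simp
qed

lemma V_integrable_x: "t \<in> {0<..<T} ==> integrable MB (\<lambda>x. V (t,x))"
proof -
 assume t: "t \<in> {0<..<T}"
 interpret finite_measure MB by (rule finite_MB)
 show ?thesis
 proof (rule integrable_const_bound[where B="max 1 lam"])
  show "AE x in MB. norm (V (t,x)) \<le> max 1 lam"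
   using t V_le V_nonneg by (intro AE_I2) (auto simp: space_restrict_space)
 qed (rule meas_x[OF V_cont t])
qed

lemma V_le_W: "t \<in> {0<..<T} ==> (\<integral>x. V (t,x) \<partial>MB) \<le> Lc t * W t"
proof -
 assume t: "t \<in> {0<..<T}"
 have "(\<integral>x. V (t,x) \<partial>MB) \<le> (\<integral>x. Lc t * nsq (w (t,x)) \<partial>MB)"
 proof (rule integral_mono_AE[OF V_integrable_x[OF t] integrable_mult_right[OF w_sq_integrable[OF t]]])
  show "AE x in MB. V (t,x) \<le> Lc t * nsq (w (t,x))"
   using w_bounds[OF t] AE_space
  proof eventually_elim
   case (elim x)
   then show ?case using V_le_w[of "(t,x)"] t by (auto simp: space_restrict_space)
  qed
 qed
 then show ?thesis by (simp add: W_def)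
qed

text \<open>\<open>fz . u_t\<close> is the time derivative of \<open>V\<close> at frozen coupling,
  and the time dependence of the coupling adds the term with \<open>ln lam\<close>. The potential
  vanishes at time 0 because it is at most \<open>Lc |w|^2\<close>.\<close>

lemma potential_identity:
 assumes b: "0 < b" "b < T"
 shows "LI (PB b) (\<lambda>y. fz y \<bullet> dt U y) = (\<integral>x. V (b, x) \<partial>MB) + ln lam * LI (PB b) (\<lambda>y. kp (fst y) * V y)" (is ?c1)
  and "integrable (PB b) (\<lambda>y. kp (fst y) * V y)" (is ?c2)
proof -
 show kVi: ?c2
 proof (rule PB_bounded[OF b])
  show "continuous_on Q (\<lambda>y. kp (fst y) * V y)" by (intro continuous_intros kp_cont V_cont)
  show "\<bar>kp (fst y) * V y\<bar> \<le> 1 * max 1 lam" if "y \<in> Q" for y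
   unfolding abs_mult using kp_bounds V_le[OF that] V_nonneg by (intro mult_mono) auto
 qed
 define R where "R y = fz y \<bullet> dt U y - kp (fst y) * ln lam * V y" for y
 have R_eq: "R y = fz y \<bullet> dt U y - ln lam * (kp (fst y) * V y)" for y by (simp add: R_def)
 have RP: "integrable (PB b) R"
  unfolding R_eq using energy_ineq_real(2)[OF b] kVi by simp
 have Rc: "continuous_on Q R" unfolding R_def by (intro continuous_intros kp_cont fz_cont conts V_cont)
 have ftc: "(\<integral>x. V (b, x) \<partial>MB) - (\<integral>x. V (a, x) \<partial>MB) = LI (PJ a b) R" if a: "0 < a" "a < b" for a
 proof -
  interpret pair_sigma_finite "lborel_on {a..b}" MB by (intro pair_sigma_finite_lborel_on) auto
  have Ra: "integrable (PJ a b) R"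
   by (rule integrable_pair_subset[OF RP]) (use a in auto)
  have "(\<integral>x. V (b, x) \<partial>MB) - (\<integral>x. V (a, x) \<partial>MB) = (\<integral>t. (\<integral>x. R (t,x) \<partial>MB) \<partial>lborel_on {a..b})"
  proof (rule time_FTC)
   show "((\<lambda>t. V (t,x)) has_real_derivative R (t,x)) (at t)" if "x \<in> BB" "t \<in> {a..b}" for x t
    using V_deriv[of t x] that a b by (simp add: R_def)
   show "continuous_on {a..b} (\<lambda>t. R (t,x))" if "x \<in> BB" for x
    using a b by (intro slice_cont_t'[OF Rc that]) auto
   show "integrable MB (\<lambda>x. V (a, x))" "integrable MB (\<lambda>x. V (b, x))" using a b by (auto intro!: V_integrable_x)
   show "integrable (PJ a b) (\<lambda>(t,x). R (t,x))" using Ra by simp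
  qed (use a in auto)
  also have "\<dots> = LI (PJ a b) R" using integral_fst'[OF Ra] by simp
  finally show ?thesis .
 qed
 \<comment> \<open>The shift by 2 keeps \<open>a k\<close> strictly below \<open>b\<close> for every
   index.\<close>
 define a where "a k = b/real (Suc (Suc k))" for k
 have a: "0 < a k" "a k < b" for k using b by (auto simp: a_def field_simps add_pos_nonneg)
 have a0: "a ----> 0" unfolding a_def by real_asymp
 have ar: "filterlim a (at_right 0) sequentially"
  unfolding filterlim_at using a0 a by (auto intro!: always_eventually simp: less_imp_neq[OF a(1), symmetric])
 have "(\<lambda>k. max 1 lam * W (a k)) ----> max 1 lam * 0"
  by (intro tendsto_mult tendsto_const filterlim_compose[OF W_tendsto ar])
 then have W0: "(\<lambda>k. max 1 lam * W (a k)) ----> 0" by simp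
 have V0: "(\<lambda>k. \<integral>x. V (a k, x) \<partial>MB) ----> 0"
 proof (rule tendsto_sandwich[OF _ _ tendsto_const W0])
  show "\<forall>\<^sub>F k in sequentially. (\<integral>x. V (a k, x) \<partial>MB) \<le> max 1 lam * W (a k)"
  proof (rule always_eventually, rule allI)
   fix k
   have "(\<integral>x. V (a k, x) \<partial>MB) \<le> Lc (a k) * W (a k)" using a[of k] b by (intro V_le_W) auto
   also have "\<dots> \<le> max 1 lam * W (a k)" using Lc_bounds(2)[of "a k"] a[of k] W_nonneg by (intro mult_right_mono) auto
   finally show "(\<integral>x. V (a k, x) \<partial>MB) \<le> max 1 lam * W (a k)" .
  qed
 qed (use V_nonneg in auto)
 have l1: "(\<lambda>k. LI (lborel2 {a k..b} BB) R) ----> (\<integral>x. V (b, x) \<partial>MB) - 0"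
  unfolding ftc[OF a, symmetric] by (intro tendsto_diff tendsto_const V0)
 have "(\<lambda>k. \<integral>y. indicator {a k..b} (fst y) * R y \<partial>PB b) ----> LI (PB b) R"
 proof (rule integral_dominated_convergence[where w="\<lambda>y. \<bar>R y\<bar>"])
  show "(\<lambda>y. indicator {a k..b} (fst y) * R y) \<in> borel_measurable (PB b)" for k
  proof (rule borel_measurable_times)
   show "(\<lambda>y. indicator {a k..b} (fst y) :: real) \<in> borel_measurable (PB b)"
    by (intro measurable_compose[OF measurable_fst borel_measurable_indicator]) (use a[of k] in \<open>auto simp: sets_restrict_space_iff\<close>)
  qed (use RP in simp)
  show "AE y in PB b. (\<lambda>k. indicator {a k..b} (fst y) * R y) ----> R y"
  proof (rule AE_I2)
   fix y assume "y \<in> space (PB b)"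
   then have y: "fst y > 0" "fst y \<le> b" by (auto simp: spaces)
   have "\<forall>\<^sub>F k in sequentially. a k < fst y" using a0 y by (intro order_tendstoD) auto
   then show "(\<lambda>k. indicator {a k..b} (fst y) * R y) ----> R y"
    by (intro tendsto_eventually, elim eventually_mono) (use y in \<open>auto simp: indicator_def\<close>)
  qed
  show "AE y in PB b. norm (indicator {a k..b} (fst y) * R y) \<le> \<bar>R y\<bar>" for k
   by (intro AE_I2) (simp add: indicator_def)
 qed (use RP in auto)
 moreover have "(\<integral>y. indicator {a k..b} (fst y) * R y \<partial>PB b) = LI (lborel2 {a k..b} BB) R" for k
  by (rule integral_pair_restrict[OF RP]) (use a[of k] in auto)
 ultimately have "(\<lambda>k. LI (lborel2 {a k..b} BB) R) ----> LI (PB b) R" by simp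
 from LIMSEQ_unique[OF this l1] have "LI (PB b) R = (\<integral>x. V (b, x) \<partial>MB)" by simp
 moreover have "LI (PB b) R = LI (PB b) (\<lambda>y. fz y \<bullet> dt U y) - ln lam * LI (PB b) (\<lambda>y. kp (fst y) * V y)"
  unfolding R_eq using energy_ineq_real(2)[OF b] kVi by simp
 ultimately show ?c1
  by linarith
qed

lemma Lc_le_powr_half: "lam \<le> 1 ==> t \<ge> 0 ==> Lc t \<le> lam powr (1/2)"
 unfolding Lc_def using lam kappa_bounds[of t] by (intro powr_mono') auto

definition "CE = 1/2 + T^2 * exp (4 * T)"

lemma CE_ge: "CE \<ge> 1/2" by (simp add: CE_def)

text \<open>For \<open>lam \<ge> 1\<close> the coupling term has the good sign. For
  \<open>lam < 1\<close> the potential is at most \<open>lam^(1/2) |w|^2\<close>, the space-time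
  integral of |w|^2 is at most \<open>T^2 exp (4 T) M0\<close>, and
  \<open>lam^(1/2) |ln lam| \<le> 1\<close>. In this case the exponential rate
  \<open>4 max 1 lam\<close> is just 4, so \<open>CE\<close> is free of \<open>lam\<close>.\<close>

theorem energy_bound:
 assumes b: "0 < b" "b < T"
 shows "LI (PB b) (\<lambda>y. nsq (dt U y)) + (\<integral>x. gsq (b, x) \<partial>MB)/2 + (\<integral>x. V (b, x) \<partial>MB) \<le> CE * M0"
proof -
 let ?I = "LI (PB b) (\<lambda>y. kp (fst y) * V y)"
 have I0: "?I \<ge> 0" using kp_bounds V_nonneg by simp
 have "- ln lam * ?I \<le> T^2 * exp (4 * T) * M0"
 proof (cases "lam \<ge> 1")
  case True
  then have "- ln lam * ?I \<le> 0" using I0 by (simp add: mult_nonneg_nonneg)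
  also have "0 \<le> T^2 * exp (4 * T) * M0" using M0_nonneg by simp
  finally show ?thesis .
 next
  case False
  then have m: "max 1 lam = 1" by simp
  have "?I \<le> (\<integral>y. lam powr (1/2) * nsq (w y) \<partial>PB b)"
  proof (rule integral_mono_AE[OF potential_identity(2)[OF b] integrable_mult_right[OF w_sq_PB(1)[OF b]]])
   show "AE y in PB b. kp (fst y) * V y \<le> lam powr (1/2) * nsq (w y)"
    using AE_pair_w_bounds[OF sub_b[OF b(2)] greaterThanAtMost_borel]
   proof eventually_elim
    case (elim y)
    have "kp (fst y) * V y \<le> 1 * V y" using kp_bounds V_nonneg by (intro mult_right_mono) auto
    also have "1 * V y \<le> Lc (fst y) * nsq (w y)" using V_le_w[of y] elim by simp
    also have "\<dots> \<le> lam powr (1/2) * nsq (w y)" using elim False by (intro mult_right_mono Lc_le_powr_half) (auto simp: mem_Times_iff)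
    finally show ?case .
   qed
  qed
  also have "\<dots> = lam powr (1/2) * LI (PB b) (\<lambda>y. nsq (w y))" by simp
  also have "\<dots> \<le> lam powr (1/2) * (b * (exp (4 * b) * b * M0))"
   using w_sq_PB(2)[OF b] unfolding m by (intro mult_left_mono) auto
  finally have "- ln lam * ?I \<le> - ln lam * (lam powr (1/2) * (b * (exp (4 * b) * b * M0)))"
   using lam False by (intro mult_left_mono) auto
  also have "\<dots> = (- ln lam * lam powr (1/2)) * (b * (exp (4 * b) * b * M0))" by simp
  also have "\<dots> \<le> 1 * (b * (exp (4 * b) * b * M0))"
   using abs_ln_powr_half_le[OF lam] False b M0_nonneg by (intro mult_right_mono) auto
  also have "\<dots> \<le> T * (exp (4 * T) * T * M0)"
   using b M0_nonneg unfolding mult_1 by (intro mult_mono mult_right_mono) auto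
  finally show ?thesis by (simp add: power2_eq_square mult_ac)
 qed
 then show ?thesis
  using energy_ineq_real(4)[OF b] potential_identity(1)[OF b] by (simp add: CE_def distrib_right)
qed

end

section \<open>The local monotonicity formula\<close>

lemma continuous_on_integral_compact_support:
 fixes F :: "real \<times> 'a::euclidean_space => real"
 assumes K: "compact K" "K \<subseteq> B" and B: "B \<in> sets borel"
  and c: "continuous_on ({a..b} \<times> B) F" and z: "\<And>t x. t \<in> {a..b} ==> x \<in> B - K ==> F (t,x) = 0"
 shows "continuous_on {a..b} (\<lambda>t. \<integral>x. F (t,x) \<partial>lborel_on B)"
 unfolding continuous_on_sequentially o_def
proof (intro allI ballI impI, elim conjE)
 fix s t assume t: "t \<in> {a..b}" and s: "\<forall>n. s n \<in> {a..b}" and lim: "s ----> t"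
 have "continuous_on ({a..b} \<times> K) F" using c by (rule continuous_on_subset) (use K in auto)
 from compact_continuous_image[OF this compact_Times[OF compact_Icc K(1)]]
 obtain M where M: "\<And>z. z \<in> {a..b} \<times> K ==> norm (F z) \<le> M"
  using compact_imp_bounded bounded_iff by (metis (no_types, lifting) imageI)
 have KB: "K \<in> sets (lborel_on B)" using K B by (auto simp: sets_restrict_space_iff compact_imp_closed)
 have cx: "continuous_on B (\<lambda>x. F (t,x))" if "t \<in> {a..b}" for t
  using that by (intro continuous_on_compose2[OF c]) (auto intro!: continuous_intros)
 show "(\<lambda>n. \<integral>x. F (s n, x) \<partial>lborel_on B) ----> (\<integral>x. F (t,x) \<partial>lborel_on B)"
 proof (rule integral_dominated_convergence[where w="\<lambda>x. \<bar>M\<bar> * indicator K x"])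
  show "integrable (lborel_on B) (\<lambda>x. \<bar>M\<bar> * indicator K x)"
   using K B KB emeasure_bounded_finite[OF compact_imp_bounded[OF K(1)]]
   by (intro integrable_mult_right integrable_real_indicator) (auto simp: emeasure_restrict_space)
  show "AE x in lborel_on B. (\<lambda>n. F (s n, x)) ----> F (t,x)"
  proof (rule AE_I2)
   fix x assume "x \<in> space (lborel_on B)"
   then have "continuous_on {a..b} (\<lambda>t. F (t,x))"
    by (intro continuous_on_compose2[OF c]) (auto intro!: continuous_intros simp: space_restrict_space)
   then show "(\<lambda>n. F (s n, x)) ----> F (t,x)"
    using t s lim by (auto simp: continuous_on_sequentially o_def)
  qed
  show "AE x in lborel_on B. norm (F (s n, x)) \<le> \<bar>M\<bar> * indicator K x" for n
  proof (rule AE_I2)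
   fix x assume x: "x \<in> space (lborel_on B)"
   show "norm (F (s n, x)) \<le> \<bar>M\<bar> * indicator K x"
   proof (cases "x \<in> K")
    case True
    then have "norm (F (s n, x)) \<le> M" using M s by auto
    then show ?thesis using True by simp
   qed (use x z s in \<open>auto simp: space_restrict_space\<close>)
  qed
 qed (use cx s t in \<open>auto intro!: borel_measurable_lborel_on\<close>)
qed

context glh begin

text \<open>The energy density along the flow, followed by its derivatives in time and in direction
  \<open>v\<close>. In \<open>ed_t\<close> the time derivative has been commuted with the spatial
  ones, so that the divergence identity can recognise \<open>grad u . grad u_t\<close>.\<close>

definition "ed z = gsq z/2 + V z"
definition "ed_t z = (\<Sum>c\<in>Basis. dx c U z \<bullet> dx c (dt U) z) + fz z \<bullet> dt U z - kp (fst z) * ln lam * V z"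
definition "ed_x v z = (\<Sum>c\<in>Basis. dx c U z \<bullet> dx v (dx c U) z) + fz z \<bullet> dx v U z"

lemma dx_sum: "z \<in> Q ==> dx v U z = (\<Sum>c\<in>Basis. (v \<bullet> c) .* dx c U z)"
proof -
 assume z: "z \<in> Q"
 have "linear (\<lambda>v. dx v U (fst z, snd z))"
  by (rule has_derivative_linear[OF slice_deriv_x[OF smooth]]) (use z in auto)
 then have l: "linear (\<lambda>v. dx v U z)" by simp
 have "dx v U z = dx (\<Sum>c\<in>Basis. (v \<bullet> c) .* c) U z" by (simp add: euclidean_representation)
 also have "\<dots> = (\<Sum>c\<in>Basis. (v \<bullet> c) .* dx c U z)"
  using linear_sum[OF l, of "\<lambda>c. (v \<bullet> c) .* c" Basis] linear_scale[OF l] by simp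
 finally show ?thesis .
qed

lemma ed_deriv_t:
 assumes t: "t \<in> {0<..<T}" and x: "x \<in> BB"
 shows "((\<lambda>t. ed (t,x)) has_real_derivative ed_t (t,x)) (at t)"
proof -
 have d: "((\<lambda>t. nsq (dx c U (t,x))) has_real_derivative 2 * (dx c U (t,x) \<bullet> dx c (dt U) (t,x))) (at t)" for c
 proof -
  have "((\<lambda>t. dx c U (t,x)) has_derivative (\<lambda>h. h .* dx c (dt U) (t,x))) (at t)"
   using slice_deriv_t[OF smooths(2) t x, of c] dt_dx_commute[OF open_Q smooth, of "(t,x)" c] t x
   by (simp add: has_vector_derivative_def)
  from has_derivative_inner[OF this this] show ?thesis
   unfolding has_field_derivative_def power2_norm_eq_inner
   by (rule has_derivative_eq_rhs) (simp add: fun_eq_iff inner_commute)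
 qed
 have "((\<lambda>t. (\<Sum>c\<in>Basis. nsq (dx c U (t,x)))/2 + V (t,x)) has_real_derivative
  (\<Sum>c\<in>Basis. 2 * (dx c U (t,x) \<bullet> dx c (dt U) (t,x)))/2 + (fz (t,x) \<bullet> dt U (t,x) - kp t * ln lam * V (t,x))) (at t)"
  by (intro DERIV_add DERIV_cdivide DERIV_sum d V_deriv t x)
 then show ?thesis
  unfolding ed_def ed_t_def gsq_def by (rule DERIV_cong) (simp add: sum_distrib_left[symmetric])
qed

lemma ed_deriv_x:
 assumes t: "t \<in> {0<..<T}" and x: "x \<in> BB"
 shows "((\<lambda>x. ed (t,x)) has_derivative (\<lambda>v. ed_x v (t,x))) (at x)"
proof -
 have d: "((\<lambda>x. F (t,x) \<bullet> F (t,x)) has_derivative (\<lambda>v. 2 * (F (t,x) \<bullet> dx v F (t,x)))) (at x)" if "smooth_on Q F" for F :: "real \<times> 'a => 'b"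
  by (rule has_derivative_eq_rhs[OF has_derivative_inner[OF slice_deriv_x[OF that t x] slice_deriv_x[OF that t x]]])
   (simp add: fun_eq_iff inner_commute)
 have "((\<lambda>x. 1/2 * (\<Sum>c\<in>Basis. dx c U (t,x) \<bullet> dx c U (t,x)) + Lc t/4 * ((U (t,x) \<bullet> U (t,x) - 1) * (U (t,x) \<bullet> U (t,x) - 1))) has_derivative
  (\<lambda>v. 1/2 * (\<Sum>c\<in>Basis. 2 * (dx c U (t,x) \<bullet> dx v (dx c U) (t,x)))
    + Lc t/4 * ((U (t,x) \<bullet> U (t,x) - 1) * (2 * (U (t,x) \<bullet> dx v U (t,x)) - 0) + (2 * (U (t,x) \<bullet> dx v U (t,x)) - 0) * (U (t,x) \<bullet> U (t,x) - 1)))) (at x)"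
  by (intro has_derivative_add has_derivative_mult_right has_derivative_sum has_derivative_mult has_derivative_diff has_derivative_const d smooths)
 from has_derivative_eq_rhs[OF this, of "\<lambda>v. ed_x v (t,x)"] show ?thesis
  by (simp add: ed_def ed_x_def gsq_def V_def fz_def power2_norm_eq_inner power2_eq_square[of "_ - 1"] fun_eq_iff
     sum_distrib_left[symmetric] algebra_simps)
qed

end

section \<open>The localised scaling identity at a point\<close>

locale glh_point = glh T lam chi U v0 g + smooth_step \<beta> \<beta>' L
 for T lam :: real and chi and U :: "real \<times> 'a::euclidean_space => 'b::euclidean_space" and v0 g \<beta> \<beta>' L +
 fixes t0 :: real and x0 :: 'a
 assumes t0: "t0 \<in> {0<..<T}" and x0: "x0 \<in> ball 0 1"
begin

definition "d0 = 1 - norm x0"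
text \<open>With s = |y|^2/d0^2 the argument \<open>3 - 4 s\<close> is at least 1 for s \<le> 1/2
  and at most 0 for s \<ge> 3/4. Since 3/4 < (9/10)^2, the support lies in the closed ball of radius
  9/10 d0, a compact part of the unit ball.\<close>

definition "\<phi> x = \<beta> (3 - 4 * nsq (x - x0)/d0^2)"
definition "b\<phi> x = 8/d0^2 * \<beta>' (3 - 4 * nsq (x - x0)/d0^2)"
text \<open>The backward heat kernel at (t0, x0) without its power of \<tau>, which the scaling
  factor of the energy replaces.\<close>

definition "G z = exp (nsq (snd z - x0)/(4 * (fst z - t0)))"
definition "YU z = (\<Sum>c\<in>Basis. ((snd z - x0) \<bullet> c) .* dx c U z)"
text \<open>The generator of the parabolic scaling about (t0, x0) applied to u; it equals
  \<open>- 2 \<tau> NU\<close>, where \<open>NU\<close> is the field whose square is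
  dissipated.\<close>

definition "PU z = YU z - (2 * (t0 - fst z)) .* dt U z"
definition "NU z = dt U z + (1/(2 * (fst z - t0))) .* YU z"
definition "PU_x v z = (\<Sum>c\<in>Basis. (v \<bullet> c) .* dx c U z + ((snd z - x0) \<bullet> c) .* dx v (dx c U) z)
 - (2 * (t0 - fst z)) .* dx v (dt U) z"
text \<open>\<open>Zd b\<close> is the spatial derivative of \<open>\<phi> G ((y \<bullet> grad u - 2 \<tau> u_t) \<bullet> d_b u - y_b e)\<close>; note \<open>grad \<phi> = - b\<phi> y\<close>.\<close>
definition "Zd b z v = - (b\<phi> (snd z) * ((snd z - x0) \<bullet> v)) * G z * (PU z \<bullet> dx b U z - ((snd z - x0) \<bullet> b) * ed z)
 + \<phi> (snd z) * (- (((snd z - x0) \<bullet> v)/(2 * (t0 - fst z))) * G z) * (PU z \<bullet> dx b U z - ((snd z - x0) \<bullet> b) * ed z)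
 + \<phi> (snd z) * G z * (PU_x v z \<bullet> dx b U z + PU z \<bullet> dx v (dx b U) z - (v \<bullet> b) * ed z - ((snd z - x0) \<bullet> b) * ed_x v z)"
definition "EGt z = ed_t z * G z - ed z * G z * nsq (snd z - x0)/(4 * (t0 - fst z)^2)"

lemma d0: "0 < d0" "d0 \<le> 1" using x0 by (auto simp: d0_def)

lemma sub_t0: "t \<in> {0<..<t0} ==> t \<in> {0<..<T}" using t0 by auto

lemma G_pos: "G z > 0" by (simp add: G_def)

lemma phi_bounds: "0 \<le> \<phi> x" "\<phi> x \<le> 1" "0 \<le> b\<phi> x" "b\<phi> x \<le> 8 * L/d0^2"
proof -
 have "8/d0^2 * \<beta>' (3 - 4 * nsq (x - x0)/d0^2) \<le> 8/d0^2 * L"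
  using \<beta>(8) by (intro mult_left_mono) auto
 then show "b\<phi> x \<le> 8 * L/d0^2" by (simp add: b\<phi>_def)
qed (use \<beta> in \<open>auto simp: \<phi>_def b\<phi>_def\<close>)

lemma phi_inner: "nsq (x - x0) \<le> d0^2/2 ==> \<phi> x = 1 \<and> b\<phi> x = 0"
proof -
 assume "nsq (x - x0) \<le> d0^2/2"
 then have "4 * nsq (x - x0)/d0^2 \<le> 2" using d0 by (simp add: field_simps)
 then show ?thesis using \<beta>(4,10) by (simp add: \<phi>_def b\<phi>_def)
qed

lemma phi_outer: "x \<notin> cball x0 (9/10 * d0) ==> \<phi> x = 0 \<and> b\<phi> x = 0"
proof -
 assume "x \<notin> cball x0 (9/10 * d0)"
 then have "9/10 * d0 \<le> norm (x - x0)" by (simp add: dist_norm norm_minus_commute)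
 then have "(9/10 * d0)^2 \<le> nsq (x - x0)" using d0 by (intro power_mono) auto
 then have "81/100 * d0^2 \<le> nsq (x - x0)" by (simp add: power_mult_distrib power_divide)
 then have "3 * d0^2 \<le> 4 * nsq (x - x0)" using zero_le_power2[of d0] by linarith
 then have "3 \<le> 4 * nsq (x - x0)/d0^2" using d0 by (simp add: pos_le_divide_eq)
 then show ?thesis using \<beta>(3,9) by (simp add: \<phi>_def b\<phi>_def)
qed

lemma K_sub: "cball x0 (9/10 * d0) \<subseteq> BB"
proof
 fix x assume "x \<in> cball x0 (9/10 * d0)"
 then have "norm (x - x0) < d0" using d0 by (simp add: dist_norm norm_minus_commute)
 then show "x \<in> BB" using norm_triangle_ineq[of "x - x0" x0] by (simp add: d0_def)
qed

lemma G_far: "t < t0 ==> \<phi> x \<noteq> 1 \<or> b\<phi> x \<noteq> 0 ==> G (t,x) \<le> exp (- (d0^2/(8 * (t0 - t))))"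
proof -
 assume t: "t < t0" and "\<phi> x \<noteq> 1 \<or> b\<phi> x \<noteq> 0"
 then have "d0^2/2 \<le> nsq (x - x0)" using phi_inner[of x] by (meson nle_le)
 then have "d0^2/2/(4 * (t0 - t)) \<le> nsq (x - x0)/(4 * (t0 - t))" using t by (intro divide_right_mono) auto
 moreover have "nsq (x - x0)/(4 * (t - t0)) = - (nsq (x - x0)/(4 * (t0 - t)))"
  using t by (simp add: field_simps)
 ultimately show ?thesis by (simp add: G_def)
qed

lemma G_le_1: "t < t0 ==> G (t,x) \<le> 1"
 by (simp add: G_def divide_nonneg_neg)

lemma phi_deriv: "(\<phi> has_derivative (\<lambda>v. - (b\<phi> x * ((x - x0) \<bullet> v)))) (at x)"
proof -
 have "((\<lambda>x. 3 - k * ((x - x0) \<bullet> (x - x0))) has_derivative (\<lambda>v. - (2 * k * ((x - x0) \<bullet> v)))) (at x)" for k :: real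
  by (auto intro!: derivative_eq_intros simp: fun_eq_iff inner_commute)
 from this[of "4/d0^2"] have "((\<lambda>x. 3 - 4 * nsq (x - x0)/d0^2) has_derivative (\<lambda>v. - (8/d0^2 * ((x - x0) \<bullet> v)))) (at x)"
  by (simp add: power2_norm_eq_inner)
 from has_derivative_compose[OF this \<beta>(1)[unfolded has_field_derivative_def]]
 show ?thesis unfolding \<phi>_def b\<phi>_def by (simp add: mult_ac)
qed

lemma phi_cont: "continuous_on S \<phi>" "continuous_on S b\<phi>"
proof -
 show "continuous_on S \<phi>" by (intro continuous_at_imp_continuous_on ballI has_derivative_continuous[OF phi_deriv])
 show "continuous_on S b\<phi>"
  unfolding b\<phi>_def by (intro continuous_intros continuous_on_compose2[OF \<beta>(2)]) (use d0 in auto)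
qed

lemma G_deriv_x:
 assumes t: "t < t0"
 shows "((\<lambda>x. G (t,x)) has_derivative (\<lambda>v. - (((x - x0) \<bullet> v)/(2 * (t0 - t))) * G (t,x))) (at x)"
proof -
 have "((\<lambda>x. (1/(4 * (t - t0))) * ((x - x0) \<bullet> (x - x0))) has_derivative (\<lambda>v. (1/(4 * (t - t0))) * (2 * ((x - x0) \<bullet> v)))) (at x)"
  using t by (auto intro!: derivative_eq_intros simp: fun_eq_iff inner_commute)
 then have "((\<lambda>x. exp ((1/(4 * (t - t0))) * ((x - x0) \<bullet> (x - x0)))) has_derivative
   (\<lambda>v. (1/(4 * (t - t0))) * (2 * ((x - x0) \<bullet> v)) * exp ((1/(4 * (t - t0))) * ((x - x0) \<bullet> (x - x0))))) (at x)"
  by (rule has_derivative_exp)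
 moreover have "exp ((1/(4 * (t - t0))) * ((x - x0) \<bullet> (x - x0))) = G (t,x)" for x
  by (simp add: G_def power2_norm_eq_inner)
 ultimately show ?thesis
  by (simp only:) (erule has_derivative_eq_rhs, use t in \<open>simp add: fun_eq_iff divide_simps, simp add: algebra_simps\<close>)
qed

lemma G_deriv_t:
 assumes t: "t < t0"
 shows "((\<lambda>t. G (t,x)) has_real_derivative - (G (t,x) * nsq (x - x0)/(4 * (t0 - t)^2))) (at t)"
proof -
 have "((\<lambda>t. nsq (x - x0)/(4 * (t - t0))) has_real_derivative - (nsq (x - x0)/(4 * (t0 - t)^2))) (at t)"
  by (rule DERIV_cong[OF DERIV_divide[OF DERIV_const DERIV_cmult[OF DERIV_diff[OF DERIV_ident DERIV_const]]]])
   (use t in \<open>auto simp: power2_eq_square divide_simps algebra_simps\<close>)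
 from DERIV_fun_exp[OF this] show ?thesis
  unfolding G_def fst_conv snd_conv by (rule DERIV_cong) simp
qed

lemma PU_deriv_x:
 assumes t: "t \<in> {0<..<T}" and x: "x \<in> BB"
 shows "((\<lambda>x. PU (t,x)) has_derivative (\<lambda>v. PU_x v (t,x))) (at x)"
 unfolding PU_def PU_x_def YU_def fst_conv snd_conv
 by (auto intro!: derivative_eq_intros slice_deriv_x smooths t x simp: fun_eq_iff add.commute)

lemma Z_deriv:
 assumes t: "t \<in> {0<..<t0}" and x: "x \<in> BB"
 shows "((\<lambda>x. \<phi> x * G (t,x) * (PU (t,x) \<bullet> dx b U (t,x) - ((x - x0) \<bullet> b) * ed (t,x))) has_derivative Zd b (t,x)) (at x)"
proof -
 have t': "t < t0" using t by simp
 show ?thesis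
  by (rule has_derivative_eq_rhs[OF has_derivative_mult[OF has_derivative_mult[OF phi_deriv G_deriv_x[OF t']]
    has_derivative_diff[OF has_derivative_inner[OF PU_deriv_x[OF sub_t0[OF t] x] slice_deriv_x[OF smooths(2) sub_t0[OF t] x]]
     has_derivative_mult[OF has_derivative_inner_left[OF has_derivative_diff[OF has_derivative_ident has_derivative_const]]
      ed_deriv_x[OF sub_t0[OF t] x]]]]])
   (simp add: fun_eq_iff Zd_def algebra_simps)
qed

lemma NU_PU: "t < t0 ==> PU (t,x) = - (2 * (t0 - t)) .* NU (t,x)"
 by (simp add: PU_def NU_def algebra_simps divide_simps)

text \<open>A weighted Pohozaev identity: the equation is multiplied by the scaling field
  \<open>PU\<close> and everything is written as a divergence plus lower-order terms. The left side
  is, up to total time derivatives, \<open>- d\<close> times the weighted energy, hence tied to the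
  derivative of the scaled energy in R.\<close>

lemma sum_Zd:
 assumes t: "t \<in> {0<..<t0}" and x: "x \<in> BB"
 shows "(2 - real DIM('a)) * (\<phi> x * ed (t,x) * G (t,x)) - 2 * (t0 - t) * \<phi> x * EGt (t,x)
  = 2 * (t0 - t) * \<phi> x * G (t,x) * nsq (NU (t,x))
   + (2 + 2 * (t0 - t) * kp t * ln lam) * \<phi> x * G (t,x) * V (t,x)
   + b\<phi> x * G (t,x) * (YU (t,x) \<bullet> PU (t,x) - nsq (x - x0) * ed (t,x))
   + (\<Sum>b\<in>Basis. Zd b (t,x) b)"
proof -
 have zQ: "(t,x) \<in> Q" using sub_t0[OF t] x by simp
 let ?z = "(t,x)" and ?y = "x - x0" and ?s = "t0 - t"
 have s: "?s > 0" using t by simp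
 have a1: "(\<Sum>b\<in>Basis. (?y \<bullet> b) * (PU ?z \<bullet> dx b U ?z - (?y \<bullet> b) * ed ?z)) = YU ?z \<bullet> PU ?z - nsq ?y * ed ?z"
 proof -
  have "nsq ?y = (\<Sum>b\<in>Basis. (?y \<bullet> b) * (?y \<bullet> b))" unfolding power2_norm_eq_inner by (rule euclidean_inner)
  then show ?thesis
   by (simp add: right_diff_distrib sum_subtractf sum_distrib_right YU_def inner_sum_left inner_sum_right mult.assoc inner_commute)
 qed
 \<comment> \<open>The terms with second spatial derivatives. They occur in both
   \<open>grad PU . grad u\<close> and \<open>y . grad e\<close>, with opposite signs, and cancel by
   symmetry of second derivatives.\<close>
 define X where "X = (\<Sum>b\<in>Basis. \<Sum>c\<in>Basis. (?y \<bullet> c) * (dx b (dx c U) ?z \<bullet> dx b U ?z))"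
 have a2: "(\<Sum>b\<in>Basis. PU_x b ?z \<bullet> dx b U ?z) = gsq ?z + X - 2 * ?s * (\<Sum>c\<in>Basis. dx c U ?z \<bullet> dx c (dt U) ?z)"
 proof -
  have "PU_x b ?z \<bullet> dx b U ?z = nsq (dx b U ?z) + (\<Sum>c\<in>Basis. (?y \<bullet> c) * (dx b (dx c U) ?z \<bullet> dx b U ?z)) - 2 * ?s * (dx b U ?z \<bullet> dx b (dt U) ?z)"
   if b: "b \<in> Basis" for b
  proof -
   have "(\<Sum>c\<in>Basis. (b \<bullet> c) .* dx c U ?z) = dx b U ?z" by (rule dx_sum[OF zQ, symmetric])
   then show ?thesis
    by (simp add: PU_x_def sum.distrib inner_diff_left inner_add_left inner_add_right inner_diff_right inner_sum_left inner_sum_right power2_norm_eq_inner inner_commute)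
  qed
  then show ?thesis by (simp add: gsq_def X_def sum.distrib sum_subtractf sum_distrib_left)
 qed
 have a3: "(\<Sum>b\<in>Basis. PU ?z \<bullet> dx b (dx b U) ?z) = PU ?z \<bullet> (dt U ?z + fz ?z)"
  using pde'[OF zQ] by (simp add: Lap_def inner_sum_right[symmetric])
 have a4: "(\<Sum>b\<in>Basis. (?y \<bullet> b) * ed_x b ?z) = X + fz ?z \<bullet> YU ?z"
 proof -
  have "X = (\<Sum>c\<in>Basis. \<Sum>b\<in>Basis. (?y \<bullet> c) * (dx b (dx c U) ?z \<bullet> dx b U ?z))" unfolding X_def by (rule sum.swap)
  also have "\<dots> = (\<Sum>b\<in>Basis. \<Sum>c\<in>Basis. (?y \<bullet> b) * (dx c U ?z \<bullet> dx b (dx c U) ?z))"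
   using dx_dx_commute[OF open_Q smooth zQ] by (intro sum.cong) (auto simp: inner_commute)
  finally have "X = \<dots>" .
  then show ?thesis
   by (simp add: ed_x_def distrib_left sum.distrib sum_distrib_left YU_def inner_sum_right)
 qed
 have a5: "(\<Sum>b\<in>(Basis :: 'a set). (b \<bullet> b) * ed ?z) = real DIM('a) * ed ?z" by (simp add: inner_Basis)
 have S: "(\<Sum>b\<in>Basis. Zd b ?z b) = - (b\<phi> x * G ?z) * (\<Sum>b\<in>Basis. (?y \<bullet> b) * (PU ?z \<bullet> dx b U ?z - (?y \<bullet> b) * ed ?z))
  + \<phi> x * G ?z * (- (1/(2 * ?s))) * (\<Sum>b\<in>Basis. (?y \<bullet> b) * (PU ?z \<bullet> dx b U ?z - (?y \<bullet> b) * ed ?z))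
  + \<phi> x * G ?z * ((\<Sum>b\<in>Basis. PU_x b ?z \<bullet> dx b U ?z) + (\<Sum>b\<in>Basis. PU ?z \<bullet> dx b (dx b U) ?z)
    - (\<Sum>b\<in>(Basis :: 'a set). (b \<bullet> b) * ed ?z) - (\<Sum>b\<in>Basis. (?y \<bullet> b) * ed_x b ?z))"
 proof -
  have "Zd b ?z b = - (b\<phi> x * G ?z) * ((?y \<bullet> b) * (PU ?z \<bullet> dx b U ?z - (?y \<bullet> b) * ed ?z))
  + \<phi> x * G ?z * (- (1/(2 * ?s))) * ((?y \<bullet> b) * (PU ?z \<bullet> dx b U ?z - (?y \<bullet> b) * ed ?z))
  + \<phi> x * G ?z * (PU_x b ?z \<bullet> dx b U ?z + PU ?z \<bullet> dx b (dx b U) ?z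
    - (b \<bullet> b) * ed ?z - (?y \<bullet> b) * ed_x b ?z)" for b
   by (simp add: Zd_def divide_simps)
  then show ?thesis by (simp only: sum.distrib sum_subtractf sum_distrib_left[symmetric])
 qed
 define q where "q = YU ?z \<bullet> PU ?z"
 define f where "f = fz ?z \<bullet> dt U ?z"
 define S1 where "S1 = (\<Sum>c\<in>Basis. dx c U ?z \<bullet> dx c (dt U) ?z)"
 have e1: "fz ?z \<bullet> YU ?z = PU ?z \<bullet> fz ?z + 2 * ?s * f"
  by (simp add: PU_def f_def inner_diff_left inner_diff_right inner_commute)
 \<comment> \<open>Substituting \<open>YU = PU + 2 \<tau> u_t\<close> produces the square of
   \<open>PU\<close>, and with it the dissipation.\<close>
 have e2: "PU ?z \<bullet> dt U ?z = (q - nsq (PU ?z))/(2 * ?s)"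
 proof -
  have "YU ?z = PU ?z + (2 * ?s) .* dt U ?z" by (simp add: PU_def)
  then have "q = nsq (PU ?z) + 2 * ?s * (PU ?z \<bullet> dt U ?z)"
   by (simp add: q_def power2_norm_eq_inner inner_add_left inner_add_right inner_commute)
  then show ?thesis using s by simp
 qed
 have e3: "nsq (PU ?z) = 4 * ?s^2 * nsq (NU ?z)"
  using NU_PU[of t x] t by (simp add: power_mult_distrib) (simp add: power2_eq_square algebra_simps)
 have e4: "gsq ?z = 2 * ed ?z - 2 * V ?z" by (simp add: ed_def)
 have et: "ed_t ?z = S1 + f - kp t * ln lam * V ?z" by (simp add: ed_t_def S1_def f_def)
 show ?thesis
  unfolding S a1 a2 a3 a4 a5 EGt_def et q_def[symmetric] S1_def[symmetric] inner_add_right e1 e2 e3 e4 fst_conv snd_conv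
  using s by (simp add: divide_simps) (simp add: algebra_simps power2_eq_square)
qed

end

lemma integral_pair_le_const:
 fixes F :: "real \<times> 'a::euclidean_space => real"
 assumes B: "B \<in> sets borel" and ab: "a \<le> b" and i: "integrable (lborel2 {a..b} B) F"
  and le: "\<And>t. t \<in> {a..b} ==> (\<integral>x. F (t,x) \<partial>lborel_on B) \<le> C"
 shows "LI (lborel2 {a..b} B) F \<le> (b - a) * C"
proof -
 interpret pair_sigma_finite "lborel_on {a..b}" "lborel_on B" using B by (intro pair_sigma_finite_lborel_on) auto
 interpret F: finite_measure "lborel_on {a..b}" by (rule finite_measure_lborel_on) auto
 have "LI (lborel2 {a..b} B) F = (\<integral>t. (\<integral>x. F (t,x) \<partial>lborel_on B) \<partial>lborel_on {a..b})"
  using integral_fst'[OF i] by simp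
 also have "\<dots> \<le> (\<integral>t. C \<partial>lborel_on {a..b})"
  using integrable_fst'[OF i] le by (intro integral_mono) (auto simp: space_restrict_space)
 also have "\<dots> = (b - a) * C"
  using ab by (simp add: space_restrict_space measure_restrict_space)
 finally show ?thesis .
qed

context glh begin

lemma ed_nonneg: "ed z \<ge> 0" by (simp add: ed_def gsq_nonneg V_nonneg)

lemma ed_cont: "continuous_on Q ed"
 unfolding ed_def[abs_def] by (intro continuous_intros cont_gsq V_cont) auto

lemma ed_t_cont: "continuous_on Q ed_t"
 unfolding ed_t_def[abs_def] by (intro continuous_intros conts fz_cont kp_cont V_cont)

lemma ed_x_cont: "continuous_on Q (ed_x v)"
 unfolding ed_x_def[abs_def] by (intro continuous_intros conts fz_cont)

lemma slice_bounds:
 assumes t: "t \<in> {0<..<T}"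
 shows "integrable MB (\<lambda>x. ed (t,x))" (is ?c1) "(\<integral>x. ed (t,x) \<partial>MB) \<le> CE * M0" (is ?c2) "(\<integral>x. gsq (t,x) \<partial>MB) \<le> 2 * (CE * M0)" (is ?c3)
proof -
 have t': "0 < t" "t < T" using t by auto
 have g: "integrable MB (\<lambda>x. gsq (t,x))" by (rule energy_ineq_real(3)[OF t'])
 note v = V_integrable_x[OF t]
 have 1: "(\<integral>x. gsq (t,x) \<partial>MB)/2 + (\<integral>x. V (t,x) \<partial>MB) \<le> CE * M0"
 proof -
  have "LI (PB t) (\<lambda>y. nsq (dt U y)) \<ge> 0" by simp
  then show ?thesis using energy_bound[OF t'] by linarith
 qed
 show ?c1 unfolding ed_def using g v by simp
 show ?c2 unfolding ed_def using g v 1 by simp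
 have "(\<integral>x. V (t,x) \<partial>MB) \<ge> 0" using V_nonneg by simp
 then show ?c3 using 1 by simp
qed

lemma PJ_bounds:
 assumes ab: "0 < a" "a \<le> b" "b < T"
 shows "integrable (PJ a b) (\<lambda>z. nsq (dt U z))" (is ?c1) "LI (PJ a b) (\<lambda>z. nsq (dt U z)) \<le> CE * M0" (is ?c2)
  "integrable (PJ a b) gsq" "LI (PJ a b) gsq \<le> (b - a) * (2 * (CE * M0))" (is ?c4)
  "integrable (PJ a b) V"
  "integrable (PJ a b) ed" "LI (PJ a b) ed \<le> (b - a) * (CE * M0)" (is ?c7)
proof -
 have b: "0 < b" "b < T" using ab by auto
 have sub: "{a..b} \<subseteq> {0<..b}" "{a..b} \<subseteq> {0<..<T}" using ab by auto
 note u = energy_ineq_real(1)[OF b]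
 show ?c1 by (rule integrable_pair_subset[OF u sub(1)]) auto
 have "LI (PJ a b) (\<lambda>z. nsq (dt U z)) \<le> LI (PB b) (\<lambda>z. nsq (dt U z))"
  by (rule integral_pair_mono_set[OF u _ sub(1)]) auto
 moreover have "(\<integral>x. gsq (b, x) \<partial>MB) \<ge> 0" "(\<integral>x. V (b, x) \<partial>MB) \<ge> 0" using V_nonneg gsq_nonneg by auto
 ultimately show ?c2 using energy_bound[OF b] by linarith
 show g: "integrable (PJ a b) gsq" by (rule integrable_pair_subset[OF gsq_integrable sub(2)]) auto
 have "integrable (PB b) V"
  by (rule PB_bounded[OF b V_cont, of "max 1 lam"]) (use V_le V_nonneg in auto)
 then show v: "integrable (PJ a b) V" by (rule integrable_pair_subset[OF _ sub(1)]) auto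
 show e: "integrable (PJ a b) ed" unfolding ed_def[abs_def] using g v by simp
 show ?c4
  by (rule integral_pair_le_const[OF _ ab(2) g]) (use slice_bounds(3) ab in auto)
 show ?c7
  by (rule integral_pair_le_const[OF _ ab(2) e]) (use slice_bounds(2) ab in auto)
qed

text \<open>The gain \<open>lam^(1/2)\<close> over the general energy bound is what later
  compensates powers of \<open>|ln lam|\<close>.\<close>

lemma PJ_V_le:
 assumes ab: "0 < a" "a \<le> b" "b < T" and lam1: "lam \<le> 1"
 shows "LI (PJ a b) V \<le> (b - a) * (lam powr (1/2) * (exp (4 * T) * T * M0))"
proof (rule integral_pair_le_const[OF _ ab(2) PJ_bounds(5)[OF ab]])
 fix t assume "t \<in> {a..b}"
 then have t: "0 < t" "t < T" using ab by auto
 have m: "max 1 lam = 1" using lam1 by simp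
 have "(\<integral>x. V (t,x) \<partial>MB) \<le> Lc t * W t" using t by (intro V_le_W) auto
 also have "\<dots> \<le> lam powr (1/2) * (exp (4 * T) * T * M0)"
 proof (rule mult_mono)
  show "Lc t \<le> lam powr (1/2)" using t lam1 by (intro Lc_le_powr_half) auto
  have "W t \<le> exp (4 * t) * t * M0" using W_le[OF t] by (simp add: m)
  also have "\<dots> \<le> exp (4 * T) * T * M0" using t M0_nonneg by (intro mult_right_mono mult_mono) auto
  finally show "W t \<le> exp (4 * T) * T * M0" .
 qed (use W_nonneg in auto)
 finally show "(\<integral>x. V (t,x) \<partial>MB) \<le> lam powr (1/2) * (exp (4 * T) * T * M0)" .
qed simp

end

context glh_point begin

section \<open>Estimates on one time window\<close>

abbreviation "K0 \<equiv> cball x0 (9/10 * d0)"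
abbreviation "Q0 \<equiv> {0<..<t0} \<times> BB"

lemma Q0_sub: "Q0 \<subseteq> Q" using t0 by auto

lemmas conts0 = conts[THEN continuous_on_subset, OF Q0_sub]
lemmas V_cont0 = continuous_on_subset[OF V_cont Q0_sub]
lemmas ed_cont0 = continuous_on_subset[OF ed_cont Q0_sub]

lemma G_cont: "continuous_on Q0 G"
 unfolding G_def[abs_def] by (intro continuous_intros) auto

lemma phi_cont_snd: "continuous_on S (\<lambda>z. \<phi> (snd z))" "continuous_on S (\<lambda>z. b\<phi> (snd z))"
 by (auto intro!: continuous_on_compose2[OF phi_cont(1)[of UNIV]] continuous_on_compose2[OF phi_cont(2)[of UNIV]] continuous_intros)

lemma YU_cont: "continuous_on Q0 YU"
 unfolding YU_def[abs_def] by (intro continuous_intros conts0)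

lemma PU_cont: "continuous_on Q0 PU"
 unfolding PU_def[abs_def] by (intro continuous_intros conts0 YU_cont)

lemma NU_cont: "continuous_on Q0 NU"
 unfolding NU_def[abs_def] by (intro continuous_intros conts0 YU_cont) auto

lemma EGt_cont: "continuous_on Q0 EGt"
 unfolding EGt_def[abs_def]
 by (intro continuous_intros ed_cont0 continuous_on_subset[OF ed_t_cont Q0_sub] G_cont) auto

lemma Zd_cont: "continuous_on Q0 (\<lambda>z. Zd b z v)"
 unfolding Zd_def PU_x_def
 by (intro continuous_intros phi_cont_snd G_cont PU_cont conts0 ed_cont0 continuous_on_subset[OF ed_x_cont Q0_sub]) auto

text \<open>\<open>HH\<close> and \<open>RR\<close> are the two sides of \<open>sum_Zd\<close>, the
  divergence omitted; their spatial integrals coincide. \<open>HH\<close> will be a derivative in R,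
  and \<open>RR\<close> contains the dissipation.\<close>

definition "HH z = (2 - real DIM('a)) * (\<phi> (snd z) * ed z * G z) - 2 * (t0 - fst z) * \<phi> (snd z) * EGt z"
definition "RR z = 2 * (t0 - fst z) * \<phi> (snd z) * G z * nsq (NU z)
   + (2 + 2 * (t0 - fst z) * kp (fst z) * ln lam) * \<phi> (snd z) * G z * V z
   + b\<phi> (snd z) * G z * (YU z \<bullet> PU z - nsq (snd z - x0) * ed z)"

lemma HH_cont: "continuous_on Q0 HH"
 unfolding HH_def[abs_def] by (intro continuous_intros phi_cont_snd ed_cont0 G_cont EGt_cont)

lemma RR_cont: "continuous_on Q0 RR"
 unfolding RR_def[abs_def]
 by (intro continuous_intros phi_cont_snd ed_cont0 G_cont NU_cont V_cont0 kp_cont YU_cont PU_cont)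

lemma K0_props: "compact K0" "K0 \<subseteq> BB" "BB \<in> sets borel" using K_sub by auto

lemma slice_cont0: "continuous_on Q0 F ==> t \<in> {0<..<t0} ==> continuous_on BB (\<lambda>x. F (t,x))"
 by (rule continuous_on_compose2[of Q0 F]) (auto intro!: continuous_intros)

lemma compact_integrable:
 fixes F :: "real \<times> 'a => real"
 assumes "continuous_on Q0 F" "\<And>z. snd z \<notin> K0 ==> F z = 0" 
 shows "t \<in> {0<..<t0} ==> integrable MB (\<lambda>x. F (t,x))"
  and "0 < a ==> b < t0 ==> integrable (PJ a b) F"
  and "0 < a ==> b < t0 ==> continuous_on {a..b} (\<lambda>t. \<integral>x. F (t,x) \<partial>MB)"
proof -
 show "t \<in> {0<..<t0} ==> integrable MB (\<lambda>x. F (t,x))"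
  by (rule integrable_compact_support[OF K0_props(3,1,2) slice_cont0[OF assms(1)]]) (use assms(2) in auto)
 have c: "0 < a ==> b < t0 ==> continuous_on ({a..b} \<times> BB) F"
  by (rule continuous_on_subset[OF assms(1)]) auto
 show "0 < a ==> b < t0 ==> integrable (PJ a b) F"
  by (rule integrable_pair_compact_support[OF K0_props c]) (use assms(2) in auto)
 show "0 < a ==> b < t0 ==> continuous_on {a..b} (\<lambda>t. \<integral>x. F (t,x) \<partial>MB)"
  by (rule continuous_on_integral_compact_support[OF K0_props c]) (use assms(2) in auto)
qed

lemma HH_RR_support: "snd z \<notin> K0 ==> HH z = 0" "snd z \<notin> K0 ==> RR z = 0"
 using phi_outer[of "snd z"] by (auto simp: HH_def RR_def)

lemma integral_HH_slice:
 assumes t: "t \<in> {0<..<t0}"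
 shows "(\<integral>x. HH (t,x) \<partial>MB) = (\<integral>x. RR (t,x) \<partial>MB)"
proof -
 note iR = compact_integrable(1)[OF RR_cont HH_RR_support(2) t]
 have Z0: "(\<integral>x. Zd b (t,x) b \<partial>MB) = 0" for b
 proof (rule integral_partial_zero[OF _ K0_props(1,2), where f'="\<lambda>x. Zd b (t,x)" and f="\<lambda>x. \<phi> x * G (t,x) * (PU (t,x) \<bullet> dx b U (t,x) - ((x - x0) \<bullet> b) * ed (t,x))"])
  show "((\<lambda>x. \<phi> x * G (t,x) * (PU (t,x) \<bullet> dx b U (t,x) - ((x - x0) \<bullet> b) * ed (t,x))) has_derivative Zd b (t,x)) (at x)"
   if "x \<in> BB" for x by (rule Z_deriv[OF t that])
  show "continuous_on BB (\<lambda>x. Zd b (t,x) b)" by (rule slice_cont0[OF Zd_cont t])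
 qed (use phi_outer in auto)
 have Zi: "integrable MB (\<lambda>x. Zd b (t,x) b)" for b
  by (rule compact_integrable(1)[OF Zd_cont _ t]) (use phi_outer in \<open>auto simp: Zd_def\<close>)
 have "(\<integral>x. HH (t,x) \<partial>MB) = (\<integral>x. RR (t,x) + (\<Sum>b\<in>Basis. Zd b (t,x) b) \<partial>MB)"
  by (intro L1_cong refl)
   (use sum_Zd[OF t] in \<open>simp add: HH_def RR_def space_restrict_space\<close>)
 also have "\<dots> = (\<integral>x. RR (t,x) \<partial>MB) + (\<Sum>b\<in>Basis. \<integral>x. Zd b (t,x) b \<partial>MB)"
  using iR Zi by (simp add: L1_sum)
 finally show ?thesis using Z0 by simp
qed

lemma integral_HH:
 assumes ab: "0 < a" "b < t0"
 shows "LI (PJ a b) HH = LI (PJ a b) RR"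
proof -
 interpret pair_sigma_finite "lborel_on {a..b}" MB by (intro pair_sigma_finite_lborel_on) auto
 note iH = compact_integrable(2)[OF HH_cont HH_RR_support(1) ab]
 note iR = compact_integrable(2)[OF RR_cont HH_RR_support(2) ab]
 have "LI (PJ a b) HH = (\<integral>t. (\<integral>x. HH (t,x) \<partial>MB) \<partial>lborel_on {a..b})" using integral_fst'[OF iH] by simp
 also have "\<dots> = (\<integral>t. (\<integral>x. RR (t,x) \<partial>MB) \<partial>lborel_on {a..b})"
  using ab by (intro L1_cong refl integral_HH_slice) (auto simp: space_restrict_space)
 also have "\<dots> = LI (PJ a b) RR" using integral_fst'[OF iR] by simp
 finally show ?thesis .
qed

text \<open>Bounds the negative part of \<open>2 + 2 \<tau> kp ln lam\<close> for \<tau> \<le> 4 R^2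
  and kp \<le> 1. With l the negative part of \<open>ln lam\<close>, the coefficient is at least
  \<open>2 - 8 R^2 l\<close>, hence nonnegative if \<open>4 R^2 l \<le> 1\<close>; otherwise the 2
  is dropped.\<close>

definition "cneg R = (if 4 * R^2 * max 0 (- ln lam) \<le> 1 then 0 else 8 * R^2 * max 0 (- ln lam))"
definition "BR R = 8 * L/d0^2 * exp (- (d0^2/(32 * R^2)))"
definition "bad R z = cneg R * V z + BR R * (16 * R ^ 4 * nsq (dt U z) + ed z)"

lemma cneg_nonneg: "0 \<le> cneg R"
proof -
 have "0 \<le> 8 * R^2 * max 0 (- ln lam)" by (intro mult_nonneg_nonneg) auto
 then show ?thesis unfolding cneg_def by (metis order_refl)
qed

lemma RR_lower:
 assumes R: "0 < R" and z: "z \<in> Q" "R^2 \<le> t0 - fst z" "t0 - fst z \<le> 4 * R^2"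
 shows "2 * R^2 * (\<phi> (snd z) * G z * nsq (NU z)) - bad R z \<le> RR z"
proof -
 obtain t x where [simp]: "z = (t,x)" by (cases z)
 let ?s = "t0 - t"
 have s: "R^2 \<le> ?s" "?s \<le> 4 * R^2" "?s > 0" using z less_le_trans[OF zero_less_power[OF R] z(2)] by auto
 have tt: "t < t0" using s by simp
 have R2: "R^2 > 0" using R by simp
 note p = phi_bounds[of x] and G0 = less_imp_le[OF G_pos[of z]]
 have 1: "2 * R^2 * (\<phi> x * G z * nsq (NU z)) \<le> 2 * ?s * (\<phi> x * G z * nsq (NU z))"
  using s p G0 by (intro mult_right_mono) auto
 have 2: "- (cneg R * V z) \<le> (2 + 2 * ?s * kp t * ln lam) * \<phi> x * G z * V z"
 proof -
  define l where "l = max 0 (- ln lam)"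
  have l: "0 \<le> l" "- ln lam \<le> l" by (auto simp: l_def)
  have A: "- (2 + 2 * ?s * kp t * ln lam) \<le> cneg R"
  proof -
   have "?s * kp t * (- ln lam) \<le> ?s * kp t * l" using s l kp_bounds[of t] by (intro mult_left_mono) auto
   also have "\<dots> \<le> (4 * R^2 * 1) * l" using s l kp_bounds[of t] by (intro mult_right_mono mult_mono) auto
   finally have le: "- (?s * kp t * ln lam) \<le> 4 * R^2 * l" by simp
   have e: "2 + 2 * ?s * kp t * ln lam = 2 + 2 * (?s * kp t * ln lam)" by simp
   define p q where p: "p = ?s * kp t * ln lam" and q: "q = R^2 * l"
   show ?thesis using le unfolding e cneg_def l_def[symmetric] p[symmetric] unfolding mult.assoc q[symmetric] by auto
  qed
  note c0 = cneg_nonneg[of R]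
  have gv: "0 \<le> \<phi> x * G z" "\<phi> x * G z \<le> 1"
   using p G0 G_le_1[OF tt, of x] mult_mono[of "\<phi> x" 1 "G z" 1] by auto
  have "- (2 + 2 * ?s * kp t * ln lam) * (\<phi> x * G z) \<le> cneg R * (\<phi> x * G z)" using A gv by (intro mult_right_mono)
  also have "\<dots> \<le> cneg R * 1" using gv c0 by (intro mult_left_mono)
  finally have "- (2 + 2 * ?s * kp t * ln lam) * (\<phi> x * G z) * V z \<le> cneg R * V z"
   using V_nonneg[of z] by (intro mult_right_mono) auto
  then show ?thesis by (simp only: minus_mult_left[symmetric] mult.assoc)
 qed
 have 3: "- (BR R * (16 * R ^ 4 * nsq (dt U z) + ed z)) \<le> b\<phi> x * G z * (YU z \<bullet> PU z - nsq (x - x0) * ed z)"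
 proof (cases "b\<phi> x = 0")
  case True
  then show ?thesis using \<beta>(11) ed_nonneg[of z] by (simp add: BR_def)
 next
  case False
  have "x \<in> K0" using phi_outer[of x] False by auto
  then have xK: "norm (x - x0) \<le> 1" using d0 by (simp add: dist_norm norm_minus_commute)
  \<comment> \<open>Completing the square: the sign-indefinite product costs only
    \<open>\<tau>^2 |u_t|^2\<close>, and the gradient of u is not charged.\<close>
  have "YU z \<bullet> PU z = nsq (YU z) - 2 * (YU z \<bullet> (?s .* dt U z))"
   by (simp add: PU_def inner_diff_right power2_norm_eq_inner)
  also have "\<dots> = nsq (YU z - ?s .* dt U z) - ?s^2 * nsq (dt U z)"
   unfolding power2_norm_eq_inner by (simp add: inner_diff_left inner_diff_right inner_commute power2_eq_square)
  also have "\<dots> \<ge> - (?s^2 * nsq (dt U z))" by simp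
  finally have a: "- (?s^2 * nsq (dt U z)) \<le> YU z \<bullet> PU z" .
  have "?s^2 \<le> (4 * R^2)^2" using s by (intro power_mono) auto
  then have "?s^2 * nsq (dt U z) \<le> 16 * R ^ 4 * nsq (dt U z)"
   by (intro mult_right_mono) (auto simp: power_mult_distrib)
  moreover have "nsq (x - x0) * ed z \<le> 1 * ed z"
   using xK ed_nonneg by (intro mult_right_mono) (auto simp: power_le_one)
  ultimately have b: "- (16 * R ^ 4 * nsq (dt U z) + ed z) \<le> YU z \<bullet> PU z - nsq (x - x0) * ed z"
   using a by linarith
  have "b\<phi> x * G z \<le> (8 * L/d0^2) * exp (- (d0^2/(32 * R^2)))"
  proof (rule mult_mono)
   have "d0^2/(32 * R^2) \<le> d0^2/(8 * ?s)" using s by (intro frac_le) auto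
   then show "G z \<le> exp (- (d0^2/(32 * R^2)))" using G_far[OF tt, of x] False by (auto intro: order_trans)
  qed (use p G0 \<beta>(11) in auto)
  then have "b\<phi> x * G z * (16 * R ^ 4 * nsq (dt U z) + ed z) \<le> BR R * (16 * R ^ 4 * nsq (dt U z) + ed z)"
   unfolding BR_def using ed_nonneg[of z] by (intro mult_right_mono) auto
  moreover have "b\<phi> x * G z * - (16 * R ^ 4 * nsq (dt U z) + ed z) \<le> b\<phi> x * G z * (YU z \<bullet> PU z - nsq (x - x0) * ed z)"
   using b p G0 by (intro mult_left_mono) auto
  ultimately show ?thesis unfolding mult_minus_right by linarith
 qed
 show ?thesis using 1 2 3 by (simp add: RR_def bad_def mult_ac)
qed

text \<open>The window has length 3 R^2, the source of that factor in both error terms. The first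
  error is absent for \<open>lam > 1\<close>, where \<open>cneg\<close> is 0.\<close>

lemma near_lower:
 assumes R: "0 < R" "4 * R^2 < t0"
 shows "2 * R^2 * LI (PJ (t0 - 4 * R^2) (t0 - R^2)) (\<lambda>z. \<phi> (snd z) * G z * nsq (NU z))
   - (cneg R * (3 * R^2 * (lam powr (1/2) * (exp (4 * T) * T * M0))) + BR R * ((16 * R ^ 4 + 3 * R^2) * (CE * M0)))
  \<le> LI (PJ (t0 - 4 * R^2) (t0 - R^2)) HH"
  and "integrable (PJ (t0 - 4 * R^2) (t0 - R^2)) (\<lambda>z. \<phi> (snd z) * G z * nsq (NU z))"
proof -
 let ?a = "t0 - 4 * R^2" and ?b = "t0 - R^2"
 have R2: "R^2 > 0" using R by simp
 have ab: "0 < ?a" "?a \<le> ?b" "?b < T" "?b < t0" using R(2) R2 t0 by (simp, simp, (unfold greaterThanLessThan_iff, linarith)+)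
 have c: "continuous_on Q0 (\<lambda>z. \<phi> (snd z) * G z * nsq (NU z))"
  by (intro continuous_intros phi_cont_snd G_cont NU_cont)
 show i: "integrable (PJ ?a ?b) (\<lambda>z. \<phi> (snd z) * G z * nsq (NU z))"
  by (rule compact_integrable(2)[OF c]) (use phi_outer ab in auto)
 note B = PJ_bounds[OF ab(1-3)]
 have ib: "integrable (PJ ?a ?b) (bad R)" unfolding bad_def[abs_def] using B by simp
 have "LI (PJ ?a ?b) (\<lambda>z. 2 * R^2 * (\<phi> (snd z) * G z * nsq (NU z)) - bad R z) \<le> LI (PJ ?a ?b) RR"
 proof (rule integral_mono)
  show "integrable (PJ ?a ?b) RR" by (rule compact_integrable(2)[OF RR_cont HH_RR_support(2) ab(1,4)])
  show "integrable (PJ ?a ?b) (\<lambda>z. 2 * R^2 * (\<phi> (snd z) * G z * nsq (NU z)) - bad R z)" using i ib by simp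
  fix z assume "z \<in> space (PJ ?a ?b)"
  then show "2 * R^2 * (\<phi> (snd z) * G z * nsq (NU z)) - bad R z \<le> RR z"
   using ab by (intro RR_lower R) (auto simp: spaces)
 qed
 then have "2 * R^2 * LI (PJ ?a ?b) (\<lambda>z. \<phi> (snd z) * G z * nsq (NU z)) - LI (PJ ?a ?b) (bad R) \<le> LI (PJ ?a ?b) HH"
  unfolding integral_HH[OF ab(1,4)] using i ib by simp
 moreover have "LI (PJ ?a ?b) (bad R) \<le> cneg R * (3 * R^2 * (lam powr (1/2) * (exp (4 * T) * T * M0))) + BR R * ((16 * R ^ 4 + 3 * R^2) * (CE * M0))"
 proof -
  have e: "LI (PJ ?a ?b) (bad R) = cneg R * LI (PJ ?a ?b) V
   + BR R * (16 * R ^ 4 * LI (PJ ?a ?b) (\<lambda>z. nsq (dt U z)) + LI (PJ ?a ?b) ed)"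
   unfolding bad_def[abs_def] using B by simp
  have v: "cneg R * LI (PJ ?a ?b) V \<le> cneg R * (3 * R^2 * (lam powr (1/2) * (exp (4 * T) * T * M0)))"
  proof (cases "lam \<le> 1")
   case True
   then show ?thesis using PJ_V_le[OF ab(1-3) True] cneg_nonneg by (intro mult_left_mono) auto
  next
   case False
   then have "cneg R = 0" by (simp add: cneg_def max_def)
   then show ?thesis by simp
  qed
  have "16 * R ^ 4 * LI (PJ ?a ?b) (\<lambda>z. nsq (dt U z)) \<le> 16 * R ^ 4 * (CE * M0)"
   using B(2) by (intro mult_left_mono) auto
  then have "16 * R ^ 4 * LI (PJ ?a ?b) (\<lambda>z. nsq (dt U z)) + LI (PJ ?a ?b) ed \<le> (16 * R ^ 4 + 3 * R^2) * (CE * M0)"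
   using B(7) by (simp add: algebra_simps)
  moreover have "BR R \<ge> 0" using \<beta>(11) by (simp add: BR_def)
  ultimately show ?thesis unfolding e by (intro add_mono[OF v] mult_left_mono)
 qed
 ultimately show "2 * R^2 * LI (PJ ?a ?b) (\<lambda>z. \<phi> (snd z) * G z * nsq (NU z))
   - (cneg R * (3 * R^2 * (lam powr (1/2) * (exp (4 * T) * T * M0))) + BR R * ((16 * R ^ 4 + 3 * R^2) * (CE * M0)))
  \<le> LI (PJ ?a ?b) HH" by linarith
qed

end

section \<open>Moving time windows and decay of the kernel\<close>

lemma inverse_power_deriv: "R \<noteq> 0 ==> ((\<lambda>R. 1/R ^ n) has_real_derivative - (real n/R ^ (n + 1))) (at R)"
proof (rule DERIV_cong[OF DERIV_divide[OF DERIV_const DERIV_pow]])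
 assume "R \<noteq> 0"
 then show "(0 * R ^ n - 1 * (real n * R ^ (n - Suc 0)))/(R ^ n * R ^ n) = - (real n/R ^ (n + 1))"
  by (cases n) (auto simp: field_simps)
qed simp

text \<open>\<open>J R/R^d + k/2 R^2\<close> is differentiated with both ends of the window moving;
  the hypothesis on \<open>q\<close> says that this derivative dominates \<open>q\<close>.
  Monotonicity of the nonnegative integral then transfers the bound to \<open>q\<close>.\<close>

lemma sliding_window_integral_le:
 fixes I q :: "real => real" and d :: nat
 assumes I: "continuous_on {a..b} I" and R12: "0 < R1" "R1 \<le> R2" and ab: "a < t0 - 4 * R2^2" "t0 - R1^2 < b"
  and J: "\<And>R. J R = integral {t0 - 4 * R^2..t0 - R^2} I"
  and q: "\<And>R. R \<in> {R1..R2} ==> 0 \<le> q R"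
   "\<And>R. R \<in> {R1..R2} ==> q R \<le> - (real d/R ^ (d + 1)) * J R + (8 * R * I (t0 - 4 * R^2) - 2 * R * I (t0 - R^2))/R ^ d + k * R"
 shows "(\<integral>\<^sup>+R\<in>{R1..R2}. ennreal (q R) \<partial>lborel) \<le> ennreal (J R2/R2 ^ d - J R1/R1 ^ d + k/2 * (R2^2 - R1^2))" (is ?c1)
  and "0 \<le> J R2/R2 ^ d - J R1/R1 ^ d + k/2 * (R2^2 - R1^2)" (is ?c2)
proof -
 define P where "P t = integral {a..t} I" for t
 have pts: "a < t0 - 4 * R^2" "t0 - 4 * R^2 \<le> t0 - R^2" "t0 - R^2 < b" if "R \<in> {R1..R2}" for R
 proof -
  have "R1^2 \<le> R^2" "R^2 \<le> R2^2" using that R12 by (auto intro!: power_mono)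
  then show "a < t0 - 4 * R^2" "t0 - 4 * R^2 \<le> t0 - R^2" "t0 - R^2 < b" using ab zero_le_power2[of R] by linarith+
 qed
 have JP: "J R = P (t0 - R^2) - P (t0 - 4 * R^2)" if R: "R \<in> {R1..R2}" for R
 proof -
  have "I integrable_on {a..t0 - R^2}"
   by (rule integrable_continuous_real[OF continuous_on_subset[OF I]]) (use pts[OF R] in auto)
  from Henstock_Kurzweil_Integration.integral_combine[OF _ pts(2)[OF R] this] show ?thesis
   using pts[OF R] by (simp add: J P_def)
 qed
 have Pd: "(P has_real_derivative I t) (at t)" if "a < t" "t < b" for t
  using integral_has_real_derivative[OF I, of t] that at_within_Icc_at[of a t b] by (simp add: P_def[abs_def])
 have Pc: "continuous_on {a<..<b} P" by (intro continuous_at_imp_continuous_on ballI DERIV_isCont[OF Pd]) auto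
 define F where "F R = (1/R ^ d) * (P (t0 - R^2) - P (t0 - 4 * R^2)) + k/2 * R^2" for R
 define f where "f R = - (real d/R ^ (d + 1)) * (P (t0 - R^2) - P (t0 - 4 * R^2)) + (8 * R * I (t0 - 4 * R^2) - 2 * R * I (t0 - R^2))/R ^ d + k * R" for R
 have fq: "q R \<le> f R" "0 \<le> f R" if "R \<in> {R1..R2}" for R
  using q[OF that] JP[OF that] unfolding f_def by (auto intro: order_trans)
 have Fd: "(F has_real_derivative f R) (at R)" if R: "R \<in> {R1..R2}" for R
 proof -
  have R0: "R \<noteq> 0" using R R12 by auto
  have g: "((\<lambda>R. t0 - c * R^2) has_real_derivative - (2 * c * R)) (at R)" for c
   by (auto intro!: derivative_eq_intros)
  have 1: "((\<lambda>R. P (t0 - 4 * R^2)) has_real_derivative I (t0 - 4 * R^2) * - (2 * 4 * R)) (at R)"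
   by (rule DERIV_chain2[OF Pd g]) (use pts[OF R] in linarith)+
  have 2: "((\<lambda>R. P (t0 - R^2)) has_real_derivative I (t0 - R^2) * - (2 * 1 * R)) (at R)"
   by (rule DERIV_chain2[OF Pd g[of 1, simplified mult_1]]) (use pts[OF R] in linarith)+
  have 3: "((\<lambda>R. k/2 * R^2) has_real_derivative k * R) (at R)" by (auto intro!: derivative_eq_intros)
  show ?thesis unfolding F_def f_def
   by (rule DERIV_cong[OF DERIV_add[OF DERIV_mult[OF inverse_power_deriv[OF R0] DERIV_diff[OF 2 1]] 3]])
    (simp add: algebra_simps diff_divide_distrib)
 qed
 have fc: "continuous_on {R1..R2} f"
 proof -
  have s: "t0 - 4 * R^2 \<in> {a<..<b}" "t0 - R^2 \<in> {a<..<b}" if "R \<in> {R1..R2}" for R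
   unfolding greaterThanLessThan_iff using pts[OF that] by linarith+
  have e: "continuous_on {R1..R2} (\<lambda>R. t0 - 4 * R^2)" "continuous_on {R1..R2} (\<lambda>R. t0 - R^2)"
   by (intro continuous_intros)+
  have n: "R ^ n \<noteq> 0" if "R \<in> {R1..R2}" for R n using that R12 by auto
  have I': "continuous_on {a<..<b} I" by (rule continuous_on_subset[OF I]) auto
  show ?thesis unfolding f_def
   by (intro continuous_intros continuous_on_compose2[OF Pc e(1)] continuous_on_compose2[OF Pc e(2)]
     continuous_on_compose2[OF I' e(1)] continuous_on_compose2[OF I' e(2)]) (use s n in blast)+
 qed
 \<comment> \<open>The integration rule asks for a Borel function on the whole line, so
   \<open>f\<close> is cut off outside the interval where it is continuous.\<close>
 define f0 where "f0 R = (if R \<in> {R1..R2} then f R else 0)" for R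
 have "(\<integral>\<^sup>+R\<in>{R1..R2}. ennreal (q R) \<partial>lborel) \<le> (\<integral>\<^sup>+R. ennreal (f0 R) * indicator {R1..R2} R \<partial>lborel)"
  using fq by (intro nn_integral_mono) (auto simp: f0_def indicator_def intro!: ennreal_leI)
 also have "\<dots> = F R2 - F R1"
 proof (rule nn_integral_FTC_Icc)
  show "f0 \<in> borel_measurable borel"
   using borel_measurable_continuous_on_if[of "{R1..R2}" f "\<lambda>_. 0"] fc unfolding f0_def[abs_def] by simp
 qed (use fq Fd R12 in \<open>auto simp: f0_def\<close>)
 finally have "(\<integral>\<^sup>+R\<in>{R1..R2}. ennreal (q R) \<partial>lborel) \<le> ennreal (F R2 - F R1)" .
 moreover have e: "F R2 - F R1 = J R2/R2 ^ d - J R1/R1 ^ d + k/2 * (R2^2 - R1^2)"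
  using R12 by (simp add: F_def JP algebra_simps diff_divide_distrib)
 ultimately show ?c1 by simp
 have "F R1 \<le> F R2"
 proof (rule DERIV_nonneg_imp_nondecreasing[OF R12(2)])
  show "\<exists>y. (F has_real_derivative y) (at R) \<and> 0 \<le> y" if "R1 \<le> R" "R \<le> R2" for R
   using Fd[of R] fq(2)[of R] that by (intro exI[of _ "f R"]) auto
 qed
 then show ?c2 unfolding e[symmetric] by simp
qed

lemma power_le_fact_exp: "z \<ge> 0 ==> z ^ n \<le> fact n * exp (z::real)"
proof -
 assume z: "z \<ge> 0"
 have "sum (\<lambda>n. z ^ n /\<^sub>R fact n) {n} \<le> (\<Sum>n. z ^ n /\<^sub>R fact n)"
  by (rule sum_le_suminf[OF summable_exp_generic]) (use z in auto)
 then show ?thesis by (simp add: exp_def field_simps)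
qed

definition exp_const :: "nat => real" where
 "exp_const n = 32 ^ n * fact n * exp (1/32)"

lemma exp_const_pos: "exp_const n > 0" by (simp add: exp_const_def)

text \<open>With z = d/R the point is that \<open>z^n exp (- z^2/32)\<close> is bounded: z \<le> 1 +
  z^2, and \<open>x^n \<le> n! exp x\<close> at x = (1 + z^2)/32, which gives
  \<open>exp_const\<close>. The 32 is 2 * 4 * 4, from |y|^2 \<ge> d0^2/2, the 4 in the kernel and
  \<tau> \<le> 4 R^2.\<close>

lemma exp_decay_le:
 assumes "R > 0" "d > 0"
 shows "exp (- (d^2/(32 * R^2)))/R ^ n \<le> exp_const n/d ^ n"
proof -
 define z where "z = d/R"
 have z: "z > 0" using assms by (simp add: z_def)
 have "z \<le> 1 + z^2" using zero_le_power2[of "z - 1/2"] by (simp add: power2_eq_square algebra_simps)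
 then have "z ^ n \<le> (32 * ((1 + z^2)/32)) ^ n" using z by (intro power_mono) auto
 also have "\<dots> = 32 ^ n * ((1 + z^2)/32) ^ n" by (rule power_mult_distrib)
 also have "\<dots> \<le> 32 ^ n * (fact n * exp ((1 + z^2)/32))" by (intro mult_left_mono power_le_fact_exp) auto
 also have "\<dots> = exp_const n * exp (z^2/32)" by (simp add: exp_const_def add_divide_distrib exp_add)
 finally have "z ^ n * exp (- (z^2/32)) \<le> exp_const n" by (simp add: exp_minus field_simps)
 moreover have "z^2/32 = d^2/(32 * R^2)" by (simp add: z_def power_divide)
 ultimately have "z ^ n * exp (- (d^2/(32 * R^2))) \<le> exp_const n" by (simp only:)
 then show ?thesis using assms unfolding z_def power_divide by (simp add: divide_simps mult_ac)
qed

text \<open>The scale 8 is chosen so that \<open>(1 + 4 l)/8 = 1/8 + l/2\<close>, whose exponential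
  the factor \<open>exp (- l/2)\<close> cancels up to a constant.\<close>

lemma log_decay_le:
 assumes "(l::real) \<ge> 0"
 shows "(1 + 4 * l) ^ n * exp (- (l/2)) \<le> 8 ^ n * fact n * exp (1/8)"
proof -
 have "(1 + 4 * l) ^ n = 8 ^ n * ((1 + 4 * l)/8) ^ n" by (simp add: power_divide)
 also have "\<dots> \<le> 8 ^ n * (fact n * exp ((1 + 4 * l)/8))" using assms by (intro mult_left_mono power_le_fact_exp) auto
 also have "\<dots> = 8 ^ n * fact n * exp (1/8) * exp (l/2)" by (simp add: add_divide_distrib exp_add)
 finally show ?thesis by (simp add: exp_minus field_simps)
qed

context glh_point begin

definition "II t = (\<integral>x. \<phi> x * ed (t,x) * G (t,x) \<partial>MB)"

lemma phi_ed_G_cont: "continuous_on Q0 (\<lambda>z. \<phi> (snd z) * ed z * G z)"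
 by (intro continuous_intros phi_cont_snd ed_cont0 G_cont)

lemma II_cont: "0 < a ==> b < t0 ==> continuous_on {a..b} II"
 unfolding II_def[abs_def] using compact_integrable(3)[OF phi_ed_G_cont] phi_outer by simp

lemma II_integral:
 assumes ab: "0 < a" "b < t0"
 shows "LI (PJ a b) (\<lambda>z. \<phi> (snd z) * ed z * G z) = integral {a..b} II"
proof -
 interpret pair_sigma_finite "lborel_on {a..b}" MB by (intro pair_sigma_finite_lborel_on) auto
 have i: "integrable (PJ a b) (\<lambda>z. \<phi> (snd z) * ed z * G z)"
  by (rule compact_integrable(2)[OF phi_ed_G_cont _ ab]) (use phi_outer in auto)
 have "LI (PJ a b) (\<lambda>z. \<phi> (snd z) * ed z * G z) = (\<integral>t. II t \<partial>lborel_on {a..b})"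
  using integral_fst'[OF i] by (simp add: II_def)
 also have "\<dots> = (LBINT t:{a..b}. II t)" by (simp add: integral_restrict_space set_lebesgue_integral_def)
 also have "\<dots> = integral {a..b} II"
  by (rule set_borel_integral_eq_integral(2)[OF borel_integrable_atLeastAtMost'[OF II_cont[OF ab]]])
 finally show ?thesis .
qed

text \<open>\<open>HH\<close> equals \<open>- d \<phi> e G\<close> minus twice the time derivative
  of \<open>\<tau> \<phi> e G\<close>, so only the ends of the window remain besides the integral of
  \<open>II\<close>. For the window from t0 - 4 R^2 to t0 - R^2, division by R^(d + 1) gives exactly
  the derivative in R of R^(-d) times the integral of \<open>II\<close>.\<close>

lemma HH_boundary:
 assumes ab: "0 < a" "a \<le> b" "b < t0"
 shows "LI (PJ a b) HH = - real DIM('a) * integral {a..b} II - 2 * ((t0 - b) * II b - (t0 - a) * II a)"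
proof -
 interpret pair_sigma_finite "lborel_on {a..b}" MB by (intro pair_sigma_finite_lborel_on) auto
 define F' where "F' z = - (\<phi> (snd z) * ed z * G z) + (t0 - fst z) * \<phi> (snd z) * EGt z" for z
 have c: "continuous_on Q0 F'" unfolding F'_def by (intro continuous_intros phi_cont_snd ed_cont0 G_cont EGt_cont)
 have z: "snd z \<notin> K0 ==> F' z = 0" for z using phi_outer[of "snd z"] by (simp add: F'_def)
 note i = compact_integrable(2)[OF c z ab(1,3)]
 have ie: "integrable (PJ a b) (\<lambda>z. \<phi> (snd z) * ed z * G z)"
  by (rule compact_integrable(2)[OF phi_ed_G_cont _ ab(1,3)]) (use phi_outer in auto)
 have ib: "integrable MB (\<lambda>x. (t0 - t) * (\<phi> x * ed (t,x) * G (t,x)))" if "t \<in> {a..b}" for t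
  using compact_integrable(1)[OF phi_ed_G_cont _, of t] phi_outer that ab by simp
 have "(\<integral>x. (t0 - b) * (\<phi> x * ed (b, x) * G (b, x)) \<partial>MB) - (\<integral>x. (t0 - a) * (\<phi> x * ed (a, x) * G (a, x)) \<partial>MB)
  = (\<integral>t. (\<integral>x. F' (t,x) \<partial>MB) \<partial>lborel_on {a..b})"
 proof (rule time_FTC)
  fix x t assume x: "x \<in> BB" and t: "t \<in> {a..b}"
  have tt: "t \<in> {0<..<T}" "t < t0" using t ab t0 by auto
  have "((\<lambda>t. (t0 - t) * (\<phi> x * (ed (t,x) * G (t,x)))) has_real_derivative
   (0 - 1) * (\<phi> x * (ed (t,x) * G (t,x))) + \<phi> x * (ed_t (t,x) * G (t,x) + - (G (t,x) * nsq (x - x0)/(4 * (t0 - t)^2)) * ed (t,x)) * (t0 - t)) (at t)"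
   by (intro DERIV_mult DERIV_cmult DERIV_diff DERIV_const DERIV_ident ed_deriv_t G_deriv_t tt x)
  then show "((\<lambda>t. (t0 - t) * (\<phi> x * ed (t,x) * G (t,x))) has_real_derivative F' (t,x)) (at t)"
   unfolding mult.assoc[of "\<phi> x"] by (rule DERIV_cong) (simp add: F'_def EGt_def algebra_simps)
 next
  fix x assume "x \<in> BB"
  then show "continuous_on {a..b} (\<lambda>t. F' (t,x))"
   using ab by (intro continuous_on_compose2[OF c]) (auto intro!: continuous_intros)
 qed (use ab i ib in auto)
 also have "\<dots> = LI (PJ a b) F'" using integral_fst'[OF i] by simp
 finally have F: "(t0 - b) * II b - (t0 - a) * II a = LI (PJ a b) F'" by (simp add: II_def)
 have H: "HH = (\<lambda>z. - real DIM('a) * (\<phi> (snd z) * ed z * G z) - 2 * F' z)"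
  by (simp add: fun_eq_iff HH_def F'_def algebra_simps)
 have "LI (PJ a b) HH = - real DIM('a) * LI (PJ a b) (\<lambda>z. \<phi> (snd z) * ed z * G z) - 2 * LI (PJ a b) F'"
  unfolding H using i ie by simp
 then show ?thesis unfolding F[symmetric] II_integral[OF ab(1,3)] .
qed

abbreviation "PR R \<equiv> PJ (t0 - 4 * R^2) (t0 - R^2)"
definition "eR R = exp (- (d0^2/(32 * R^2)))"

lemma window:
 assumes R: "0 < R" "4 * R^2 < t0"
 shows "0 < t0 - 4 * R^2" "t0 - 4 * R^2 \<le> t0 - R^2" "t0 - R^2 < T" "t0 - R^2 < t0"
proof -
 have "R^2 > 0" using R by simp
 then show "0 < t0 - 4 * R^2" "t0 - 4 * R^2 \<le> t0 - R^2" "t0 - R^2 < T" "t0 - R^2 < t0"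
  using R(2) t0 unfolding greaterThanLessThan_iff by linarith+
qed

lemma phi_far:
 assumes s: "0 < t0 - t" and t: "t0 - t \<le> 4 * R^2"
 shows "(1 - \<phi> x) * G (t,x) \<le> eR R"
proof (cases "\<phi> x = 1")
 case True
 then show ?thesis by (simp add: eR_def)
next
 case False
 have "(1 - \<phi> x) * G (t,x) \<le> 1 * exp (- (d0^2/(8 * (t0 - t))))"
  using G_far[of t x] False phi_bounds[of x] s less_imp_le[OF G_pos] by (intro mult_mono) auto
 also have "d0^2/(32 * R^2) \<le> d0^2/(8 * (t0 - t))" using s t by (intro frac_le) auto
 then have "1 * exp (- (d0^2/(8 * (t0 - t)))) \<le> eR R" by (simp add: eR_def)
 finally show ?thesis .
qed

lemma NU_sq_le:
 assumes R: "0 < R" and z: "z \<in> Q" "R^2 \<le> t0 - fst z"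
 shows "nsq (NU z) \<le> 2 * nsq (dt U z) + 2/R ^ 4 * gsq z"
proof -
 let ?s = "t0 - fst z"
 have s: "?s > 0" by (rule less_le_trans[OF zero_less_power[OF R] z(2)])
 have "norm (snd z - x0) \<le> 2" using z x0 norm_triangle_ineq4[of "snd z" x0] by auto
 then have y: "nsq (snd z - x0) \<le> 2^2" by (intro power_mono) auto
 have "nsq (YU z) \<le> nsq (snd z - x0) * gsq z"
  unfolding YU_def gsq_def by (rule norm_sum_scaleR_Basis_sq)
 also have "\<dots> \<le> 2^2 * gsq z" by (rule mult_right_mono[OF y gsq_nonneg])
 finally have Y: "nsq (YU z) \<le> 4 * gsq z" by simp
 have "nsq ((1/(2 * ?s)) .* YU z) = nsq (YU z)/(4 * ?s^2)"
 proof -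
  have "nsq ((1/(2 * c)) .* v) = nsq v/(4 * c^2)" for c and v :: 'b
   by (simp add: power_mult_distrib power_divide)
  then show ?thesis .
 qed
 also have "\<dots> \<le> (4 * gsq z)/(4 * ?s^2)" by (rule divide_right_mono[OF Y]) simp
 also have "\<dots> \<le> (4 * gsq z)/(4 * R ^ 4)"
 proof -
  have "(R^2)^2 \<le> ?s^2" using z by (intro power_mono) auto
  then show ?thesis using R gsq_nonneg[of z] by (intro frac_le) auto
 qed
 finally have "nsq ((1/(2 * ?s)) .* YU z) \<le> gsq z/R ^ 4" by simp
 moreover have "NU z = dt U z - (1/(2 * ?s)) .* YU z"
 proof -
  have "1/(2 * (fst z - t0)) = - (1/(2 * ?s))" using s by (simp add: divide_simps)
  then show ?thesis unfolding NU_def by simp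
 qed
 ultimately show ?thesis
  using norm_diff_sq_le[of "dt U z" "(1/(2 * ?s)) .* YU z"] by simp
qed

text \<open>The dissipation to be estimated carries no cutoff. Where \<open>\<phi> < 1\<close> the
  weighted kernel is at most \<open>eR R\<close>, and |NU|^2 is controlled by u_t and, with a factor
  R^(-4) since \<tau> \<ge> R^2, by the gradient; a window of length 3 R^2 leaves 12/R^2.\<close>

lemma far_dissipation:
 assumes R: "0 < R" "4 * R^2 < t0"
 shows "integrable (PR R) (\<lambda>z. nsq (NU z) * G z)" (is ?c1)
  and "LI (PR R) (\<lambda>z. nsq (NU z) * G z)
   \<le> LI (PR R) (\<lambda>z. \<phi> (snd z) * G z * nsq (NU z)) + eR R * (CE * M0 * (2 + 12/R^2))" (is ?c2)
proof -
 note ab = window[OF R] note B = PJ_bounds[OF ab(1-3)]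
 have sp: "z \<in> Q" "R^2 \<le> t0 - fst z" "t0 - fst z \<le> 4 * R^2" "0 < t0 - fst z" if "z \<in> space (PR R)" for z
 proof -
  have "t0 - 4 * R^2 \<le> fst z" "fst z \<le> t0 - R^2" "snd z \<in> BB"
   using that by (auto simp: spaces)
  then show "z \<in> Q" "R^2 \<le> t0 - fst z" "t0 - fst z \<le> 4 * R^2" "0 < t0 - fst z"
   using ab unfolding mem_Times_iff greaterThanLessThan_iff by - (intro conjI, linarith, linarith, assumption, linarith+)
 qed
 let ?D = "\<lambda>z. 2 * nsq (dt U z) + 2/R ^ 4 * gsq z"
 have D: "integrable (PR R) ?D" using B by simp
 have G1: "0 \<le> G z" "G z \<le> 1" if "z \<in> space (PR R)" for z
  using G_pos[of z] G_le_1[of "fst z" "snd z"] sp(2)[OF that] less_le_trans[OF zero_less_power[OF R(1)] sp(2)[OF that]] by auto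
 have c: "continuous_on ({t0 - 4 * R^2..t0 - R^2} \<times> BB) (\<lambda>z. nsq (NU z) * G z)"
 proof (rule continuous_on_subset[of Q0])
  show "{t0 - 4 * R^2..t0 - R^2} \<times> BB \<subseteq> Q0" using ab by (intro Sigma_mono subsetI) (auto simp del: diff_gt_0_iff_gt intro: order_le_less_trans less_le_trans)
 qed (intro continuous_intros NU_cont G_cont)
 show i: ?c1
 proof (rule L1_bound[OF D])
  show "(\<lambda>z. nsq (NU z) * G z) \<in> borel_measurable (PR R)" by (rule measurable_pair_continuous_on[OF c])
  show "AE z in PR R. norm (nsq (NU z) * G z) \<le> norm (?D z)"
  proof (rule AE_I2)
   fix z assume z: "z \<in> space (PR R)"
   have "nsq (NU z) * G z \<le> ?D z * 1"
    using NU_sq_le[OF R(1) sp(1,2)[OF z]] G1[OF z] gsq_nonneg[of z] by (intro mult_mono) auto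
   moreover have "0 \<le> nsq (NU z) * G z" using G1[OF z] by simp
   ultimately show "norm (nsq (NU z) * G z) \<le> norm (?D z)" by simp
  qed
 qed
 note i2 = near_lower(2)[OF R]
 have "LI (PR R) (\<lambda>z. nsq (NU z) * G z) \<le> LI (PR R) (\<lambda>z. \<phi> (snd z) * G z * nsq (NU z) + eR R * ?D z)"
 proof (rule integral_mono[OF i])
  show "integrable (PR R) (\<lambda>z. \<phi> (snd z) * G z * nsq (NU z) + eR R * ?D z)"
   by (rule Bochner_Integration.integrable_add[OF i2 integrable_mult_right[OF D]])
  fix z assume z: "z \<in> space (PR R)"
  have "(1 - \<phi> (snd z)) * G z * nsq (NU z) \<le> eR R * ?D z"
   using phi_far[of "fst z" R "snd z"] sp[OF z] NU_sq_le[OF R(1) sp(1,2)[OF z]]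
   by (intro mult_mono) (auto simp: eR_def)
  then show "nsq (NU z) * G z \<le> \<phi> (snd z) * G z * nsq (NU z) + eR R * ?D z"
   by (simp add: algebra_simps)
 qed
 also have "\<dots> = LI (PR R) (\<lambda>z. \<phi> (snd z) * G z * nsq (NU z)) + eR R * LI (PR R) ?D"
  using i2 D by simp
 also have "LI (PR R) ?D = 2 * LI (PR R) (\<lambda>z. nsq (dt U z)) + 2/R ^ 4 * LI (PR R) gsq"
  using B by simp
 also have "\<dots> \<le> 2 * (CE * M0) + 2/R ^ 4 * ((t0 - R^2 - (t0 - 4 * R^2)) * (2 * (CE * M0)))"
  using B by (intro add_mono mult_left_mono) auto
 also have "\<dots> = CE * M0 * (2 + 12/R^2)" using R by (simp add: field_simps power2_eq_square power4_eq_xxxx)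
 finally show ?c2
  by (simp add: eR_def)
qed

end

definition log_const :: "nat => real" where
 "log_const n = 8 ^ (n + 1) * fact (n + 1) * exp (1/8)"

text \<open>The hypothesis says that R^2 is at least of order 1/l, so negative powers of R cost only
  powers of l = |ln lam|, and these lose against \<open>lam^(1/2) = exp (- l/2)\<close>. The extra
  factor l raises the power in \<open>log_const\<close> by one.\<close>

lemma small_window_le:
 assumes R: "R > 0" and l: "l \<ge> 0" "4 * R^2 * l > 1"
 shows "l * exp (- (l/2))/R ^ n \<le> log_const n"
proof -
 have "1/R^2 \<le> 4 * l" using l R by (simp add: field_simps)
 moreover have "1/R \<le> 1 + 1/R^2"
  using zero_le_power2[of "1/R - 1/2"] by (simp add: power2_eq_square algebra_simps)
 ultimately have "1/R \<le> 1 + 4 * l" by linarith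
 then have "(1/R) ^ n \<le> (1 + 4 * l) ^ n" using R by (intro power_mono) auto
 then have "l * (1/R) ^ n \<le> (1 + 4 * l) * (1 + 4 * l) ^ n" using l R by (intro mult_mono) auto
 then have "l * (1/R) ^ n * exp (- (l/2)) \<le> (1 + 4 * l) * (1 + 4 * l) ^ n * exp (- (l/2))"
  by (rule mult_right_mono) simp
 also have "(1 + 4 * l) * (1 + 4 * l) ^ n * exp (- (l/2)) = (1 + 4 * l) ^ (n + 1) * exp (- (l/2))" by simp
 also have "\<dots> \<le> log_const n" unfolding log_const_def by (rule log_decay_le[OF l(1)])
 finally show ?thesis by (simp add: power_one_over)
qed

text \<open>Bernoulli's inequality at a/b. The right side is expressed by \<open>b^2 - a^2\<close>,
  the form of the error term between two radii.\<close>

lemma inverse_power_diff_le: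
 fixes a b :: real
 assumes ab: "0 < a" "a \<le> b"
 shows "1/a ^ n - 1/b ^ n \<le> real n * (b^2 - a^2)/a ^ (n + 2)"
proof -
 have "1 + real n * (a/b - 1) \<le> (1 + (a/b - 1)) ^ n" by (rule Bernoulli_inequality) (use ab in simp)
 then have "1 - (a/b) ^ n \<le> real n * (1 - a/b)" by (simp add: algebra_simps)
 also have "1 - a/b = (b - a)/b" using ab by (simp add: diff_divide_distrib)
 also have "(b - a)/b \<le> (b^2 - a^2)/a^2"
 proof -
  have "a^2 \<le> b * (b + a)" using ab by (simp add: power2_eq_square mult_mono add_increasing2 distrib_left)
  then have "(b - a) * a^2 \<le> (b - a) * (b * (b + a))" using ab by (intro mult_left_mono) auto
  also have "\<dots> = (b^2 - a^2) * b" by (simp add: power2_eq_square algebra_simps)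
  finally show ?thesis using ab by (intro divide_le_eq[THEN iffD2]) (simp_all add: field_simps)
 qed
 finally have "1 - (a/b) ^ n \<le> real n * ((b^2 - a^2)/a^2)" by (simp add: mult_left_mono)
 then have "(1 - (a/b) ^ n)/a ^ n \<le> real n * ((b^2 - a^2)/a^2)/a ^ n"
  using ab by (intro divide_right_mono) auto
 moreover have "(1 - (a/b) ^ n)/a ^ n = 1/a ^ n - 1/b ^ n" using ab by (simp add: power_divide field_simps)
 ultimately show ?thesis using ab by (simp add: power_add power2_eq_square mult_ac)
qed

text \<open>\<open>CE\<close> restated outside the locale: the final constant has to be fixed before
  the initial map, \<lambda>, the flow and the point are.\<close>

definition energy_const :: "real => real" where "energy_const T = 1/2 + T^2 * exp (4 * T)"

text \<open>The summands account, in this order, for the dissipation where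
  \<open>\<phi> < 1\<close>, for the terms with the gradient of the cutoff, and for the time
  dependence of the coupling.\<close>

definition near_const :: "real => real => nat => real" where
 "near_const T L d = energy_const T * (T + 12) * exp_const (d + 2) + 8 * L * (4 * T + 3) * energy_const T * exp_const d
  + 24 * T^2 * exp (4 * T) * log_const d"

definition far_const :: "real => nat => real" where
 "far_const T d = energy_const T * (3 * d + 1) * exp_const d"

context glh_point begin

lemma CE_eq: "CE = energy_const T" by (simp add: CE_def energy_const_def)

lemma A_nonneg: "0 \<le> CE * M0" using M0_nonneg CE_ge by simp

lemma d0_power: "0 < d0 ^ n" "d0 ^ n \<le> 1" using d0 by (auto intro: power_le_one)

definition "DR R = LI (PR R) (\<lambda>z. nsq (NU z) * G z)"

text \<open>All errors of the window are divided by the power of R that turns \<open>HH\<close> into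
  a derivative. Exponential decay trades R^(-d-2) and R^(-d) for the same powers of 1/d0, each term
  retaining one factor R, so that integration over R yields R2^2 - R1^2.\<close>

lemma key_inequality:
 assumes R: "0 < R" "4 * R^2 < t0"
 shows "DR R/R ^ (DIM('a) - 1) \<le> LI (PR R) HH/R ^ (DIM('a) + 1) + near_const T L DIM('a) * M0/d0 ^ (DIM('a) + 2) * R"
proof -
 define p where "p = R ^ (DIM('a) - 1)"
 have p: "p > 0" using R by (simp add: p_def)
 obtain n where n: "DIM('a) = Suc n" using dim by (cases "DIM('a)") auto
 have pw: "R ^ DIM('a) = p * R" "R ^ (DIM('a) + 1) = p * R^2" "R ^ (DIM('a) + 2) = p * R ^ 3"
  by (simp_all add: p_def n power2_eq_square power3_eq_cube mult_ac)
 have R2: "4 * R^2 \<le> T" "2 * R^2 + 12 \<le> T + 12" using R(2) t0 zero_le_power2[of R] unfolding greaterThanLessThan_iff by linarith+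
 have AT: "0 \<le> CE * M0 * (T + 12)" "0 \<le> 8 * L/d0^2 * (4 * T + 3) * (CE * M0)" "0 \<le> 8 * L/d0^2 * (4 * T + 3)"
  using A_nonneg T \<beta>(11) by auto
 define X where "X = LI (PR R) (\<lambda>z. \<phi> (snd z) * G z * nsq (NU z))"
 define H where "H = LI (PR R) HH"
 define P0 where "P0 = lam powr (1/2) * (exp (4 * T) * T * M0)"
 have X0: "X \<ge> 0" unfolding X_def using phi_bounds less_imp_le[OF G_pos] by (intro L1_nonneg) simp
 have nl: "2 * R^2 * X - (cneg R * (3 * R^2 * P0) + BR R * ((16 * R ^ 4 + 3 * R^2) * (CE * M0))) \<le> H"
  using near_lower(1)[OF R] unfolding X_def H_def P0_def .
 have eRb: "eR R/R ^ n \<le> exp_const n/d0 ^ n" for n unfolding eR_def by (rule exp_decay_le[OF R(1) d0(1)])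
 have t1: "eR R * (CE * M0 * (2 + 12/R^2))/p \<le> R * (CE * M0 * (T + 12) * (exp_const (DIM('a) + 2)/d0 ^ (DIM('a) + 2)))"
 proof -
  have "eR R * (CE * M0 * (2 + 12/R^2))/p = R * (CE * M0 * (2 * R^2 + 12) * (eR R/R ^ (DIM('a) + 2)))"
   unfolding pw using p R by (simp add: field_simps power2_eq_square power3_eq_cube)
  also have "\<dots> \<le> R * (CE * M0 * (T + 12) * (exp_const (DIM('a) + 2)/d0 ^ (DIM('a) + 2)))"
   using R(1) R2 A_nonneg AT by (intro mult_left_mono[OF mult_mono[OF mult_left_mono eRb]]) (auto simp: eR_def)
  finally show ?thesis .
 qed
 have t3: "BR R * ((16 * R ^ 4 + 3 * R^2) * (CE * M0))/(p * R^2) \<le> R * (8 * L * (4 * T + 3) * (CE * M0) * (exp_const DIM('a)/d0 ^ (DIM('a) + 2)))"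
 proof -
  have "BR R * ((16 * R ^ 4 + 3 * R^2) * (CE * M0))/(p * R^2) = R * (8 * L/d0^2 * (16 * R^2 + 3) * (CE * M0) * (eR R/R ^ DIM('a)))"
   unfolding pw BR_def eR_def[symmetric] using p R d0 by (simp add: field_simps power2_eq_square power4_eq_xxxx)
  also have "\<dots> \<le> R * (8 * L/d0^2 * (4 * T + 3) * (CE * M0) * (exp_const DIM('a)/d0 ^ DIM('a)))"
   using R(1) R2 A_nonneg AT \<beta>(11) by (intro mult_left_mono[OF mult_mono[OF mult_right_mono[OF mult_left_mono] eRb]]) (auto simp: eR_def)
  also have "\<dots> = R * (8 * L * (4 * T + 3) * (CE * M0) * (exp_const DIM('a)/d0 ^ (DIM('a) + 2)))"
   by (simp add: power_add power2_eq_square)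
  finally show ?thesis .
 qed
 have t2: "cneg R * (3 * R^2 * P0)/(p * R^2) \<le> R * (24 * T^2 * exp (4 * T) * log_const DIM('a) * M0/d0 ^ (DIM('a) + 2))"
 proof -
  have lc: "log_const DIM('a) \<ge> 0" by (simp add: log_const_def)
  have "cneg R * (3 * R^2 * P0)/(p * R^2) \<le> R * (24 * T^2 * exp (4 * T) * log_const DIM('a) * M0)"
  proof (cases "4 * R^2 * max 0 (- ln lam) \<le> 1")
   case True
   then show ?thesis using R M0_nonneg lc by (simp add: cneg_def)
  next
   case False
   define l where "l = - ln lam"
   have l: "l \<ge> 0" "max 0 (- ln lam) = l" using False unfolding l_def by (cases "- ln lam \<ge> 0"; simp add: max_def)+
   have lp: "lam powr (1/2) = exp (- (l/2))" using lam by (simp add: powr_def l_def)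
   have "cneg R * (3 * R^2 * P0)/(p * R^2) = R * (24 * R^2 * exp (4 * T) * T * M0 * (l * exp (- (l/2))/R ^ DIM('a)))"
    unfolding pw cneg_def P0_def lp l(2) using False[unfolded l(2)] p R by (simp add: field_simps power2_eq_square)
   also have "\<dots> \<le> R * (24 * T * exp (4 * T) * T * M0 * log_const DIM('a))"
   proof (intro mult_left_mono mult_mono)
    show "l * exp (- (l/2))/R ^ DIM('a) \<le> log_const DIM('a)"
     by (rule small_window_le[OF R(1) l(1)]) (use False l in simp)
   qed (use R R2 T M0_nonneg l in auto)
   finally show ?thesis by (simp add: power2_eq_square mult_ac)
  qed
  also have "\<dots> \<le> R * (24 * T^2 * exp (4 * T) * log_const DIM('a) * M0/d0 ^ (DIM('a) + 2))"
  proof (rule mult_left_mono)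
   have "24 * T^2 * exp (4 * T) * log_const DIM('a) * M0/1 \<le> 24 * T^2 * exp (4 * T) * log_const DIM('a) * M0/d0 ^ (DIM('a) + 2)"
    using d0_power[of "DIM('a) + 2"] lc M0_nonneg by (intro frac_le) (simp_all del: power_Suc add_2_eq_Suc')
   then show "24 * T^2 * exp (4 * T) * log_const DIM('a) * M0 \<le> 24 * T^2 * exp (4 * T) * log_const DIM('a) * M0/d0 ^ (DIM('a) + 2)" by simp
  qed (use R in simp)
  finally show ?thesis .
 qed
 have "DR R/p \<le> (X + eR R * (CE * M0 * (2 + 12/R^2)))/p"
  unfolding DR_def X_def using far_dissipation(2)[OF R] p by (intro divide_right_mono) auto
 also have "\<dots> = X/p + eR R * (CE * M0 * (2 + 12/R^2))/p" by (rule add_divide_distrib)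
 \<comment> \<open>The identity provides twice the dissipation, because 2 \<tau> \<ge> 2 R^2; one
   half is discarded.\<close>
 also have "X/p \<le> (2 * R^2 * X)/(p * R^2)" using p R X0 by (simp add: field_simps)
 also have "\<dots> \<le> (H + (cneg R * (3 * R^2 * P0) + BR R * ((16 * R ^ 4 + 3 * R^2) * (CE * M0))))/(p * R^2)"
  using nl p by (intro divide_right_mono) auto
 also have "\<dots> = H/(p * R^2) + (cneg R * (3 * R^2 * P0)/(p * R^2) + BR R * ((16 * R ^ 4 + 3 * R^2) * (CE * M0))/(p * R^2))"
  by (simp only: add_divide_distrib)
 finally have "DR R/p \<le> H/(p * R^2) + (R * (24 * T^2 * exp (4 * T) * log_const DIM('a) * M0/d0 ^ (DIM('a) + 2))
   + R * (8 * L * (4 * T + 3) * (CE * M0) * (exp_const DIM('a)/d0 ^ (DIM('a) + 2))))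
   + R * (CE * M0 * (T + 12) * (exp_const (DIM('a) + 2)/d0 ^ (DIM('a) + 2)))"
  using t1 t2 t3 by linarith
 also have "\<dots> = H/(p * R^2) + near_const T L DIM('a) * M0/d0 ^ (DIM('a) + 2) * R"
  unfolding near_const_def CE_eq[symmetric] by (simp add: add_divide_distrib algebra_simps)
 finally show ?thesis unfolding pw p_def[symmetric] H_def .
qed

section \<open>Comparison of two radii\<close>

definition "EN R = LI (PR R) (\<lambda>z. \<phi> (snd z) * ed z * G z)/R ^ DIM('a)"
definition "EE R = LI (PR R) (\<lambda>z. ed z * G z)/R ^ DIM('a)"

lemma near_monotone:
 assumes R12: "0 < R1" "R1 < R2" "4 * R2^2 < t0" and k: "k = near_const T L DIM('a) * M0/d0 ^ (DIM('a) + 2)"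
 shows "(\<integral>\<^sup>+R\<in>{R1..R2}. ennreal (DR R/R ^ (DIM('a) - 1)) \<partial>lborel) \<le> ennreal (EN R2 - EN R1 + k/2 * (R2^2 - R1^2))" (is ?c1)
  and "0 \<le> EN R2 - EN R1 + k/2 * (R2^2 - R1^2)"
proof -
 have R: "0 < R" "4 * R^2 < t0" if "R \<in> {R1..R2}" for R
 proof -
  have "R^2 \<le> R2^2" using that R12 by (intro power_mono) auto
  then show "4 * R^2 < t0" using R12(3) by linarith
  show "0 < R" using that R12 by simp
 qed
 have E: "EN R = integral {t0 - 4 * R^2..t0 - R^2} II/R ^ DIM('a)" if "R \<in> {R1..R2}" for R
  unfolding EN_def using II_integral[OF window(1,4)[OF R[OF that]]] by simp
 have R1: "R1^2 > 0" using R12 by simp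
 have c: "continuous_on {(t0 - 4 * R2^2)/2..t0 - R1^2/2} II" by (rule II_cont) (use R12 in auto)
 have ab: "(t0 - 4 * R2^2)/2 < t0 - 4 * R2^2" "t0 - R1^2 < t0 - R1^2/2" using R12(3) R1 by simp_all
 have q0: "0 \<le> DR R/R ^ (DIM('a) - 1)" if "R \<in> {R1..R2}" for R
  unfolding DR_def using less_imp_le[OF G_pos] R[OF that] by simp
 have q: "DR R/R ^ (DIM('a) - 1) \<le> - (real DIM('a)/R ^ (DIM('a) + 1)) * integral {t0 - 4 * R^2..t0 - R^2} II
    + (8 * R * II (t0 - 4 * R^2) - 2 * R * II (t0 - R^2))/R ^ DIM('a) + k * R" if "R \<in> {R1..R2}" for R
 proof -
  have "LI (PR R) HH/R ^ (DIM('a) + 1) = - (real DIM('a)/R ^ (DIM('a) + 1)) * integral {t0 - 4 * R^2..t0 - R^2} II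
    + (8 * R * II (t0 - 4 * R^2) - 2 * R * II (t0 - R^2))/R ^ DIM('a)"
   unfolding HH_boundary[OF window(1,2,4)[OF R[OF that]]] using R(1)[OF that]
   by (simp add: divide_simps) (simp add: algebra_simps power2_eq_square)
  then show ?thesis using key_inequality[OF R[OF that]] k by simp
 qed
 note S = sliding_window_integral_le[OF c R12(1) less_imp_le[OF R12(2)] ab refl q0 q]
 show ?c1
  "0 \<le> EN R2 - EN R1 + k/2 * (R2^2 - R1^2)"
  using S E R12 by simp_all
qed

text \<open>The part of the weighted energy outside the cutoff. It extends up to the sphere, where
  the divergence identity would produce boundary terms.\<close>

definition "fe z = (1 - \<phi> (snd z)) * ed z * G z"

lemma fe_props:
 assumes ab: "0 < a" "a \<le> b" "b < t0"
 shows "integrable (PJ a b) fe" "integrable (PJ a b) (\<lambda>z. ed z * G z)" (is ?c2) "\<And>z. fe z \<ge> 0"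
  and "\<And>R. t0 - a \<le> 4 * R^2 ==> LI (PJ a b) fe \<le> (b - a) * (eR R * (CE * M0))"
proof -
 have bT: "b < T" using ab t0 by simp
 note e = PJ_bounds(6)[OF ab(1,2) bT]
 have c: "continuous_on ({a..b} \<times> BB) (\<lambda>z. ed z * G z)" 
  by (rule continuous_on_subset[of Q0]) (use ab in \<open>auto intro!: continuous_intros ed_cont0 G_cont\<close>)
 show i: ?c2
 proof (rule L1_bound[OF e])
  show "(\<lambda>z. ed z * G z) \<in> borel_measurable (PJ a b)" by (rule measurable_pair_continuous_on[OF c])
  show "AE z in PJ a b. norm (ed z * G z) \<le> norm (ed z)"
  proof (rule AE_I2)
   fix z assume "z \<in> space (PJ a b)"
   then have "fst z < t0" using ab by (auto simp: spaces)
   then have "\<bar>G z\<bar> \<le> 1" using G_le_1[of "fst z" "snd z"] less_imp_le[OF G_pos[of z]] by simp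
   then show "norm (ed z * G z) \<le> norm (ed z)" using mult_left_mono[of "\<bar>G z\<bar>" 1 "\<bar>ed z\<bar>"] by (simp add: abs_mult)
  qed
 qed
 have "integrable (PJ a b) (\<lambda>z. \<phi> (snd z) * ed z * G z)"
  by (rule compact_integrable(2)[OF phi_ed_G_cont _ ab(1,3)]) (use phi_outer in auto)
 with i have "integrable (PJ a b) (\<lambda>z. ed z * G z - \<phi> (snd z) * ed z * G z)" by (rule L1_diff)
 then show f: "integrable (PJ a b) fe" by (simp add: fe_def[abs_def] left_diff_distrib)
 show "fe z \<ge> 0" for z using phi_bounds[of "snd z"] ed_nonneg less_imp_le[OF G_pos] by (simp add: fe_def)
 fix R :: real assume R: "t0 - a \<le> 4 * R^2"
 have "LI (PJ a b) fe \<le> LI (PJ a b) (\<lambda>z. eR R * ed z)"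
 proof (rule integral_mono[OF f integrable_mult_right[OF e]])
  fix z assume "z \<in> space (PJ a b)"
  then have "(1 - \<phi> (snd z)) * G z \<le> eR R"
   using phi_far[of "fst z" R "snd z"] ab R by (auto simp: spaces)
  from mult_right_mono[OF this ed_nonneg] show "fe z \<le> eR R * ed z" by (simp add: fe_def mult_ac)
 qed
 also have "\<dots> = eR R * LI (PJ a b) ed" by simp
 also have "\<dots> \<le> eR R * ((b - a) * (CE * M0))"
  using PJ_bounds(7)[OF ab(1,2) bT] by (intro mult_left_mono) (auto simp: eR_def)
 finally show "LI (PJ a b) fe \<le> (b - a) * (eR R * (CE * M0))" by (simp add: mult_ac)
qed

text \<open>No derivative in R is taken. The window of \<open>R1\<close> is covered by that of
  \<open>R2\<close> and the interval from t0 - R2^2 to t0 - R1^2. Both the integral over this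
  interval and the change of the factor R^(-d) are proportional to R2^2 - R1^2, and the kernel is
  exponentially small on \<open>fe\<close>.\<close>

lemma far_monotone:
 assumes R12: "0 < R1" "R1 < R2" "4 * R2^2 < t0"
 shows "LI (PR R1) fe/R1 ^ DIM('a) - LI (PR R2) fe/R2 ^ DIM('a) \<le> far_const T DIM('a) * M0/d0 ^ (DIM('a) + 2) * (R2^2 - R1^2)"
proof -
 have lt: "R1^2 < R2^2" using R12 by (intro power_strict_mono) auto
 have R1: "0 < R1" "4 * R1^2 < t0" using R12 lt by auto
 have R2: "0 < R2" "4 * R2^2 < t0" using R12 by auto
 note W1 = window[OF R1] note W2 = window[OF R2]
 let ?a = "t0 - 4 * R2^2" and ?b = "t0 - R1^2" and ?c = "t0 - R2^2"
 have ab: "0 < ?a" "?a \<le> ?b" "?b < t0" using W1 W2 lt by linarith+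
 have cb: "0 < ?c" "?c \<le> ?b" using W2 lt by linarith+
 have i: "integrable (PJ ?a ?b) fe" by (rule fe_props(1)[OF ab])
 have sub: "{t0 - 4 * R1^2..t0 - R1^2} \<subseteq> {?a..?b}" "{?a..?c} \<subseteq> {?a..?b}" "{?c..?b} \<subseteq> {?a..?b}" using lt W2(2) by auto
 have ii: "integrable (PJ ?a ?b) (\<lambda>z. indicator {u..v} (fst z) * fe z)" for u v
 proof (rule L1_bound[OF i])
  have "{u..v} \<inter> {?a..?b} \<in> sets (lborel_on {?a..?b})" by (auto simp: sets_restrict_space_iff)
  have "(\<lambda>t. indicator {u..v} t :: real) \<in> borel_measurable (lborel_on {?a..?b})"
   by (intro measurable_restrict_space1) simp
  from borel_measurable_times[OF measurable_compose[OF measurable_fst this] borel_measurable_integrable[OF i]]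
  show "(\<lambda>z. indicator {u..v} (fst z) * fe z) \<in> borel_measurable (PJ ?a ?b)" .
 qed (auto simp: indicator_def)
 have "LI (PR R1) fe = (\<integral>z. indicator {t0 - 4 * R1^2..t0 - R1^2} (fst z) * fe z \<partial>PJ ?a ?b)"
  by (rule integral_pair_restrict[OF i sub(1), symmetric]) auto
 also have "\<dots> \<le> (\<integral>z. indicator {?a..?c} (fst z) * fe z + indicator {?c..?b} (fst z) * fe z \<partial>PJ ?a ?b)"
  using ii lt by (intro integral_mono) (auto simp: indicator_def fe_props(3)[OF ab])
 also have "\<dots> = (\<integral>z. indicator {?a..?c} (fst z) * fe z \<partial>PJ ?a ?b) + (\<integral>z. indicator {?c..?b} (fst z) * fe z \<partial>PJ ?a ?b)"
  using ii by simp
 also have "\<dots> = LI (PR R2) fe + LI (PJ ?c ?b) fe"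
  using integral_pair_restrict[OF i sub(2)] integral_pair_restrict[OF i sub(3)] by simp
 finally have F: "LI (PR R1) fe \<le> LI (PR R2) fe + LI (PJ ?c ?b) fe" .
 let ?F1 = "LI (PR R1) fe" and ?F2 = "LI (PR R2) fe"
 have F1: "0 \<le> ?F1" "?F1 \<le> 3 * R1^2 * (eR R1 * (CE * M0))"
  using fe_props(3)[OF ab] fe_props(4)[OF W1(1,2,4), of R1] by auto
 have H3: "LI (PJ ?c ?b) fe \<le> (R2^2 - R1^2) * (eR R2 * (CE * M0))"
  using fe_props(4)[OF cb ab(3), of R2] zero_le_power2[of R2] by simp
 have "?F1/R1 ^ DIM('a) - ?F2/R2 ^ DIM('a) \<le> ?F1/R1 ^ DIM('a) - (?F1 - LI (PJ ?c ?b) fe)/R2 ^ DIM('a)"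
  using F R12 by (intro diff_left_mono divide_right_mono) auto
 also have "\<dots> = (1/R1 ^ DIM('a) - 1/R2 ^ DIM('a)) * ?F1 + LI (PJ ?c ?b) fe/R2 ^ DIM('a)"
  by (simp add: algebra_simps diff_divide_distrib)
 \<comment> \<open>The length 3 R1^2 of the window reduces the power R1^(d + 2) to R1^d before the
   exponential decay is used.\<close>
 also have "\<dots> \<le> (real DIM('a) * (R2^2 - R1^2)/R1 ^ (DIM('a) + 2)) * (3 * R1^2 * (eR R1 * (CE * M0))) + ((R2^2 - R1^2) * (eR R2 * (CE * M0)))/R2 ^ DIM('a)"
  using F1 H3 inverse_power_diff_le[of R1 R2 "DIM('a)"] R12 lt
  by (intro add_mono mult_mono divide_right_mono) auto
 also have "\<dots> = (R2^2 - R1^2) * (CE * M0) * (3 * DIM('a) * (eR R1/R1 ^ DIM('a)) + eR R2/R2 ^ DIM('a))"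
 proof -
  have "(real DIM('a) * D/R1 ^ (DIM('a) + 2)) * (3 * R1^2 * (eR R1 * (CE * M0))) + (D * (eR R2 * (CE * M0)))/R2 ^ DIM('a)
   = D * (CE * M0) * (3 * DIM('a) * (eR R1/R1 ^ DIM('a)) + eR R2/R2 ^ DIM('a))" for D
   using R12 by (simp add: power_add distrib_left power2_eq_square mult_ac)
  then show ?thesis .
 qed
 also have "\<dots> \<le> (R2^2 - R1^2) * (CE * M0) * (3 * DIM('a) * (exp_const DIM('a)/d0 ^ (DIM('a) + 2)) + exp_const DIM('a)/d0 ^ (DIM('a) + 2))"
 proof -
  have "eR R/R ^ DIM('a) \<le> exp_const DIM('a)/d0 ^ (DIM('a) + 2)" if "R > 0" for R
  proof -
   have "eR R/R ^ DIM('a) \<le> exp_const DIM('a)/d0 ^ DIM('a)" unfolding eR_def by (rule exp_decay_le[OF that d0(1)])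
   also have "\<dots> \<le> exp_const DIM('a)/d0 ^ (DIM('a) + 2)"
    using d0 d0_power exp_const_pos[of "DIM('a)"] by (intro frac_le power_decreasing) auto
   finally show ?thesis .
  qed
  then show ?thesis using R12 lt A_nonneg by (intro mult_left_mono add_mono) auto
 qed
 also have "\<dots> = far_const T DIM('a) * M0/d0 ^ (DIM('a) + 2) * (R2^2 - R1^2)"
  unfolding far_const_def CE_eq by (simp add: algebra_simps add_divide_distrib diff_divide_distrib)
 finally show ?thesis .
qed

text \<open>The far constant is doubled because the error term contains k/2. The second conclusion
  accompanies the first since \<open>ennreal\<close> truncates negative numbers to 0.\<close>

theorem monotonicity:
 assumes R12: "0 < R1" "R1 < R2" "4 * R2^2 < t0"
  and k: "k = (near_const T L DIM('a) + 2 * far_const T DIM('a)) * M0/d0 ^ (DIM('a) + 2)"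
 shows "(\<integral>\<^sup>+R\<in>{R1..R2}. ennreal (DR R/R ^ (DIM('a) - 1)) \<partial>lborel) \<le> ennreal (EE R2 - EE R1 + k/2 * (R2^2 - R1^2))" (is ?c1)
  and "0 \<le> EE R2 - EE R1 + k/2 * (R2^2 - R1^2)" (is ?c2)
proof -
 have lt: "R1^2 < R2^2" using R12 by (intro power_strict_mono) auto
 have sp: "EE R = EN R + LI (PR R) fe/R ^ DIM('a)" if R: "0 < R" "4 * R^2 < t0" for R
 proof -
  note W = window[OF R]
  have i: "integrable (PR R) (\<lambda>z. \<phi> (snd z) * ed z * G z)"
   by (rule compact_integrable(2)[OF phi_ed_G_cont _ W(1,4)]) (use phi_outer in auto)
  have "(\<lambda>z. ed z * G z) = (\<lambda>z. \<phi> (snd z) * ed z * G z + fe z)" by (simp add: fun_eq_iff fe_def algebra_simps)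
  then show ?thesis using i fe_props(1)[OF W(1,2,4)] by (simp add: EE_def EN_def add_divide_distrib)
 qed
 have le: "EN R2 - EN R1 + near_const T L DIM('a) * M0/d0 ^ (DIM('a) + 2)/2 * (R2^2 - R1^2) \<le> EE R2 - EE R1 + k/2 * (R2^2 - R1^2)"
  using far_monotone[OF R12] sp[of R1] sp[of R2] R12 lt unfolding k by (simp add: add_divide_distrib distrib_right)
 show ?c1
  by (rule order_trans[OF near_monotone(1)[OF R12 refl] ennreal_leI[OF le]])
 show ?c2 by (rule order_trans[OF near_monotone(2)[OF R12 refl] le])
qed

end

section \<open>Passage to Borel representatives\<close>

text \<open>\<open>weak_partial\<close> is a Hilbert choice; the Sobolev condition only provides
  some square-integrable derivative, and uniqueness almost everywhere carries its properties to the
  chosen one.\<close>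

lemma sobolev_H_1_weak_partial:
 fixes u0 :: "'a::euclidean_space => 'b::euclidean_space"
 assumes u0: "sobolev_H 1 (ball 0 1) u0" and b: "b \<in> Basis"
 shows "has_weak_partial (ball 0 1) b u0 (weak_partial (ball 0 1) b u0)"
  and "L2_fun (lebesgue_on (ball 0 1)) (weak_partial (ball 0 1) b u0)"
proof -
 let ?B = "ball (0::'a) 1"
 obtain h where h: "has_weak_partial ?B b u0 h" "L2_fun (lebesgue_on ?B) h" using u0 b by auto
 show wp: "has_weak_partial ?B b u0 (weak_partial ?B b u0)"
  unfolding weak_partial_def by (rule someI[of _ h]) (rule h(1))
 have ae: "AE x in lebesgue_on ?B. h x = weak_partial ?B b u0 x"
  by (rule has_weak_partial_unique[OF open_ball h(1) wp])
 have hm: "h \<in> borel_measurable (lebesgue_on ?B)" using h(2) by (simp add: L2_fun_def)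
 have m: "weak_partial ?B b u0 \<in> borel_measurable (lebesgue_on ?B)"
  by (rule borel_measurable_lebesgue_on_AE[OF _ hm ae]) simp
 have "integrable (lebesgue_on ?B) (\<lambda>x. nsq (weak_partial ?B b u0 x))"
  using h(2) ae m by (subst integrable_cong_AE[of _ _ "\<lambda>x. nsq (h x)"]) (auto simp: L2_fun_def elim: eventually_mono)
 then show "L2_fun (lebesgue_on ?B) (weak_partial ?B b u0)" using m by (simp add: L2_fun_def)
qed

text \<open>All conditions on the initial map are integral or almost-everywhere statements, so they
  survive the exchange of the map and its weak derivatives for Borel representatives.\<close>

lemma initial_data_borel:
 fixes u0 :: "'a::euclidean_space => 'b::euclidean_space"
 assumes u0: "sobolev_H_sphere 1 (ball 0 1) u0"
 obtains v0 g where "v0 \<in> borel_measurable borel" "AE x in lborel_on (ball 0 1). u0 x = v0 x" "AE x in lborel_on (ball 0 1). norm (v0 x) = 1"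
  "\<And>b. b \<in> Basis ==> g b \<in> borel_measurable borel"
  "\<And>b. b \<in> Basis ==> integrable (lborel_on (ball 0 1)) (\<lambda>x. nsq (g b x))"
  "\<And>b (\<phi>::'a => real). b \<in> Basis ==> test_function (ball 0 1) \<phi> ==>
    (\<integral>x. partial_deriv b \<phi> x .* v0 x \<partial>lborel_on (ball 0 1)) = - (\<integral>x. \<phi> x .* g b x \<partial>lborel_on (ball 0 1))"
  "\<And>b. b \<in> Basis ==> (\<integral>x. nsq (weak_partial (ball 0 1) b u0 x) \<partial>lebesgue_on (ball 0 1)) = (\<integral>x. nsq (g b x) \<partial>lborel_on (ball 0 1))"
proof -
 let ?B = "ball (0::'a) 1"
 have s: "sobolev_H 1 ?B u0" and n1: "AE x in lebesgue_on ?B. norm (u0 x) = 1" using u0 by (auto simp: sobolev_H_sphere_def)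
 have um: "u0 \<in> borel_measurable (lebesgue_on ?B)" using s by (simp add: L2_fun_def)
 have Bb: "?B \<in> sets borel" by simp
 obtain v0 where v0: "v0 \<in> borel_measurable borel" "AE x in lborel_on ?B. u0 x = v0 x"
  by (rule lebesgue_on_ex_borel[OF Bb um])
 have v0l: "AE x in lebesgue_on ?B. u0 x = v0 x" using v0(2) by (simp add: AE_lebesgue_on)
 note W = sobolev_H_1_weak_partial[OF s]
 have "\<exists>h. h \<in> borel_measurable borel \<and> (AE x in lborel_on ?B. weak_partial ?B b u0 x = h x)" if "b \<in> Basis" for b
  using W(2)[OF that] lebesgue_on_ex_borel[OF Bb, of "weak_partial ?B b u0"] by (metis L2_fun_def)
 then obtain g where g: "\<And>b. b \<in> Basis ==> g b \<in> borel_measurable borel"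
  "\<And>b. b \<in> Basis ==> AE x in lborel_on ?B. weak_partial ?B b u0 x = g b x" by metis
 have gl: "AE x in lebesgue_on ?B. weak_partial ?B b u0 x = g b x" if "b \<in> Basis" for b
  using g(2)[OF that] by (simp add: AE_lebesgue_on)
 have gm: "g b \<in> borel_measurable (lborel_on ?B)" if "b \<in> Basis" for b
  using g(1)[OF that] by (intro measurable_restrict_space1) simp
 have vm: "v0 \<in> borel_measurable (lborel_on ?B)" using v0(1) by (intro measurable_restrict_space1) simp
 have lm: "f \<in> borel_measurable (lebesgue_on ?B)" if "f \<in> borel_measurable borel" for f :: "'a => 'c::euclidean_space"
  using that by (intro measurable_restrict_space1 measurable_completion) simp
 have wm: "weak_partial ?B b u0 \<in> borel_measurable (lebesgue_on ?B)" if "b \<in> Basis" for b using W(2)[OF that] by (simp add: L2_fun_def)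
 show ?thesis
 proof (rule that[OF v0(1,2) _ g(1)])
  show "AE x in lborel_on ?B. norm (v0 x) = 1"
   using n1 v0(2) by (auto simp: AE_lebesgue_on elim: eventually_elim2)
  fix b :: 'a assume b: "b \<in> Basis"
  have nm: "(\<lambda>x. nsq (g b x)) \<in> borel_measurable (lborel_on ?B)" using gm[OF b] by measurable
  have e: "(\<integral>x. nsq (weak_partial ?B b u0 x) \<partial>lebesgue_on ?B) = (\<integral>x. nsq (g b x) \<partial>lebesgue_on ?B)"
   using wm[OF b] lm[OF g(1)[OF b]] gl[OF b] by (intro integral_cong_AE) (auto elim: eventually_mono)
  then show "(\<integral>x. nsq (weak_partial ?B b u0 x) \<partial>lebesgue_on ?B) = (\<integral>x. nsq (g b x) \<partial>lborel_on ?B)"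
   using integral_lebesgue_on(1)[OF Bb nm] by simp
  have "integrable (lebesgue_on ?B) (\<lambda>x. nsq (g b x))"
   using W(2)[OF b] wm[OF b] lm[OF g(1)[OF b]] gl[OF b]
   by (subst integrable_cong_AE[of _ _ "\<lambda>x. nsq (weak_partial ?B b u0 x)"]) (auto simp: L2_fun_def elim: eventually_mono)
  then show "integrable (lborel_on ?B) (\<lambda>x. nsq (g b x))" using integral_lebesgue_on(2)[OF Bb nm] by simp
  fix \<phi> :: "'a => real" assume t: "test_function ?B \<phi>"
  have pc: "continuous_on UNIV \<phi>" "continuous_on UNIV (partial_deriv b \<phi>)"
   using t smooth_on_imp_continuous_on[OF smooth_on_deriv[of UNIV \<phi> b]] by (auto simp: test_function_def partial_deriv_def[abs_def] intro: smooth_on_imp_continuous_on)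
  have pb: "\<phi> \<in> borel_measurable borel" "partial_deriv b \<phi> \<in> borel_measurable borel"
   by (auto intro!: borel_measurable_continuous_onI pc)
  have pm: "\<phi> \<in> borel_measurable (lborel_on ?B)" "partial_deriv b \<phi> \<in> borel_measurable (lborel_on ?B)"
   using pb by (auto intro!: measurable_restrict_space1)
  have "(\<integral>x. partial_deriv b \<phi> x .* v0 x \<partial>lborel_on ?B) = (\<integral>x. partial_deriv b \<phi> x .* v0 x \<partial>lebesgue_on ?B)"
   using pm vm by (intro integral_lebesgue_on(1)[OF Bb, symmetric] borel_measurable_scaleR)
  also have "\<dots> = (\<integral>x. partial_deriv b \<phi> x .* u0 x \<partial>lebesgue_on ?B)"
   using um lm[OF v0(1)] lm[OF pb(2)] v0l by (intro integral_cong_AE borel_measurable_scaleR) (auto elim: eventually_mono)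
  also have "\<dots> = - (\<integral>x. \<phi> x .* weak_partial ?B b u0 x \<partial>lebesgue_on ?B)"
   using W(1)[OF b] t by (simp add: has_weak_partial_def)
  also have "(\<integral>x. \<phi> x .* weak_partial ?B b u0 x \<partial>lebesgue_on ?B) = (\<integral>x. \<phi> x .* g b x \<partial>lebesgue_on ?B)"
   using wm[OF b] lm[OF g(1)[OF b]] lm[OF pb(1)] gl[OF b] by (intro integral_cong_AE borel_measurable_scaleR) (auto elim: eventually_mono)
  also have "\<dots> = (\<integral>x. \<phi> x .* g b x \<partial>lborel_on ?B)"
   using pm gm[OF b] by (intro integral_lebesgue_on(1)[OF Bb] borel_measurable_scaleR)
  finally show "(\<integral>x. partial_deriv b \<phi> x .* v0 x \<partial>lborel_on ?B) = - (\<integral>x. \<phi> x .* g b x \<partial>lborel_on ?B)" .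
 qed
qed

lemma smooth_flow_derivatives:
 fixes u :: "real => 'a::euclidean_space => 'b::euclidean_space"
 assumes s: "smooth_on ({0<..<T} \<times> ball 0 1) (\<lambda>(t,x). u t x)" and t: "t \<in> {0<..<T}" and x: "x \<in> ball 0 1"
 shows "frechet_derivative (u t) (at x) = (\<lambda>v. dx v (\<lambda>(t,x). u t x) (t,x))"
  and "partial_deriv b (u t) x = dx b (\<lambda>(t,x). u t x) (t,x)"
  and "vector_derivative (\<lambda>s. u s x) (at t) = dt (\<lambda>(t,x). u t x) (t,x)"
  and "laplacian (u t) x = (\<Sum>b\<in>Basis. dx b (dx b (\<lambda>(t,x). u t x)) (t,x))"
  and "smooth_on (ball 0 1) (u t)"
proof -
 let ?U = "\<lambda>(t,x). u t x"
 have o: "open ({0<..<T} \<times> ball (0::'a) 1)" by (intro open_Times) auto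
 have D: "(u t has_derivative (\<lambda>v. dx v ?U (t,x))) (at x)" if "x \<in> ball 0 1" for x
  using has_derivative_slice_x[OF o s, of t x] t that by simp
 show f: "frechet_derivative (u t) (at x) = (\<lambda>v. dx v ?U (t,x))" using frechet_derivative_at[OF D[OF x]] by simp
 show "partial_deriv b (u t) x = dx b ?U (t,x)" by (simp add: partial_deriv_def f)
 show "vector_derivative (\<lambda>s. u s x) (at t) = dt ?U (t,x)"
  using vector_derivative_at[OF has_vector_derivative_slice_t[OF o s, of t x]] t x by simp
 show "smooth_on (ball 0 1) (u t)"
  using smooth_on_slice_x[OF o s open_ball, of "0::'a" 1 t] t by simp
 have "partial_deriv b (partial_deriv b (u t)) x = dx b (dx b ?U) (t,x)" for b
 proof -
  have "((\<lambda>x. dx b ?U (t,x)) has_derivative (\<lambda>v. dx v (dx b ?U) (t,x))) (at x)"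
   using has_derivative_slice_x[OF o smooth_on_dx[OF s], of t x] t x by simp
  then have "(partial_deriv b (u t) has_derivative (\<lambda>v. dx v (dx b ?U) (t,x))) (at x)"
  proof (rule has_derivative_transform_within_open[OF _ open_ball x])
   fix z :: 'a assume "z \<in> ball 0 1"
   then show "dx b ?U (t, z) = partial_deriv b (u t) z" using frechet_derivative_at[OF D[of z]] by (simp add: partial_deriv_def fun_eq_iff)
  qed
  from frechet_derivative_at[OF this] show ?thesis by (simp add: partial_deriv_def fun_eq_iff)
 qed
 then show "laplacian (u t) x = (\<Sum>b\<in>Basis. dx b (dx b ?U) (t,x))" by (simp add: laplacian_def)
qed

text \<open>If the Dirichlet integral of u is infinite the bound is trivial; otherwise
  \<open>grad u - grad u0\<close> is the weak gradient of the difference. The 4 is the 2 from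
  Hardy's inequality for the zero-trace space times the 2 from splitting the difference of
  gradients.\<close>

lemma hardy_flow:
 fixes u :: "'a::euclidean_space => 'b::euclidean_space"
 assumes dim: "DIM('a) \<ge> 2" and u0: "sobolev_H 1 (ball 0 1) u0" and s: "smooth_on (ball 0 1) u"
  and z: "H1_zero (ball 0 1) (\<lambda>x. u x - u0 x)"
 shows "(\<integral>\<^sup>+x. ennreal ((norm (u x - u0 x)/(1 - nsq x))^2) \<partial>lebesgue_on (ball 0 1))
  \<le> ennreal (4 * (\<Sum>b\<in>Basis. \<integral>x. nsq (weak_partial (ball 0 1) b u0 x) \<partial>lebesgue_on (ball 0 1)))
    + 4 * (\<integral>\<^sup>+x. ennreal (grad_sq u x) \<partial>lborel_on (ball 0 1))"
proof (cases "(\<integral>\<^sup>+x. ennreal (grad_sq u x) \<partial>lborel_on (ball (0::'a) 1)) = \<infinity>")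
 case True
 then show ?thesis by simp
next
 case False
 let ?B = "ball (0::'a) 1" and ?M = "lebesgue_on (ball (0::'a) 1)"
 let ?p = "\<lambda>b. partial_deriv b u" and ?q = "\<lambda>b. weak_partial (ball 0 1) b u0"
 have Bb: "?B \<in> sets borel" by simp
 have pc: "continuous_on ?B (?p b)" for b
  unfolding partial_deriv_def[abs_def] by (rule smooth_on_imp_continuous_on[OF smooth_on_deriv[OF s]])
 have gm: "(\<lambda>x. nsq (?p b x)) \<in> borel_measurable (lborel_on ?B)" for b
  by (intro borel_measurable_lborel_on continuous_intros pc)
 have pm: "?p b \<in> borel_measurable ?M" for b
  using continuous_imp_measurable_on_sets_lebesgue[OF pc] by simp
 have pi: "integrable (lborel_on ?B) (\<lambda>x. nsq (?p b x))" if b: "b \<in> Basis" for b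
 proof (rule integrableI_nonneg[OF gm])
  have "(\<integral>\<^sup>+x. ennreal (nsq (?p b x)) \<partial>lborel_on ?B) \<le> (\<integral>\<^sup>+x. ennreal (grad_sq u x) \<partial>lborel_on ?B)"
   unfolding grad_sq_def using b by (intro nn_integral_mono ennreal_leI member_le_sum) auto
  also have "\<dots> < \<infinity>" using False by (simp add: less_top)
  finally show "(\<integral>\<^sup>+x. ennreal (nsq (?p b x)) \<partial>lborel_on ?B) < \<infinity>" .
 qed simp
 have pL: "L2_fun ?M (?p b)" if "b \<in> Basis" for b
  using pm pi[OF that] integral_lebesgue_on(2)[OF Bb gm] by (simp add: L2_fun_def)
 note q = sobolev_H_1_weak_partial[OF u0]
 note G = has_weak_partial_diff[OF open_ball smooth_on_has_weak_partial[OF open_ball s] q(1)]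
 note GL = L2_fun_diff[OF pL q(2)]
 have "(\<integral>\<^sup>+x. ennreal ((norm (u x - u0 x)/(1 - nsq x))^2) \<partial>?M) \<le> ennreal (2 * (\<Sum>b\<in>Basis. \<integral>x. nsq (?p b x - ?q b x) \<partial>?M))"
  by (rule hardy_H1_zero[OF dim z G GL])
 also have "\<dots> \<le> ennreal (4 * (\<Sum>b\<in>Basis. \<integral>x. nsq (?q b x) \<partial>?M) + 4 * (\<Sum>b\<in>Basis. \<integral>x. nsq (?p b x) \<partial>lborel_on ?B))"
 proof (rule ennreal_leI)
  have "(\<integral>x. nsq (?p b x - ?q b x) \<partial>?M) \<le> 2 * (\<integral>x. nsq (?p b x) \<partial>lborel_on ?B) + 2 * (\<integral>x. nsq (?q b x) \<partial>?M)"
   if b: "b \<in> Basis" for b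
  proof -
   have i: "integrable ?M (\<lambda>x. nsq (?p b x))" "integrable ?M (\<lambda>x. nsq (?q b x))" "integrable ?M (\<lambda>x. nsq (?p b x - ?q b x))"
    using pL[OF b] q(2)[OF b] GL[OF b b] by (auto simp: L2_fun_def)
   have "(\<integral>x. nsq (?p b x - ?q b x) \<partial>?M) \<le> (\<integral>x. 2 * nsq (?p b x) + 2 * nsq (?q b x) \<partial>?M)"
    using i norm_diff_sq_le by (intro integral_mono) auto
   then show ?thesis using i integral_lebesgue_on(1)[OF Bb gm, of b] by simp
  qed
  then have "(\<Sum>b\<in>Basis. \<integral>x. nsq (?p b x - ?q b x) \<partial>?M) \<le> (\<Sum>b\<in>Basis. 2 * (\<integral>x. nsq (?p b x) \<partial>lborel_on ?B) + 2 * (\<integral>x. nsq (?q b x) \<partial>?M))"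
   by (rule sum_mono)
  then show "2 * (\<Sum>b\<in>Basis. \<integral>x. nsq (?p b x - ?q b x) \<partial>?M)
   \<le> 4 * (\<Sum>b\<in>Basis. \<integral>x. nsq (?q b x) \<partial>?M) + 4 * (\<Sum>b\<in>Basis. \<integral>x. nsq (?p b x) \<partial>lborel_on ?B)"
   by (simp add: sum.distrib sum_distrib_left[symmetric])
 qed
 also have "\<dots> = ennreal (4 * (\<Sum>b\<in>Basis. \<integral>x. nsq (?q b x) \<partial>?M)) + 4 * ennreal (\<Sum>b\<in>Basis. \<integral>x. nsq (?p b x) \<partial>lborel_on ?B)"
  by (simp add: ennreal_plus sum_nonneg ennreal_mult)
 also have "ennreal (\<Sum>b\<in>Basis. \<integral>x. nsq (?p b x) \<partial>lborel_on ?B) = (\<integral>\<^sup>+x. ennreal (grad_sq u x) \<partial>lborel_on ?B)"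
  unfolding grad_sq_def using pi by (subst nn_integral_eq_integral) (auto simp: sum_nonneg L1_sum)
 finally show ?thesis .
qed

lemma GLHF_glh:
 fixes u :: "real => 'a::euclidean_space => 'b::euclidean_space"
 assumes dim: "DIM('a) \<ge> 2" and T: "T > 0" and lam: "lam > 0" and chi: "cutoff chi"
  and u0: "sobolev_H_sphere 1 (ball 0 1) u0" and u: "GLHF chi T lam u0 u"
 obtains v0 g where "glh T lam chi (\<lambda>(t,x). u t x) v0 g"
  "(\<integral>x. weak_grad_sq (ball 0 1) u0 x \<partial>lebesgue_on (ball 0 1)) = (\<Sum>b\<in>Basis. \<integral>x. nsq (g b x) \<partial>lborel_on (ball 0 1))"
proof -
 let ?B = "ball (0::'a) 1" and ?U = "\<lambda>(t,x). u t x"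
 have s1: "sobolev_H 1 ?B u0" using u0 by (simp add: sobolev_H_sphere_def)
 have Bb: "?B \<in> sets borel" "{0<..<T} \<in> sets borel" by auto
 obtain v0 g where V: "v0 \<in> borel_measurable borel" "AE x in lborel_on ?B. u0 x = v0 x" "AE x in lborel_on ?B. norm (v0 x) = 1"
  "\<And>b. b \<in> Basis ==> g b \<in> borel_measurable borel"
  "\<And>b. b \<in> Basis ==> integrable (lborel_on ?B) (\<lambda>x. nsq (g b x))"
  "\<And>b (\<phi>::'a => real). b \<in> Basis ==> test_function ?B \<phi> ==>
    (\<integral>x. partial_deriv b \<phi> x .* v0 x \<partial>lborel_on ?B) = - (\<integral>x. \<phi> x .* g b x \<partial>lborel_on ?B)"
  "\<And>b. b \<in> Basis ==> (\<integral>x. nsq (weak_partial ?B b u0 x) \<partial>lebesgue_on ?B) = (\<integral>x. nsq (g b x) \<partial>lborel_on ?B)"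
  by (rule initial_data_borel[OF u0]) (rule that)
 have sm: "smooth_on ({0<..<T} \<times> ?B) ?U" using u by (simp add: GLHF_def)
 note D = smooth_flow_derivatives[OF sm]
 have gr: "(\<integral>\<^sup>+x. ennreal (grad_sq (u t) x) \<partial>lborel_on ?B) = (\<integral>\<^sup>+x. ennreal (\<Sum>b\<in>Basis. nsq (dx b ?U (t,x))) \<partial>lborel_on ?B)"
  if "t \<in> {0<..<T}" for t
  using D(2)[OF that] by (intro nn_integral_cong) (simp add: grad_sq_def space_restrict_space)
 have c: "(\<integral>\<^sup>+x. ennreal (f (u0 x) x) \<partial>lebesgue_on ?B) = (\<integral>\<^sup>+x. ennreal (f (v0 x) x) \<partial>lborel_on ?B)" for f
  unfolding nn_integral_lebesgue_on[OF Bb(1)] using V(2) by (intro nn_integral_cong_AE) (auto elim: eventually_mono)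
 have "glh T lam chi ?U v0 g"
 proof (unfold_locales; (fact dim T lam chi sm V)?)
  fix z assume "z \<in> {0<..<T} \<times> ?B"
  then obtain t x where z: "z = (t,x)" "t \<in> {0<..<T}" "x \<in> ?B" by auto
  have "vector_derivative (\<lambda>s. u s x) (at t) - laplacian (u t) x
    + (lam powr (1 - kappa t) * deriv chi ((nsq (u t x) - 1)^2) * (nsq (u t x) - 1)) .* u t x = 0"
   using u z by (simp add: GLHF_def)
  then show "dt ?U z = (\<Sum>b\<in>Basis. dx b (dx b ?U) z)
   - (lam powr (1 - kappa (fst z)) * deriv chi ((nsq (?U z) - 1)^2) * (nsq (?U z) - 1)) .* ?U z"
   unfolding D(3)[OF z(2,3)] D(4)[OF z(2,3)] z(1) by (simp add: algebra_simps)
 next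
  have "(\<integral>\<^sup>+t. (\<integral>\<^sup>+x. ennreal (grad_sq (u t) x) \<partial>lborel_on ?B) \<partial>lborel_on {0<..<T}) < \<infinity>"
   using u Bb by (simp add: GLHF_def nn_integral_restrict_space)
  also have "(\<integral>\<^sup>+t. (\<integral>\<^sup>+x. ennreal (grad_sq (u t) x) \<partial>lborel_on ?B) \<partial>lborel_on {0<..<T})
   = (\<integral>\<^sup>+t. (\<integral>\<^sup>+x. ennreal (\<Sum>b\<in>Basis. nsq (dx b ?U (t,x))) \<partial>lborel_on ?B) \<partial>lborel_on {0<..<T})"
   by (intro nn_integral_cong gr) (simp add: space_restrict_space)
  finally show "(\<integral>\<^sup>+t. (\<integral>\<^sup>+x. ennreal (\<Sum>b\<in>Basis. nsq (dx b ?U (t,x))) \<partial>lborel_on ?B) \<partial>lborel_on {0<..<T}) < \<infinity>" .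
 next
  have "AE t in lborel_on {0<..<T}. H1_zero ?B (\<lambda>x. u t x - u0 x)" using u by (simp add: GLHF_def AE_lebesgue_on)
  then show "AE t in lborel_on {0<..<T}. (\<integral>\<^sup>+x. ennreal ((norm (?U (t,x) - v0 x)/(1 - nsq x))^2) \<partial>lborel_on ?B)
   \<le> ennreal (4 * (\<Sum>b\<in>Basis. \<integral>x. nsq (g b x) \<partial>lborel_on ?B))
    + 4 * (\<integral>\<^sup>+x. ennreal (\<Sum>b\<in>Basis. nsq (dx b ?U (t,x))) \<partial>lborel_on ?B)"
   using AE_space
  proof eventually_elim
   case (elim t)
   then have t: "t \<in> {0<..<T}" by (simp add: space_restrict_space)
   have zB: "(0::'a) \<in> ?B" by simp
   show ?case
    using hardy_flow[OF dim s1 D(5)[OF t zB] elim(1)] V(7) unfolding gr[OF t, symmetric]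
    by (simp add: c[of "\<lambda>v x. (norm (u t x - v)/(1 - nsq x))^2"])
  qed
 next
  show "((\<lambda>t. \<integral>\<^sup>+x. ennreal (nsq (?U (t,x) - v0 x)) \<partial>lborel_on ?B) \<longlongrightarrow> 0) (at_right 0)"
   using u by (simp add: GLHF_def c[of "\<lambda>v x. nsq (u _ x - v)"])
 qed
 moreover have "(\<integral>x. weak_grad_sq ?B u0 x \<partial>lebesgue_on ?B) = (\<Sum>b\<in>Basis. \<integral>x. nsq (g b x) \<partial>lborel_on ?B)"
  unfolding weak_grad_sq_def using sobolev_H_1_weak_partial(2)[OF s1] V(7)
  by (subst L1_sum) (auto simp: L2_fun_def)
 ultimately show ?thesis by (rule that)
qed

lemma infdist_frontier_ball:
 fixes x :: "'a::euclidean_space"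
 assumes x: "x \<in> ball 0 1"
 shows "infdist x (frontier (ball 0 1)) = 1 - norm x"
proof (rule antisym)
 have f: "frontier (ball (0::'a) 1) = sphere 0 1" by (simp add: frontier_ball)
 have ne: "sphere (0::'a) 1 \<noteq> {}" by simp
 obtain s where s: "s \<in> sphere 0 1" "dist x s = 1 - norm x"
 proof (cases "x = 0")
  case True
  obtain e :: 'a where "e \<in> Basis" using nonempty_Basis by blast
  then show ?thesis using True by (intro that[of e]) auto
 next
  case False
  have "x - x /\<^sub>R norm x = (1 - inverse (norm x)) .* x" by (simp add: algebra_simps)
  moreover have "\<bar>1 - inverse (norm x)\<bar> * norm x = 1 - norm x" using False x by (simp add: abs_if field_simps)
  ultimately have "dist x (x /\<^sub>R norm x) = 1 - norm x" by (simp add: dist_norm)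
  then show ?thesis using False by (intro that[of "x /\<^sub>R norm x"]) auto
 qed
 show "infdist x (frontier (ball 0 1)) \<le> 1 - norm x" unfolding f using infdist_le[OF s(1), of x] s(2) by simp
 show "1 - norm x \<le> infdist x (frontier (ball 0 1))"
  unfolding f infdist_def using ne
  by (auto simp: dist_norm intro!: cINF_greatest) (metis norm_triangle_sub add.commute diff_le_eq norm_minus_commute)
qed

context glh_point begin

section \<open>Identification with the quantities of the statement\<close>

lemma scaled_energy_eq:
 assumes U: "U = (\<lambda>(t,x). u t x)" and R: "0 < R" "4 * R^2 < t0"
 shows "scaled_energy chi lam u R t0 x0 = EE R"
proof -
 note W = window[OF R]
 interpret pair_sigma_finite "lborel_on {t0 - 4 * R^2..t0 - R^2}" MB by (intro pair_sigma_finite_lborel_on) auto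
 note i = fe_props(2)[OF W(1,2,4)]
 have e: "energy_density chi lam u t x * exp (nsq (x - x0)/(4 * (t - t0))) = ed (t,x) * G (t,x)"
  if t: "t \<in> {t0 - 4 * R^2..t0 - R^2}" and x: "x \<in> BB" for t x
 proof -
  have tT: "t \<in> {0<..<T}" using t W by auto
  note D = smooth_flow_derivatives[OF smooth[unfolded U] tT x]
  have Ut: "U (t,x) = u t x" by (simp add: U)
  have "nsq (u t x) \<le> 1" using max_principle[of "(t,x)"] tT x by (simp add: Ut power_le_one)
  then have "(nsq (u t x) - 1)^2 \<le> 1" by (simp add: abs_square_le_1)
  then have "chi ((nsq (u t x) - 1)^2) = (nsq (u t x) - 1)^2" using chi by (simp add: cutoff_def)
  then have "energy_density chi lam u t x = ed (t,x)"
   by (simp add: energy_density_def ed_def gsq_def grad_sq_def D(2)[folded U] V_def Lc_def Ut)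
  then show ?thesis by (simp add: G_def)
 qed
 have "(LBINT t:{t0 - (2 * R)^2..t0 - R^2}. LBINT x:BB. energy_density chi lam u t x * exp (nsq (x - x0)/(4 * (t - t0))))
  = (\<integral>t. (\<integral>x. energy_density chi lam u t x * exp (nsq (x - x0)/(4 * (t - t0))) \<partial>MB) \<partial>lborel_on {t0 - 4 * R^2..t0 - R^2})"
  by (simp add: set_lebesgue_integral_def integral_restrict_space power_mult_distrib)
 also have "\<dots> = (\<integral>t. (\<integral>x. ed (t,x) * G (t,x) \<partial>MB) \<partial>lborel_on {t0 - 4 * R^2..t0 - R^2})"
  by (intro L1_cong refl e) (auto simp: space_restrict_space)
 also have "\<dots> = LI (PR R) (\<lambda>z. ed z * G z)" using integral_fst'[OF i] by simp
 finally show ?thesis by (simp add: scaled_energy_def EE_def)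
qed

text \<open>For each R the inner nonnegative integral is finite by \<open>far_dissipation\<close>,
  so it is the real number \<open>DR R\<close>; only the outer integral stays in extended
  form.\<close>

lemma dissipation_eq:
 assumes U: "U = (\<lambda>(t,x). u t x)" and R12: "0 < R1" "R1 < R2" "4 * R2^2 < t0"
 shows "dissipation u R1 R2 t0 x0 = (\<integral>\<^sup>+R\<in>{R1..R2}. ennreal (DR R/R ^ (DIM('a) - 1)) \<partial>lborel)"
 unfolding dissipation_def
proof (rule nn_integral_cong, goal_cases)
 case (1 R)
 show ?case
 proof (cases "R \<in> {R1..R2}")
  case True
  have "R^2 \<le> R2^2" using True R12 by (intro power_mono) auto
  then have R: "0 < R" "4 * R^2 < t0" using True R12(1) le_less_trans[OF _ R12(3), of "4 * R^2"] by auto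
  note W = window[OF R]
  have G0: "0 \<le> nsq (NU z) * G z" for z using less_imp_le[OF G_pos[of z]] by simp
  have e: "nsq (vector_derivative (\<lambda>s. u s x) (at t) + frechet_derivative (u t) (at x) ((x - x0) /\<^sub>R (2 * (t - t0))))
    * exp (nsq (x - x0)/(4 * (t - t0))) = nsq (NU (t,x)) * G (t,x)"
   if t: "t \<in> {t0 - 4 * R^2..t0 - R^2}" and x: "x \<in> BB" for t x
  proof -
   have tT: "t \<in> {0<..<T}" using t W by auto
   note D = smooth_flow_derivatives[OF smooth[unfolded U] tT x]
   have "(\<Sum>c\<in>Basis. (((x - x0) /\<^sub>R (2 * (t - t0))) \<bullet> c) .* dx c U (t,x)) = (1/(2 * (t - t0))) .* YU (t,x)"
    by (simp add: YU_def scaleR_sum_right divide_inverse mult_ac)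
   then have "vector_derivative (\<lambda>s. u s x) (at t) + frechet_derivative (u t) (at x) ((x - x0) /\<^sub>R (2 * (t - t0))) = NU (t,x)"
    unfolding D(1,3)[folded U] NU_def fst_conv by (subst dx_sum) (use tT x in simp, rule arg_cong)
   then show ?thesis by (simp add: G_def)
  qed
  have "(\<integral>\<^sup>+t\<in>{t0 - (2*R)^2..t0 - R^2}. (\<integral>\<^sup>+x\<in>BB. ennreal (nsq (vector_derivative (\<lambda>s. u s x) (at t)
          + frechet_derivative (u t) (at x) ((x - x0) /\<^sub>R (2 * (t - t0))))
         * exp (nsq (x - x0)/(4 * (t - t0)))) \<partial>lborel) \<partial>lborel)
   = (\<integral>\<^sup>+t. (\<integral>\<^sup>+x. ennreal (nsq (vector_derivative (\<lambda>s. u s x) (at t)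
          + frechet_derivative (u t) (at x) ((x - x0) /\<^sub>R (2 * (t - t0))))
         * exp (nsq (x - x0)/(4 * (t - t0)))) \<partial>MB) \<partial>lborel_on {t0 - 4 * R^2..t0 - R^2})"
   by (simp add: nn_integral_restrict_space power_mult_distrib)
  also have "\<dots> = (\<integral>\<^sup>+t. (\<integral>\<^sup>+x. ennreal (nsq (NU (t,x)) * G (t,x)) \<partial>MB) \<partial>lborel_on {t0 - 4 * R^2..t0 - R^2})"
   by (intro nn_integral_cong arg_cong[where f=ennreal] e) (auto simp: space_restrict_space)
  also have "\<dots> = (\<integral>\<^sup>+z. ennreal (nsq (NU z) * G z) \<partial>PR R)"
   using far_dissipation(1)[OF R] by (intro nn_integral_pair[symmetric]) auto
  also have "\<dots> = ennreal (DR R)"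
   unfolding DR_def using far_dissipation(1)[OF R] G0 by (intro nn_integral_eq_integral) auto
  finally show ?thesis
   using R True G0 by (simp add: ennreal_mult[symmetric] DR_def)
 qed simp
qed

end

theorem corollary2p13:
  fixes D :: nat and T \<delta>0 :: real and chi :: "real \<Rightarrow> real"
  assumes "CARD('d::finite) \<ge> 2" and "D \<ge> 2" and "CARD('n::finite) = D + 1"
    and "T > 0" and "0 < \<delta>0" and "\<delta>0 < 1" and "cutoff chi"
  shows "\<exists>C>0. \<forall>(u0 :: real ^ 'd \<Rightarrow> real ^ 'n) lam u t0 x0 R1 R2.
    initial_data \<delta>0 u0 \<and> lam > 0 \<and> GLHF chi T lam u0 u \<and>
    t0 \<in> {0<..<T} \<and> x0 \<in> ball 0 1 \<and>
    0 < R1 \<and> R1 < R2 \<and> t0 - (2 * R2)\<^sup>2 > 0 \<longrightarrow>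
      ereal (scaled_energy chi lam u R2 t0 x0) \<ge>
        ereal (scaled_energy chi lam u R1 t0 x0) + enn2ereal (dissipation u R1 R2 t0 x0)
        - ereal (monotonicity_const C \<delta>0 u0 x0 / 2 * (R2\<^sup>2 - R1\<^sup>2))"
proof -
 obtain \<beta> \<beta>' L where "smooth_step \<beta> \<beta>' L" using smooth_step_exists by blast
 then interpret smooth_step \<beta> \<beta>' L .
 define n where "n = CARD('d)"
 \<comment> \<open>Only T, the slope bound \<open>L\<close> of the fixed step function and the
   dimension enter, so C precedes all quantified data.\<close>
 define C0 where "C0 = near_const T L n + 2 * far_const T n"
 have main: "ereal (scaled_energy chi lam u R2 t0 x0) \<ge>
    ereal (scaled_energy chi lam u R1 t0 x0) + enn2ereal (dissipation u R1 R2 t0 x0)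
    - ereal (monotonicity_const (max 1 C0) \<delta>0 u0 x0/2 * (R2^2 - R1^2))"
  if u0: "initial_data \<delta>0 u0" and lam: "lam > 0" and u: "GLHF chi T lam u0 u"
   and t0: "t0 \<in> {0<..<T}" and x0: "x0 \<in> ball 0 1" and R12: "0 < R1" "R1 < R2" "t0 - (2 * R2)^2 > 0"
  for u0 :: "real ^ 'd => real ^ 'n" and lam u t0 x0 R1 R2
 proof -
  have dim: "DIM(real ^ 'd) = n" "n \<ge> 2" using assms(1) by (simp_all add: n_def)
  have "sobolev_H_sphere 1 (ball 0 1) u0" using u0 by (simp add: initial_data_def)
  then obtain v0 g where gl: "glh T lam chi (\<lambda>(t,x). u t x) v0 g"
   and M: "(\<integral>x. weak_grad_sq (ball 0 1) u0 x \<partial>lebesgue_on (ball 0 1)) = (\<Sum>b\<in>Basis. \<integral>x. nsq (g b x) \<partial>lborel_on (ball 0 1))"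
   using GLHF_glh[of T lam chi u0 u] dim assms(4,7) lam u by metis
  interpret glh T lam chi "\<lambda>(t,x). u t x" v0 g by (rule gl)
  interpret glh_point T lam chi "\<lambda>(t,x). u t x" v0 g \<beta> \<beta>' L t0 x0
   by unfold_locales (fact t0 x0)+
  define k where "k = (near_const T L DIM(real ^ 'd) + 2 * far_const T DIM(real ^ 'd)) * M0/d0 ^ (DIM(real ^ 'd) + 2)"
  have R2: "4 * R2^2 < t0" using R12 by (simp add: power_mult_distrib)
  have lt: "R1^2 < R2^2" using R12 by (intro power_strict_mono) auto
  have R1: "4 * R1^2 < t0" using lt R2 by linarith
  have E: "scaled_energy chi lam u R1 t0 x0 = EE R1" "scaled_energy chi lam u R2 t0 x0 = EE R2"
   using scaled_energy_eq[OF refl] R12 R1 R2 by auto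
  have X: "dissipation u R1 R2 t0 x0 \<le> ennreal (EE R2 - EE R1 + k/2 * (R2^2 - R1^2))" "0 \<le> EE R2 - EE R1 + k/2 * (R2^2 - R1^2)"
   using monotonicity[OF R12(1,2) R2 k_def] unfolding dissipation_eq[OF refl R12(1,2) R2] by auto
  \<comment> \<open>The bound passes through \<open>ennreal\<close>; nonnegativity of its argument,
    \<open>X(2)\<close>, ensures that no truncation takes place.\<close>
  have "enn2ereal (dissipation u R1 R2 t0 x0) \<le> enn2ereal (ennreal (EE R2 - EE R1 + k/2 * (R2^2 - R1^2)))"
   using X(1) by (simp add: less_eq_ennreal.rep_eq)
  then have dis: "enn2ereal (dissipation u R1 R2 t0 x0) \<le> ereal (EE R2 - EE R1 + k/2 * (R2^2 - R1^2))"
   using X(2) by (simp add: enn2ereal_ennreal)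
  \<comment> \<open>The tangential integral is nonnegative, also in the case of a non-integrable
    integrand, where the Bochner integral is 0 by convention; adding it to \<open>M0\<close> can
    only enlarge the constant.\<close>
  have tg: "0 \<le> (\<integral>x. tangential_grad_sq \<delta>0 u0 x \<partial>surface_measure)"
   by (intro L1_nonneg) (simp add: tangential_grad_sq_def sum_nonneg)
  have "k \<le> monotonicity_const (max 1 C0) \<delta>0 u0 x0"
  proof -
   have "C0/d0 ^ (n + 2) * M0 \<le> max 1 C0/d0 ^ (n + 2) * ((\<integral>x. tangential_grad_sq \<delta>0 u0 x \<partial>surface_measure) + M0)"
    using d0_power[of "n + 2"] M0_nonneg tg by (intro mult_mono divide_right_mono divide_nonneg_nonneg) (auto simp del: power_Suc add_2_eq_Suc')
   then show ?thesis
    unfolding k_def monotonicity_const_def infdist_frontier_ball[OF x0] d0_def[symmetric] M[folded M0_def] dim(1)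
    by (simp add: C0_def n_def)
  qed
  then have "k/2 * (R2^2 - R1^2) \<le> monotonicity_const (max 1 C0) \<delta>0 u0 x0/2 * (R2^2 - R1^2)"
   using lt by (intro mult_right_mono) auto
  then have le: "EE R1 + (EE R2 - EE R1 + k/2 * (R2^2 - R1^2)) - monotonicity_const (max 1 C0) \<delta>0 u0 x0/2 * (R2^2 - R1^2) \<le> EE R2"
   by simp
  have "ereal (EE R1) + enn2ereal (dissipation u R1 R2 t0 x0) - ereal (monotonicity_const (max 1 C0) \<delta>0 u0 x0/2 * (R2^2 - R1^2))
   \<le> ereal (EE R1) + ereal (EE R2 - EE R1 + k/2 * (R2^2 - R1^2)) - ereal (monotonicity_const (max 1 C0) \<delta>0 u0 x0/2 * (R2^2 - R1^2))"
   by (intro ereal_minus_mono add_left_mono dis order_refl)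
  also have "\<dots> \<le> ereal (EE R2)" using le by simp
  finally show ?thesis unfolding E .
 qed
 \<comment> \<open>The maximum with 1 makes the witness positive.\<close>
 show ?thesis by (rule exI[of _ "max 1 C0"]) (use main in auto)
qed

end
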